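(* Let $\mathfrak X$ be a Banach space, $p,r\in(0,\infty)$, $q\in(0,\infty]$, $s\in\mathbb R$, and let $\varphi$ be a fixed Littlewood--Paley function. If $V\in\mathscr A_{\max\{p,r\}}(\mathbb R^n;\mathscr L(\mathfrak X))$, then, for any $f\in\mathscr S_\infty'(\mathbb R^n;\mathfrak X)$, $$\|f\|_{\dot B^s_{p,q}(V,\varphi)}\approx\|f\|_{\dot B^s_{p,q}(\rho^V_r,\varphi)},$$ where the positive equivalence constants are independent of $f$.
   Context: Weights. $f:\mathbb R^n\to\mathfrak X$ is strongly measurable if it is a pointwise limit of simple functions. $V:\mathbb R^n\to\mathscr L(\mathfrak X)$ is a weight if $V(\cdot)\mathfrak e$ and $V(\cdot)^{-1}\mathfrak e$ are strongly measurable for every $\mathfrak e\in\mathfrak X$ and $V(x)$ is invertible for a.e. $x$. It is a $p$-weight ($p\in(0,\infty]$) if moreover $\mathbf 1_QV(\cdot)\mathfrak e\in L^p(\mathbb R^n;\mathfrak X)$ for all cubes $Q$ and all $\mathfrak e$. $V^{-*}(x):=(V(x)^{-1})^*\in\mathscr L(\mathfrak X^* )$, to which the same notions apply with $\mathfrak X^*$ in place of $\mathfrak X$. $\rho^V_{p,Q}(\mathfrak e):=\big(\frac1{|Q|}\int_Q\|V(x)\mathfrak e\|^p\,dx\big)^{1/p}$, similarly $\rho^{V^{-*}}_{p,Q}(\mathfrak e^* )$; $\rho^*(\mathfrak e^* ):=\sup_{\mathfrak e\ne0}|\langle\mathfrak e^*,\mathfrak e\rangle|/\rho(\mathfrak e)$.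 $\mathscr A_p$ condition. For $p\in(0,\infty)$, $V\in\mathscr A_p(\mathbb R^n;\mathscr L(\mathfrak X))$ means that $V$ is a $p$-weight and there is a finite $C$ such that for all cubes $Q$: (i) if $p\in(1,\infty)$, $p'=p/(p-1)$: also $V^{-*}$ is a $p'$-weight and $\rho^{V^{-*}}_{p',Q}(\mathfrak e^* )\le C(\rho^V_{p,Q})^*(\mathfrak e^* )$ for all $\mathfrak e^*\in\mathfrak X^*$; (ii) if $p\in(0,1]$: $\operatorname{ess\,sup}_{y\in Q}\rho^V_{p,Q}(V(y)^{-1}\mathfrak e)\le C\|\mathfrak e\|$ for all $\mathfrak e\in\mathfrak X$. Littlewood--Paley functions. $\varphi\in\mathscr S(\mathbb R^n)$ is a Littlewood--Paley function if, for some $\sqrt2<\alpha<\beta<\pi$, $c\,\mathbf 1_{[1/\alpha,\alpha]}(|\xi|)\le|\hat\varphi(\xi)|\le C\,\mathbf 1_{[1/\beta,\beta]}(|\xi|)$ for some $c,C>0$ and all $\xi$ (with $\hat\varphi(\xi)=\int\varphi(x)e^{-ix\cdot\xi}dx$). Put $\varphi_j(x):=2^{jn}\varphi(2^jx)$, $j\in\mathbb Z$. Distributions. $\mathscr S_\infty$ is the space of Schwartz functions on $\mathbb R^n$ all of whose moments vanish, with the topology of $\mathscr S$; $\mathscr S'_\infty(\mathbb R^n;\mathfrak X)$ is the set of continuous linear maps $\mathscr S_\infty\to\mathfrak X$. Note $\varphi_j*f$ is a function $\mathbb R^n\to\mathfrak X$. Besov quasi-norms. $\mathscr D_j$ is the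 set of dyadic cubes $2^{-j}([0,1)^n+k)$, $k\in\mathbb Z^n$; $\mathscr D=\bigcup_j\mathscr D_j$. Then $$\|f\|_{\dot B^s_{p,q}(V,\varphi)}:=\Big(\sum_{j\in\mathbb Z}\Big[2^{js}\big\|\,\|V(\cdot)(\varphi_j*f)(\cdot)\|_{\mathfrak X}\big\|_{L^p(\mathbb R^n)}\Big]^q\Big)^{1/q}$$ (supremum over $j$ if $q=\infty$), and for a family $\rho=\{\rho_Q\}_{Q\in\mathscr D}$ of quasi-norms on $\mathfrak X$, $\|f\|_{\dot B^s_{p,q}(\rho,\varphi)}$ is defined by the same formula with $\|V(x)(\varphi_j*f)(x)\|_{\mathfrak X}$ replaced by $\rho_Q((\varphi_j*f)(x))$ for $x\in Q\in\mathscr D_j$. Here $\rho^V_r:=\{\rho^V_{r,Q}\}_{Q\in\mathscr D}$. Both quantities may be $+\infty$. *)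

theory Defs
  imports "HOL-Probability.Essential_Supremum"
begin

section \<open>Complex Banach spaces, their bounded operators and duals\<close>

text \<open>
  Test functions are complex valued, so Banach spaces are taken over the complex numbers. As HOL
  only has real Banach spaces, the complex scalar multiplication is added as a class; complex
  Banach spaces are the types of sort \<open>{complex_normed_vector, banach}\<close>.
\<close>

class complex_normed_vector = real_normed_vector +
  fixes scaleC :: "complex \<Rightarrow> 'a \<Rightarrow> 'a"  (infixr \<open>*\<^sub>C\<close> 75)
  assumes scaleC_add_right: "c *\<^sub>C (x + y) = c *\<^sub>C x + c *\<^sub>C y"
    and scaleC_add_left: "(c + d) *\<^sub>C x = c *\<^sub>C x + d *\<^sub>C x"
    and scaleC_scaleC: "c *\<^sub>C d *\<^sub>C x = (c * d) *\<^sub>C x"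
    and scaleC_of_real: "complex_of_real r *\<^sub>C x = r *\<^sub>R x"
    and norm_scaleC: "norm (c *\<^sub>C x) = cmod c * norm x"

instantiation complex :: complex_normed_vector
begin

definition scaleC_complex :: "complex \<Rightarrow> complex \<Rightarrow> complex"
  where "scaleC_complex c x = c * x"

instance
  by standard (simp_all add: scaleC_complex_def algebra_simps norm_mult scaleR_conv_of_real)

end

lemma bounded_linear_scaleC_right:
  "bounded_linear (\<lambda>x::'a::complex_normed_vector. c *\<^sub>C x)"
proof (rule bounded_linear_intro)
  fix r :: real and x :: 'a
  have "c *\<^sub>C complex_of_real r *\<^sub>C x = complex_of_real r *\<^sub>C c *\<^sub>C x"
    by (simp only: scaleC_scaleC mult.commute)
  then show "c *\<^sub>C r *\<^sub>R x = r *\<^sub>R c *\<^sub>C x"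
    by (simp only: scaleC_of_real)
  show "norm (c *\<^sub>C x) \<le> norm x * cmod c"
    by (simp add: norm_scaleC)
qed (rule scaleC_add_right)

lemma scaleC_zero_right [simp]: "c *\<^sub>C (0::'a::complex_normed_vector) = 0"
  using norm_scaleC[of c "0::'a"] by simp

typedef (overloaded) ('a, 'b) cblinfun =
  "{T :: 'a::complex_normed_vector \<Rightarrow>\<^sub>L 'b::complex_normed_vector. \<forall>c x. T (c *\<^sub>C x) = c *\<^sub>C T x}"
  morphisms blinfun_of_cblinfun Abs_cblinfun
  by (rule exI[of _ 0]) simp

setup_lifting type_definition_cblinfun

instantiation cblinfun :: (complex_normed_vector, complex_normed_vector) complex_normed_vector
begin

lift_definition norm_cblinfun :: "('a, 'b) cblinfun \<Rightarrow> real" is norm .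

lift_definition minus_cblinfun :: "('a, 'b) cblinfun \<Rightarrow> ('a, 'b) cblinfun \<Rightarrow> ('a, 'b) cblinfun"
  is "(-)"
  by (simp add: blinfun.diff_left linear_diff[OF bounded_linear.linear[OF bounded_linear_scaleC_right]])

definition dist_cblinfun :: "('a, 'b) cblinfun \<Rightarrow> ('a, 'b) cblinfun \<Rightarrow> real"
  where "dist_cblinfun S T = norm (S - T)"

definition
  "(uniformity :: (('a, 'b) cblinfun \<times> ('a, 'b) cblinfun) filter) =
    (INF e\<in>{0 <..}. principal {(x, y). dist x y < e})"

definition open_cblinfun :: "('a, 'b) cblinfun set \<Rightarrow> bool"
  where "open_cblinfun S = (\<forall>x\<in>S. \<forall>\<^sub>F (x', y) in uniformity. x' = x \<longrightarrow> y \<in> S)"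

lift_definition uminus_cblinfun :: "('a, 'b) cblinfun \<Rightarrow> ('a, 'b) cblinfun" is uminus
  by (simp add: blinfun.minus_left linear_neg[OF bounded_linear.linear[OF bounded_linear_scaleC_right]])

lift_definition zero_cblinfun :: "('a, 'b) cblinfun" is 0
  by simp

lift_definition plus_cblinfun :: "('a, 'b) cblinfun \<Rightarrow> ('a, 'b) cblinfun \<Rightarrow> ('a, 'b) cblinfun"
  is "(+)"
  by (simp add: blinfun.add_left scaleC_add_right)

lift_definition scaleR_cblinfun :: "real \<Rightarrow> ('a, 'b) cblinfun \<Rightarrow> ('a, 'b) cblinfun" is scaleR
  by (simp add: blinfun.scaleR_left linear_scale[OF bounded_linear.linear[OF bounded_linear_scaleC_right]])

lift_definition scaleC_cblinfun :: "complex \<Rightarrow> ('a, 'b) cblinfun \<Rightarrow> ('a, 'b) cblinfun"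
  is "\<lambda>c T. blinfun_compose (Blinfun (\<lambda>y. c *\<^sub>C y)) T"
  by (simp add: bounded_linear_Blinfun_apply[OF bounded_linear_scaleC_right] scaleC_scaleC mult.commute)

definition sgn_cblinfun :: "('a, 'b) cblinfun \<Rightarrow> ('a, 'b) cblinfun"
  where "sgn_cblinfun T = inverse (norm T) *\<^sub>R T"

lemma norm_scaleC_blinfun:
  fixes T :: "'a \<Rightarrow>\<^sub>L 'b"
  shows "norm (blinfun_compose (Blinfun (\<lambda>y. c *\<^sub>C y)) T) = cmod c * norm T"
proof -
  have le: "norm (blinfun_compose (Blinfun (\<lambda>y. d *\<^sub>C y)) S) \<le> cmod d * norm S"
    for d and S :: "'a \<Rightarrow>\<^sub>L 'b"
  proof (rule norm_blinfun_bound)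
    fix x
    have "cmod d * norm (S x) \<le> cmod d * (norm S * norm x)"
      by (intro mult_left_mono norm_blinfun) auto
    then show "norm (blinfun_compose (Blinfun (\<lambda>y. d *\<^sub>C y)) S x) \<le> cmod d * norm S * norm x"
      by (simp add: bounded_linear_Blinfun_apply[OF bounded_linear_scaleC_right] norm_scaleC mult.assoc)
  qed simp
  show ?thesis
  proof (cases "c = 0")
    case True
    then show ?thesis using le[of c T] by simp
  next
    case False
    let ?S = "blinfun_compose (Blinfun (\<lambda>y. c *\<^sub>C y)) T"
    have "blinfun_compose (Blinfun (\<lambda>y. inverse c *\<^sub>C y)) ?S = T"
      using False scaleC_of_real[of 1]
      by (intro blinfun_eqI)
        (simp add: bounded_linear_Blinfun_apply[OF bounded_linear_scaleC_right] scaleC_scaleC)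
    then have "norm T \<le> cmod (inverse c) * norm ?S"
      using le[of "inverse c" ?S] by simp
    then have "norm T \<le> norm ?S / cmod c"
      by (simp only: norm_inverse divide_inverse mult.commute)
    then have "cmod c * norm T \<le> norm ?S"
      using False by (simp add: pos_le_divide_eq mult.commute)
    then show ?thesis using le[of c T] by simp
  qed
qed

instance
proof
  fix S T U :: "('a, 'b) cblinfun" and a b :: real and c d :: complex
  show "dist S T = norm (S - T)" by (rule dist_cblinfun_def)
  show "sgn T = inverse (norm T) *\<^sub>R T" by (rule sgn_cblinfun_def)
  show "(uniformity :: (('a, 'b) cblinfun \<times> ('a, 'b) cblinfun) filter) =
      (INF e\<in>{0 <..}. principal {(x, y). dist x y < e})"
    by (rule uniformity_cblinfun_def)
  show "open X = (\<forall>x\<in>X. \<forall>\<^sub>F (x', y) in uniformity. x' = x \<longrightarrow> y \<in> X)"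
    for X :: "('a, 'b) cblinfun set"
    by (rule open_cblinfun_def)
  show "S + T + U = S + (T + U)" by transfer simp
  show "S + T = T + S" by transfer simp
  show "0 + T = T" by transfer simp
  show "- T + T = 0" by transfer simp
  show "S - T = S + - T" by transfer simp
  show "a *\<^sub>R (S + T) = a *\<^sub>R S + a *\<^sub>R T" by transfer (simp add: scaleR_add_right)
  show "(a + b) *\<^sub>R T = a *\<^sub>R T + b *\<^sub>R T" by transfer (simp add: scaleR_add_left)
  show "a *\<^sub>R b *\<^sub>R T = (a * b) *\<^sub>R T" by transfer simp
  show "1 *\<^sub>R T = T" by transfer simp
  show "(norm T = 0) = (T = 0)" by transfer simp
  show "norm (S + T) \<le> norm S + norm T" by transfer (rule norm_triangle_ineq)
  show "norm (a *\<^sub>R T) = \<bar>a\<bar> * norm T" by transfer simp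
  note [simp] = bounded_linear_Blinfun_apply[OF bounded_linear_scaleC_right]
    blinfun.add_left blinfun.scaleR_left
  show "c *\<^sub>C (S + T) = c *\<^sub>C S + c *\<^sub>C T"
    by transfer (intro blinfun_eqI, simp add: scaleC_add_right)
  show "(c + d) *\<^sub>C T = c *\<^sub>C T + d *\<^sub>C T"
    by transfer (intro blinfun_eqI, simp add: scaleC_add_left)
  show "c *\<^sub>C d *\<^sub>C T = (c * d) *\<^sub>C T"
    by transfer (intro blinfun_eqI, simp add: scaleC_scaleC)
  show "complex_of_real a *\<^sub>C T = a *\<^sub>R T"
    by transfer (intro blinfun_eqI, simp add: scaleC_of_real)
  show "norm (c *\<^sub>C T) = cmod c * norm T"
    by transfer (rule norm_scaleC_blinfun)
qed

end

instance cblinfun :: (complex_normed_vector, "{complex_normed_vector, banach}") banach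
proof
  fix X :: "nat \<Rightarrow> ('a, 'b) cblinfun"
  let ?r = "blinfun_of_cblinfun :: ('a, 'b) cblinfun \<Rightarrow> 'a \<Rightarrow>\<^sub>L 'b"
  have dist_r: "dist (?r S) (?r T) = dist S T" for S T
    unfolding dist_norm by transfer simp
  assume "Cauchy X"
  then have "Cauchy (\<lambda>n. ?r (X n))"
    unfolding Cauchy_def dist_r .
  then obtain L where L: "(\<lambda>n. ?r (X n)) \<longlonglongrightarrow> L"
    by (auto simp: Cauchy_convergent_iff convergent_def)
  have "L (c *\<^sub>C x) = c *\<^sub>C L x" for c x
  proof -
    have 1: "(\<lambda>n. ?r (X n) (c *\<^sub>C x)) \<longlonglongrightarrow> L (c *\<^sub>C x)"
      by (intro tendsto_intros L)
    have "(\<lambda>n. c *\<^sub>C ?r (X n) x) \<longlonglongrightarrow> c *\<^sub>C L x"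
      by (rule bounded_linear.tendsto[OF bounded_linear_scaleC_right]) (intro tendsto_intros L)
    moreover have "(\<lambda>n. c *\<^sub>C ?r (X n) x) = (\<lambda>n. ?r (X n) (c *\<^sub>C x))"
      using blinfun_of_cblinfun[of "X n" for n] by force
    ultimately show ?thesis
      using LIMSEQ_unique[OF 1] by simp
  qed
  then have "?r (Abs_cblinfun L) = L"
    by (intro Abs_cblinfun_inverse) simp
  then obtain T where T: "L = ?r T"
    by (rule that[OF sym])
  have "X \<longlonglongrightarrow> T"
    using L unfolding T tendsto_iff dist_r .
  then show "convergent X" by (auto simp: convergent_def)
qed

lift_definition cblinfun_apply ::
  "('a::complex_normed_vector, 'b::complex_normed_vector) cblinfun \<Rightarrow> 'a \<Rightarrow> 'b"
  is blinfun_apply .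

declare [[coercion
  "cblinfun_apply :: ('a::complex_normed_vector, 'b::complex_normed_vector) cblinfun \<Rightarrow> 'a \<Rightarrow> 'b"]]

lift_definition cblinfun_compose ::
  "('b::complex_normed_vector, 'c::complex_normed_vector) cblinfun \<Rightarrow>
   ('a::complex_normed_vector, 'b) cblinfun \<Rightarrow> ('a, 'c) cblinfun"  (infixl \<open>o\<^sub>C\<close> 55)
  is blinfun_compose
  by simp

lift_definition id_cblinfun :: "('a::complex_normed_vector, 'a) cblinfun" is id_blinfun
  by simp

lemma cblinfun_eqI: "(\<And>x. cblinfun_apply S x = cblinfun_apply T x) \<Longrightarrow> S = T"
  by transfer (rule blinfun_eqI)

lemma cblinfun_compose_apply [simp]: "cblinfun_apply (S o\<^sub>C T) x = S (T x)"
  by transfer simp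

lemma id_cblinfun_apply [simp]: "cblinfun_apply id_cblinfun x = x"
  by transfer simp

lemma norm_cblinfun_eq_onorm: "norm T = onorm (cblinfun_apply T)"
  by transfer (rule norm_blinfun.rep_eq)

type_synonym 'a cdual = "('a, complex) cblinfun"

lemma bounded_linear_precompose:
  fixes T :: "('a::complex_normed_vector, 'b::complex_normed_vector) cblinfun"
  shows "bounded_linear (\<lambda>e :: ('b, 'c::complex_normed_vector) cblinfun. e o\<^sub>C T)"
proof (rule bounded_linear_intro)
  fix d e :: "('b, 'c) cblinfun" and r :: real
  show "(d + e) o\<^sub>C T = (d o\<^sub>C T) + (e o\<^sub>C T)"
    by transfer (auto intro: blinfun_eqI simp: blinfun.add_left)
  show "(r *\<^sub>R e) o\<^sub>C T = r *\<^sub>R (e o\<^sub>C T)"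
    by transfer (auto intro: blinfun_eqI simp: blinfun.scaleR_left)
  show "norm (e o\<^sub>C T) \<le> norm e * norm T"
    by transfer (rule norm_blinfun_compose)
qed

lemma scaleC_cblinfun_compose: "(c *\<^sub>C S) o\<^sub>C T = c *\<^sub>C (S o\<^sub>C T)"
  by transfer (auto intro: blinfun_eqI)

text \<open>The Banach space adjoint, mapping a functional \<open>e\<close> to \<open>e \<circ> T\<close>.\<close>

lift_definition adjoint_cblinfun ::
  "('a::complex_normed_vector, 'b::complex_normed_vector) cblinfun \<Rightarrow> ('b cdual, 'a cdual) cblinfun"
  is "\<lambda>T. Blinfun (\<lambda>e. e o\<^sub>C Abs_cblinfun T)"
  by (simp add: bounded_linear_Blinfun_apply[OF bounded_linear_precompose] scaleC_cblinfun_compose)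

lemma adjoint_cblinfun_apply: "cblinfun_apply (adjoint_cblinfun T) e = e o\<^sub>C T"
  by (simp add: cblinfun_apply.rep_eq adjoint_cblinfun.rep_eq
      bounded_linear_Blinfun_apply[OF bounded_linear_precompose] blinfun_of_cblinfun_inverse)

definition is_inverse_cblinfun ::
  "('a::complex_normed_vector, 'a) cblinfun \<Rightarrow> ('a, 'a) cblinfun \<Rightarrow> bool"
  where "is_inverse_cblinfun T S \<longleftrightarrow> T o\<^sub>C S = id_cblinfun \<and> S o\<^sub>C T = id_cblinfun"

definition invertible_cblinfun :: "('a::complex_normed_vector, 'a) cblinfun \<Rightarrow> bool"
  where "invertible_cblinfun T \<longleftrightarrow> (\<exists>S. is_inverse_cblinfun T S)"

text \<open>
  The inverse of a weight is only needed almost everywhere; it is set to \<open>0\<close> on the exceptional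
  null set. As Lebesgue measure is complete, this choice does not affect measurability.
\<close>

definition inv_cblinfun :: "('a::complex_normed_vector, 'a) cblinfun \<Rightarrow> ('a, 'a) cblinfun"
  where "inv_cblinfun T = (if invertible_cblinfun T then THE S. is_inverse_cblinfun T S else 0)"


section \<open>Lebesgue quasi-norms with values in \<open>[0, \<infinity>]\<close>\<close>

text \<open>The power \<open>x\<^sup>a\<close> on \<open>[0, \<infinity>]\<close>, meant for exponents \<open>a > 0\<close>.\<close>

definition ennpowr :: "ennreal \<Rightarrow> real \<Rightarrow> ennreal"
  where "ennpowr x a = (if x = \<infinity> then \<infinity> else ennreal (enn2real x powr a))"

definition Lp_qnorm :: "'x measure \<Rightarrow> ennreal \<Rightarrow> ('x \<Rightarrow> ennreal) \<Rightarrow> ennreal" where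
  "Lp_qnorm M p g =
    (if p = \<infinity> then esssup M g
     else ennpowr (\<integral>\<^sup>+x. ennpowr (g x) (enn2real p) \<partial>M) (1 / enn2real p))"

definition lq_qnorm :: "ennreal \<Rightarrow> ('i \<Rightarrow> ennreal) \<Rightarrow> ennreal" where
  "lq_qnorm q a =
    (if q = \<infinity> then (SUP j. a j)
     else ennpowr (\<Sum>\<^sub>\<infinity>j. ennpowr (a j) (enn2real q)) (1 / enn2real q))"


section \<open>Weights\<close>

text \<open>
  Cubes have sides parallel to the axes. They are half-open, so that dyadic cubes are cubes;
  inclusion of the boundary, a null set, plays no role in the conditions below.
\<close>

definition cube :: "real ^ 'n \<Rightarrow> real \<Rightarrow> (real ^ 'n) set"
  where "cube a l = {x. \<forall>i. a $ i \<le> x $ i \<and> x $ i < a $ i + l}"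

definition cubes :: "(real ^ 'n) set set"
  where "cubes = {cube a l | a l. l > 0}"

definition strongly_measurable :: "(real ^ 'n \<Rightarrow> 'a::real_normed_vector) \<Rightarrow> bool" where
  "strongly_measurable f \<longleftrightarrow>
    (\<exists>s. (\<forall>k::nat. simple_function lebesgue (s k)) \<and> (\<forall>x. (\<lambda>k. s k x) \<longlonglongrightarrow> f x))"

definition weight :: "(real ^ 'n \<Rightarrow> ('a::{complex_normed_vector, banach}, 'a) cblinfun) \<Rightarrow> bool" where
  "weight V \<longleftrightarrow>
    (\<forall>e. strongly_measurable (\<lambda>x. V x e) \<and> strongly_measurable (\<lambda>x. inv_cblinfun (V x) e)) \<and>
    (AE x in lebesgue. invertible_cblinfun (V x))"

definition in_Lp :: "ennreal \<Rightarrow> (real ^ 'n \<Rightarrow> 'a::real_normed_vector) \<Rightarrow> bool" where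
  "in_Lp p f \<longleftrightarrow> strongly_measurable f \<and> Lp_qnorm lebesgue p (\<lambda>x. ennreal (norm (f x))) < \<infinity>"

definition p_weight ::
  "ennreal \<Rightarrow> (real ^ 'n \<Rightarrow> ('a::{complex_normed_vector, banach}, 'a) cblinfun) \<Rightarrow> bool" where
  "p_weight p V \<longleftrightarrow>
    weight V \<and> (\<forall>Q\<in>cubes. \<forall>e. in_Lp p (\<lambda>x. indicat_real Q x *\<^sub>R V x e))"

definition inv_adjoint_weight ::
  "(real ^ 'n \<Rightarrow> ('a::{complex_normed_vector, banach}, 'a) cblinfun) \<Rightarrow>
   real ^ 'n \<Rightarrow> ('a cdual, 'a cdual) cblinfun"
  where "inv_adjoint_weight V x = adjoint_cblinfun (inv_cblinfun (V x))"

definition avg_qnorm ::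
  "(real ^ 'n \<Rightarrow> ('a::{complex_normed_vector, banach}, 'a) cblinfun) \<Rightarrow> real \<Rightarrow>
   (real ^ 'n) set \<Rightarrow> 'a \<Rightarrow> ennreal"  (\<open>\<rho>\<close>) where
  "\<rho> V p Q e =
    ennpowr ((\<integral>\<^sup>+x\<in>Q. ennpowr (ennreal (norm (V x e))) p \<partial>lebesgue) / emeasure lebesgue Q) (1 / p)"

definition dual_qnorm ::
  "('a::complex_normed_vector \<Rightarrow> ennreal) \<Rightarrow> 'a cdual \<Rightarrow> ennreal"
  where "dual_qnorm r e' = (SUP e\<in>- {0}. ennreal (cmod (e' e)) / r e)"

text \<open>
  The library's \<open>esssup\<close> is \<open>\<infinity>\<close> on non-measurable functions. This is harmless here: for a \<open>p\<close>-weight,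
  \<open>\<rho> V p Q\<close> is lower semicontinuous by Fatou's lemma and \<open>inv_cblinfun (V y) e\<close> is strongly
  measurable in \<open>y\<close>.
\<close>

definition A_class ::
  "real \<Rightarrow> (real ^ 'n \<Rightarrow> ('a::{complex_normed_vector, banach}, 'a) cblinfun) set" where
  "A_class p = {V. p_weight (ennreal p) V \<and>
    (if p > 1 then
       p_weight (ennreal (p / (p - 1))) (inv_adjoint_weight V) \<and>
       (\<exists>C::real. \<forall>Q\<in>cubes. \<forall>e'.
          \<rho> (inv_adjoint_weight V) (p / (p - 1)) Q e' \<le> ennreal C * dual_qnorm (\<rho> V p Q) e')
     else
       (\<exists>C::real. \<forall>Q\<in>cubes. \<forall>e.
          esssup (lebesgue_on Q) (\<lambda>y. \<rho> V p Q (inv_cblinfun (V y) e)) \<le> ennreal (C * norm e)))}"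


section \<open>Schwartz functions and distributions modulo polynomials\<close>

primrec iter_partial :: "'n list \<Rightarrow> (real ^ 'n \<Rightarrow> complex) \<Rightarrow> real ^ 'n \<Rightarrow> complex" where
  "iter_partial [] f = f"
| "iter_partial (i # is) f =
    (\<lambda>x. frechet_derivative (iter_partial is f) (at x) (axis i 1))"

text \<open>
  All iterated partial derivatives being differentiable everywhere is equivalent to \<open>C\<^sup>\<infinity>\<close>.
\<close>

definition smooth :: "(real ^ 'n \<Rightarrow> complex) \<Rightarrow> bool"
  where "smooth f \<longleftrightarrow> (\<forall>is x. iter_partial is f differentiable (at x))"

definition schwartz_seminorm :: "nat \<Rightarrow> 'n list \<Rightarrow> (real ^ 'n \<Rightarrow> complex) \<Rightarrow> ennreal" where
  "schwartz_seminorm N is f = (SUP x. ennreal ((1 + norm x) ^ N * cmod (iter_partial is f x)))"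

definition schwartz :: "(real ^ 'n \<Rightarrow> complex) set"
  where "schwartz = {f. smooth f \<and> (\<forall>N is. schwartz_seminorm N is f < \<infinity>)}"

definition schwartz_topology :: "(real ^ 'n \<Rightarrow> complex) topology" where
  "schwartz_topology = topology_generated_by
    {{g \<in> schwartz. schwartz_seminorm N is (\<lambda>x. g x - f x) < ennreal \<epsilon>} | N is f \<epsilon>.
      f \<in> schwartz \<and> \<epsilon> > 0}"

definition schwartz_inf :: "(real ^ 'n \<Rightarrow> complex) set" where
  "schwartz_inf =
    {f \<in> schwartz. \<forall>\<gamma> :: 'n \<Rightarrow> nat. (LINT x|lebesgue. (\<Prod>i\<in>UNIV. (x $ i) ^ \<gamma> i) *\<^sub>R f x) = 0}"

text \<open>Only the values of a distribution on \<^const>\<open>schwartz_inf\<close> are relevant.\<close>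

definition distributions_inf ::
  "((real ^ 'n \<Rightarrow> complex) \<Rightarrow> 'a::{complex_normed_vector, banach}) set" where
  "distributions_inf = {f.
    (\<forall>g\<in>schwartz_inf. \<forall>h\<in>schwartz_inf. f (\<lambda>x. g x + h x) = f g + f h) \<and>
    (\<forall>c. \<forall>g\<in>schwartz_inf. f (\<lambda>x. c * g x) = c *\<^sub>C f g) \<and>
    continuous_map (subtopology schwartz_topology schwartz_inf) euclidean f}"

definition fourier :: "(real ^ 'n \<Rightarrow> complex) \<Rightarrow> real ^ 'n \<Rightarrow> complex"
  where "fourier f \<xi> = (LINT x|lebesgue. f x * exp (- \<i> * complex_of_real (x \<bullet> \<xi>)))"

definition littlewood_paley :: "(real ^ 'n \<Rightarrow> complex) \<Rightarrow> bool" where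
  "littlewood_paley \<phi> \<longleftrightarrow> \<phi> \<in> schwartz \<and>
    (\<exists>\<alpha> \<beta>. sqrt 2 < \<alpha> \<and> \<alpha> < \<beta> \<and> \<beta> < pi \<and>
      (\<exists>c>0. \<exists>C>0. \<forall>\<xi>.
        c * indicat_real {1 / \<alpha>..\<alpha>} (norm \<xi>) \<le> cmod (fourier \<phi> \<xi>) \<and>
        cmod (fourier \<phi> \<xi>) \<le> C * indicat_real {1 / \<beta>..\<beta>} (norm \<xi>)))"

definition dilate :: "int \<Rightarrow> (real ^ 'n \<Rightarrow> complex) \<Rightarrow> real ^ 'n \<Rightarrow> complex"
  where "dilate j \<phi> x = complex_of_real (2 powi (j * int CARD('n))) * \<phi> ((2 powi j) *\<^sub>R x)"

definition convolve ::
  "(real ^ 'n \<Rightarrow> complex) \<Rightarrow> ((real ^ 'n \<Rightarrow> complex) \<Rightarrow> 'a) \<Rightarrow> real ^ 'n \<Rightarrow> 'a"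
  where "convolve g f x = f (\<lambda>y. g (x - y))"


section \<open>Besov quasi-norms\<close>

definition dyadic_cubes :: "int \<Rightarrow> (real ^ 'n) set set" where
  "dyadic_cubes j =
    {cube (\<chi> i. 2 powi (- j) * real_of_int (k i)) (2 powi (- j)) | k :: 'n \<Rightarrow> int. True}"

definition dyadic_cube_at :: "int \<Rightarrow> real ^ 'n \<Rightarrow> (real ^ 'n) set"
  where "dyadic_cube_at j x = (THE Q. Q \<in> dyadic_cubes j \<and> x \<in> Q)"

definition besov_qnorm :: "real \<Rightarrow> real \<Rightarrow> ennreal \<Rightarrow> (int \<Rightarrow> real ^ 'n \<Rightarrow> ennreal) \<Rightarrow> ennreal" where
  "besov_qnorm s p q G =
    lq_qnorm q (\<lambda>j. ennreal (2 powr (of_int j * s)) * Lp_qnorm lebesgue (ennreal p) (G j))"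

definition besov_weight_qnorm ::
  "real \<Rightarrow> real \<Rightarrow> ennreal \<Rightarrow> (real ^ 'n \<Rightarrow> ('a::{complex_normed_vector, banach}, 'a) cblinfun) \<Rightarrow>
   (real ^ 'n \<Rightarrow> complex) \<Rightarrow> ((real ^ 'n \<Rightarrow> complex) \<Rightarrow> 'a) \<Rightarrow> ennreal" where
  "besov_weight_qnorm s p q V \<phi> f =
    besov_qnorm s p q (\<lambda>j x. ennreal (norm (V x (convolve (dilate j \<phi>) f x))))"

definition besov_avg_qnorm ::
  "real \<Rightarrow> real \<Rightarrow> ennreal \<Rightarrow> ((real ^ 'n) set \<Rightarrow> 'a::{complex_normed_vector, banach} \<Rightarrow> ennreal) \<Rightarrow>
   (real ^ 'n \<Rightarrow> complex) \<Rightarrow> ((real ^ 'n \<Rightarrow> complex) \<Rightarrow> 'a) \<Rightarrow> ennreal" where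
  "besov_avg_qnorm s p q R \<phi> f =
    besov_qnorm s p q (\<lambda>j x. R (dyadic_cube_at j x) (convolve (dilate j \<phi>) f x))"

end

theory Submission
  imports Defs "HOL-Probability.Sinc_Integral" "HOL-Probability.Characteristic_Functions"
begin

text \<open>
  Put \<open>g = \<phi>\<^sub>j * f\<close> and \<open>P = max p r\<close>. The function \<open>g\<close> is band-limited strictly below the Nyquist
  frequency of the grid \<open>2\<^sup>-\<^sup>j \<int>\<^sup>n\<close>, so it is recovered from its values on every translate of that grid by an
  oversampled Shannon series \<open>g x = \<Sum>\<^sub>l c\<^sub>l g (y\<^sub>l)\<close> with rapidly decaying scalar coefficients. Scalars
  commute with every bounded operator \<open>T\<close>, hence \<open>\<parallel>T (g x)\<parallel>\<^sup>\<delta>\<close> is at most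
  \<open>C \<Sum>\<^sub>l (1 + distance)\<^sup>-\<^sup>L \<parallel>T (g y\<^sub>l)\<parallel>\<^sup>\<delta>\<close> with \<open>C\<close> independent of \<open>f\<close>, \<open>j\<close> and \<open>T\<close>.

  The \<open>A\<^sub>P\<close> condition makes \<open>\<rho>\<close> doubling and its exponents below \<open>P\<close> interchangeable. Taking \<open>T = V x\<close> and
  integrating over \<open>x\<close> and over all translates of the grid bounds the weighted norm by the averaged one.
  For the converse with \<open>P > 1\<close>, take for \<open>T\<close> a functional \<open>e'\<close> norming \<open>\<rho> V P Q\<close> at \<open>g x\<close>: it satisfies
  \<open>\<bar>e' u\<bar> \<le> \<parallel>V\<^sup>-\<^sup>* e'\<parallel> \<parallel>V u\<parallel>\<close>, and Hoelder's inequality separates the two factors. For \<open>P \<le> 1\<close> the condition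
  bounds \<open>\<rho> V P Q\<close> by \<open>\<parallel>V y \<cdot>\<parallel>\<close> pointwise almost everywhere on \<open>Q\<close>.
\<close>

section \<open>Powers of extended reals and quasi-norms\<close>

text \<open>The average \<open>\<rho>\<close> is taken with one vector fixed, while \<open>g\<close>
  varies with the point. In each term of the series \<open>g\<close> is frozen at a grid point while
  \<open>x\<close> runs through a cube; integrating over the offset of the grid undoes the freezing.

  The obstacle is uniformity in \<open>f\<close>. A distribution has an order of its own, and the
  series is summed with kernels whose decay is matched to it, though the constants must not depend
  on it. Each kernel is a sinc function times two groups of sinc factors, whose widths share the gap
  between the band limit \<open>\<beta>\<close> and \<open>pi\<close>. The first group is fixed and
  alone gives the constants; the second depends on the order and only secures convergence.

  For \<open>P > 1\<close> the exponent \<open>\<delta>\<close> with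
  \<open>1 / \<delta> = 1 / p' + 1 / p\<close> makes Hoelder's inequality return the exponent
  \<open>p\<close> exactly, for every \<open>p > 0\<close>; the later power
  \<open>p / \<delta>\<close> is affordable as the decay is arbitrary. For \<open>P \<le> 1\<close>
  the difficulty is instead that the null sets of the condition depend on the vector; countable sets
  of vectors and lower semicontinuity of \<open>\<rho>\<close> remove it.\<close>

lemma ennpowr_ennreal: "0 \<le> x \<Longrightarrow> ennpowr (ennreal x) a = ennreal (x powr a)"
  by (simp add: ennpowr_def)

lemma ennpowr_top [simp]: "ennpowr top a = top"
  by (simp add: ennpowr_def)

lemma ennpowr_0 [simp]: "ennpowr 0 a = 0"
  by (simp add: ennpowr_def)

lemma ennpowr_1 [simp]: "ennpowr x 1 = x"
  by (cases x) (simp_all add: ennpowr_ennreal)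

lemma ennpowr_mono: "x \<le> y \<Longrightarrow> 0 < a \<Longrightarrow> ennpowr x a \<le> ennpowr y a"
  by (cases x; cases y) (simp_all add: ennpowr_ennreal top_unique powr_mono2)

lemma ennpowr_mult: "0 < a \<Longrightarrow> ennpowr (x * y) a = ennpowr x a * ennpowr y a"
  by (cases x; cases y)
    (auto simp: ennpowr_ennreal ennreal_mult_top ennreal_top_mult powr_mult
      simp flip: ennreal_mult ennreal_0)

lemma ennpowr_ennpowr: "ennpowr (ennpowr x a) b = ennpowr x (a * b)"
  by (cases x) (simp_all add: ennpowr_ennreal powr_powr)

lemma ennpowr_le_iff: "0 < a \<Longrightarrow> ennpowr x a \<le> y \<longleftrightarrow> x \<le> ennpowr y (1 / a)"
proof
  assume a: "0 < a" "ennpowr x a \<le> y"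
  show "x \<le> ennpowr y (1 / a)"
    using ennpowr_mono[OF a(2), of "1 / a"] a(1) by (simp add: ennpowr_ennpowr)
next
  assume a: "0 < a" "x \<le> ennpowr y (1 / a)"
  show "ennpowr x a \<le> y"
    using ennpowr_mono[OF a(2), of a] a(1) by (simp add: ennpowr_ennpowr)
qed

lemma ennpowr_cancel: "0 < a \<Longrightarrow> ennpowr x a \<le> ennpowr y a \<Longrightarrow> x \<le> y"
  by (simp add: ennpowr_le_iff ennpowr_ennpowr)

lemma ennpowr_eq_0_iff: "ennpowr x a = 0 \<longleftrightarrow> x = 0"
  by (cases x) (auto simp: ennpowr_ennreal)

lemma ennpowr_eq_top_iff: "ennpowr x a = top \<longleftrightarrow> x = top"
  by (cases x) (auto simp: ennpowr_ennreal)

lemma measurable_ennpowr [measurable (raw)]: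
  assumes [measurable]: "f \<in> borel_measurable M"
  shows "(\<lambda>x. ennpowr (f x) a) \<in> borel_measurable M"
  unfolding ennpowr_def by measurable

lemma ennpowr_mult3_le:
  assumes "ennpowr x a \<le> c * ennpowr y a" "0 < a"
  shows "x \<le> ennpowr c (1 / a) * y"
  using assms by (simp add: ennpowr_le_iff ennpowr_mult ennpowr_ennpowr)

section \<open>Lebesgue and sequence quasi-norms, Hoelder's inequality\<close>

lemma Lp_qnorm_le:
  assumes "0 < p" and "0 \<le> C"
    and "(\<integral>\<^sup>+x. ennpowr (F x) p \<partial>M) \<le> ennreal (C powr p) * (\<integral>\<^sup>+x. ennpowr (G x) p \<partial>M)"
  shows "Lp_qnorm M (ennreal p) F \<le> ennreal C * Lp_qnorm M (ennreal p) G"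
proof -
  have "ennpowr (\<integral>\<^sup>+x. ennpowr (F x) p \<partial>M) (1 / p) \<le>
      ennpowr (ennreal (C powr p) * (\<integral>\<^sup>+x. ennpowr (G x) p \<partial>M)) (1 / p)"
    using assms by (intro ennpowr_mono) auto
  also have "\<dots> = ennreal C * ennpowr (\<integral>\<^sup>+x. ennpowr (G x) p \<partial>M) (1 / p)"
    using assms by (simp add: ennpowr_mult ennpowr_ennreal powr_powr)
  finally show ?thesis
    using assms by (simp add: Lp_qnorm_def)
qed

lemma lq_qnorm_le:
  assumes "0 < q" and "0 \<le> C" and le: "\<And>j. a j \<le> ennreal C * b j"
  shows "lq_qnorm q a \<le> ennreal C * lq_qnorm q b"
proof (cases "q = \<infinity>")
  case True
  have "(SUP j. a j) \<le> (SUP j. ennreal C * b j)"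
    by (intro SUP_mono) (use le in auto)
  then show ?thesis
    using True by (simp add: lq_qnorm_def SUP_mult_left_ennreal)
next
  case False
  define r where "r = enn2real q"
  have r: "0 < r"
    using assms(1) False by (cases q) (auto simp: r_def)
  have "(\<Sum>\<^sub>\<infinity>j. ennpowr (a j) r) \<le> (\<Sum>\<^sub>\<infinity>j. ennreal (C powr r) * ennpowr (b j) r)"
  proof (intro infsum_mono)
    fix j
    have "ennpowr (a j) r \<le> ennpowr (ennreal C * b j) r"
      by (intro ennpowr_mono le r)
    then show "ennpowr (a j) r \<le> ennreal (C powr r) * ennpowr (b j) r"
      using assms r by (simp add: ennpowr_mult ennpowr_ennreal)
  qed (auto intro: nonneg_summable_on_complete)
  also have "\<dots> = ennreal (C powr r) * (\<Sum>\<^sub>\<infinity>j. ennpowr (b j) r)"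
    by (simp add: nonneg_infsum_complete sum_distrib_left[symmetric] SUP_mult_left_ennreal)
  finally have "ennpowr (\<Sum>\<^sub>\<infinity>j. ennpowr (a j) r) (1 / r) \<le>
      ennpowr (ennreal (C powr r) * (\<Sum>\<^sub>\<infinity>j. ennpowr (b j) r)) (1 / r)"
    using r by (intro ennpowr_mono) auto
  also have "\<dots> = ennreal C * ennpowr (\<Sum>\<^sub>\<infinity>j. ennpowr (b j) r) (1 / r)"
    using r assms by (simp add: ennpowr_mult ennpowr_ennreal powr_powr)
  finally show ?thesis
    using False by (simp add: lq_qnorm_def r_def)
qed

text \<open>Both Besov quantities share the outer norms in \<open>x\<close> and \<open>j\<close>.
  The theorem thus reduces to comparing \<open>p\<close>-th power integrals on a single level
  \<open>j\<close>, with a constant that does not depend on \<open>j\<close>.\<close>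

lemma besov_qnorm_le:
  fixes F G :: "int \<Rightarrow> real ^ 'n \<Rightarrow> ennreal"
  assumes "0 < p" "0 < q" "0 \<le> C"
    and "\<And>j. (\<integral>\<^sup>+x. ennpowr (F j x) p \<partial>lebesgue) \<le>
      ennreal (C powr p) * (\<integral>\<^sup>+x. ennpowr (G j x) p \<partial>lebesgue)"
  shows "besov_qnorm s p q F \<le> ennreal C * besov_qnorm s p q G"
  unfolding besov_qnorm_def
proof (rule lq_qnorm_le)
  fix j
  have "Lp_qnorm lebesgue (ennreal p) (F j) \<le> ennreal C * Lp_qnorm lebesgue (ennreal p) (G j)"
    using assms by (intro Lp_qnorm_le) auto
  then show "ennreal (2 powr (real_of_int j * s)) * Lp_qnorm lebesgue (ennreal p) (F j)
         \<le> ennreal C * (ennreal (2 powr (real_of_int j * s)) * Lp_qnorm lebesgue (ennreal p) (G j))"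
    by (subst mult.left_commute) (rule mult_left_mono, auto)
qed (use assms in auto)

lemma young_ennreal:
  assumes "0 < t" "t < 1"
  shows "ennpowr x t * ennpowr y (1 - t) \<le> ennreal t * x + ennreal (1 - t) * y"
proof (cases "x = top \<or> y = top")
  case True
  then have "ennreal t * x + ennreal (1 - t) * y = top"
    using assms by (auto simp: ennreal_mult_eq_top_iff)
  then show ?thesis by (simp only: top_greatest)
next
  case False
  then obtain a b where ab: "x = ennreal a" "y = ennreal b" "0 \<le> a" "0 \<le> b"
    by (metis ennreal_cases infinity_ennreal_def)
  have "a powr t * b powr (1 - t) \<le> t * a + (1 - t) * b"
  proof (cases "a = 0 \<or> b = 0")
    case False
    then show ?thesis
      using Youngs_inequality_0[of t "1 - t" a b] assms ab by auto
  qed (use assms ab in auto)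
  then show ?thesis
    using assms ab
    by (simp add: ennpowr_ennreal flip: ennreal_mult ennreal_plus)
qed

text \<open>Weights \<open>t\<close> and \<open>1 - t\<close> stand in for conjugate exponents,
  since the applications produce fractions such as \<open>\<delta> / p'\<close> and
  \<open>\<delta> / p\<close> with sum 1. Young's inequality is applied after normalising both
  integrals to 1.\<close>

lemma nn_integral_hoelder:
  assumes l: "0 < t" "t < 1"
    and [measurable]: "F \<in> borel_measurable M" "G \<in> borel_measurable M"
  shows "(\<integral>\<^sup>+x. ennpowr (F x) t * ennpowr (G x) (1 - t) \<partial>M) \<le>
    ennpowr (\<integral>\<^sup>+x. F x \<partial>M) t * ennpowr (\<integral>\<^sup>+x. G x \<partial>M) (1 - t)"
proof -
  let ?A = "\<integral>\<^sup>+x. F x \<partial>M" and ?B = "\<integral>\<^sup>+x. G x \<partial>M"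
  consider "?A = 0" | "?B = 0" | "?A \<noteq> 0" "?B \<noteq> 0" "?A = top \<or> ?B = top"
    | "?A \<noteq> 0" "?B \<noteq> 0" "?A \<noteq> top" "?B \<noteq> top"
    by blast
  then show ?thesis
  proof cases
    case 1
    \<comment> \<open>In \<open>ennreal\<close> the product \<open>0 * top\<close> is
      \<open>0\<close>, so a vanishing factor settles the case even if the other integral is
      infinite.\<close>
    then have "AE x in M. F x = 0" by (simp add: nn_integral_0_iff_AE)
    then have "(\<integral>\<^sup>+x. ennpowr (F x) t * ennpowr (G x) (1 - t) \<partial>M) = (\<integral>\<^sup>+x. 0 \<partial>M)"
      by (intro nn_integral_cong_AE) auto
    then show ?thesis by simp
  next
    case 2
    then have "AE x in M. G x = 0" by (simp add: nn_integral_0_iff_AE)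
    then have "(\<integral>\<^sup>+x. ennpowr (F x) t * ennpowr (G x) (1 - t) \<partial>M) = (\<integral>\<^sup>+x. 0 \<partial>M)"
      by (intro nn_integral_cong_AE) auto
    then show ?thesis by simp
  next
    case 3
    then have "ennpowr ?A t * ennpowr ?B (1 - t) = top"
      by (auto simp: ennreal_mult_top ennreal_top_mult ennpowr_eq_0_iff)
    then show ?thesis by simp
  next
    case 4
    then obtain a b where ab: "?A = ennreal a" "?B = ennreal b" "0 < a" "0 < b"
      by (metis ennreal_cases infinity_ennreal_def less_eq_real_def ennreal_0)
    have pt: "ennpowr (F x) t * ennpowr (G x) (1 - t) \<le>
        ennpowr ?A t * ennpowr ?B (1 - t) *
          (ennreal t * (ennreal (1 / a) * F x) + ennreal (1 - t) * (ennreal (1 / b) * G x))" for x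
    proof -
      have F: "F x = ennreal a * (ennreal (1 / a) * F x)"
        and G: "G x = ennreal b * (ennreal (1 / b) * G x)"
        using ab by (simp_all add: mult.assoc[symmetric] flip: ennreal_mult)
      have "ennpowr (F x) t * ennpowr (G x) (1 - t) =
          ennpowr ?A t * ennpowr ?B (1 - t) *
            (ennpowr (ennreal (1 / a) * F x) t * ennpowr (ennreal (1 / b) * G x) (1 - t))"
        unfolding ab(1,2)
        by (subst F, subst G) (use l in \<open>simp add: ennpowr_mult ac_simps\<close>)
      also have "\<dots> \<le> ennpowr ?A t * ennpowr ?B (1 - t) *
          (ennreal t * (ennreal (1 / a) * F x) + ennreal (1 - t) * (ennreal (1 / b) * G x))"
        by (intro mult_left_mono young_ennreal l) auto
      finally show ?thesis .
    qed
    have "(\<integral>\<^sup>+x. ennpowr (F x) t * ennpowr (G x) (1 - t) \<partial>M) \<le>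
        ennpowr ?A t * ennpowr ?B (1 - t) *
          (ennreal t * (ennreal (1 / a) * ?A) + ennreal (1 - t) * (ennreal (1 / b) * ?B))"
      by (rule order_trans[OF nn_integral_mono[OF pt]])
        (simp add: nn_integral_cmult nn_integral_add)
    also have "ennreal t * (ennreal (1 / a) * ?A) + ennreal (1 - t) * (ennreal (1 / b) * ?B) = 1"
      unfolding ab(1,2) using ab(3,4) l by (simp flip: ennreal_mult ennreal_plus)
    finally show ?thesis by simp
  qed
qed

section \<open>The Hahn--Banach theorem\<close>

text \<open>Homogeneity is only an inequality: this is what has to be checked for infima, and
  applying it to \<open>inverse c\<close> as well gives equality
  (\<open>sublinear_scale\<close>).\<close>

definition sublinear :: "('a::real_vector \<Rightarrow> real) \<Rightarrow> bool" where
  "sublinear p \<longleftrightarrow> (\<forall>x y. p (x + y) \<le> p x + p y) \<and> (\<forall>c>0. \<forall>x. p (c *\<^sub>R x) \<le> c * p x)"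

lemma sublinear_add: "sublinear p \<Longrightarrow> p (x + y) \<le> p x + p y"
  and sublinear_scale_le: "sublinear p \<Longrightarrow> 0 < c \<Longrightarrow> p (c *\<^sub>R x) \<le> c * p x"
  by (auto simp: sublinear_def)

lemma sublinear_scale:
  assumes "sublinear p" "0 < c"
  shows "p (c *\<^sub>R x) = c * p x"
proof (rule antisym)
  have "p x \<le> inverse c * p (c *\<^sub>R x)"
    using sublinear_scale_le[OF assms(1), of "inverse c" "c *\<^sub>R x"] assms(2) by simp
  then show "c * p x \<le> p (c *\<^sub>R x)"
    using assms(2) by (simp add: field_simps)
qed (use assms sublinear_scale_le in auto)

lemma sublinear_0: "sublinear p \<Longrightarrow> p 0 = 0"
  using sublinear_scale[of p 2 0] by simp

lemma sublinear_minus: "sublinear p \<Longrightarrow> - p (- x) \<le> p x"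
  using sublinear_add[of p x "- x"] by (simp add: sublinear_0)

text \<open>A minimal sublinear functional is unchanged by this reduction, hence odd, hence linear.\<close>

lemma sublinear_reduce:
  assumes p: "sublinear p"
  obtains q where "sublinear q" "\<And>x. q x \<le> p x" "q (- y) \<le> - p y"
proof -
  \<comment> \<open>The infimum over \<open>t \<ge> 0\<close> pushes \<open>p\<close> down along the
    ray through \<open>y\<close>. The bound \<open>- p (- x)\<close> keeps it finite, and
    \<open>t = 1\<close> at the point \<open>- y\<close> gives the value
    \<open>p 0 - p y\<close>.\<close>
  define f where "f x t = p (x + t *\<^sub>R y) - t * p y" for x t
  define q where "q x = (INF t\<in>{0..}. f x t)" for x
  have lower: "- p (- x) \<le> f x t" if "0 \<le> t" for x t
  proof (cases "t = 0")
    case True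
    then show ?thesis using sublinear_minus[OF p] by (simp add: f_def)
  next
    case False
    then have "t * p y = p (t *\<^sub>R y)" using that sublinear_scale[OF p, of t y] by simp
    also have "\<dots> \<le> p (x + t *\<^sub>R y) + p (- x)"
      using sublinear_add[OF p, of "x + t *\<^sub>R y" "- x"] by simp
    finally show ?thesis by (simp add: f_def)
  qed
  have bdd: "bdd_below (f x ` {0..})" for x
    using lower by (intro bdd_belowI2) auto
  have le: "q x \<le> f x t" if "0 \<le> t" for x t
    unfolding q_def using that by (intro cINF_lower bdd) auto
  have "sublinear q"
    unfolding sublinear_def
  proof (intro conjI allI impI)
    fix u v
    have *: "q (u + v) \<le> f u s + f v t" if "0 \<le> s" "0 \<le> t" for s t
    proof -
      have "q (u + v) \<le> f (u + v) (s + t)" using that by (intro le) auto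
      also have "\<dots> \<le> f u s + f v t"
        using sublinear_add[OF p, of "u + s *\<^sub>R y" "v + t *\<^sub>R y"]
        by (simp add: f_def algebra_simps)
      finally show ?thesis .
    qed
    have "q (u + v) - f u s \<le> q v" if "0 \<le> s" for s
      unfolding q_def[of v] using * that by (intro cINF_greatest) (auto simp: algebra_simps)
    then have "q (u + v) - q v \<le> q u"
      unfolding q_def[of u] by (intro cINF_greatest) (auto simp: algebra_simps)
    then show "q (u + v) \<le> q u + q v" by simp
  next
    fix c :: real and x assume c: "0 < c"
    have "q (c *\<^sub>R x) / c \<le> f x t" if "0 \<le> t" for t
    proof -
      have "q (c *\<^sub>R x) \<le> f (c *\<^sub>R x) (c * t)" using that c by (intro le) auto
      also have "\<dots> = c * f x t"
        using sublinear_scale[OF p c, of "x + t *\<^sub>R y"] by (simp add: f_def algebra_simps)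
      finally show ?thesis using c by (simp add: field_simps)
    qed
    then have "q (c *\<^sub>R x) / c \<le> q x"
      unfolding q_def[of x] by (intro cINF_greatest) auto
    then show "q (c *\<^sub>R x) \<le> c * q x" using c by (simp add: field_simps)
  qed
  moreover have "q x \<le> p x" for x using le[of 0 x] by (simp add: f_def)
  moreover have "q (- y) \<le> - p y"
    using le[of 1 "- y"] by (simp add: f_def sublinear_0[OF p])
  ultimately show ?thesis by (rule that)
qed

text \<open>Zorn's lemma for the reversed pointwise order. A chain is bounded by its pointwise
  infimum, which is finite because every member stays above \<open>- p (- x)\<close>.\<close>

lemma sublinear_minimal:
  assumes p: "sublinear p"
  obtains m where "sublinear m" "\<And>x. m x \<le> p x"
    "\<And>q. sublinear q \<Longrightarrow> (\<And>x. q x \<le> m x) \<Longrightarrow> q = m"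
proof -
  define A where "A = {q. sublinear q \<and> q \<le> p}"
  define P where "P = (\<lambda>a b. b \<le> (a :: 'a \<Rightarrow> real))"
  have "\<exists>m\<in>A. \<forall>a\<in>A. P m a \<longrightarrow> a = m"
  proof (rule predicate_Zorn)
    show "partial_order_on A (relation_of P A)"
      by (rule partial_order_on_relation_ofI) (auto simp: P_def)
  next
    fix C assume C: "C \<in> Chains (relation_of P A)"
    then have CA: "C \<subseteq> A" and tot: "\<And>a b. a \<in> C \<Longrightarrow> b \<in> C \<Longrightarrow> a \<le> b \<or> b \<le> a"
      by (auto simp: Chains_def relation_of_def P_def)
    show "\<exists>u\<in>A. \<forall>a\<in>C. P a u"
    proof (cases "C = {}")
      case True
      then show ?thesis using p by (auto simp: A_def)
    next
      case False
      define u where "u x = (INF q\<in>C. q x)" for x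
      have "- p (- x) \<le> q x" if "q \<in> C" for q x
      proof -
        have "sublinear q" "q (- x) \<le> p (- x)" using CA that by (auto simp: A_def le_fun_def)
        then show ?thesis using sublinear_minus[of q x] by linarith
      qed
      then have bdd: "bdd_below ((\<lambda>q. q x) ` C)" for x by (intro bdd_belowI2)
      have le: "u x \<le> q x" if "q \<in> C" for q x
        unfolding u_def using that by (intro cINF_lower bdd)
      have sub: "sublinear q" if "q \<in> C" for q using CA that by (auto simp: A_def)
      have "sublinear u"
        unfolding sublinear_def
      proof (intro conjI allI impI)
        fix x y
        \<comment> \<open>Two members evaluated at different points have to be compared with one
          functional; the smaller of the two in the chain serves for both.\<close>
        have *: "u (x + y) \<le> q x + r y" if qr: "q \<in> C" "r \<in> C" for q r
        proof -
          obtain w where w: "w \<in> C" "w \<le> q" "w \<le> r"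
            using tot[OF qr] qr by auto
          have "u (x + y) \<le> w (x + y)" using w(1) by (rule le)
          also have "\<dots> \<le> w x + w y" by (rule sublinear_add[OF sub[OF w(1)]])
          also have "\<dots> \<le> q x + r y" using w(2,3) by (intro add_mono) (auto simp: le_fun_def)
          finally show ?thesis .
        qed
        have **: "u (x + y) - q x \<le> r y" if "q \<in> C" "r \<in> C" for q r
          using *[OF that] by linarith
        have ***: "u (x + y) - q x \<le> u y" if "q \<in> C" for q
          unfolding u_def[of y] by (rule cINF_greatest[OF False]) (rule **[OF that])
        have "u (x + y) - u y \<le> q x" if "q \<in> C" for q
          using ***[OF that] by linarith
        then have "u (x + y) - u y \<le> u x"
          unfolding u_def[of x] by (rule cINF_greatest[OF False])
        then show "u (x + y) \<le> u x + u y" by simp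
      next
        fix c :: real and x assume c: "0 < c"
        have "u (c *\<^sub>R x) / c \<le> q x" if "q \<in> C" for q
          using le[OF that, of "c *\<^sub>R x"] sublinear_scale[OF sub[OF that] c, of x] c
          by (simp add: field_simps)
        then have "u (c *\<^sub>R x) / c \<le> u x"
          unfolding u_def[of x] by (rule cINF_greatest[OF False])
        then show "u (c *\<^sub>R x) \<le> c * u x" using c by (simp add: field_simps)
      qed
      moreover have "u \<le> p"
      proof (rule le_funI)
        fix x
        obtain q where q: "q \<in> C" using False by blast
        then have "q x \<le> p x" using CA by (auto simp: A_def le_fun_def)
        with le[OF q, of x] show "u x \<le> p x" by linarith
      qed
      ultimately have "u \<in> A" by (simp add: A_def)
      moreover have "\<forall>a\<in>C. P a u" unfolding P_def le_fun_def using le by blast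
      ultimately show ?thesis by blast
    qed
  qed
  then obtain m where m: "m \<in> A" "\<And>a. a \<in> A \<Longrightarrow> a \<le> m \<Longrightarrow> a = m"
    by (auto simp: P_def)
  have le: "m x \<le> p x" for x using m(1) by (simp add: A_def le_fun_def)
  have "q = m" if q: "sublinear q" "\<And>x. q x \<le> m x" for q
  proof (rule m(2))
    have "q x \<le> p x" for x using q(2)[of x] le[of x] by linarith
    then show "q \<in> A" using q(1) by (simp add: A_def le_fun_def)
  qed (use q(2) in \<open>simp add: le_fun_def\<close>)
  then show ?thesis
    using m(1) le by (intro that[of m]) (auto simp: A_def)
qed

text \<open>Reducing \<open>p\<close> at \<open>y\<close> before minimising forces the minimal
  functional to attain \<open>p y\<close>; its linearity comes from minimality against the
  reductions at all other points.\<close>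

lemma hahn_banach_real:
  assumes p: "sublinear p"
  obtains m :: "'a::real_vector \<Rightarrow> real" where "linear m" "\<And>x. m x \<le> p x" "m y = p y"
proof -
  obtain p' where p': "sublinear p'" "\<And>x. p' x \<le> p x" "p' (- y) \<le> - p y"
    using sublinear_reduce[OF p, where y=y] by blast
  obtain m where m: "sublinear m" "\<And>x. m x \<le> p' x"
    "\<And>q. sublinear q \<Longrightarrow> (\<And>x. q x \<le> m x) \<Longrightarrow> q = m"
    using sublinear_minimal[OF p'(1)] by blast
  have neg: "m (- x) = - m x" for x
  proof -
    obtain q where q: "sublinear q" "\<And>x. q x \<le> m x" "q (- x) \<le> - m x"
      using sublinear_reduce[OF m(1), where y=x] by blast
    have "q = m" using q by (intro m(3))
    then show ?thesis using q(3) sublinear_minus[OF m(1), of x] by simp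
  qed
  have add: "m (x + y) = m x + m y" for x y
    using sublinear_add[OF m(1), of x y] sublinear_add[OF m(1), of "x + y" "- y"] by (simp add: neg)
  have scale: "m (c *\<^sub>R x) = c * m x" for c x
  proof -
    consider "c = 0" | "c > 0" | "c < 0" by linarith
    then show ?thesis
    proof cases
      case 3
      then show ?thesis using sublinear_scale[OF m(1), of "- c" x] neg[of "c *\<^sub>R x"] by simp
    qed (use sublinear_0[OF m(1)] sublinear_scale[OF m(1)] in auto)
  qed
  have le: "m x \<le> p x" for x using m(2) p'(2) order_trans by blast
  have "p y \<le> m y" using m(2)[of "- y"] p'(3) by (simp add: neg)
  then show ?thesis
    using le[of y] by (intro that[of m] linearI) (auto simp: add scale le)
qed

lemma scaleC_scaleR_commute: "c *\<^sub>C r *\<^sub>R x = r *\<^sub>R c *\<^sub>C x"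
  by (rule linear_scale[OF bounded_linear.linear[OF bounded_linear_scaleC_right]])

text \<open>The functional is the complexification of a real one. A rotation by a unimodular scalar
  reduces \<open>cmod (g x)\<close> to a value of \<open>m\<close>, and the seminorm does not see
  the rotation. The bound by \<open>K\<close> puts the functional into the dual.\<close>

lemma hahn_banach_seminorm:
  fixes N :: "'a::complex_normed_vector \<Rightarrow> real"
  assumes add: "\<And>x y. N (x + y) \<le> N x + N y"
    and scale: "\<And>c x. N (c *\<^sub>C x) = cmod c * N x"
    and bound: "\<And>x. N x \<le> K * norm x"
  obtains e' :: "'a cdual" where "\<And>x. cmod (e' x) \<le> N x" "cmod (e' y) = N y"
proof -
  have "sublinear N"
    unfolding sublinear_def
  proof (intro conjI allI impI)
    fix c :: real and x assume "0 < c"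
    then show "N (c *\<^sub>R x) \<le> c * N x"
      using scale[of "complex_of_real c" x] by (simp add: scaleC_of_real)
  qed (rule add)
  then obtain m where m: "linear m" "\<And>x. m x \<le> N x" "m y = N y"
    using hahn_banach_real by blast
  \<comment> \<open>A complex linear functional is recovered from its real part \<open>m\<close> in
    this way.\<close>
  define g where "g x = Complex (m x) (- m (\<i> *\<^sub>C x))" for x
  have ii: "\<i> *\<^sub>C \<i> *\<^sub>C x = - x" for x :: 'a
    using scaleC_of_real[of "-1" x] by (simp add: scaleC_scaleC)
  have g_add: "g (x + z) = g x + g z" for x z
    using m(1) by (simp add: g_def scaleC_add_right linear_add complex_eq_iff)
  have g_R: "g (r *\<^sub>R x) = r *\<^sub>R g x" for r x
    using m(1) by (simp add: g_def scaleC_scaleR_commute linear_scale complex_eq_iff)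
  have g_i: "g (\<i> *\<^sub>C x) = \<i> * g x" for x
    using m(1) by (simp add: g_def ii linear_neg complex_eq_iff)
  have g_C: "g (c *\<^sub>C x) = c * g x" for c x
  proof -
    have c: "c = complex_of_real (Re c) + complex_of_real (Im c) * \<i>"
      by (simp add: complex_eq_iff)
    have "c *\<^sub>C x = Re c *\<^sub>R x + Im c *\<^sub>R \<i> *\<^sub>C x"
      by (subst c) (simp only: scaleC_add_left scaleC_scaleC[symmetric] scaleC_of_real)
    then have "g (c *\<^sub>C x) = Re c *\<^sub>R g x + Im c *\<^sub>R (\<i> * g x)"
      by (simp only: g_add g_R g_i)
    then show ?thesis
      by (simp add: complex_eq_iff)
  qed
  have g_le: "cmod (g x) \<le> N x" for x
  proof (cases "g x = 0")
    case True
    then have "N x \<ge> 0" using m(2)[of x] by (simp add: g_def complex_eq_iff)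
    then show ?thesis using True by simp
  next
    case False
    \<comment> \<open>\<open>c\<close> rotates \<open>g x\<close> onto the positive real axis, where
      \<open>g\<close> agrees with its real part.\<close>
    define c where "c = cnj (sgn (g x))"
    have c1: "cmod c = 1" using False by (simp add: c_def norm_sgn)
    have "c * g x = (g x * cnj (g x)) / complex_of_real (cmod (g x))"
      by (simp add: c_def sgn_eq)
    also have "\<dots> = complex_of_real (cmod (g x))"
      unfolding complex_norm_square[symmetric] using False by (simp add: power2_eq_square)
    finally have c2: "c * g x = complex_of_real (cmod (g x))" .
    note c = c1 c2
    have "cmod (g x) = Re (g (c *\<^sub>C x))" by (simp add: g_C c)
    also have "\<dots> \<le> N (c *\<^sub>C x)" using m(2) by (simp add: g_def)
    finally show ?thesis by (simp add: scale c)
  qed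
  have "bounded_linear g"
    by (rule bounded_linear_intro[where K=K]) (auto simp: g_add g_R mult.commute intro: order_trans[OF g_le bound])
  then have app: "blinfun_apply (Blinfun g) = g" by (rule bounded_linear_Blinfun_apply)
  define e' :: "'a cdual" where "e' = Abs_cblinfun (Blinfun g)"
  have e': "cblinfun_apply e' x = g x" for x
    by (simp add: e'_def cblinfun_apply.rep_eq Abs_cblinfun_inverse app g_C scaleC_complex_def)
  have "N y \<le> cmod (g y)"
    using m(3) complex_Re_le_cmod[of "g y"] by (simp add: g_def)
  then show ?thesis
    using g_le[of y] g_le by (intro that[of e']) (auto simp: e')
qed

section \<open>Operator-valued weights\<close>

lemma bounded_linear_cblinfun_apply: "bounded_linear (cblinfun_apply T)"
  by (simp add: cblinfun_apply.rep_eq blinfun.bounded_linear_right)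

lemma norm_cblinfun_apply_le: "norm (cblinfun_apply T x) \<le> norm T * norm x"
  unfolding cblinfun_apply.rep_eq norm_cblinfun.rep_eq by (rule norm_blinfun)

lemma cblinfun_apply_scaleC: "cblinfun_apply T (c *\<^sub>C x) = c *\<^sub>C cblinfun_apply T x"
  using blinfun_of_cblinfun[of T] by (simp add: cblinfun_apply.rep_eq)

lemma inverse_cblinfun:
  assumes "invertible_cblinfun T"
  shows "cblinfun_apply T (inv_cblinfun T x) = x" "cblinfun_apply (inv_cblinfun T) (T x) = x"
proof -
  obtain S where S: "is_inverse_cblinfun T S"
    using assms by (auto simp: invertible_cblinfun_def)
  have uniq: "S' = S" if "is_inverse_cblinfun T S'" for S'
  proof (rule cblinfun_eqI)
    fix x
    have "T (S x) = x"
      by (metis S cblinfun_compose_apply id_cblinfun_apply is_inverse_cblinfun_def)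
    moreover have "S' (T (S x)) = S x"
      by (metis that cblinfun_compose_apply id_cblinfun_apply is_inverse_cblinfun_def)
    ultimately show "S' x = S x" by simp
  qed
  have "inv_cblinfun T = S"
    unfolding inv_cblinfun_def if_P[OF assms] using S uniq by (rule the_equality)
  then show "T (inv_cblinfun T x) = x" "inv_cblinfun T (T x) = x"
    using S by (metis cblinfun_compose_apply id_cblinfun_apply is_inverse_cblinfun_def)+
qed

section \<open>Strong measurability\<close>

lemma strongly_measurable_norm:
  assumes "strongly_measurable f"
  shows "(\<lambda>x. norm (f x)) \<in> borel_measurable lebesgue"
proof -
  obtain s :: "nat \<Rightarrow> _" where s: "\<And>k. simple_function lebesgue (s k)" "\<And>x. (\<lambda>k. s k x) \<longlonglongrightarrow> f x"
    using assms by (auto simp: strongly_measurable_def)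
  show ?thesis
  proof (rule borel_measurable_LIMSEQ_real)
    show "(\<lambda>k. norm (s k x)) \<longlonglongrightarrow> norm (f x)" for x by (intro tendsto_norm s)
    show "(\<lambda>x. norm (s k x)) \<in> borel_measurable lebesgue" for k
      using simple_function_compose1[OF s(1)[of k], of norm] by (rule borel_measurable_simple_function)
  qed
qed

text \<open>Countably many vectors stand in for the possibly uncountably many values of
  \<open>f\<close>, so that the null sets of almost everywhere statements about single vectors can
  be united.\<close>

lemma strongly_measurable_separable:
  assumes "strongly_measurable f"
  obtains D where "countable D" "\<And>x. f x \<in> closure D"
proof -
  obtain s :: "nat \<Rightarrow> _" where s: "\<And>k. simple_function lebesgue (s k)" "\<And>x. (\<lambda>k. s k x) \<longlonglongrightarrow> f x"
    using assms by (auto simp: strongly_measurable_def)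
  show ?thesis
  proof (rule that)
    show "countable (\<Union>k. range (s k))"
      using s(1) by (auto simp: simple_function_def intro: countable_finite)
    show "f x \<in> closure (\<Union>k. range (s k))" for x
      using s(2)[of x] by (auto simp: closure_sequential intro!: exI[of _ "\<lambda>k. s k x"])
  qed
qed

text \<open>The \<open>t\<close>-th power of \<open>\<rho>\<close> times the volume. Unlike the
  average it increases with the set, and Fatou's lemma applies to it directly.\<close>

definition wint :: "(real ^ 'n \<Rightarrow> ('a::complex_normed_vector, 'a) cblinfun) \<Rightarrow> real \<Rightarrow>
    (real ^ 'n) set \<Rightarrow> 'a \<Rightarrow> ennreal" where
  "wint V t Q e = (\<integral>\<^sup>+x\<in>Q. ennpowr (ennreal (norm (V x e))) t \<partial>lebesgue)"

section \<open>Cubes and lower semicontinuity of the averages\<close>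

lemma cube_measurable [measurable, simp]: "cube a l \<in> sets borel"
proof -
  have "cube a l = (\<Inter>i. {x. a $ i \<le> x $ i} \<inter> {x. x $ i < a $ i + l})"
    by (auto simp: cube_def)
  also have "\<dots> \<in> sets borel"
    by (intro sets.countable_INT'' sets.Int borel_closed borel_open closed_Collect_le open_Collect_less
        continuous_intros) auto
  finally show ?thesis .
qed

lemma cube_lebesgue [measurable, simp]: "cube a l \<in> sets lebesgue"
  by simp

lemma emeasure_cube:
  fixes a :: "real ^ 'n"
  assumes "0 < l"
  shows "emeasure lborel (cube a l) = ennreal (l ^ CARD('n))"
    and "emeasure lebesgue (cube a l) = ennreal (l ^ CARD('n))"
proof -
  let ?b = "a + (\<chi> i. l)"
  have prod: "(\<Prod>b\<in>Basis. (?b - a) \<bullet> b) = l ^ CARD('n)"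
  proof -
    have "(\<Prod>b\<in>(Basis :: (real ^ 'n) set). (?b - a) \<bullet> b) = (\<Prod>b\<in>(Basis :: (real ^ 'n) set). l)"
      by (intro prod.cong) (auto simp: Basis_vec_def inner_axis)
    then show ?thesis by simp
  qed
  have le: "\<And>b. b \<in> Basis \<Longrightarrow> a \<bullet> b \<le> ?b \<bullet> b"
    using assms by (auto simp: Basis_vec_def inner_axis)
  have "emeasure lborel (box a ?b) \<le> emeasure lborel (cube a l)"
    by (intro emeasure_mono) (auto simp: cube_def mem_box_cart less_imp_le)
  moreover have "emeasure lborel (cube a l) \<le> emeasure lborel (cbox a ?b)"
    by (intro emeasure_mono) (auto simp: cube_def mem_box_cart less_imp_le)
  ultimately show "emeasure lborel (cube a l) = ennreal (l ^ CARD('n))"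
    using le prod by (simp add: emeasure_lborel_box_eq emeasure_lborel_cbox_eq del: inner_diff_left)
  then show "emeasure lebesgue (cube a l) = ennreal (l ^ CARD('n))" by simp
qed

lemma cube_in_cubes: "0 < l \<Longrightarrow> cube a l \<in> cubes"
  by (auto simp: cubes_def)

lemma wint_rho:
  fixes V :: "real ^ 'n \<Rightarrow> ('a::{complex_normed_vector, banach}, 'a) cblinfun"
  assumes "0 < l" "0 < t"
  shows "wint V t (cube a l) e = ennreal (l ^ CARD('n)) * ennpowr (\<rho> V t (cube a l) e) t"
proof -
  have "ennpowr (\<rho> V t (cube a l) e) t = wint V t (cube a l) e / ennreal (l ^ CARD('n))"
    using assms by (simp add: avg_qnorm_def wint_def emeasure_cube ennpowr_ennpowr)
  then show ?thesis
    using assms by (simp add: ennreal_times_divide mult.commute[of "ennreal _"] mult_divide_eq_ennreal ennreal_eq_0_iff not_le)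
qed

lemma rho_le_iff:
  fixes V :: "real ^ 'n \<Rightarrow> ('a::{complex_normed_vector, banach}, 'a) cblinfun"
  assumes "0 < l" "0 < t"
  shows "\<rho> V t (cube a l) e \<le> K \<longleftrightarrow> wint V t (cube a l) e \<le> ennreal (l ^ CARD('n)) * ennpowr K t"
proof -
  have "\<rho> V t (cube a l) e \<le> K \<longleftrightarrow> ennpowr (\<rho> V t (cube a l) e) t \<le> ennpowr K t"
    using assms(2) ennpowr_mono ennpowr_cancel by blast
  also have "\<dots> \<longleftrightarrow> wint V t (cube a l) e \<le> ennreal (l ^ CARD('n)) * ennpowr K t"
    unfolding wint_rho[OF assms] using assms(1)
    by (subst ennreal_mult_le_mult_iff) (auto simp: ennreal_eq_0_iff not_le)
  finally show ?thesis .
qed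

lemma weight_measurable:
  assumes "weight V"
  shows "(\<lambda>x. norm (V x e)) \<in> borel_measurable lebesgue"
  using assms by (intro strongly_measurable_norm) (auto simp: weight_def)


text \<open>Fatou's lemma: each single \<open>V x\<close> is continuous, but no bound on its norm
  that is integrable in \<open>x\<close> is at hand for dominated convergence.\<close>

lemma wint_lsc:
  fixes V :: "real ^ 'n \<Rightarrow> ('a::{complex_normed_vector, banach}, 'a) cblinfun"
  assumes "weight V" "0 < t" "u \<longlonglongrightarrow> e" and [measurable]: "Q \<in> sets lebesgue"
  shows "wint V t Q e \<le> liminf (\<lambda>k. wint V t Q (u k))"
proof -
  note [measurable] = weight_measurable[OF assms(1)]
  have lim: "(\<lambda>k. ennpowr (ennreal (norm (V x (u k)))) t * indicator Q x)
      \<longlonglongrightarrow> ennpowr (ennreal (norm (V x e))) t * indicator Q x" for x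
    by (cases "x \<in> Q")
      (auto simp: ennpowr_ennreal assms(2) intro!: tendsto_intros assms(2,3) bounded_linear.tendsto[OF bounded_linear_cblinfun_apply])
  have "wint V t Q e = (\<integral>\<^sup>+x. liminf (\<lambda>k. ennpowr (ennreal (norm (V x (u k)))) t * indicator Q x) \<partial>lebesgue)"
    unfolding wint_def by (rule nn_integral_cong, rule sym, rule lim_imp_Liminf[OF _ lim]) simp
  also have "\<dots> \<le> liminf (\<lambda>k. wint V t Q (u k))"
    unfolding wint_def by (rule nn_integral_liminf) measurable
  finally show ?thesis .
qed

text \<open>Extends a bound from a countable set of vectors to its closure. The map \<open>h\<close>
  makes room for the inverse of \<open>V y\<close> in \<open>A_class_le_1_pointwise\<close>, where
  the bound concerns \<open>u\<close> and the integral its image.\<close>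

lemma wint_closure:
  fixes D :: "'a::{complex_normed_vector, banach} set" and h :: "'a \<Rightarrow> 'a" and V :: "real ^ 'n \<Rightarrow> ('a::{complex_normed_vector, banach}, 'a) cblinfun"
  assumes "weight V" "0 < t" "Q \<in> sets lebesgue" "e \<in> closure D" "continuous_on UNIV b"
    and le: "\<And>u. u \<in> D \<Longrightarrow> wint V t Q (h u) \<le> ennreal (b u)" and h: "continuous_on UNIV h"
  shows "wint V t Q (h e) \<le> ennreal (b e)"
proof -
  obtain u where u: "\<And>k. u k \<in> D" "u \<longlonglongrightarrow> e"
    using assms(4) unfolding closure_sequential by blast
  have lim: "(\<lambda>k. h (u k)) \<longlonglongrightarrow> h e" "(\<lambda>k. ennreal (b (u k))) \<longlonglongrightarrow> ennreal (b e)"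
    using continuous_on_tendsto_compose[OF h u(2)] continuous_on_tendsto_compose[OF assms(5) u(2)]
    by (simp_all add: tendsto_ennrealI)
  have "wint V t Q (h e) \<le> liminf (\<lambda>k. wint V t Q (h (u k)))"
    by (rule wint_lsc[OF assms(1,2) lim(1) assms(3)])
  also have "\<dots> \<le> liminf (\<lambda>k. ennreal (b (u k)))"
    by (intro Liminf_mono always_eventually allI le[OF u(1)])
  also have "\<dots> = ennreal (b e)" by (intro lim_imp_Liminf lim) simp
  finally show ?thesis .
qed

section \<open>The averages as seminorms for exponents at least 1\<close>

lemma powr_convex_le:
  fixes a b t p :: real
  assumes "0 \<le> a" "0 \<le> b" "0 < t" "t < 1" "1 \<le> p"
  shows "(t * a + (1 - t) * b) powr p \<le> t * a powr p + (1 - t) * b powr p"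
proof (cases "a = 0 \<or> b = 0")
  case True
  have *: "(s * c) powr p \<le> s * c powr p" if "0 < s" "s < 1" "0 \<le> c" for s c :: real
  proof -
    have "s powr p \<le> s powr 1" using that assms by (intro powr_mono') auto
    then show ?thesis using that by (simp add: powr_mult mult_right_mono)
  qed
  show ?thesis using True *[of t a] *[of "1 - t" b] assms by auto
next
  case False
  then show ?thesis
    using convex_onD[OF powr_convex[OF assms(5)], of "1 - t" a b] assms by (simp add: algebra_simps)
qed

text \<open>Minkowski's inequality, from convexity of the \<open>P\<close>-th power with weights
  \<open>\<alpha> / (\<alpha> + \<beta>)\<close> and \<open>\<beta> / (\<alpha> + \<beta>)\<close>.
  Strictly positive bounds in place of the two averages keep these quotients meaningful; the callers
  add slack.\<close>

lemma rho_add_le: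
  fixes V :: "real ^ 'n \<Rightarrow> ('a::{complex_normed_vector, banach}, 'a) cblinfun"
  assumes V: "weight V" and P: "1 \<le> P" and l: "0 < l"
    and ab: "0 < \<alpha>" "0 < \<beta>" "\<rho> V P (cube a l) x \<le> ennreal \<alpha>" "\<rho> V P (cube a l) y \<le> ennreal \<beta>"
  shows "\<rho> V P (cube a l) (x + y) \<le> ennreal (\<alpha> + \<beta>)"
proof -
  note [measurable] = weight_measurable[OF V]
  let ?n = "CARD('n)" and ?Q = "cube a l"
  let ?t = "\<alpha> / (\<alpha> + \<beta>)"
  let ?A = "(\<alpha> + \<beta>) powr P * ?t / \<alpha> powr P" and ?B = "(\<alpha> + \<beta>) powr P * (1 - ?t) / \<beta> powr P"
  have P0: "0 < P" using P by simp
  have wx: "wint V P ?Q x \<le> ennreal (l ^ ?n * \<alpha> powr P)"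
    and wy: "wint V P ?Q y \<le> ennreal (l ^ ?n * \<beta> powr P)"
    using ab l P0 by (simp_all add: rho_le_iff ennpowr_ennreal ennreal_mult)
  have t: "0 < ?t" "?t < 1" and t': "1 - ?t = \<beta> / (\<alpha> + \<beta>)" using ab by (auto simp: field_simps)
  have AB: "0 \<le> ?A" "0 \<le> ?B" using t ab by auto
  have pt: "ennpowr (ennreal (norm (V z (x + y)))) P \<le>
      ennreal ?A * ennpowr (ennreal (norm (V z x))) P +
      ennreal ?B * ennpowr (ennreal (norm (V z y))) P" for z
  proof -
    let ?u = "norm (V z x)" and ?v = "norm (V z y)"
    have "norm (V z (x + y)) \<le> ?u + ?v"
      using norm_triangle_ineq by (simp add: linear_add[OF bounded_linear.linear[OF bounded_linear_cblinfun_apply]])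
    also have "\<dots> = (\<alpha> + \<beta>) * (?t * (?u / \<alpha>) + (1 - ?t) * (?v / \<beta>))"
      unfolding t' distrib_left using ab by simp
    finally have "norm (V z (x + y)) powr P \<le> ((\<alpha> + \<beta>) * (?t * (?u / \<alpha>) + (1 - ?t) * (?v / \<beta>))) powr P"
      using P by (intro powr_mono2) auto
    also have "\<dots> = (\<alpha> + \<beta>) powr P * (?t * (?u / \<alpha>) + (1 - ?t) * (?v / \<beta>)) powr P"
      by (rule powr_mult)
    also have "\<dots> \<le> (\<alpha> + \<beta>) powr P * (?t * (?u / \<alpha>) powr P + (1 - ?t) * (?v / \<beta>) powr P)"
      using ab t P by (intro mult_left_mono powr_convex_le) auto
    also have "\<dots> = ?A * ?u powr P + ?B * ?v powr P"
      using ab by (simp add: powr_divide distrib_left)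
    finally have "ennreal (norm (V z (x + y)) powr P) \<le> ennreal (?A * ?u powr P + ?B * ?v powr P)"
      by (rule ennreal_leI)
    also have "\<dots> = ennreal ?A * ennreal (?u powr P) + ennreal ?B * ennreal (?v powr P)"
      using AB by (simp only: ennreal_mult ennreal_plus powr_ge_zero mult_nonneg_nonneg)
    finally show ?thesis
      by (simp only: ennpowr_ennreal norm_ge_zero)
  qed
  have "wint V P ?Q (x + y) \<le> ennreal ?A * wint V P ?Q x + ennreal ?B * wint V P ?Q y"
    unfolding wint_def
    by (rule order_trans[OF nn_integral_mono[OF mult_right_mono[OF pt]]])
      (simp_all add: nn_integral_add nn_integral_cmult distrib_right mult.assoc)
  also have "\<dots> \<le> ennreal ?A * ennreal (l ^ ?n * \<alpha> powr P) + ennreal ?B * ennreal (l ^ ?n * \<beta> powr P)"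
    by (intro add_mono mult_left_mono wx wy) auto
  also have "\<dots> = ennreal (?A * (l ^ ?n * \<alpha> powr P) + ?B * (l ^ ?n * \<beta> powr P))"
    using AB l by (simp only: ennreal_mult ennreal_plus powr_ge_zero mult_nonneg_nonneg less_imp_le zero_le_power)
  also have "?A * (l ^ ?n * \<alpha> powr P) + ?B * (l ^ ?n * \<beta> powr P) =
      (\<alpha> + \<beta>) powr P * l ^ ?n * (?t + (1 - ?t))"
    using ab unfolding distrib_left by simp
  finally have "wint V P ?Q (x + y) \<le> ennreal (l ^ ?n) * ennpowr (ennreal (\<alpha> + \<beta>)) P"
    using ab l by (simp add: ennpowr_ennreal ennreal_mult mult.commute del: ennreal_plus)
  then show ?thesis
    using rho_le_iff[OF l P0] by blast
qed

lemma rho_scaleC: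
  fixes V :: "real ^ 'n \<Rightarrow> ('a::{complex_normed_vector, banach}, 'a) cblinfun"
  assumes V: "weight V" and t: "0 < t" and l: "0 < l"
  shows "\<rho> V t (cube a l) (c *\<^sub>C x) = ennreal (cmod c) * \<rho> V t (cube a l) x"
proof -
  note [measurable] = weight_measurable[OF V]
  have "ennpowr (ennreal (cmod c) * ennreal (norm (V z x))) t =
      ennreal (cmod c powr t) * ennpowr (ennreal (norm (V z x))) t" for z
    using t by (simp add: ennpowr_mult ennpowr_ennreal)
  then show ?thesis
    using t
    by (simp add: avg_qnorm_def cblinfun_apply_scaleC norm_scaleC ennreal_mult mult.assoc nn_integral_cmult
        ennreal_times_divide[symmetric] ennpowr_mult ennpowr_ennreal powr_powr)
qed

lemma rho_finite:
  fixes V :: "real ^ 'n \<Rightarrow> ('a::{complex_normed_vector, banach}, 'a) cblinfun"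
  assumes V: "p_weight (ennreal t) V" and t: "0 < t" and l: "0 < l"
  shows "\<rho> V t (cube a l) e < top"
proof -
  have "in_Lp (ennreal t) (\<lambda>x. indicat_real (cube a l) x *\<^sub>R V x e)"
    using V cube_in_cubes[OF l] by (auto simp: p_weight_def)
  then have "(\<integral>\<^sup>+x. ennpowr (ennreal (norm (indicat_real (cube a l) x *\<^sub>R V x e))) t \<partial>lebesgue) < top"
    using t by (auto simp: in_Lp_def Lp_qnorm_def less_top[symmetric] ennpowr_eq_top_iff)
  also have "(\<lambda>x. ennpowr (ennreal (norm (indicat_real (cube a l) x *\<^sub>R V x e))) t) =
      (\<lambda>x. ennpowr (ennreal (norm (V x e))) t * indicator (cube a l) x)"
    by (auto simp: indicator_def)
  moreover have "ennreal (l ^ CARD('n)) \<noteq> 0"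
    using l by (simp add: ennreal_eq_0_iff not_le)
  ultimately show ?thesis
    using l by (auto simp: avg_qnorm_def less_top[symmetric] ennpowr_eq_top_iff emeasure_cube ennreal_divide_eq_top_iff)
qed

text \<open>A \<open>p\<close>-weight has finite averages for each vector separately. The Baire
  category theorem turns this into one bound: the sublevel sets are closed by lower semicontinuity,
  so one of them contains a ball.\<close>

lemma rho_bounded:
  fixes V :: "real ^ 'n \<Rightarrow> ('a::{complex_normed_vector, banach}, 'a) cblinfun"
  assumes V: "p_weight (ennreal P) V" and P: "1 \<le> P" and l: "0 < l"
  obtains K where "\<And>e. \<rho> V P (cube a l) e \<le> ennreal (K * norm e)"
proof -
  have w: "weight V" using V by (simp add: p_weight_def)
  have P0: "0 < P" using P by simp
  define T where "T k = {e. \<rho> V P (cube a l) e \<le> ennreal (real k)}" for k :: nat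
  have cl: "closed (T k)" for k
  proof -
    have "e \<in> T k" if e: "e \<in> closure (T k)" for e
    proof -
      have "wint V P (cube a l) e \<le> ennreal (l ^ CARD('n) * real k powr P)"
      proof (rule wint_closure[OF w P0 cube_lebesgue e, where h="\<lambda>x. x" and b="\<lambda>_. l ^ CARD('n) * real k powr P"])
        show "wint V P (cube a l) u \<le> ennreal (l ^ CARD('n) * real k powr P)" if "u \<in> T k" for u
          using that l P0 by (simp add: T_def rho_le_iff ennpowr_ennreal ennreal_mult)
      qed auto
      then show ?thesis
        using l P0 by (simp add: T_def rho_le_iff ennpowr_ennreal ennreal_mult)
    qed
    then show ?thesis
      by (metis closure_subset closure_eq subset_antisym subsetI)
  qed
  have un: "\<Union>(range T) = UNIV"
  proof (intro set_eqI iffI UNIV_I)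
    fix e
    obtain k :: nat where "enn2real (\<rho> V P (cube a l) e) \<le> real k"
      using real_arch_simple by blast
    then have "\<rho> V P (cube a l) e \<le> ennreal (real k)"
      using rho_finite[OF V P0 l, of a e]
      by (metis ennreal_enn2real ennreal_leI)
    then show "e \<in> \<Union>(range T)" by (auto simp: T_def)
  qed
  have "\<exists>k. interior (T k) \<noteq> {}"
  proof (rule ccontr)
    assume "\<not> ?thesis"
    then have "Met_TC.mtopology interior_of \<Union>(range T) = {}"
      using cl complete_UNIV by (intro Met_TC.metric_Baire_category_alt) auto
    then show False unfolding un by simp
  qed
  then obtain k e0 r where r: "0 < r" "ball e0 r \<subseteq> T k"
    by (metis all_not_in_conv mem_interior)
  \<comment> \<open>Scaled to length \<open>r / 2\<close>, \<open>e\<close> is a difference of two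
    points of the ball, so its average is at most \<open>2 * (k + 1)\<close>; undoing the scaling
    costs \<open>2 * norm e / r\<close>. The \<open>+ 1\<close> makes the bounds positive when
    \<open>k = 0\<close>.\<close>
  define K where "K = 4 * (real k + 1) / r"
  have "\<rho> V P (cube a l) e \<le> ennreal (K * norm e)" for e
  proof (cases "e = 0")
    case True
    then show ?thesis using rho_scaleC[OF w P0 l, of a 0 0] by simp
  next
    case False
    define s where "s = r / (2 * norm e)"
    have s: "0 < s" using False r by (simp add: s_def)
    have "e0 + s *\<^sub>R e \<in> T k" "e0 \<in> T k"
      using r False by (auto simp: s_def dist_norm intro!: subsetD[OF r(2)])
    then have "\<rho> V P (cube a l) (e0 + s *\<^sub>R e) \<le> ennreal (real k + 1)"
      "\<rho> V P (cube a l) (complex_of_real (-1) *\<^sub>C e0) \<le> ennreal (real k + 1)"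
      unfolding rho_scaleC[OF w P0 l]
      by (auto simp: T_def intro: order_trans ennreal_leI simp del: ennreal_plus)
    then have "\<rho> V P (cube a l) (e0 + s *\<^sub>R e + complex_of_real (-1) *\<^sub>C e0) \<le>
        ennreal ((real k + 1) + (real k + 1))"
      by - (rule rho_add_le[OF w P l], auto simp del: ennreal_plus)
    also have "e0 + s *\<^sub>R e + complex_of_real (-1) *\<^sub>C e0 = complex_of_real s *\<^sub>C e"
      unfolding scaleC_of_real by simp
    finally have *: "ennreal s * \<rho> V P (cube a l) e \<le> ennreal ((real k + 1) + (real k + 1))"
      unfolding rho_scaleC[OF w P0 l] using s by simp
    have "\<rho> V P (cube a l) e = ennreal (1 / s) * (ennreal s * \<rho> V P (cube a l) e)"
      using s by (simp add: mult.assoc[symmetric] flip: ennreal_mult)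
    also have "\<dots> \<le> ennreal (1 / s) * ennreal ((real k + 1) + (real k + 1))"
      by (intro mult_left_mono *) auto
    also have "\<dots> = ennreal (1 / s * ((real k + 1) + (real k + 1)))"
      using s by (intro ennreal_mult[symmetric]) auto
    also have "1 / s * ((real k + 1) + (real k + 1)) = K * norm e"
      using r False by (simp add: s_def K_def field_simps)
    finally show ?thesis .
  qed
  then show ?thesis by (rule that)
qed

text \<open>Homogeneity, Minkowski's inequality and the Baire bound make the average a continuous
  seminorm, to which the Hahn--Banach theorem applies. The triangle inequality is the reason for
  \<open>1 \<le> P\<close>.\<close>

lemma rho_norming_functional:
  fixes V :: "real ^ 'n \<Rightarrow> ('a::{complex_normed_vector, banach}, 'a) cblinfun"
  assumes V: "p_weight (ennreal P) V" and P: "1 \<le> P" and l: "0 < l"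
  obtains e' :: "'a cdual" where "\<And>u. ennreal (cmod (e' u)) \<le> \<rho> V P (cube a l) u"
    "ennreal (cmod (e' e)) = \<rho> V P (cube a l) e"
proof -
  have w: "weight V" using V by (simp add: p_weight_def)
  have P0: "0 < P" using P by simp
  define N where "N u = enn2real (\<rho> V P (cube a l) u)" for u
  have N: "\<rho> V P (cube a l) u = ennreal (N u)" for u
    using rho_finite[OF V P0 l, of a u] by (simp add: N_def)
  have N0: "0 \<le> N u" for u by (simp add: N_def)
  obtain K where K: "\<And>e. \<rho> V P (cube a l) e \<le> ennreal (K * norm e)"
    using rho_bounded[OF V P l] by blast
  have "\<exists>e' :: 'a cdual. (\<forall>x. cmod (e' x) \<le> N x) \<and> cmod (e' e) = N e"
  proof (rule hahn_banach_seminorm[of N "max K 0" e])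
    fix x y
    \<comment> \<open>\<open>rho_add_le\<close> asks for positive bounds; a slack of
      \<open>d / 2\<close> for each summand provides them.\<close>
    have "N (x + y) \<le> N x + N y + d" if "0 < d" for d
    proof -
      have "ennreal (N (x + y)) \<le> ennreal ((N x + d / 2) + (N y + d / 2))"
        unfolding N[symmetric] using that N0[of x] N0[of y]
        by (intro rho_add_le w P l) (auto simp: N intro!: ennreal_leI simp del: ennreal_plus)
      then show ?thesis using N0[of x] N0[of y] that by (subst (asm) ennreal_le_iff) auto
    qed
    then show "N (x + y) \<le> N x + N y" by (rule field_le_epsilon)
  next
    fix c x
    show "N (c *\<^sub>C x) = cmod c * N x"
      unfolding N_def rho_scaleC[OF w P0 l] by (simp add: enn2real_mult)
  next
    fix x
    have "ennreal (N x) \<le> ennreal (max K 0 * norm x)"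
      unfolding N[symmetric] by (rule order_trans[OF K]) (auto intro!: ennreal_leI mult_right_mono)
    then show "N x \<le> max K 0 * norm x" by (subst (asm) ennreal_le_iff) auto
  qed blast
  then show ?thesis
    by (metis that N ennreal_leI)
qed

section \<open>Duality and consequences of the Muckenhoupt condition\<close>

lemma dual_qnorm_le:
  assumes "\<And>u. ennreal (cmod (cblinfun_apply e' u)) \<le> K * R u"
  shows "dual_qnorm R e' \<le> K"
  unfolding dual_qnorm_def
proof (rule SUP_least)
  fix u
  show "ennreal (cmod (e' u)) / R u \<le> K"
  proof (cases "R u = 0")
    \<comment> \<open>A vanishing denominator forces a vanishing numerator, and
      \<open>0 / 0 = 0\<close> in \<open>ennreal\<close>.\<close>
    case True
    then show ?thesis using assms[of u] by simp
  next
    case False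
    then show ?thesis using assms[of u]
      by (intro divide_le_posI_ennreal) (auto simp: zero_less_iff_neq_zero mult.commute)
  qed
qed

text \<open>The functional is measured in the exponent \<open>\<delta>\<close>, smaller than both
  \<open>p'\<close> and \<open>t\<close>. This leaves \<open>t > 0\<close> free, so that
  \<open>V u\<close> appears in exactly the exponent wanted, also below 1.\<close>

lemma dual_hoelder:
  fixes V :: "real ^ 'n \<Rightarrow> ('a::{complex_normed_vector, banach}, 'a) cblinfun"
  assumes V: "weight V" and W: "weight (inv_adjoint_weight V)"
    and pos: "0 < \<delta>" "0 < t" "0 < p'" and eq: "1 / \<delta> = 1 / p' + 1 / t"
    and [measurable]: "(\<lambda>y. norm (V y (u y))) \<in> borel_measurable lebesgue" "R \<in> sets lebesgue"
  shows "(\<integral>\<^sup>+y\<in>R. ennpowr (ennreal (cmod (cblinfun_apply e' (u y)))) \<delta> \<partial>lebesgue) \<le>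
    ennpowr (wint (inv_adjoint_weight V) p' R e') (\<delta> / p') *
    ennpowr (\<integral>\<^sup>+y\<in>R. ennpowr (ennreal (norm (V y (u y)))) t \<partial>lebesgue) (\<delta> / t)"
proof -
  let ?W = "inv_adjoint_weight V"
  note [measurable] = weight_measurable[OF W]
  have t: "0 < \<delta> / p'" "\<delta> / p' < 1" "1 - \<delta> / p' = \<delta> / t"
  proof -
    have "\<delta> * (1 / \<delta>) = \<delta> * (1 / p' + 1 / t)" by (simp only: eq)
    then have "1 = \<delta> / p' + \<delta> / t" using pos by (simp add: distrib_left)
    moreover have "0 < \<delta> / t" "0 < \<delta> / p'" using pos by auto
    ultimately show "0 < \<delta> / p'" "\<delta> / p' < 1" "1 - \<delta> / p' = \<delta> / t" by linarith+
  qed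
  define F where "F y = ennpowr (ennreal (norm (?W y e'))) p' * indicator R y" for y
  define G where "G y = ennpowr (ennreal (norm (V y (u y)))) t * indicator R y" for y
  have [measurable]: "F \<in> borel_measurable lebesgue" "G \<in> borel_measurable lebesgue"
    unfolding F_def G_def by measurable
  have "AE y in lebesgue. invertible_cblinfun (V y)" using V by (simp add: weight_def)
  then have "AE y in lebesgue. ennpowr (ennreal (cmod (e' (u y)))) \<delta> * indicator R y \<le>
      ennpowr (F y) (\<delta> / p') * ennpowr (G y) (\<delta> / t)"
  proof eventually_elim
    fix y assume y: "invertible_cblinfun (V y)"
    have "e' (u y) = ?W y e' (V y (u y))"
      by (simp add: inv_adjoint_weight_def adjoint_cblinfun_apply inverse_cblinfun[OF y])
    then have "cmod (e' (u y)) \<le> norm (?W y e') * norm (V y (u y))"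
      by (metis norm_cblinfun_apply_le)
    then have "ennpowr (ennreal (cmod (e' (u y)))) \<delta> \<le>
        ennpowr (ennreal (norm (?W y e')) * ennreal (norm (V y (u y)))) \<delta>"
      using pos by (intro ennpowr_mono) (auto simp flip: ennreal_mult intro: ennreal_leI)
    also have "\<dots> = ennpowr (ennreal (norm (?W y e'))) \<delta> * ennpowr (ennreal (norm (V y (u y)))) \<delta>"
      using pos by (intro ennpowr_mult)
    finally show "ennpowr (ennreal (cmod (e' (u y)))) \<delta> * indicator R y \<le>
      ennpowr (F y) (\<delta> / p') * ennpowr (G y) (\<delta> / t)"
      using pos by (auto simp: F_def G_def indicator_def ennpowr_ennpowr)
  qed
  then have "(\<integral>\<^sup>+y\<in>R. ennpowr (ennreal (cmod (e' (u y)))) \<delta> \<partial>lebesgue) \<le>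
      (\<integral>\<^sup>+y. ennpowr (F y) (\<delta> / p') * ennpowr (G y) (1 - \<delta> / p') \<partial>lebesgue)"
    unfolding t(3) by (rule nn_integral_mono_AE)
  also have "\<dots> \<le> ennpowr (\<integral>\<^sup>+y. F y \<partial>lebesgue) (\<delta> / p') * ennpowr (\<integral>\<^sup>+y. G y \<partial>lebesgue) (1 - \<delta> / p')"
    by (rule nn_integral_hoelder[OF t(1,2)]) measurable
  finally show ?thesis
    unfolding t(3) by (simp add: F_def G_def wint_def)
qed

text \<open>The null set in the condition depends on the vector, while the vector wanted here,
  \<open>V y e\<close>, moves with \<open>y\<close>. It is enough to treat countably many vectors
  whose closure contains all values \<open>V y e\<close>; lower semicontinuity does the rest. The
  null set obtained still depends on \<open>e\<close>.\<close>

lemma A_class_le_1_pointwise: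
  fixes V :: "real ^ 'n \<Rightarrow> ('a::{complex_normed_vector, banach}, 'a) cblinfun"
  assumes V: "V \<in> A_class P" and P: "0 < P" "P \<le> 1"
  obtains C where "0 \<le> C" "\<And>a l e. 0 < l \<Longrightarrow>
    AE y in lebesgue. y \<in> cube a l \<longrightarrow> \<rho> V P (cube a l) e \<le> ennreal (C * norm (V y e))"
proof -
  have w: "weight V" using V by (simp add: A_class_def p_weight_def)
  obtain C0 where C0: "\<And>Q e. Q \<in> cubes \<Longrightarrow>
      esssup (lebesgue_on Q) (\<lambda>y. \<rho> V P Q (inv_cblinfun (V y) e)) \<le> ennreal (C0 * norm e)"
    using V P by (auto simp: A_class_def)
  define C where "C = max C0 0"
  have "AE y in lebesgue. y \<in> cube a l \<longrightarrow> \<rho> V P (cube a l) e \<le> ennreal (C * norm (V y e))"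
    if l: "0 < l" for a :: "real ^ 'n" and l e
  proof -
    let ?Q = "cube a l"
    have 1: "AE y in lebesgue. y \<in> ?Q \<longrightarrow> \<rho> V P ?Q (inv_cblinfun (V y) u) \<le> ennreal (C * norm u)" for u
    proof -
      have "AE y in lebesgue_on ?Q. \<rho> V P ?Q (inv_cblinfun (V y) u) \<le> ennreal (C * norm u)"
        using esssup_AE
      proof eventually_elim
        fix y
        assume "\<rho> V P ?Q (inv_cblinfun (V y) u) \<le>
          esssup (lebesgue_on ?Q) (\<lambda>y. \<rho> V P ?Q (inv_cblinfun (V y) u))"
        also have "\<dots> \<le> ennreal (C0 * norm u)" by (intro C0 cube_in_cubes l)
        also have "\<dots> \<le> ennreal (C * norm u)"
          by (intro ennreal_leI mult_right_mono) (auto simp: C_def)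
        finally show "\<rho> V P ?Q (inv_cblinfun (V y) u) \<le> ennreal (C * norm u)" .
      qed
      then show ?thesis by (subst (asm) AE_restrict_space_iff) auto
    qed
    have "strongly_measurable (\<lambda>y. V y e)" using w by (simp add: weight_def)
    then obtain D where D: "countable D" "\<And>y. V y e \<in> closure D"
      by (rule strongly_measurable_separable) blast
    have "AE y in lebesgue. \<forall>u\<in>D. y \<in> ?Q \<longrightarrow> \<rho> V P ?Q (inv_cblinfun (V y) u) \<le> ennreal (C * norm u)"
      unfolding AE_ball_countable[OF D(1)] using 1 by blast
    moreover have "AE y in lebesgue. invertible_cblinfun (V y)" using w by (simp add: weight_def)
    ultimately show ?thesis
    proof eventually_elim
      fix y
      assume y: "\<forall>u\<in>D. y \<in> ?Q \<longrightarrow> \<rho> V P ?Q (inv_cblinfun (V y) u) \<le> ennreal (C * norm u)"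
        "invertible_cblinfun (V y)"
      show "y \<in> ?Q \<longrightarrow> \<rho> V P ?Q e \<le> ennreal (C * norm (V y e))"
      proof
        assume yQ: "y \<in> ?Q"
        have C: "0 \<le> C" by (simp add: C_def)
        have rl: "\<rho> V P ?Q x \<le> ennreal (C * norm u) \<longleftrightarrow> wint V P ?Q x \<le> ennreal (l ^ CARD('n) * (C * norm u) powr P)"
          for x u :: 'a
          unfolding rho_le_iff[OF l P(1)]
          by (subst ennpowr_ennreal, simp add: C, subst ennreal_mult, use l in simp_all)
        have "wint V P ?Q (inv_cblinfun (V y) (V y e)) \<le> ennreal (l ^ CARD('n) * (C * norm (V y e)) powr P)"
        proof (rule wint_closure[OF w P(1) cube_lebesgue D(2), where b="\<lambda>u. l ^ CARD('n) * (C * norm u) powr P"])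
          show "continuous_on UNIV (\<lambda>u::'a. l ^ CARD('n) * (C * norm u) powr P)"
            using P by (intro continuous_intros continuous_on_powr') (auto simp: C_def)
          show "wint V P ?Q (inv_cblinfun (V y) u) \<le> ennreal (l ^ CARD('n) * (C * norm u) powr P)"
            if "u \<in> D" for u
            using y(1) that yQ rl by blast
          show "continuous_on UNIV (cblinfun_apply (inv_cblinfun (V y)))"
            using bounded_linear_cblinfun_apply by (rule linear_continuous_on)
        qed
        then show "\<rho> V P ?Q e \<le> ennreal (C * norm (V y e))"
          unfolding rl inverse_cblinfun(2)[OF y(2)] .
      qed
    qed
  qed
  then show ?thesis by (intro that[of C]) (auto simp: C_def)
qed

text \<open>Trades the dual quasi-norm, a supremum of quotients, for any domination of the
  functional by the average; functionals come with such a domination below.\<close>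

lemma A_class_gt_1_dual:
  fixes V :: "real ^ 'n \<Rightarrow> ('a::{complex_normed_vector, banach}, 'a) cblinfun"
  assumes V: "V \<in> A_class P" and P: "1 < P"
  obtains C where "0 \<le> C" "\<And>a l e' K. 0 < l \<Longrightarrow>
    (\<And>u. ennreal (cmod (cblinfun_apply e' u)) \<le> K * \<rho> V P (cube a l) u) \<Longrightarrow>
    \<rho> (inv_adjoint_weight V) (P / (P - 1)) (cube a l) e' \<le> ennreal C * K"
proof -
  obtain C0 where C0: "\<And>Q e'. Q \<in> cubes \<Longrightarrow>
      \<rho> (inv_adjoint_weight V) (P / (P - 1)) Q e' \<le> ennreal C0 * dual_qnorm (\<rho> V P Q) e'"
    using V P by (auto simp: A_class_def)
  show ?thesis
  proof (rule that[of "max C0 0"])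
    fix a :: "real ^ 'n" and l e' K
    assume l: "0 < l" and le: "\<And>u. ennreal (cmod (cblinfun_apply e' u)) \<le> K * \<rho> V P (cube a l) u"
    have "\<rho> (inv_adjoint_weight V) (P / (P - 1)) (cube a l) e' \<le>
        ennreal C0 * dual_qnorm (\<rho> V P (cube a l)) e'"
      by (intro C0 cube_in_cubes l)
    also have "\<dots> \<le> ennreal (max C0 0) * K"
      by (intro mult_mono ennreal_leI dual_qnorm_le le) auto
    finally show "\<rho> (inv_adjoint_weight V) (P / (P - 1)) (cube a l) e' \<le> ennreal (max C0 0) * K" .
  qed simp
qed

text \<open>Shrinking the cube and lowering the exponent happen in one stroke: a lower bound on
  \<open>V y e\<close>, pointwise or through a norming functional of the large cube, is averaged
  over the small one. The pointwise bound loses nothing (\<open>\<gamma> = 0\<close>). The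
  functional loses the volume ratio to the power \<open>1 / p'\<close>, because the dual weight is
  estimated on the large cube.\<close>

lemma A_class_rho_le:
  fixes V :: "real ^ 'n \<Rightarrow> ('a::{complex_normed_vector, banach}, 'a) cblinfun"
  assumes V: "V \<in> A_class P" and P: "0 < P"
  obtains \<gamma> where "0 \<le> \<gamma>" "\<And>t. 0 < t \<Longrightarrow> \<exists>C\<ge>0. \<forall>b m c l e. 0 < m \<longrightarrow> 0 < l \<longrightarrow> cube b m \<subseteq> cube c l \<longrightarrow>
    \<rho> V P (cube c l) e \<le> ennreal (C * (l / m) powr \<gamma>) * \<rho> V t (cube b m) e"
proof (cases "P \<le> 1")
  case True
  have w: "weight V" using V by (simp add: A_class_def p_weight_def)
  note [measurable] = weight_measurable[OF w]
  obtain C where C: "0 \<le> C" "\<And>a l e. 0 < l \<Longrightarrow>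
    AE y in lebesgue. y \<in> cube a l \<longrightarrow> \<rho> V P (cube a l) e \<le> ennreal (C * norm (V y e))"
    using A_class_le_1_pointwise[OF V P True] by blast
  have *: "\<rho> V P (cube c l) e \<le> ennreal (C * (l / m) powr 0) * \<rho> V t (cube b m) e"
    if t: "0 < t" and ml: "0 < m" "0 < l" and sub: "cube b m \<subseteq> cube c l" for t b m c l e
  proof -
    let ?n = "CARD('n)" and ?X = "\<rho> V P (cube c l) e"
    have "ennreal (m ^ ?n) * ennpowr ?X t = (\<integral>\<^sup>+y\<in>cube b m. ennpowr ?X t \<partial>lebesgue)"
      using ml by (subst nn_integral_cmult_indicator) (auto simp: emeasure_cube mult.commute)
    also have "\<dots> \<le> (\<integral>\<^sup>+y\<in>cube b m. ennreal (C powr t) * ennpowr (ennreal (norm (V y e))) t \<partial>lebesgue)"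
      using C(2)[OF ml(2), of c e]
    proof (intro nn_integral_mono_AE, eventually_elim)
      fix y assume y: "y \<in> cube c l \<longrightarrow> ?X \<le> ennreal (C * norm (V y e))"
      show "ennpowr ?X t * indicator (cube b m) y \<le>
          ennreal (C powr t) * ennpowr (ennreal (norm (V y e))) t * indicator (cube b m) y"
      proof (cases "y \<in> cube b m")
        case True
        then have "ennpowr ?X t \<le> ennpowr (ennreal (C * norm (V y e))) t"
          using y sub t by (intro ennpowr_mono) auto
        then show ?thesis
          using C(1) t by (simp add: ennreal_mult ennpowr_mult ennpowr_ennreal True)
      qed simp
    qed
    also have "\<dots> = ennreal (C powr t) * wint V t (cube b m) e"
      unfolding wint_def by (simp add: mult.assoc nn_integral_cmult)
    also have "\<dots> = ennreal (m ^ ?n) * (ennreal (C powr t) * ennpowr (\<rho> V t (cube b m) e) t)"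
      using ml t by (simp add: wint_rho mult.left_commute)
    finally have "ennpowr ?X t \<le> ennreal (C powr t) * ennpowr (\<rho> V t (cube b m) e) t"
      using ml by (subst (asm) ennreal_mult_le_mult_iff) (auto simp: ennreal_eq_0_iff not_le)
    then have "?X \<le> ennpowr (ennreal (C powr t)) (1 / t) * \<rho> V t (cube b m) e"
      using t by (rule ennpowr_mult3_le)
    then show ?thesis
      using C(1) t ml by (simp add: ennpowr_ennreal powr_powr)
  qed
  show ?thesis
    by (rule that[of 0]) (use C(1) * in blast)+
next
  case False
  then have P1: "1 < P" by simp
  have w: "weight V" and pw: "p_weight (ennreal P) V" and W: "weight (inv_adjoint_weight V)"
    using V P1 by (auto simp: A_class_def p_weight_def)
  note [measurable] = weight_measurable[OF w]
  define p' where "p' = P / (P - 1)"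
  have p': "0 < p'" using P1 by (simp add: p'_def)
  obtain C where C: "0 \<le> C" "\<And>a l e' K. 0 < l \<Longrightarrow>
    (\<And>u. ennreal (cmod (cblinfun_apply e' u)) \<le> K * \<rho> V P (cube a l) u) \<Longrightarrow>
    \<rho> (inv_adjoint_weight V) p' (cube a l) e' \<le> ennreal C * K"
    using A_class_gt_1_dual[OF V P1] unfolding p'_def by blast
  let ?n = "CARD('n)"
  have *: "\<rho> V P (cube c l) e \<le> ennreal (C * (l / m) powr (?n / p')) * \<rho> V t (cube b m) e"
    if t: "0 < t" and ml: "0 < m" "0 < l" and sub: "cube b m \<subseteq> cube c l" for t b m c l e
  proof -
    let ?X = "\<rho> V P (cube c l) e" and ?W = "inv_adjoint_weight V"
    define \<delta> where "\<delta> = 1 / (1 / p' + 1 / t)"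
    have \<delta>: "0 < \<delta>" "1 / \<delta> = 1 / p' + 1 / t"
      using p' t by (auto simp: \<delta>_def add_pos_pos)
    obtain e' :: "'a cdual" where e': "\<And>u. ennreal (cmod (e' u)) \<le> \<rho> V P (cube c l) u"
      "ennreal (cmod (e' e)) = ?X"
      using rho_norming_functional[OF pw less_imp_le[OF P1] ml(2)] by blast
    have "\<rho> ?W p' (cube c l) e' \<le> ennreal C * 1"
      using e'(1) ml by (intro C(2)) auto
    then have "wint ?W p' (cube c l) e' \<le> ennreal (l ^ ?n * C powr p')"
      using ml p' C(1) by (simp add: rho_le_iff ennpowr_ennreal ennreal_mult)
    moreover have "wint ?W p' (cube b m) e' \<le> wint ?W p' (cube c l) e'"
      unfolding wint_def using sub by (intro nn_integral_mono) (auto simp: indicator_def)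
    ultimately have Wle: "wint ?W p' (cube b m) e' \<le> ennreal (l ^ ?n * C powr p')" by order
    have m: "m ^ ?n = (m ^ ?n) powr (\<delta> / p') * (m ^ ?n) powr (\<delta> / t)"
    proof -
      have "\<delta> * (1 / \<delta>) = \<delta> * (1 / p' + 1 / t)" by (simp only: \<delta>(2))
      then have "\<delta> / p' + \<delta> / t = 1" using \<delta>(1) by (simp add: distrib_left)
      then show ?thesis using ml by (simp flip: powr_add)
    qed
    \<comment> \<open>Its power \<open>1 / \<delta>\<close> is the constant of the claim:
      \<open>\<delta>\<close> cancels, and \<open>C\<close> times the power \<open>?n / p'\<close>
      of \<open>l / m\<close> remains.\<close>
    define B where "B = ((l ^ ?n * C powr p') / m ^ ?n) powr (\<delta> / p')"
    have "ennreal (m ^ ?n) * ennpowr ?X \<delta> =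
        (\<integral>\<^sup>+y\<in>cube b m. ennpowr (ennreal (cmod (e' e))) \<delta> \<partial>lebesgue)"
      unfolding e'(2) using ml by (subst nn_integral_cmult_indicator) (auto simp: emeasure_cube mult.commute)
    also have "\<dots> \<le> ennpowr (wint ?W p' (cube b m) e') (\<delta> / p') * ennpowr (wint V t (cube b m) e) (\<delta> / t)"
      using dual_hoelder[OF w W \<delta>(1) t p' \<delta>(2), of "\<lambda>_. e" "cube b m" e']
      by (simp add: wint_def)
    also have "\<dots> \<le> ennpowr (ennreal (l ^ ?n * C powr p')) (\<delta> / p') *
        ennpowr (ennreal (m ^ ?n) * ennpowr (\<rho> V t (cube b m) e) t) (\<delta> / t)"
      using \<delta> p' t ml by (intro mult_mono ennpowr_mono Wle) (auto simp: wint_rho)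
    also have "\<dots> = ennreal ((l ^ ?n * C powr p') powr (\<delta> / p') * (m ^ ?n) powr (\<delta> / t)) *
        ennpowr (\<rho> V t (cube b m) e) \<delta>"
      using \<delta> p' t ml by (simp add: ennpowr_mult ennpowr_ennreal ennpowr_ennpowr ennreal_mult powr_mult mult.assoc)
    also have "(l ^ ?n * C powr p') powr (\<delta> / p') * (m ^ ?n) powr (\<delta> / t) = m ^ ?n * B"
    proof -
      have "m ^ ?n * B = ((m ^ ?n) powr (\<delta> / p') * (m ^ ?n) powr (\<delta> / t)) *
          ((l ^ ?n * C powr p') powr (\<delta> / p') / (m ^ ?n) powr (\<delta> / p'))"
        unfolding B_def powr_divide by (simp only: m[symmetric])
      then show ?thesis using ml by simp
    qed
    finally have "ennreal (m ^ ?n) * ennpowr ?X \<delta> \<le> ennreal (m ^ ?n) * (ennreal B * ennpowr (\<rho> V t (cube b m) e) \<delta>)"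
      using ml by (simp add: ennreal_mult mult.assoc B_def)
    then have "ennpowr ?X \<delta> \<le> ennreal B * ennpowr (\<rho> V t (cube b m) e) \<delta>"
      using ml by (subst (asm) ennreal_mult_le_mult_iff) (auto simp: ennreal_eq_0_iff not_le)
    then have "?X \<le> ennpowr (ennreal B) (1 / \<delta>) * \<rho> V t (cube b m) e"
      using \<delta>(1) by (rule ennpowr_mult3_le)
    also have "ennpowr (ennreal B) (1 / \<delta>) = ennreal (C * (l / m) powr (?n / p'))"
    proof -
      have "(l ^ ?n * C powr p') / m ^ ?n = ((l / m) powr ?n) * C powr p'"
        using ml by (simp add: powr_realpow power_divide)
      then have "B powr (1 / \<delta>) = (((l / m) powr ?n) * C powr p') powr (1 / p')"
        using \<delta>(1) by (simp add: B_def powr_powr)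
      also have "\<dots> = C * (l / m) powr (?n / p')"
        using p' C(1) by (simp add: powr_mult powr_powr)
      finally show ?thesis by (simp add: ennpowr_ennreal B_def)
    qed
    finally show ?thesis .
  qed
  have "0 \<le> ?n / p'" using p' by simp
  then show ?thesis
    by (rule that) (use C(1) * in blast)
qed

section \<open>Sampling of band-limited functions\<close>

definition sn :: "real \<Rightarrow> real" where "sn y = (if y = 0 then 1 else sin y / y)"

lemma abs_sn_le_1: "\<bar>sn y\<bar> \<le> 1"
  using abs_sin_x_le_abs_x[of y] by (auto simp: sn_def abs_divide divide_simps)

text \<open>The \<open>2\<close> in \<open>2 + \<bar>y\<bar>\<close> leaves room to move the
  argument by up to 1 and still keep \<open>1 + ...\<close> in the denominator; this is used when
  points are known only up to their grid cell.\<close>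

lemma sn_decay:
  assumes "0 < b"
  shows "\<bar>sn (b * y)\<bar> \<le> (2 + 1 / b) / (2 + \<bar>y\<bar>)"
proof -
  have "\<bar>y\<bar> * \<bar>sn (b * y)\<bar> \<le> 1 / b"
  proof (cases "y = 0")
    case False
    then have "\<bar>y\<bar> * \<bar>sn (b * y)\<bar> = \<bar>sin (b * y)\<bar> / b"
      using assms by (simp add: sn_def abs_mult abs_divide)
    also have "\<dots> \<le> 1 / b" using assms by (simp add: divide_right_mono)
    finally show ?thesis .
  qed (use assms in simp)
  then have "(2 + \<bar>y\<bar>) * \<bar>sn (b * y)\<bar> \<le> 2 + 1 / b"
    using abs_sn_le_1[of "b * y"] by (simp add: distrib_right)
  then show ?thesis by (simp add: pos_le_divide_eq mult.commute)
qed

text \<open>Multiplication by a sinc factor is an average over frequencies. This is used once for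
  the base kernel and again for every further factor.\<close>

lemma has_integral_cis_sn:
  assumes "0 < b"
  shows "((\<lambda>v. cis (y * (v + w))) has_integral (of_real (2 * b * sn (b * y)) * cis (y * w))) {-b..b}"
proof (cases "y = 0")
  case True
  then show ?thesis
    using has_integral_const_real[of "1::complex" "-b" b] assms by (simp add: sn_def scaleR_conv_of_real)
next
  case False
  have "((\<lambda>v. cis (y * (v + w))) has_integral
      (cis (y * (b + w)) / (\<i> * y) - cis (y * (- b + w)) / (\<i> * y))) {-b..b}"
  proof (rule fundamental_theorem_of_calculus)
    fix v
    show "((\<lambda>v. cis (y * (v + w)) / (\<i> * y)) has_vector_derivative cis (y * (v + w))) (at v within {-b..b})"
    proof -
      have "((\<lambda>z. exp (\<i> * y * (z + w)) / (\<i> * y)) has_field_derivative exp (\<i> * y * (complex_of_real v + w))) (at (of_real v))"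
        using False by (auto intro!: derivative_eq_intros)
      then have "((\<lambda>v. exp (\<i> * y * (complex_of_real v + w)) / (\<i> * y)) has_vector_derivative exp (\<i> * y * (complex_of_real v + w))) (at v within {-b..b})"
        by (rule has_vector_derivative_real_field)
      then show ?thesis by (simp add: cis_conv_exp mult.assoc)
    qed
  qed (use assms in simp)
  also have "cis (y * (b + w)) / (\<i> * y) - cis (y * (- b + w)) / (\<i> * y) =
      (cis (y * b) - cis (- (y * b))) / (\<i> * y) * cis (y * w)"
  proof -
    have "cis (y * (b + w)) = cis (y * b) * cis (y * w)" "cis (y * (- b + w)) = cis (- (y * b)) * cis (y * w)"
      by (simp_all add: cis_mult algebra_simps)
    then show ?thesis by (simp only: diff_divide_distrib left_diff_distrib times_divide_eq_left)
  qed
  also have "cis (y * b) - cis (- (y * b)) = 2 * \<i> * of_real (sin (b * y))"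
    by (simp add: complex_eq_iff mult.commute)
  also have "2 * \<i> * of_real (sin (b * y)) / (\<i> * y) = complex_of_real (2 * b * sn (b * y))"
    using False assms by (simp add: sn_def)
  finally show ?thesis .
qed

lemma sn_pi_int: "k \<noteq> 0 \<Longrightarrow> sn (pi * of_int k) = 0"
  using sin_int_times_real[of k pi] by (simp add: sn_def sin_zero_iff_int2 mult.commute)

section \<open>Dirichlet and Fejer kernels\<close>

definition dirichlet_kernel :: "nat \<Rightarrow> real \<Rightarrow> real" where
  "dirichlet_kernel m \<theta> = 1 + (\<Sum>k<m. 2 * cos (real (Suc k) * \<theta>))"

definition fejer_kernel :: "nat \<Rightarrow> real \<Rightarrow> real" where
  "fejer_kernel K \<theta> = (\<Sum>m<K. dirichlet_kernel m \<theta>) / K"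

lemma atLeastAtMost_int_Suc:
  "{- int (Suc m)..int (Suc m)} = insert (int (Suc m)) (insert (- int (Suc m)) {- int m..int m})"
  by auto

lemma sum_cis_dirichlet: "(\<Sum>k\<in>{- int m..int m}. cis (- (of_int k * \<theta>))) = of_real (dirichlet_kernel m \<theta>)"
proof (induction m)
  case (Suc m)
  have "(\<Sum>k\<in>{- int (Suc m)..int (Suc m)}. cis (- (of_int k * \<theta>))) =
      cis (- (real (Suc m) * \<theta>)) + (cis (real (Suc m) * \<theta>) + of_real (dirichlet_kernel m \<theta>))"
  proof -
    have "- (of_int (- int (Suc m)) * \<theta>) = real (Suc m) * \<theta>" "- (of_int (int (Suc m)) * \<theta>) = - (real (Suc m) * \<theta>)"
      by (simp_all add: algebra_simps)
    then show ?thesis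
      unfolding atLeastAtMost_int_Suc by (subst sum.insert, simp, simp, subst sum.insert, simp, simp, simp only: Suc)
  qed
  also have "\<dots> = of_real (dirichlet_kernel (Suc m) \<theta>)"
    by (simp add: dirichlet_kernel_def complex_eq_iff)
  finally show ?case .
qed (simp add: dirichlet_kernel_def)

lemma dirichlet_kernel_sin: "dirichlet_kernel m \<theta> * sin (\<theta> / 2) = sin ((real m + 1 / 2) * \<theta>)"
proof (induction m)
  case (Suc m)
  have "dirichlet_kernel (Suc m) \<theta> * sin (\<theta> / 2) =
      sin ((real m + 1 / 2) * \<theta>) + 2 * cos (real (Suc m) * \<theta>) * sin (\<theta> / 2)"
    using Suc by (simp add: dirichlet_kernel_def algebra_simps)
  also have "(real m + 1 / 2) * \<theta> = real (Suc m) * \<theta> - \<theta> / 2" by (simp add: algebra_simps)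
  also have "sin (real (Suc m) * \<theta> - \<theta> / 2) + 2 * cos (real (Suc m) * \<theta>) * sin (\<theta> / 2) =
      sin (real (Suc m) * \<theta> + \<theta> / 2)"
    unfolding sin_diff sin_add by simp
  also have "real (Suc m) * \<theta> + \<theta> / 2 = (real (Suc m) + 1 / 2) * \<theta>" by (simp add: algebra_simps)
  finally show ?case .
qed (simp add: dirichlet_kernel_def)

text \<open>The Fejer kernel in closed form, multiplied out so that the induction has no case for a
  vanishing sine.\<close>

lemma sum_dirichlet_sin:
  "(\<Sum>m<K. dirichlet_kernel m \<theta>) * (sin (\<theta> / 2))\<^sup>2 = (sin (real K * (\<theta> / 2)))\<^sup>2"
proof (induction K)
  case (Suc K)
  let ?a = "real K * (\<theta> / 2)" and ?h = "\<theta> / 2"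
  have "(\<Sum>m<Suc K. dirichlet_kernel m \<theta>) * (sin ?h)\<^sup>2 =
      (sin ?a)\<^sup>2 + (dirichlet_kernel K \<theta> * sin ?h) * sin ?h"
    using Suc by (simp add: algebra_simps power2_eq_square)
  also have "\<dots> = (sin ?a)\<^sup>2 + sin (2 * ?a + ?h) * sin ?h"
    unfolding dirichlet_kernel_sin by (simp add: algebra_simps)
  also have "\<dots> = (sin (?a + ?h))\<^sup>2"
  proof -
    have c: "cos ?a * cos ?a = 1 - sin ?a * sin ?a" "cos ?h * cos ?h = 1 - sin ?h * sin ?h"
      using sin_cos_squared_add[of ?a] sin_cos_squared_add[of ?h] by (auto simp: power2_eq_square)
    have "(sin ?a)\<^sup>2 + sin (2 * ?a + ?h) * sin ?h =
      sin ?a * sin ?a + 2 * sin ?a * cos ?a * cos ?h * sin ?h + (cos ?a * cos ?a - sin ?a * sin ?a) * (sin ?h * sin ?h)"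
      unfolding sin_add[of "2 * ?a"] sin_double cos_double by (simp add: power2_eq_square algebra_simps)
    also have "\<dots> = sin ?a * sin ?a * (cos ?h * cos ?h) + 2 * sin ?a * cos ?a * cos ?h * sin ?h + (cos ?a * cos ?a) * (sin ?h * sin ?h)"
      unfolding c by (simp add: algebra_simps)
    also have "\<dots> = (sin (?a + ?h))\<^sup>2"
      unfolding sin_add by (simp add: power2_eq_square algebra_simps)
    finally show ?thesis .
  qed
  also have "?a + ?h = real (Suc K) * (\<theta> / 2)" by (simp add: algebra_simps add_divide_distrib)
  finally show ?case .
qed simp

lemma abs_sin_mult_nat_le: "\<bar>sin (real n * x)\<bar> \<le> real n * \<bar>sin x\<bar>"
proof (induction n)
  case (Suc n)
  have "\<bar>sin (real (Suc n) * x)\<bar> \<le> \<bar>sin (real n * x) * cos x\<bar> + \<bar>cos (real n * x) * sin x\<bar>"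
    using abs_triangle_ineq[of "sin (real n * x) * cos x" "cos (real n * x) * sin x"] sin_add[of "real n * x" x]
    by (simp add: distrib_right add.commute)
  also have "\<dots> \<le> \<bar>sin (real n * x)\<bar> * 1 + 1 * \<bar>sin x\<bar>"
    unfolding abs_mult by (intro add_mono mult_mono) auto
  finally show ?case using Suc by (simp add: algebra_simps)
qed simp

lemma fejer_kernel_nonneg: "0 \<le> fejer_kernel K \<theta>"
proof (cases "sin (\<theta> / 2) = 0")
  case True
  have "dirichlet_kernel m \<theta> \<ge> 0" for m
  proof -
    obtain i :: int where "\<theta> / 2 = of_int i * pi" using True by (auto simp: sin_zero_iff_int2)
    then have "real (Suc k) * \<theta> = 2 * pi * of_int (int (Suc k) * i)" for k by (simp add: field_simps)
    then have "cos (real (Suc k) * \<theta>) = 1" for k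
      using cos_int_2pin[of "int (Suc k) * i"] by (simp only:)
    then show ?thesis by (simp add: dirichlet_kernel_def)
  qed
  then show ?thesis by (simp add: fejer_kernel_def sum_nonneg)
next
  case False
  then have "(\<Sum>m<K. dirichlet_kernel m \<theta>) = (sin (real K * (\<theta> / 2)))\<^sup>2 / (sin (\<theta> / 2))\<^sup>2"
    using sum_dirichlet_sin[of \<theta> K] by (simp add: field_simps)
  then show ?thesis by (simp add: fejer_kernel_def)
qed

text \<open>The first bound is uniform in \<open>K\<close> and yields a majorant, the second gives
  convergence to 0 away from the peak.\<close>

lemma fejer_kernel_le:
  assumes "sin (\<theta> / 2) \<noteq> 0"
  shows "fejer_kernel K \<theta> \<le> 1 / \<bar>sin (\<theta> / 2)\<bar>" "fejer_kernel K \<theta> \<le> (1 / (sin (\<theta> / 2))\<^sup>2) / K"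
proof -
  let ?s = "sin (\<theta> / 2)"
  have *: "fejer_kernel K \<theta> = (sin (real K * (\<theta> / 2)))\<^sup>2 / ?s\<^sup>2 / K"
  proof -
    have "(\<Sum>m<K. dirichlet_kernel m \<theta>) = (sin (real K * (\<theta> / 2)))\<^sup>2 / ?s\<^sup>2"
      using sum_dirichlet_sin[of \<theta> K] assms by (simp add: eq_divide_eq)
    then show ?thesis by (simp add: fejer_kernel_def)
  qed
  have "(sin (real K * (\<theta> / 2)))\<^sup>2 \<le> 1" by (simp add: abs_square_le_1)
  then show "fejer_kernel K \<theta> \<le> (1 / ?s\<^sup>2) / K"
    unfolding * by (intro divide_right_mono) auto
  \<comment> \<open>One factor is bounded by 1, the other by \<open>K\<close> times the sine of the
    single angle; this cancels \<open>K\<close> and one power of the sine.\<close>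
  have "(sin (real K * (\<theta> / 2)))\<^sup>2 = \<bar>sin (real K * (\<theta> / 2))\<bar> * \<bar>sin (real K * (\<theta> / 2))\<bar>"
    by (simp add: power2_eq_square)
  also have "\<dots> \<le> 1 * (real K * \<bar>?s\<bar>)"
    by (intro mult_mono abs_sin_mult_nat_le) auto
  finally have "(sin (real K * (\<theta> / 2)))\<^sup>2 \<le> real K * \<bar>?s\<bar>" by simp
  then have "fejer_kernel K \<theta> \<le> (real K * \<bar>?s\<bar>) / ?s\<^sup>2 / K"
    unfolding * by (intro divide_right_mono) auto
  also have "\<dots> \<le> 1 / \<bar>?s\<bar>"
  proof (cases "K = 0")
    case False
    have "real K * a / (a * a) / K \<le> 1 / a" if "0 < a" for a
      using that False by simp
    from this[of "\<bar>?s\<bar>"] show ?thesis using assms by (simp add: power2_eq_square)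
  qed simp
  finally show "fejer_kernel K \<theta> \<le> 1 / \<bar>?s\<bar>" .
qed

text \<open>\<open>d\<close> is the minimum of \<open>sn\<close> on \<open>[-c, c]\<close>, which is
  positive because \<open>sin\<close> has no zero inside \<open>(0, pi)\<close>.\<close>

lemma sin_ge_linear:
  assumes "0 < c" "c < pi"
  obtains d where "0 < d" "\<And>y. \<bar>y\<bar> \<le> c \<Longrightarrow> d * \<bar>y\<bar> \<le> \<bar>sin y\<bar>"
proof -
  have eq: "sn = (\<lambda>x. if x = 0 then 1 else sin x / x)" by (auto simp: sn_def fun_eq_iff)
  have "continuous_on {-c..c} sn"
    unfolding eq by (intro continuous_at_imp_continuous_on ballI isCont_sinc)
  then obtain z where z: "z \<in> {-c..c}" "\<And>y. y \<in> {-c..c} \<Longrightarrow> sn z \<le> sn y"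
    using continuous_attains_inf[of "{-c..c}" sn] assms by auto
  have "0 < sn z"
  proof (cases "z = 0")
    case False
    then consider "0 < z" "z < pi" | "0 < - z" "- z < pi" using z(1) assms by force
    then show ?thesis
    proof cases
      case 1
      then show ?thesis using sin_gt_zero[of z] by (simp add: sn_def)
    next
      case 2
      then show ?thesis using sin_gt_zero[of "- z"] by (simp add: sn_def divide_neg_neg)
    qed
  qed (simp add: sn_def)
  moreover have "sn z * \<bar>y\<bar> \<le> \<bar>sin y\<bar>" if "\<bar>y\<bar> \<le> c" for y
  proof (cases "y = 0")
    case False
    have "sn z \<le> sn y" using that by (intro z) auto
    also have "\<dots> \<le> \<bar>sin y\<bar> / \<bar>y\<bar>" using False abs_ge_self[of "sin y / y"] by (simp add: sn_def abs_divide)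
    finally show ?thesis using False by (simp add: field_simps)
  qed simp
  ultimately show ?thesis by (rule that)
qed

text \<open>Cesaro means of the symmetric partial sums of the sampling series with kernel
  \<open>S\<close> for the exponential of frequency \<open>w\<close>, divided by that exponential at
  \<open>x\<close>. Exact reproduction at \<open>x\<close> thus means that the limit is 1.\<close>

definition fejer_mean :: "(real \<Rightarrow> real) \<Rightarrow> real \<Rightarrow> real \<Rightarrow> nat \<Rightarrow> complex" where
  "fejer_mean S x w K = (\<Sum>m<K. \<Sum>k\<in>{- int m..int m}. of_real (S (x - of_int k)) * cis (- ((x - of_int k) * w))) / K"

text \<open>Each sinc value is an average of exponentials over one period; summing the exponentials
  over \<open>k\<close> first produces the Fejer kernel.\<close>

lemma fejer_mean_sn_pi:
  "((\<lambda>u. cis (x * (u - w)) * of_real (fejer_kernel K (u - w)))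
    has_integral (2 * pi * fejer_mean (\<lambda>y. sn (pi * y)) x w K)) {-pi..pi}"
proof -
  have "((\<lambda>u. cis ((x - of_int k) * (u - w))) has_integral
      (2 * pi * (of_real (sn (pi * (x - of_int k))) * cis (- ((x - of_int k) * w))))) {-pi..pi}" for k :: int
    using has_integral_cis_sn[of pi "x - of_int k" "- w"] by (simp add: mult.assoc)
  then have "((\<lambda>u. (\<Sum>m<K. \<Sum>k\<in>{- int m..int m}. cis ((x - of_int k) * (u - w))) / K) has_integral
      ((\<Sum>m<K. \<Sum>k\<in>{- int m..int m}. 2 * pi * (of_real (sn (pi * (x - of_int k))) * cis (- ((x - of_int k) * w)))) / K)) {-pi..pi}"
    by (intro has_integral_divide has_integral_sum) auto
  also have "(\<Sum>m<K. \<Sum>k\<in>{- int m..int m}. 2 * pi * (of_real (sn (pi * (x - of_int k))) * cis (- ((x - of_int k) * w)))) / K =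
      2 * pi * fejer_mean (\<lambda>y. sn (pi * y)) x w K"
    by (simp add: fejer_mean_def sum_distrib_left[symmetric])
  also have "(\<lambda>u. (\<Sum>m<K. \<Sum>k\<in>{- int m..int m}. cis ((x - of_int k) * (u - w))) / K) =
      (\<lambda>u. cis (x * (u - w)) * of_real (fejer_kernel K (u - w)))"
  proof
    fix u
    have "cis ((x - of_int k) * (u - w)) = cis (x * (u - w)) * cis (- (of_int k * (u - w)))" for k :: int
      by (simp add: cis_mult algebra_simps)
    then have "(\<Sum>m<K. \<Sum>k\<in>{- int m..int m}. cis ((x - of_int k) * (u - w))) =
        (\<Sum>m<K. \<Sum>k\<in>{- int m..int m}. cis (x * (u - w)) * cis (- (of_int k * (u - w))))"
      by (simp only:)
    also have "\<dots> = cis (x * (u - w)) * (\<Sum>m<K. of_real (dirichlet_kernel m (u - w)))"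
      by (simp only: sum_distrib_left[symmetric] sum_cis_dirichlet)
    finally show "(\<Sum>m<K. \<Sum>k\<in>{- int m..int m}. cis ((x - of_int k) * (u - w))) / K =
        cis (x * (u - w)) * of_real (fejer_kernel K (u - w))"
      by (simp add: fejer_kernel_def)
  qed
  finally show ?thesis .
qed


lemma cesaro_mean_tendsto:
  fixes a :: "nat \<Rightarrow> complex"
  assumes "a \<longlonglongrightarrow> L"
  shows "(\<lambda>K. (\<Sum>m<K. a m) / of_nat K) \<longlonglongrightarrow> L"
proof (rule LIMSEQ_I)
  fix r :: real assume r: "0 < r"
  obtain N where N: "\<And>m. m \<ge> N \<Longrightarrow> norm (a m - L) < r / 2"
    using LIMSEQ_D[OF assms, of "r / 2"] r by auto
  define B where "B = (\<Sum>m<N. norm (a m - L))"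
  obtain M :: nat where M: "2 * B / r < real M" using reals_Archimedean2 by blast
  show "\<exists>no. \<forall>K\<ge>no. norm ((\<Sum>m<K. a m) / of_nat K - L) < r"
  proof (intro exI allI impI)
    fix K assume K: "max (Suc M) N \<le> K"
    then have K0: "0 < real K" by simp
    have "(\<Sum>m<K. a m) / of_nat K - L = (\<Sum>m<K. a m - L) / of_nat K"
      using K by (simp add: sum_subtractf field_simps)
    then have "norm ((\<Sum>m<K. a m) / of_nat K - L) \<le> (\<Sum>m<K. norm (a m - L)) / K"
      by (simp add: norm_divide divide_right_mono norm_sum)
    also have "(\<Sum>m<K. norm (a m - L)) = B + (\<Sum>m\<in>{N..<K}. norm (a m - L))"
      unfolding B_def lessThan_atLeast0 using K by (simp add: sum.atLeastLessThan_concat)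
    also have "\<dots> \<le> B + (\<Sum>m\<in>{N..<K}. r / 2)"
      by (intro add_left_mono sum_mono, rule less_imp_le, rule N) simp
    also have "\<dots> \<le> B + real K * (r / 2)" using r by simp
    finally have le: "norm ((\<Sum>m<K. a m) / of_nat K - L) \<le> (B + real K * (r / 2)) / K"
      using K0 by (simp add: divide_right_mono)
    have "2 * B < r * real M" using M r by (simp add: field_simps)
    also have "\<dots> \<le> r * real K" using K r by simp
    finally have "(B + real K * (r / 2)) / K < r" using K0 by (simp add: field_simps)
    with le show "norm ((\<Sum>m<K. a m) / of_nat K - L) < r" by linarith
  qed
qed

lemma norm_cis_minus_1_le: "norm (cis t - 1) \<le> \<bar>t\<bar>"
proof -
  have "cis t - 1 = 2 * \<i> * of_real (sin (t / 2)) * cis (t / 2)"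
  proof -
    have "cis t = cis (t / 2) * cis (t / 2)" by (simp add: cis_mult)
    moreover have "1 = cis (- (t / 2)) * cis (t / 2)" by (simp add: cis_mult)
    moreover have "cis (t / 2) - cis (- (t / 2)) = 2 * \<i> * of_real (sin (t / 2))"
      by (simp add: complex_eq_iff)
    ultimately show ?thesis by (metis left_diff_distrib)
  qed
  then have "norm (cis t - 1) = 2 * \<bar>sin (t / 2)\<bar>" by (simp add: norm_mult)
  also have "\<dots> \<le> \<bar>t\<bar>" using abs_sin_x_le_abs_x[of "t / 2"] by simp
  finally show ?thesis .
qed

text \<open>Fejer means are used because they are positive: this gives the bound 1, which is what survives
  multiplication by further sinc factors.\<close>

definition fejer_bounded_conv :: "(real \<Rightarrow> real) \<Rightarrow> real \<Rightarrow> bool" where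
  "fejer_bounded_conv S B \<longleftrightarrow> (\<forall>x w. \<bar>w\<bar> < B \<longrightarrow>
    (\<forall>K. norm (fejer_mean S x w K) \<le> 1) \<and> fejer_mean S x w \<longlonglongrightarrow> 1)"

lemma continuous_fejer_kernel: "continuous_on A (\<lambda>u. fejer_kernel K (u - w))"
  unfolding fejer_kernel_def dirichlet_kernel_def divide_inverse by (intro continuous_intros)

text \<open>The means are averages of \<open>cis (x * (u - w))\<close> against the Fejer kernel. Its
  total mass is read off at \<open>x = 0\<close>; with positivity this gives the bound 1, and
  concentration at \<open>u = w\<close> gives the limit.\<close>

lemma fejer_bounded_conv_sn_pi: "fejer_bounded_conv (\<lambda>y. sn (pi * y)) pi"
  unfolding fejer_bounded_conv_def
proof (intro allI impI)
  fix x w :: real assume w: "\<bar>w\<bar> < pi"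
  let ?\<sigma> = "fejer_mean (\<lambda>y. sn (pi * y)) x w"
  let ?S = "{-pi..pi}"
  \<comment> \<open>The kernel vanishes at all integers but 0, so every partial sum is 1. For
    \<open>K = 0\<close> the quotient is 0 instead.\<close>
  have mean_0: "fejer_mean (\<lambda>y. sn (pi * y)) 0 w K = 1" if "K \<noteq> 0" for K
  proof -
    have "(\<Sum>k\<in>{- int m..int m}. of_real (sn (pi * (0 - of_int k))) * cis (- ((0 - of_int k) * w))) = (1::complex)" for m
    proof -
      have "(\<Sum>k\<in>{- int m..int m}. of_real (sn (pi * (0 - of_int k))) * cis (- ((0 - of_int k) * w))) =
          (\<Sum>k\<in>{- int m..int m}. if k = 0 then 1 else (0::complex))"
        by (intro sum.cong) (use sn_pi_int[of "- k" for k] in \<open>auto simp: sn_def\<close>)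
      then show ?thesis by simp
    qed
    then show ?thesis using that by (simp add: fejer_mean_def)
  qed
  have F_int: "((\<lambda>u. complex_of_real (fejer_kernel K (u - w))) has_integral of_real (2 * pi)) ?S" if "K \<noteq> 0" for K
    using fejer_mean_sn_pi[of 0 w K] mean_0[OF that] by simp
  have F_int_real: "((\<lambda>u. fejer_kernel K (u - w)) has_integral 2 * pi) ?S" if "K \<noteq> 0" for K
    using has_integral_linear[OF F_int[OF that] bounded_linear_Re] by (simp add: o_def)
  have bound: "norm (?\<sigma> K) \<le> 1" for K
  proof (cases "K = 0")
    case False
    have "norm (2 * pi * ?\<sigma> K) \<le> 2 * pi"
    proof -
      have "norm (2 * pi * ?\<sigma> K) \<le> (2 * pi) \<bullet> (1::real)"
        using fejer_mean_sn_pi[of x w K] F_int_real[OF False]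
        by (rule has_integral_norm_bound_integral_component) (simp add: norm_mult fejer_kernel_nonneg)
      then show ?thesis by simp
    qed
    then show ?thesis by (simp add: norm_mult)
  qed (simp add: fejer_mean_def)
  \<comment> \<open>The angle \<open>(u - w) / 2\<close> stays in \<open>[-c, c]\<close>. Here
    \<open>\<bar>w\<bar> < pi\<close> enters through \<open>c < pi\<close>: it excludes a second
    peak of the kernel on the period.\<close>
  define c where "c = (pi + \<bar>w\<bar>) / 2"
  have c: "0 < c" "c < pi" using w pi_gt_zero by (auto simp: c_def)
  obtain d where d: "0 < d" "\<And>y. \<bar>y\<bar> \<le> c \<Longrightarrow> d * \<bar>y\<bar> \<le> \<bar>sin y\<bar>"
    using sin_ge_linear[OF c] by blast
  have sin_ne: "sin ((u - w) / 2) \<noteq> 0" "\<bar>u - w\<bar> / \<bar>sin ((u - w) / 2)\<bar> \<le> 2 / d" if "u \<in> ?S" "u \<noteq> w" for u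
  proof -
    have "\<bar>(u - w) / 2\<bar> \<le> c" using that(1) by (auto simp: c_def)
    then have le: "d * \<bar>(u - w) / 2\<bar> \<le> \<bar>sin ((u - w) / 2)\<bar>" by (rule d)
    moreover have "0 < d * \<bar>(u - w) / 2\<bar>" using d that(2) by simp
    ultimately show ne: "sin ((u - w) / 2) \<noteq> 0" by auto
    show "\<bar>u - w\<bar> / \<bar>sin ((u - w) / 2)\<bar> \<le> 2 / d"
      using le ne d(1) by (simp add: divide_simps mult.commute)
  qed
  \<comment> \<open>The factor \<open>\<bar>u - w\<bar>\<close> comes from
    \<open>norm (cis t - 1) \<le> \<bar>t\<bar>\<close> and cancels the singularity of the majorant
    \<open>1 / \<bar>sin ((u - w) / 2)\<bar>\<close>.\<close>
  let ?g = "\<lambda>K u. \<bar>u - w\<bar> * fejer_kernel K (u - w)"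
  have lim: "(\<lambda>K. integral ?S (?g K)) \<longlonglongrightarrow> integral ?S (\<lambda>u. 0)"
  proof (rule dominated_convergence(2)[where h = "\<lambda>_. 2 / d"])
    show "?g K integrable_on ?S" for K
      by (intro integrable_continuous_interval continuous_intros continuous_fejer_kernel)
    show "(\<lambda>_. 2 / d) integrable_on ?S" by (rule integrable_const_ivl)
    show "norm (?g K u) \<le> 2 / d" if u: "u \<in> ?S" for K u
    proof (cases "u = w")
      case False
      have "?g K u \<le> \<bar>u - w\<bar> * (1 / \<bar>sin ((u - w) / 2)\<bar>)"
        by (intro mult_left_mono fejer_kernel_le sin_ne u False) auto
      also have "\<dots> \<le> 2 / d" using sin_ne(2)[OF u False] by simp
      finally show ?thesis by (simp add: abs_mult fejer_kernel_nonneg)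
    qed (use d in simp)
    show "(\<lambda>K. ?g K u) \<longlonglongrightarrow> 0" if u: "u \<in> ?S" for u
    proof (cases "u = w")
      case False
      show ?thesis
      proof (rule tendsto_sandwich[OF _ _ tendsto_const])
        show "\<forall>\<^sub>F K in sequentially. 0 \<le> ?g K u" by (simp add: fejer_kernel_nonneg)
        show "\<forall>\<^sub>F K in sequentially. ?g K u \<le> \<bar>u - w\<bar> * ((1 / (sin ((u - w) / 2))\<^sup>2) / real K)"
          by (intro always_eventually allI mult_left_mono fejer_kernel_le sin_ne u False) auto
        show "(\<lambda>K. \<bar>u - w\<bar> * ((1 / (sin ((u - w) / 2))\<^sup>2) / real K)) \<longlonglongrightarrow> 0"
          by (rule tendsto_mult_right_zero[OF lim_const_over_n])
      qed
    qed simp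
  qed
  have "?\<sigma> \<longlonglongrightarrow> 1"
  proof (rule LIM_zero_cancel, rule Lim_null_comparison)
    show "(\<lambda>K. \<bar>x\<bar> / (2 * pi) * integral ?S (?g K)) \<longlonglongrightarrow> 0"
      using lim by (intro tendsto_mult_right_zero) simp
    show "\<forall>\<^sub>F K in sequentially. norm (?\<sigma> K - 1) \<le> \<bar>x\<bar> / (2 * pi) * integral ?S (?g K)"
      using eventually_gt_at_top[of "0::nat"]
    proof eventually_elim
      fix K :: nat assume K: "0 < K"
      have i1: "((\<lambda>u. cis (x * (u - w)) * of_real (fejer_kernel K (u - w)) - of_real (fejer_kernel K (u - w)))
          has_integral (2 * pi * ?\<sigma> K - of_real (2 * pi))) ?S"
        using K by (intro has_integral_diff fejer_mean_sn_pi F_int) auto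
      have i2: "((\<lambda>u. \<bar>x\<bar> * ?g K u) has_integral \<bar>x\<bar> * integral ?S (?g K)) ?S"
        by (intro has_integral_mult_right integrable_integral integrable_continuous_interval
            continuous_intros continuous_fejer_kernel)
      have "norm (2 * pi * ?\<sigma> K - of_real (2 * pi)) \<le> (\<bar>x\<bar> * integral ?S (?g K)) \<bullet> (1::real)"
        using i1 i2
      proof (rule has_integral_norm_bound_integral_component)
        fix u
        have "norm (cis (x * (u - w)) * of_real (fejer_kernel K (u - w)) - of_real (fejer_kernel K (u - w))) =
            norm (cis (x * (u - w)) - 1) * fejer_kernel K (u - w)"
          using norm_mult[of "cis (x * (u - w)) - 1" "of_real (fejer_kernel K (u - w))"]
          by (simp add: left_diff_distrib fejer_kernel_nonneg)
        also have "\<dots> \<le> \<bar>x * (u - w)\<bar> * fejer_kernel K (u - w)"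
          by (intro mult_right_mono norm_cis_minus_1_le fejer_kernel_nonneg)
        finally show "norm (cis (x * (u - w)) * of_real (fejer_kernel K (u - w)) - of_real (fejer_kernel K (u - w))) \<le>
            (\<bar>x\<bar> * ?g K u) \<bullet> 1" by (simp add: abs_mult mult.assoc)
      qed
      moreover have "2 * pi * ?\<sigma> K - of_real (2 * pi) = of_real (2 * pi) * (?\<sigma> K - 1)"
        by (simp add: algebra_simps)
      ultimately have "2 * pi * norm (?\<sigma> K - 1) \<le> \<bar>x\<bar> * integral ?S (?g K)"
        by (simp add: norm_mult)
      then show "norm (?\<sigma> K - 1) \<le> \<bar>x\<bar> / (2 * pi) * integral ?S (?g K)"
        by (simp add: field_simps)
    qed
  qed
  with bound show "(\<forall>K. norm (?\<sigma> K) \<le> 1) \<and> ?\<sigma> \<longlonglongrightarrow> 1" by blast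
qed

lemma sn_minus [simp]: "sn (- y) = sn y"
  by (simp add: sn_def)

text \<open>The new factor averages the frequency over an interval of half-length \<open>b\<close>,
  so the admissible band shrinks by \<open>b\<close>. The bound 1 survives averaging and is also the
  majorant for passing to the limit.\<close>

lemma fejer_bounded_conv_mult_sn:
  assumes S: "fejer_bounded_conv S B" and b: "0 < b"
  shows "fejer_bounded_conv (\<lambda>y. S y * sn (b * y)) (B - b)"
  unfolding fejer_bounded_conv_def
proof (intro allI impI)
  fix x w :: real assume w: "\<bar>w\<bar> < B - b"
  let ?T = "\<lambda>y. S y * sn (b * y)" and ?I = "{-b..b}"
  have SB: "norm (fejer_mean S x (v + w) K) \<le> 1" "(\<lambda>K. fejer_mean S x (v + w) K) \<longlonglongrightarrow> 1" if "v \<in> ?I" for v K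
    using S w that unfolding fejer_bounded_conv_def by (auto simp: abs_le_iff abs_less_iff)
  have i: "((\<lambda>v. fejer_mean S x (v + w) K) has_integral (2 * b * fejer_mean ?T x w K)) ?I" for K
  proof -
    have "((\<lambda>v. of_real (S (x - of_int k)) * cis (- ((x - of_int k) * (v + w)))) has_integral
        (2 * b * (of_real (?T (x - of_int k)) * cis (- ((x - of_int k) * w))))) ?I" for k :: int
    proof -
      have "((\<lambda>v. of_real (S (x - of_int k)) * cis (- (x - of_int k) * (v + w))) has_integral
        of_real (S (x - of_int k)) * (of_real (2 * b * sn (b * - (x - of_int k))) * cis (- (x - of_int k) * w))) ?I"
        by (intro has_integral_mult_right has_integral_cis_sn b)
      also have "sn (b * - (x - of_int k)) = sn (b * (x - of_int k))"
        using sn_minus[of "b * (x - of_int k)"] by (simp only: mult_minus_right)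
      finally show ?thesis unfolding mult_minus_left by (simp add: mult_ac)
    qed
    then have "((\<lambda>v. fejer_mean S x (v + w) K) has_integral
        ((\<Sum>m<K. \<Sum>k\<in>{- int m..int m}. 2 * b * (of_real (?T (x - of_int k)) * cis (- ((x - of_int k) * w)))) / K)) ?I"
      unfolding fejer_mean_def by (intro has_integral_divide has_integral_sum) auto
    then show ?thesis
      by (simp only: sum_distrib_left[symmetric] fejer_mean_def times_divide_eq_right)
  qed
  have "norm (fejer_mean ?T x w K) \<le> 1" for K
  proof -
    have "((\<lambda>v. 1::real) has_integral 2 * b) ?I"
      using has_integral_const_real[of "1::real" "-b" b] b by simp
    with i[of K] have "norm (2 * b * fejer_mean ?T x w K) \<le> (2 * b) \<bullet> (1::real)"
      by (rule has_integral_norm_bound_integral_component) (use SB in simp)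
    then show ?thesis using b by (simp add: norm_mult)
  qed
  moreover have "fejer_mean ?T x w \<longlonglongrightarrow> 1"
  proof -
    have "(\<lambda>K. integral ?I (\<lambda>v. fejer_mean S x (v + w) K)) \<longlonglongrightarrow> integral ?I (\<lambda>v. 1::complex)"
    proof (rule dominated_convergence(2)[where h = "\<lambda>_. 1"])
      show "(\<lambda>v. fejer_mean S x (v + w) K) integrable_on ?I" for K using i by blast
      show "(\<lambda>_. 1::real) integrable_on ?I" by (rule integrable_const_ivl)
    qed (use SB in auto)
    then have "(\<lambda>K. 2 * b * fejer_mean ?T x w K) \<longlonglongrightarrow> of_real (2 * b)"
      using b by (simp add: integral_unique[OF i] scaleR_conv_of_real)
    then have "(\<lambda>K. (2 * b * fejer_mean ?T x w K) / of_real (2 * b)) \<longlonglongrightarrow> of_real (2 * b) / of_real (2 * b)"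
      using b by (intro tendsto_divide tendsto_const) auto
    then show ?thesis using b by simp
  qed
  ultimately show "(\<forall>K. norm (fejer_mean ?T x w K) \<le> 1) \<and> fejer_mean ?T x w \<longlonglongrightarrow> 1" by blast
qed

lemma fejer_bounded_conv_mult_sn_power:
  assumes "fejer_bounded_conv S B" "0 < b"
  shows "fejer_bounded_conv (\<lambda>y. S y * sn (b * y) ^ M) (B - real M * b)"
proof (induction M)
  case (Suc M)
  then show ?case
    using fejer_bounded_conv_mult_sn[OF Suc assms(2)] by (simp add: algebra_simps)
qed (use assms in simp)

text \<open>By absolute summability the unconditional sum is the limit of the symmetric partial
  sums. Their Cesaro means have the same limit, which is known to be 1.\<close>

lemma fejer_bounded_conv_has_sum:
  assumes S: "fejer_bounded_conv S B" and w: "\<bar>w\<bar> < B"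
    and sum: "(\<lambda>k::int. \<bar>S (x - of_int k)\<bar>) summable_on UNIV"
  shows "((\<lambda>k::int. of_real (S (x - of_int k)) * cis (- ((x - of_int k) * w))) has_sum 1) UNIV"
proof -
  let ?f = "\<lambda>k::int. of_real (S (x - of_int k)) * cis (- ((x - of_int k) * w))"
  have "(\<lambda>k. norm (?f k)) summable_on UNIV" using sum by (simp add: norm_mult)
  then have "?f summable_on UNIV" by (rule abs_summable_summable)
  then have hs: "(?f has_sum infsum ?f UNIV) UNIV" by (rule has_sum_infsum)
  have "filterlim (\<lambda>m. {- int m..int m}) (finite_subsets_at_top UNIV) sequentially"
    unfolding filterlim_finite_subsets_at_top
  proof (intro allI impI)
    fix X :: "int set" assume X: "finite X \<and> X \<subseteq> UNIV"
    define N where "N = Max (insert 0 ((\<lambda>k. nat \<bar>k\<bar>) ` X))"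
    have N: "nat \<bar>k\<bar> \<le> N" if "k \<in> X" for k unfolding N_def using X that by (intro Max_ge) auto
    show "\<forall>\<^sub>F m in sequentially. finite {- int m..int m} \<and> X \<subseteq> {- int m..int m} \<and> {- int m..int m} \<subseteq> UNIV"
      using eventually_ge_at_top[of N]
    proof eventually_elim
      fix m assume "N \<le> m"
      then have "\<bar>k\<bar> \<le> int m" if "k \<in> X" for k using N[OF that] by linarith
      then show "finite {- int m..int m} \<and> X \<subseteq> {- int m..int m} \<and> {- int m..int m} \<subseteq> UNIV"
        by fastforce
    qed
  qed
  with hs have "(\<lambda>m. \<Sum>k\<in>{- int m..int m}. ?f k) \<longlonglongrightarrow> infsum ?f UNIV"
    unfolding has_sum_def by (rule filterlim_compose)
  then have "fejer_mean S x w \<longlonglongrightarrow> infsum ?f UNIV"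
    unfolding fejer_mean_def by (rule cesaro_mean_tendsto)
  moreover have "fejer_mean S x w \<longlonglongrightarrow> 1" using S w by (simp add: fejer_bounded_conv_def)
  ultimately have "infsum ?f UNIV = 1" by (rule LIMSEQ_unique)
  with hs show ?thesis by simp
qed

section \<open>Absolutely convergent sampling kernels in one dimension\<close>

lemma summable_on_int_inverse_square: "(\<lambda>k::int. 1 / (1 + \<bar>real_of_int k\<bar>)\<^sup>2) summable_on UNIV"
proof -
  let ?f = "\<lambda>k::int. 1 / (1 + \<bar>real_of_int k\<bar>)\<^sup>2"
  have "summable (\<lambda>n. 1 / (real (Suc n))\<^sup>2)"
    using inverse_power_summable[of 2, where 'a = real] summable_Suc_iff[of "\<lambda>n. 1 / (real n)\<^sup>2"]
    by (simp add: inverse_eq_divide)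
  then have nat: "(\<lambda>n. 1 / (real (Suc n))\<^sup>2) summable_on UNIV"
    by (intro norm_summable_imp_summable_on) simp
  have "?f summable_on range int"
    by (subst summable_on_reindex) (use nat in \<open>simp_all add: o_def add.commute inj_on_def\<close>)
  moreover have "?f summable_on range (\<lambda>n. - int n)"
    by (subst summable_on_reindex) (use nat in \<open>simp_all add: o_def add.commute inj_on_def\<close>)
  ultimately have "?f summable_on (range int \<union> range (\<lambda>n. - int n))" by (rule summable_on_union)
  also have "range int \<union> range (\<lambda>n. - int n) = UNIV"
  proof (intro set_eqI iffI UNIV_I)
    fix k :: int
    show "k \<in> range int \<union> range (\<lambda>n. - int n)" by (cases k rule: int_cases2) auto
  qed
  finally show ?thesis .
qed

lemma summable_on_int_shift_square: "(\<lambda>k::int. 1 / (2 + \<bar>x - real_of_int k\<bar>)\<^sup>2) summable_on UNIV"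
proof -
  let ?f = "\<lambda>k::int. 1 / (1 + \<bar>real_of_int k\<bar>)\<^sup>2"
  have "(?f \<circ> (\<lambda>k. k - \<lfloor>x\<rfloor>)) summable_on UNIV"
    using summable_on_int_inverse_square
      summable_on_reindex[of "\<lambda>k::int. k - \<lfloor>x\<rfloor>" UNIV ?f]
    by (simp add: inj_on_def surj_plus_right[of "- \<lfloor>x\<rfloor>", simplified])
  then show ?thesis
  proof (rule summable_on_comparison_test)
    fix k :: int
    have "\<bar>real_of_int (k - \<lfloor>x\<rfloor>)\<bar> \<le> \<bar>x - real_of_int k\<bar> + 1" by linarith
    then show "1 / (2 + \<bar>x - real_of_int k\<bar>)\<^sup>2 \<le> (?f \<circ> (\<lambda>k. k - \<lfloor>x\<rfloor>)) k"
      by (auto intro!: divide_left_mono power_mono mult_pos_pos zero_less_power)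
  qed auto
qed

text \<open>The bound of order \<open>M\<close> has a constant independent of \<open>K\<close>. The order \<open>K\<close> is later matched to the order of the
  distribution, to make the series converge; only the uniform bound enters the estimates.\<close>

lemma sampling_kernel_1d:
  assumes \<beta>: "0 < \<beta>" "\<beta> < pi"
  obtains C where "0 < C" "\<And>K. \<exists>X C'. 0 < C' \<and> (\<forall>y. \<bar>X y\<bar> \<le> C / (2 + \<bar>y\<bar>) ^ M) \<and>
    (\<forall>y. \<bar>X y\<bar> \<le> C' / (2 + \<bar>y\<bar>) ^ K) \<and>
    (\<forall>x w. \<bar>w\<bar> \<le> \<beta> \<longrightarrow> ((\<lambda>k::int. of_real (X (x - of_int k)) * cis (- ((x - of_int k) * w))) has_sum 1) UNIV)"
proof -
  \<comment> \<open>Half of the gap \<open>pi - \<beta>\<close> is shared by the \<open>M\<close>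
    factors of width \<open>b1\<close>, which is independent of \<open>K\<close>; the other half
    goes to the \<open>K'\<close> factors of width \<open>b2\<close>. The \<open>+ 1\<close> makes
    the inequalities strict and covers \<open>M = 0\<close>.\<close>
  define b1 where "b1 = (pi - \<beta>) / (2 * (real M + 1))"
  have b1: "0 < b1" using \<beta> by (simp add: b1_def)
  have pw: "\<bar>sn (b * y)\<bar> ^ m \<le> (2 + 1 / b) ^ m / (2 + \<bar>y\<bar>) ^ m" if "0 < b" for b y m
    unfolding power_divide[symmetric] by (intro power_mono sn_decay that) simp
  have pw1: "\<bar>sn (b * y)\<bar> ^ m \<le> 1" for b y m
    by (intro power_le_one abs_sn_le_1) simp
  have "\<exists>X C'. 0 < C' \<and> (\<forall>y. \<bar>X y\<bar> \<le> (2 + 1 / b1) ^ M / (2 + \<bar>y\<bar>) ^ M) \<and>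
    (\<forall>y. \<bar>X y\<bar> \<le> C' / (2 + \<bar>y\<bar>) ^ K) \<and>
    (\<forall>x w. \<bar>w\<bar> \<le> \<beta> \<longrightarrow> ((\<lambda>k::int. of_real (X (x - of_int k)) * cis (- ((x - of_int k) * w))) has_sum 1) UNIV)" for K
  proof -
    \<comment> \<open>Order at least 2 makes the series converge absolutely.\<close>
    define K' where "K' = max K 2"
    define b2 where "b2 = (pi - \<beta>) / (2 * (real K' + 1))"
    have b2: "0 < b2" using \<beta> by (simp add: b2_def)
    define X where "X y = sn (pi * y) * sn (b1 * y) ^ M * sn (b2 * y) ^ K'" for y
    define C' where "C' = (2 + 1 / b2) ^ K'"
    have C': "0 < C'" using b2 by (simp add: C'_def add_pos_pos)
    have X1: "\<bar>X y\<bar> \<le> (2 + 1 / b1) ^ M / (2 + \<bar>y\<bar>) ^ M" for y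
    proof -
      have "\<bar>X y\<bar> \<le> 1 * ((2 + 1 / b1) ^ M / (2 + \<bar>y\<bar>) ^ M) * 1"
        unfolding X_def abs_mult power_abs
        by (intro mult_mono abs_sn_le_1 pw pw1 b1) (use b1 in auto)
      then show ?thesis by simp
    qed
    have X2: "\<bar>X y\<bar> \<le> C' / (2 + \<bar>y\<bar>) ^ K'" for y
    proof -
      have "\<bar>X y\<bar> \<le> 1 * 1 * ((2 + 1 / b2) ^ K' / (2 + \<bar>y\<bar>) ^ K')"
        unfolding X_def abs_mult power_abs
        by (intro mult_mono abs_sn_le_1 pw pw1 b2) (use b2 in auto)
      then show ?thesis by (simp add: C'_def)
    qed
    have mono: "C' / (2 + \<bar>y\<bar>) ^ K' \<le> C' / (2 + \<bar>y\<bar>) ^ k" if "k \<le> K'" for y k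
      using C' that by (intro divide_left_mono power_increasing) auto
    have F: "fejer_bounded_conv X (pi - real M * b1 - real K' * b2)"
      unfolding X_def
      by (intro fejer_bounded_conv_mult_sn_power fejer_bounded_conv_sn_pi b1 b2)
    have "real M * b1 < (pi - \<beta>) / 2" "real K' * b2 < (pi - \<beta>) / 2"
      using \<beta> by (simp_all add: b1_def b2_def field_simps)
    then have B: "\<beta> < pi - real M * b1 - real K' * b2" by (simp add: field_simps)
    have summ: "(\<lambda>k::int. \<bar>X (x - of_int k)\<bar>) summable_on UNIV" for x
    proof (rule summable_on_comparison_test)
      show "(\<lambda>k::int. C' * (1 / (2 + \<bar>x - real_of_int k\<bar>)\<^sup>2)) summable_on UNIV"
        by (intro summable_on_cmult_right summable_on_int_shift_square)
      show "\<bar>X (x - of_int k)\<bar> \<le> C' * (1 / (2 + \<bar>x - real_of_int k\<bar>)\<^sup>2)" for k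
        using order_trans[OF X2 mono[of 2]] by (simp add: K'_def)
    qed auto
    have "((\<lambda>k::int. of_real (X (x - of_int k)) * cis (- ((x - of_int k) * w))) has_sum 1) UNIV"
      if "\<bar>w\<bar> \<le> \<beta>" for x w
      using that B by (intro fejer_bounded_conv_has_sum[OF F _ summ]) auto
    moreover have "\<bar>X y\<bar> \<le> C' / (2 + \<bar>y\<bar>) ^ K" for y
      using order_trans[OF X2 mono[of K]] by (simp add: K'_def)
    ultimately show ?thesis using C' X1 by blast
  qed
  moreover have "0 < (2 + 1 / b1) ^ M" using b1 by (simp add: add_pos_pos)
  ultimately show ?thesis by (rule that[rotated])
qed

section \<open>Products over the coordinates\<close>

lemma sum_prod_UNIV_le:
  fixes f :: "'i::finite \<Rightarrow> 'b \<Rightarrow> real"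
  assumes nn: "\<And>i x. 0 \<le> f i x" and s: "\<And>i. f i summable_on UNIV" and P: "finite P"
  shows "(\<Sum>p\<in>P. \<Prod>i\<in>UNIV. f i (p i)) \<le> (\<Prod>i\<in>UNIV. infsum (f i) UNIV)"
proof -
  \<comment> \<open>The finite set of multi-indices is enclosed in the product of its projections,
    over which the sum factors.\<close>
  define B where "B i = (\<lambda>p. p i) ` P" for i
  have fin: "finite (B i)" for i using P by (simp add: B_def)
  have "(\<Sum>p\<in>P. \<Prod>i\<in>UNIV. f i (p i)) \<le> (\<Sum>p\<in>PiE UNIV B. \<Prod>i\<in>UNIV. f i (p i))"
    by (intro sum_mono2 finite_PiE fin) (auto simp: B_def prod_nonneg nn)
  also have "\<dots> = (\<Prod>i\<in>UNIV. \<Sum>y\<in>B i. f i y)"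
    by (rule prod_sum_PiE[symmetric]) (auto simp: fin)
  also have "\<dots> \<le> (\<Prod>i\<in>UNIV. infsum (f i) UNIV)"
    by (intro prod_mono) (auto intro!: sum_nonneg nn finite_sum_le_infsum s fin)
  finally show ?thesis .
qed

lemma summable_on_prod_UNIV:
  fixes f :: "'i::finite \<Rightarrow> 'b \<Rightarrow> real"
  assumes "\<And>i x. 0 \<le> f i x" "\<And>i. f i summable_on UNIV"
  shows "(\<lambda>p. \<Prod>i\<in>UNIV. f i (p i)) summable_on UNIV"
  by (rule nonneg_bdd_above_summable_on)
    (auto intro!: prod_nonneg assms bdd_aboveI2 sum_prod_UNIV_le)

lemma has_sum_prod_UNIV:
  fixes f :: "'i::finite \<Rightarrow> 'b \<Rightarrow> complex"
  assumes s: "\<And>i. (\<lambda>x. norm (f i x)) summable_on UNIV" and f: "\<And>i. (f i has_sum a i) UNIV"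
  shows "((\<lambda>p. \<Prod>i\<in>UNIV. f i (p i)) has_sum (\<Prod>i\<in>UNIV. a i)) UNIV"
proof -
  have "(\<lambda>p. norm (\<Prod>i\<in>UNIV. f i (p i))) summable_on UNIV"
    unfolding prod_norm[symmetric] by (rule summable_on_prod_UNIV) (auto simp: s)
  then have "(\<lambda>p. \<Prod>i\<in>UNIV. f i (p i)) summable_on UNIV"
    by (rule abs_summable_summable)
  moreover have "infsum (\<lambda>p. \<Prod>i\<in>UNIV. f i (p i)) UNIV = (\<Prod>i\<in>UNIV. a i)"
    using infsum_prod_PiE_abs[of UNIV f "\<lambda>_. UNIV"] s infsumI[OF f] by simp
  ultimately show ?thesis by (metis has_sum_infsum)
qed

section \<open>Sampling in several variables\<close>

definition lat :: "('n \<Rightarrow> int) \<Rightarrow> real ^ 'n" where "lat k = (\<chi> i. of_int (k i))"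

lemma lat_nth [simp]: "lat k $ i = of_int (k i)"
  by (simp add: lat_def)

lemma inner_vec_sum: "x \<bullet> y = (\<Sum>i\<in>UNIV. x $ i * y $ i)" for x y :: "real ^ 'n"
  by (simp add: inner_vec_def)

lemma cis_sum: "finite A \<Longrightarrow> cis (\<Sum>i\<in>A. f i) = (\<Prod>i\<in>A. cis (f i))"
  by (induction A rule: finite_induct) (simp_all flip: cis_mult)

text \<open>The frequencies fill a cube instead of a ball because the kernels are products over the
  coordinates. Referring to a density \<open>m\<close>, and not to the Fourier transform of
  \<open>h\<close>, lets the derivatives of a function be treated like the function itself.\<close>

definition box_limited :: "real \<Rightarrow> (real ^ 'n \<Rightarrow> complex) \<Rightarrow> (real ^ 'n \<Rightarrow> complex) \<Rightarrow> bool" where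
  "box_limited \<beta> m h \<longleftrightarrow> integrable lborel m \<and> (\<forall>\<xi>. (\<exists>i. \<beta> < \<bar>\<xi> $ i\<bar>) \<longrightarrow> m \<xi> = 0) \<and>
    (\<forall>x. h x = (\<integral>\<xi>. m \<xi> * cis (x \<bullet> \<xi>) \<partial>lborel))"

lemma integrable_mult_cis:
  fixes m :: "real ^ 'n \<Rightarrow> complex"
  assumes "integrable lborel m"
  shows "integrable lborel (\<lambda>\<xi>. m \<xi> * cis (x \<bullet> \<xi>))"
proof (rule Bochner_Integration.integrable_bound[OF assms])
  have [measurable]: "(\<lambda>\<xi>. cis (x \<bullet> \<xi>)) \<in> borel_measurable borel"
    by (intro borel_measurable_continuous_onI continuous_intros)
  show "(\<lambda>\<xi>. m \<xi> * cis (x \<bullet> \<xi>)) \<in> borel_measurable lborel"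
    using assms by measurable
qed (simp add: norm_mult)

text \<open>The product of the one-dimensional identities expands every exponential with frequency
  in the cube; integrating against \<open>m\<close> gives the series for \<open>h\<close>. The
  offset \<open>t\<close> provides all translates of the grid.\<close>

lemma sampling_formula:
  fixes h :: "real ^ 'n \<Rightarrow> complex" and X :: "real \<Rightarrow> real"
  assumes h: "box_limited \<beta> m h"
    and sX: "\<And>y. (\<lambda>k::int. \<bar>X (y - of_int k)\<bar>) summable_on UNIV"
    and X: "\<And>y w. \<bar>w\<bar> \<le> \<beta> \<Longrightarrow>
      ((\<lambda>k::int. of_real (X (y - of_int k)) * cis (- ((y - of_int k) * w))) has_sum 1) UNIV"
  shows "((\<lambda>k. of_real (\<Prod>i\<in>UNIV. X ((x - t) $ i - of_int (k i))) * h (lat k + t)) has_sum h x) UNIV"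
proof -
  define P where "P k = (\<Prod>i\<in>UNIV. X ((x - t) $ i - of_int (k i)))" for k :: "'n \<Rightarrow> int"
  have m: "integrable lborel m" and m0: "\<And>\<xi> i. \<beta> < \<bar>\<xi> $ i\<bar> \<Longrightarrow> m \<xi> = 0"
    and hm: "\<And>x. h x = (\<integral>\<xi>. m \<xi> * cis (x \<bullet> \<xi>) \<partial>lborel)"
    using h unfolding box_limited_def by blast+
  have sP: "(\<lambda>k. \<bar>P k\<bar>) summable_on UNIV"
    unfolding P_def abs_prod by (rule summable_on_prod_UNIV) (auto intro: sX)
  define A where "A = infsum (\<lambda>k. \<bar>P k\<bar>) UNIV"
  have hsA: "((\<lambda>k. \<bar>P k\<bar>) has_sum A) UNIV"
    unfolding A_def using sP by (rule has_sum_infsum)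
  have exp_sum: "((\<lambda>k. of_real (P k) * cis ((lat k + t) \<bullet> \<xi>)) has_sum cis (x \<bullet> \<xi>)) UNIV"
    if \<xi>: "\<And>i. \<bar>\<xi> $ i\<bar> \<le> \<beta>" for \<xi>
  proof -
    let ?z = "x - t"
    have "((\<lambda>k. \<Prod>i\<in>UNIV. of_real (X (?z $ i - of_int (k i))) * cis (- ((?z $ i - of_int (k i)) * \<xi> $ i)))
        has_sum (\<Prod>i\<in>(UNIV::'n set). 1)) UNIV"
      by (rule has_sum_prod_UNIV[where f="\<lambda>i k. of_real (X (?z $ i - of_int k)) * cis (- ((?z $ i - of_int k) * \<xi> $ i))"])
        (use X[OF \<xi>] sX in \<open>auto simp: norm_mult\<close>)
    then have "((\<lambda>k. cis (x \<bullet> \<xi>) * (\<Prod>i\<in>UNIV. of_real (X (?z $ i - of_int (k i))) * cis (- ((?z $ i - of_int (k i)) * \<xi> $ i))))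
        has_sum (cis (x \<bullet> \<xi>) * 1)) UNIV"
      by (intro has_sum_cmult_right) simp
    moreover have "cis (x \<bullet> \<xi>) * (\<Prod>i\<in>UNIV. of_real (X (?z $ i - of_int (k i))) * cis (- ((?z $ i - of_int (k i)) * \<xi> $ i))) =
        of_real (P k) * cis ((lat k + t) \<bullet> \<xi>)" for k
    proof -
      have "(\<Prod>i\<in>UNIV. cis (- ((?z $ i - of_int (k i)) * \<xi> $ i))) = cis (- (?z - lat k) \<bullet> \<xi>)"
        by (simp add: cis_sum[symmetric] inner_vec_sum sum_negf left_diff_distrib)
      then have "(\<Prod>i\<in>UNIV. of_real (X (?z $ i - of_int (k i))) * cis (- ((?z $ i - of_int (k i)) * \<xi> $ i))) =
          of_real (P k) * cis (- (?z - lat k) \<bullet> \<xi>)"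
        by (simp add: prod.distrib P_def)
      moreover have "cis (x \<bullet> \<xi>) * cis (- (?z - lat k) \<bullet> \<xi>) = cis ((lat k + t) \<bullet> \<xi>)"
        unfolding cis_mult by (simp add: inner_simps algebra_simps)
      ultimately show ?thesis by (simp add: mult.left_commute)
    qed
    ultimately show ?thesis by simp
  qed
  \<comment> \<open>The remainder bound is free of \<open>\<xi>\<close>, so it can be integrated
    against \<open>m\<close> for each finite partial sum, without exchanging an infinite sum and an
    integral.\<close>
  have exp_tail: "norm (cis (x \<bullet> \<xi>) - (\<Sum>k\<in>F. of_real (P k) * cis ((lat k + t) \<bullet> \<xi>))) \<le> A - (\<Sum>k\<in>F. \<bar>P k\<bar>)"
    if \<xi>: "\<And>i. \<bar>\<xi> $ i\<bar> \<le> \<beta>" and F: "finite F" for \<xi> F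
  proof -
    let ?f = "\<lambda>k. of_real (P k) * cis ((lat k + t) \<bullet> \<xi>)"
    have 1: "(?f has_sum (cis (x \<bullet> \<xi>) - sum ?f F)) (- F)"
      using has_sum_Diff[OF exp_sum[OF \<xi>] has_sum_finite[OF F]] by (simp add: Compl_eq_Diff_UNIV)
    have 2: "((\<lambda>k. norm (?f k)) has_sum (A - (\<Sum>k\<in>F. \<bar>P k\<bar>))) (- F)"
      using has_sum_Diff[OF hsA has_sum_finite[OF F]] by (simp add: Compl_eq_Diff_UNIV norm_mult)
    show ?thesis
      using norm_infsum_le[OF 1 2] by simp
  qed
  have bound: "norm (h x - (\<Sum>k\<in>F. of_real (P k) * h (lat k + t))) \<le>
      (\<integral>\<xi>. norm (m \<xi>) \<partial>lborel) * (A - (\<Sum>k\<in>F. \<bar>P k\<bar>))" if F: "finite F" for F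
  proof -
    have "h x - (\<Sum>k\<in>F. of_real (P k) * h (lat k + t)) =
        (\<integral>\<xi>. m \<xi> * cis (x \<bullet> \<xi>) - (\<Sum>k\<in>F. of_real (P k) * (m \<xi> * cis ((lat k + t) \<bullet> \<xi>))) \<partial>lborel)"
      unfolding hm by (simp add: Bochner_Integration.integral_diff Bochner_Integration.integral_sum integrable_mult_cis m)
    also have "norm \<dots> \<le> (\<integral>\<xi>. norm (m \<xi>) * (A - (\<Sum>k\<in>F. \<bar>P k\<bar>)) \<partial>lborel)"
    proof (rule order_trans[OF integral_norm_bound integral_mono])
      show "integrable lborel (\<lambda>\<xi>. norm (m \<xi> * cis (x \<bullet> \<xi>) - (\<Sum>k\<in>F. of_real (P k) * (m \<xi> * cis ((lat k + t) \<bullet> \<xi>)))))"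
        by (intro integrable_norm Bochner_Integration.integrable_diff Bochner_Integration.integrable_sum integrable_mult_right integrable_mult_cis m)
      show "integrable lborel (\<lambda>\<xi>. norm (m \<xi>) * (A - (\<Sum>k\<in>F. \<bar>P k\<bar>)))"
        using m by (intro integrable_mult_left integrable_norm)
      fix \<xi>
      have "m \<xi> * cis (x \<bullet> \<xi>) - (\<Sum>k\<in>F. of_real (P k) * (m \<xi> * cis ((lat k + t) \<bullet> \<xi>))) =
          m \<xi> * (cis (x \<bullet> \<xi>) - (\<Sum>k\<in>F. of_real (P k) * cis ((lat k + t) \<bullet> \<xi>)))"
        by (simp add: right_diff_distrib sum_distrib_left mult.left_commute)
      then have eq: "norm (m \<xi> * cis (x \<bullet> \<xi>) - (\<Sum>k\<in>F. of_real (P k) * (m \<xi> * cis ((lat k + t) \<bullet> \<xi>)))) =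
          norm (m \<xi>) * norm (cis (x \<bullet> \<xi>) - (\<Sum>k\<in>F. of_real (P k) * cis ((lat k + t) \<bullet> \<xi>)))"
        by (simp add: norm_mult)
      show "norm (m \<xi> * cis (x \<bullet> \<xi>) - (\<Sum>k\<in>F. of_real (P k) * (m \<xi> * cis ((lat k + t) \<bullet> \<xi>)))) \<le>
          norm (m \<xi>) * (A - (\<Sum>k\<in>F. \<bar>P k\<bar>))"
      proof (cases "\<exists>i. \<beta> < \<bar>\<xi> $ i\<bar>")
        case True
        then have "m \<xi> = 0" using m0 by blast
        then show ?thesis by simp
      next
        case False
        then show ?thesis unfolding eq by (intro mult_left_mono exp_tail F) (auto simp: not_less)
      qed
    qed
    finally show ?thesis by simp
  qed
  show ?thesis
    unfolding P_def[symmetric] has_sum_def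
  proof (rule LIM_zero_cancel)
    show "((\<lambda>F. (\<Sum>k\<in>F. of_real (P k) * h (lat k + t)) - h x) \<longlongrightarrow> 0) (finite_subsets_at_top UNIV)"
    proof (rule Lim_null_comparison)
      show "\<forall>\<^sub>F F in finite_subsets_at_top UNIV. norm ((\<Sum>k\<in>F. of_real (P k) * h (lat k + t)) - h x) \<le>
        (\<integral>\<xi>. norm (m \<xi>) \<partial>lborel) * (A - (\<Sum>k\<in>F. \<bar>P k\<bar>))"
        using bound by (intro eventually_finite_subsets_at_top_weakI) (simp add: norm_minus_commute)
      have "((\<lambda>F. A - (\<Sum>k\<in>F. \<bar>P k\<bar>)) \<longlongrightarrow> A - A) (finite_subsets_at_top UNIV)"
        using hsA unfolding has_sum_def by (intro tendsto_intros)
      then show "((\<lambda>F. (\<integral>\<xi>. norm (m \<xi>) \<partial>lborel) * (A - (\<Sum>k\<in>F. \<bar>P k\<bar>))) \<longlongrightarrow> 0) (finite_subsets_at_top UNIV)"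
        by (intro tendsto_mult_right_zero) simp
    qed
  qed
qed

section \<open>Fourier inversion\<close>

lemma lborel_integrable_affine:
  fixes f :: "'a::euclidean_space \<Rightarrow> complex"
  assumes f: "integrable lborel f" and c: "c \<noteq> 0"
  shows "integrable lborel (\<lambda>x. f (t + c *\<^sub>R x))"
proof -
  have [measurable]: "f \<in> borel_measurable borel" using f by auto
  have "integrable (density (distr lborel borel (\<lambda>x. t + c *\<^sub>R x)) (\<lambda>_. \<bar>c\<bar> ^ DIM('a))) f"
    using f lborel_affine[OF c, of t] by simp
  then have "integrable lborel (\<lambda>x. (\<bar>c\<bar> ^ DIM('a)) *\<^sub>R f (t + c *\<^sub>R x))"
    by (subst (asm) integrable_density) (auto simp: integrable_distr_eq)
  from integrable_scaleR_right[of "1 / \<bar>c\<bar> ^ DIM('a)", OF this] show ?thesis using c by simp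
qed

lemma lborel_integral_affine:
  fixes f :: "'a::euclidean_space \<Rightarrow> complex"
  assumes [measurable]: "f \<in> borel_measurable borel" and c: "c \<noteq> 0"
  shows "(\<integral>x. f x \<partial>lborel) = of_real (\<bar>c\<bar> ^ DIM('a)) * (\<integral>x. f (t + c *\<^sub>R x) \<partial>lborel)"
  by (subst lborel_affine[OF c, of t])
    (simp add: integral_density integral_distr scaleR_conv_of_real)

lemma lborel_prod_vec:
  fixes f :: "'n::finite \<Rightarrow> real \<Rightarrow> complex"
  assumes f: "\<And>i. integrable lborel (f i)"
  shows "integrable lborel (\<lambda>x::real ^ 'n. \<Prod>i\<in>UNIV. f i (x $ i))"
    and "(\<integral>x. (\<Prod>i\<in>UNIV. f i (x $ i)) \<partial>(lborel :: (real ^ 'n) measure)) = (\<Prod>i\<in>UNIV. (\<integral>x. f i x \<partial>lborel))"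
proof -
  let ?B = "Basis :: (real ^ 'n) set"
  \<comment> \<open>\<open>lborel\<close> is the image of a product measure indexed by
    \<open>Basis\<close>; \<open>ix\<close> reads the coordinate off a basis vector.\<close>
  define ix where "ix b = (THE i. b = axis i (1::real))" for b :: "real ^ 'n"
  have ix: "ix (axis i 1) = i" for i by (simp add: ix_def axis_eq_axis)
  have reidx: "(\<Prod>b\<in>?B. F (ix b)) = (\<Prod>i\<in>UNIV. F i)" for F :: "'n \<Rightarrow> complex"
  proof -
    have B: "?B = (\<lambda>i. axis i 1) ` UNIV" by (auto simp: Basis_vec_def)
    show ?thesis unfolding B by (subst prod.reindex) (auto simp: inj_on_def axis_eq_axis ix)
  qed
  let ?T = "\<lambda>f. \<Sum>b\<in>?B. f b *\<^sub>R b"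
  have [measurable]: "?T \<in> (\<Pi>\<^sub>M b\<in>?B. lborel) \<rightarrow>\<^sub>M borel"
    by measurable
  have [measurable]: "f i \<in> borel_measurable borel" for i using f[of i] by auto
  have [measurable]: "(\<lambda>x::real ^ 'n. \<Prod>i\<in>UNIV. f i (x $ i)) \<in> borel_measurable borel"
    by measurable
  have T: "(\<Prod>i\<in>UNIV. f i (?T g $ i)) = (\<Prod>b\<in>?B. f (ix b) (g b))" for g
  proof -
    have "?T g $ i = g (axis i 1)" for i
    proof -
      have "?T g $ i = ?T g \<bullet> axis i 1" by (simp add: inner_axis)
      also have "\<dots> = g (axis i 1)" by (intro inner_sum_left_Basis) (auto simp: Basis_vec_def)
      finally show ?thesis .
    qed
    moreover have "(\<Prod>b\<in>?B. f (ix b) (g b)) = (\<Prod>b\<in>?B. f (ix b) (g (axis (ix b) 1)))"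
      by (intro prod.cong) (auto simp: Basis_vec_def ix)
    ultimately show ?thesis using reidx[of "\<lambda>i. f i (g (axis i 1))"] by simp
  qed
  interpret product_sigma_finite "\<lambda>_::real ^ 'n. lborel :: real measure" by standard
  show "integrable lborel (\<lambda>x::real ^ 'n. \<Prod>i\<in>UNIV. f i (x $ i))"
  proof -
    have "integrable (\<Pi>\<^sub>M b\<in>?B. lborel) (\<lambda>g. \<Prod>b\<in>?B. f (ix b) (g b))"
      by (intro product_integrable_prod f) simp
    then have "integrable (\<Pi>\<^sub>M b\<in>?B. lborel) (\<lambda>g. \<Prod>i\<in>UNIV. f i (?T g $ i))"
      by (simp only: T)
    then have "integrable (distr (\<Pi>\<^sub>M b\<in>?B. lborel) borel ?T) (\<lambda>x::real ^ 'n. \<Prod>i\<in>UNIV. f i (x $ i))"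
      by (subst integrable_distr_eq) measurable
    then show ?thesis by (simp only: lborel_eq[symmetric])
  qed
  have "(\<integral>x. (\<Prod>i\<in>UNIV. f i (x $ i)) \<partial>(lborel :: (real ^ 'n) measure)) = (\<Prod>b\<in>?B. (\<integral>x. f (ix b) x \<partial>lborel))"
  proof -
    have "(\<integral>x. (\<Prod>i\<in>UNIV. f i (x $ i)) \<partial>(lborel :: (real ^ 'n) measure)) =
        (\<integral>g. (\<Prod>i\<in>UNIV. f i (?T g $ i)) \<partial>(\<Pi>\<^sub>M b\<in>?B. lborel))"
      by (subst lborel_eq, subst integral_distr) measurable
    also have "\<dots> = (\<integral>g. (\<Prod>b\<in>?B. f (ix b) (g b)) \<partial>(\<Pi>\<^sub>M b\<in>?B. lborel))"
      by (simp only: T)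
    also have "\<dots> = (\<Prod>b\<in>?B. (\<integral>x. f (ix b) x \<partial>lborel))"
      by (intro product_integral_prod f) simp
    finally show ?thesis .
  qed
  also have "\<dots> = (\<Prod>i\<in>UNIV. (\<integral>x. f i x \<partial>lborel))" by (rule reidx)
  finally show "(\<integral>x. (\<Prod>i\<in>UNIV. f i (x $ i)) \<partial>(lborel :: (real ^ 'n) measure)) = (\<Prod>i\<in>UNIV. (\<integral>x. f i x \<partial>lborel))" .
qed

section \<open>Gaussians and their Fourier transforms\<close>

lemma gaussian_integral_1d:
  "integrable lborel (\<lambda>u. complex_of_real (exp (- u\<^sup>2 / 2)))"
  "(\<integral>u. of_real (exp (- u\<^sup>2 / 2)) * cis (t * u) \<partial>lborel) = of_real (sqrt (2 * pi) * exp (- t\<^sup>2 / 2))"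
proof -
  have eq: "exp (- u\<^sup>2 / 2) = sqrt (2 * pi) * std_normal_density u" for u :: real
    by (simp add: std_normal_density_def)
  show "integrable lborel (\<lambda>u. complex_of_real (exp (- u\<^sup>2 / 2)))"
    unfolding eq of_real_mult by (intro integrable_mult_right integrable_of_real integrable_normal_density) simp
  have "of_real (exp (- (t^2) / 2)) = char std_normal_distribution t"
    by (simp add: char_std_normal_distribution)
  also have "\<dots> = (\<integral>u. std_normal_density u *\<^sub>R iexp (t * u) \<partial>lborel)"
    unfolding char_def by (subst integral_density) auto
  finally have *: "(\<integral>u. std_normal_density u *\<^sub>R iexp (t * u) \<partial>lborel) = of_real (exp (- t\<^sup>2 / 2))" by simp
  have "(\<integral>u. of_real (exp (- u\<^sup>2 / 2)) * cis (t * u) \<partial>lborel) =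
      (\<integral>u. of_real (sqrt (2 * pi)) * (std_normal_density u *\<^sub>R iexp (t * u)) \<partial>lborel)"
    unfolding eq by (simp add: scaleR_conv_of_real cis_conv_exp mult.assoc)
  also have "\<dots> = of_real (sqrt (2 * pi)) * of_real (exp (- t\<^sup>2 / 2))"
    unfolding integral_mult_right_zero * ..
  finally show "(\<integral>u. of_real (exp (- u\<^sup>2 / 2)) * cis (t * u) \<partial>lborel) = of_real (sqrt (2 * pi) * exp (- t\<^sup>2 / 2))"
    by simp
qed

definition gauss :: "real ^ 'n \<Rightarrow> real" where "gauss x = exp (- (x \<bullet> x) / 2)"

lemma gauss_prod: "gauss x = (\<Prod>i\<in>UNIV. exp (- (x $ i)\<^sup>2 / 2))"
  by (simp add: gauss_def inner_vec_sum exp_sum[symmetric] sum_negf sum_divide_distrib power2_eq_square)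

lemma integrable_gauss: "integrable lborel (\<lambda>x::real ^ 'n. complex_of_real (gauss x))"
  unfolding gauss_prod of_real_prod by (intro lborel_prod_vec gaussian_integral_1d)

lemma gauss_fourier:
  fixes z :: "real ^ 'n"
  shows "(\<integral>\<xi>. of_real (gauss \<xi>) * cis (z \<bullet> \<xi>) \<partial>lborel) = of_real (sqrt (2 * pi) ^ CARD('n) * gauss z)"
proof -
  have i: "integrable lborel (\<lambda>u. of_real (exp (- u\<^sup>2 / 2)) * cis (z $ i * u))" for i
  proof (rule Bochner_Integration.integrable_bound[OF gaussian_integral_1d(1)])
    show "(\<lambda>u. of_real (exp (- u\<^sup>2 / 2)) * cis (z $ i * u)) \<in> borel_measurable lborel"
    proof -
      have "(\<lambda>u. of_real (exp (- u\<^sup>2 / 2)) * cis (z $ i * u)) \<in> borel_measurable borel"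
        by (intro borel_measurable_continuous_onI continuous_intros) auto
      then show ?thesis by simp
    qed
  qed (simp add: norm_mult)
  have "(\<integral>\<xi>. of_real (gauss \<xi>) * cis (z \<bullet> \<xi>) \<partial>lborel) =
      (\<integral>\<xi>. (\<Prod>i\<in>UNIV. of_real (exp (- (\<xi> $ i)\<^sup>2 / 2)) * cis (z $ i * \<xi> $ i)) \<partial>lborel)"
    by (simp add: gauss_prod inner_vec_sum cis_sum prod.distrib)
  also have "\<dots> = (\<Prod>i\<in>UNIV. of_real (sqrt (2 * pi) * exp (- (z $ i)\<^sup>2 / 2)))"
    by (subst lborel_prod_vec(2)[OF i]) (simp only: gaussian_integral_1d)
  also have "\<dots> = of_real (sqrt (2 * pi) ^ CARD('n) * gauss z)"
    by (simp add: gauss_prod prod.distrib)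
  finally show ?thesis .
qed


lemma gauss_fourier_scaled:
  fixes z :: "real ^ 'n"
  assumes e: "0 < e"
  shows "integrable lborel (\<lambda>\<xi>::real ^ 'n. complex_of_real (gauss (e *\<^sub>R \<xi>)))"
    and "(\<integral>\<xi>. of_real (gauss (e *\<^sub>R \<xi>)) * cis (z \<bullet> \<xi>) \<partial>lborel) =
      of_real ((1 / e) ^ CARD('n) * (sqrt (2 * pi) ^ CARD('n) * gauss ((1 / e) *\<^sub>R z)))"
proof -
  show "integrable lborel (\<lambda>\<xi>::real ^ 'n. complex_of_real (gauss (e *\<^sub>R \<xi>)))"
    using lborel_integrable_affine[OF integrable_gauss, of e 0] e by simp
  have [measurable]: "(\<lambda>\<xi>. of_real (gauss (e *\<^sub>R \<xi>)) * cis (z \<bullet> \<xi>)) \<in> borel_measurable borel"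
    unfolding gauss_def by (intro borel_measurable_continuous_onI continuous_intros) auto
  have "(\<integral>\<xi>. of_real (gauss (e *\<^sub>R \<xi>)) * cis (z \<bullet> \<xi>) \<partial>lborel) =
      of_real ((1 / e) ^ CARD('n)) * (\<integral>\<xi>. of_real (gauss \<xi>) * cis (((1 / e) *\<^sub>R z) \<bullet> \<xi>) \<partial>lborel)"
    using e by (subst lborel_integral_affine[of _ "1 / e" 0]) auto
  then show "(\<integral>\<xi>. of_real (gauss (e *\<^sub>R \<xi>)) * cis (z \<bullet> \<xi>) \<partial>lborel) =
      of_real ((1 / e) ^ CARD('n) * (sqrt (2 * pi) ^ CARD('n) * gauss ((1 / e) *\<^sub>R z)))"
    unfolding gauss_fourier by (simp add: power_one_over)
qed

text \<open>The double integral behind the formula need not converge absolutely, so a Gaussian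
  cut-off in frequency is inserted. Fubini's theorem turns it into a Gaussian average of
  \<open>h\<close> around \<open>x\<close>, and both sides converge as the cut-off is
  removed.\<close>

lemma fourier_inversion:
  fixes h F :: "real ^ 'n \<Rightarrow> complex"
  assumes cont: "continuous_on UNIV h" and int: "integrable lborel h" and bdd: "\<And>x. norm (h x) \<le> B"
    and F: "\<And>\<xi>. F \<xi> = (\<integral>y. h y * cis (- (y \<bullet> \<xi>)) \<partial>lborel)" and intF: "integrable lborel F"
  shows "h x = (\<integral>\<xi>. of_real (1 / (2 * pi) ^ CARD('n)) * F \<xi> * cis (x \<bullet> \<xi>) \<partial>lborel)"
proof -
  let ?K = "sqrt (2 * pi) ^ CARD('n)"
  have [measurable]: "h \<in> borel_measurable borel" using cont by (rule borel_measurable_continuous_onI)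
  have [measurable]: "F \<in> borel_measurable borel" using intF by auto
  have gauss_cont [continuous_intros]: "continuous_on A (\<lambda>x. gauss (f x))" if "continuous_on A f" for A :: "'c::topological_space set" and f :: "'c \<Rightarrow> real ^ 'n"
    unfolding gauss_def using that by (intro continuous_intros) auto
  have gauss_le: "gauss z \<le> 1" "0 < gauss z" for z :: "real ^ 'n" by (simp_all add: gauss_def)
  have gauss_even: "gauss (- z) = gauss z" for z :: "real ^ 'n" by (simp add: gauss_def)
  \<comment> \<open>Integrating over the frequency first leaves a Gaussian of width \<open>e\<close>
    about \<open>x\<close>. The substitution by \<open>x + e *\<^sub>R u\<close> moves the width
    into the argument of \<open>h\<close>, where continuity applies.\<close>
  have key: "(\<integral>\<xi>. F \<xi> * cis (x \<bullet> \<xi>) * of_real (gauss (e *\<^sub>R \<xi>)) \<partial>lborel) =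
      of_real ?K * (\<integral>u. h (x + e *\<^sub>R u) * of_real (gauss u) \<partial>lborel)" if e: "0 < e" for e
  proof -
    define f where "f y \<xi> = h y * (of_real (gauss (e *\<^sub>R \<xi>)) * cis ((x - y) \<bullet> \<xi>))" for y \<xi>
    have [measurable]: "(\<lambda>p::(real^'n) \<times> (real^'n). of_real (gauss (e *\<^sub>R snd p)) * cis ((x - fst p) \<bullet> snd p)) \<in> borel_measurable borel"
      by (intro borel_measurable_continuous_onI continuous_intros)
    have fm: "case_prod f \<in> borel_measurable (lborel \<Otimes>\<^sub>M lborel)"
    proof -
      have "(\<lambda>p::(real^'n) \<times> (real^'n). h (fst p) * (of_real (gauss (e *\<^sub>R snd p)) * cis ((x - fst p) \<bullet> snd p))) \<in> borel_measurable (borel \<Otimes>\<^sub>M borel)"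
        by measurable (simp add: borel_prod)
      also have "(\<lambda>p::(real^'n) \<times> (real^'n). h (fst p) * (of_real (gauss (e *\<^sub>R snd p)) * cis ((x - fst p) \<bullet> snd p))) = case_prod f"
        by (auto simp: f_def fun_eq_iff)
      finally show ?thesis by (simp cong: measurable_cong_sets sets_pair_measure_cong)
    qed
    have f\<xi>: "integrable lborel (f y)" for y
    proof (unfold f_def, intro integrable_mult_right)
      show "integrable lborel (\<lambda>\<xi>. of_real (gauss (e *\<^sub>R \<xi>)) * cis ((x - y) \<bullet> \<xi>))"
        by (intro integrable_mult_cis gauss_fourier_scaled(1) e)
    qed
    have fint: "integrable (lborel \<Otimes>\<^sub>M lborel) (case_prod f)"
    proof (rule lborel_pair.Fubini_integrable[OF fm])
      have "(\<integral>\<xi>. norm (case_prod f (y, \<xi>)) \<partial>lborel) = norm (h y) * (\<integral>\<xi>. gauss (e *\<^sub>R \<xi>) \<partial>(lborel :: (real ^ 'n) measure))" for y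
        by (simp add: f_def norm_mult less_imp_le gauss_le)
      then show "integrable lborel (\<lambda>y. \<integral>\<xi>. norm (case_prod f (y, \<xi>)) \<partial>lborel)"
        using int by simp
    qed (use f\<xi> in simp)
    have "(\<integral>\<xi>. F \<xi> * cis (x \<bullet> \<xi>) * of_real (gauss (e *\<^sub>R \<xi>)) \<partial>lborel) = (\<integral>\<xi>. (\<integral>y. f y \<xi> \<partial>lborel) \<partial>lborel)"
    proof (rule Bochner_Integration.integral_cong[OF refl])
      fix \<xi>
      have "F \<xi> * cis (x \<bullet> \<xi>) * of_real (gauss (e *\<^sub>R \<xi>)) =
          (\<integral>y. h y * cis (- (y \<bullet> \<xi>)) * (cis (x \<bullet> \<xi>) * of_real (gauss (e *\<^sub>R \<xi>))) \<partial>lborel)"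
        unfolding F by (subst integral_mult_left_zero) (simp add: mult.assoc)
      also have "\<dots> = (\<integral>y. f y \<xi> \<partial>lborel)"
      proof (rule Bochner_Integration.integral_cong[OF refl])
        fix y
        have "cis ((x - y) \<bullet> \<xi>) = cis (- (y \<bullet> \<xi>)) * cis (x \<bullet> \<xi>)"
          by (simp add: cis_mult inner_diff_left)
        then show "h y * cis (- (y \<bullet> \<xi>)) * (cis (x \<bullet> \<xi>) * of_real (gauss (e *\<^sub>R \<xi>))) = f y \<xi>"
          by (simp add: f_def mult_ac)
      qed
      finally show "F \<xi> * cis (x \<bullet> \<xi>) * of_real (gauss (e *\<^sub>R \<xi>)) = (\<integral>y. f y \<xi> \<partial>lborel)" .
    qed
    also have "\<dots> = (\<integral>y. (\<integral>\<xi>. f y \<xi> \<partial>lborel) \<partial>lborel)"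
      by (rule lborel_pair.Fubini_integral[OF fint])
    also have "\<dots> = (\<integral>y. h y * of_real ((1 / e) ^ CARD('n) * (?K * gauss ((1 / e) *\<^sub>R (x - y)))) \<partial>lborel)"
      unfolding f_def integral_mult_right_zero gauss_fourier_scaled(2)[OF e] ..
    also have "\<dots> = of_real (e ^ CARD('n)) * (\<integral>u. h (x + e *\<^sub>R u) * of_real ((1 / e) ^ CARD('n) * (?K * gauss ((1 / e) *\<^sub>R (x - (x + e *\<^sub>R u))))) \<partial>lborel)"
    proof -
      have [measurable]: "(\<lambda>y. complex_of_real ((1 / e) ^ CARD('n) * (?K * gauss ((1 / e) *\<^sub>R (x - y))))) \<in> borel_measurable borel"
        by (intro borel_measurable_continuous_onI continuous_intros)
      have "(\<lambda>y. h y * of_real ((1 / e) ^ CARD('n) * (?K * gauss ((1 / e) *\<^sub>R (x - y))))) \<in> borel_measurable borel"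
        by measurable
      from lborel_integral_affine[OF this, of e x] e show ?thesis by simp
    qed
    also have "\<dots> = of_real (e ^ CARD('n)) * (\<integral>u. of_real ((1 / e) ^ CARD('n) * ?K) * (h (x + e *\<^sub>R u) * of_real (gauss u)) \<partial>lborel)"
      using e by (simp add: gauss_even mult_ac)
    also have "\<dots> = of_real (e ^ CARD('n)) * (of_real ((1 / e) ^ CARD('n) * ?K) * (\<integral>u. h (x + e *\<^sub>R u) * of_real (gauss u) \<partial>lborel))"
      by (simp only: integral_mult_right_zero)
    also have "\<dots> = of_real (e ^ CARD('n) * (1 / e) ^ CARD('n)) * (of_real ?K * (\<integral>u. h (x + e *\<^sub>R u) * of_real (gauss u) \<partial>lborel))"
      by (simp only: of_real_mult mult_ac)
    also have "e ^ CARD('n) * (1 / e) ^ CARD('n) = 1"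
      using e by (simp add: power_one_over)
    finally show ?thesis by simp
  qed
  define e where "e m = 1 / real (Suc m)" for m
  have e: "0 < e m" for m by (simp add: e_def)
  have e0: "e \<longlonglongrightarrow> 0" unfolding e_def using LIMSEQ_Suc[OF lim_const_over_n[of 1]] by simp
  have "(\<lambda>m. \<integral>\<xi>. F \<xi> * cis (x \<bullet> \<xi>) * of_real (gauss (e m *\<^sub>R \<xi>)) \<partial>lborel) \<longlonglongrightarrow> (\<integral>\<xi>. F \<xi> * cis (x \<bullet> \<xi>) \<partial>lborel)"
  proof (rule integral_dominated_convergence[where w="\<lambda>\<xi>. norm (F \<xi>)"])
    have [measurable]: "(\<lambda>\<xi>. cis (x \<bullet> \<xi>)) \<in> borel_measurable borel" "(\<lambda>\<xi>::real^'n. complex_of_real (gauss (e m *\<^sub>R \<xi>))) \<in> borel_measurable borel" for m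
      by (intro borel_measurable_continuous_onI continuous_intros)+
    show "(\<lambda>\<xi>. F \<xi> * cis (x \<bullet> \<xi>)) \<in> borel_measurable lborel"
      "(\<lambda>\<xi>. F \<xi> * cis (x \<bullet> \<xi>) * of_real (gauss (e m *\<^sub>R \<xi>))) \<in> borel_measurable lborel" for m
      by measurable
    have "(\<lambda>m. F \<xi> * cis (x \<bullet> \<xi>) * of_real (gauss (e m *\<^sub>R \<xi>))) \<longlonglongrightarrow> F \<xi> * cis (x \<bullet> \<xi>) * of_real (gauss (0 *\<^sub>R \<xi>))" for \<xi>
      unfolding gauss_def by (intro tendsto_intros e0) auto
    then show "AE \<xi> in lborel. (\<lambda>m. F \<xi> * cis (x \<bullet> \<xi>) * of_real (gauss (e m *\<^sub>R \<xi>))) \<longlonglongrightarrow> F \<xi> * cis (x \<bullet> \<xi>)"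
      by (simp add: gauss_def)
    show "AE \<xi> in lborel. norm (F \<xi> * cis (x \<bullet> \<xi>) * of_real (gauss (e m *\<^sub>R \<xi>))) \<le> norm (F \<xi>)" for m
      by (simp add: norm_mult mult_left_le gauss_le less_imp_le)
  qed (use intF in simp)
  moreover have "(\<lambda>m. of_real ?K * (\<integral>u. h (x + e m *\<^sub>R u) * of_real (gauss u) \<partial>lborel)) \<longlonglongrightarrow>
      of_real ?K * (\<integral>u. h x * of_real (gauss u) \<partial>(lborel :: (real ^ 'n) measure))"
  proof (intro tendsto_mult tendsto_const, rule integral_dominated_convergence[where w="\<lambda>u::real^'n. B * gauss u"])
    have [measurable]: "(\<lambda>u::real^'n. complex_of_real (gauss u)) \<in> borel_measurable borel"
      by (intro borel_measurable_continuous_onI continuous_intros)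
    show "(\<lambda>u::real^'n. h x * of_real (gauss u)) \<in> borel_measurable lborel"
      "(\<lambda>u. h (x + e m *\<^sub>R u) * of_real (gauss u)) \<in> borel_measurable lborel" for m
      by measurable
    have "integrable lborel (\<lambda>u::real^'n. norm (complex_of_real (gauss u)))"
      using integrable_gauss by (rule integrable_norm)
    then show "integrable lborel (\<lambda>u::real^'n. B * gauss u)"
      by (simp add: less_imp_le gauss_le)
    have "(\<lambda>m. x + e m *\<^sub>R u) \<longlonglongrightarrow> x + 0 *\<^sub>R u" for u by (intro tendsto_intros e0)
    then have "(\<lambda>m. h (x + e m *\<^sub>R u)) \<longlonglongrightarrow> h x" for u
      using continuous_on_tendsto_compose[OF cont] by fastforce
    then show "AE u::real^'n in lborel. (\<lambda>m. h (x + e m *\<^sub>R u) * of_real (gauss u)) \<longlonglongrightarrow> h x * of_real (gauss u)"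
      by (intro AE_I2 tendsto_intros)
    show "AE u in lborel. norm (h (x + e m *\<^sub>R u) * of_real (gauss u)) \<le> B * gauss u" for m
      using bdd by (simp add: norm_mult mult_right_mono gauss_le less_imp_le)
  qed
  ultimately have "(\<integral>\<xi>. F \<xi> * cis (x \<bullet> \<xi>) \<partial>lborel) = of_real ?K * (\<integral>u. h x * of_real (gauss u) \<partial>(lborel :: (real ^ 'n) measure))"
    unfolding key[OF e] by (rule LIMSEQ_unique)
  also have "(\<integral>u. h x * of_real (gauss u) \<partial>(lborel :: (real ^ 'n) measure)) = h x * of_real ?K"
    using gauss_fourier[of "0::real^'n"] by (simp add: gauss_def)
  also have "of_real ?K * (h x * of_real ?K) = of_real ((2 * pi) ^ CARD('n)) * h x"
  proof -
    have "?K * ?K = (sqrt (2 * pi) * sqrt (2 * pi)) ^ CARD('n)" by (rule power_mult_distrib[symmetric])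
    also have "\<dots> = (2 * pi) ^ CARD('n)" by (simp only: real_sqrt_mult_self abs_of_nonneg) simp
    finally have "?K * ?K = (2 * pi) ^ CARD('n)" .
    then have "of_real ((2 * pi) ^ CARD('n)) = complex_of_real ?K * complex_of_real ?K"
      by (simp only: of_real_mult[symmetric])
    then show ?thesis by simp
  qed
  finally have "h x = of_real (1 / (2 * pi) ^ CARD('n)) * (\<integral>\<xi>. F \<xi> * cis (x \<bullet> \<xi>) \<partial>lborel)"
    by simp
  also have "\<dots> = (\<integral>\<xi>. of_real (1 / (2 * pi) ^ CARD('n)) * F \<xi> * cis (x \<bullet> \<xi>) \<partial>lborel)"
    by (simp only: mult.assoc integral_mult_right_zero)
  finally show ?thesis .
qed

section \<open>Schwartz functions and distributions\<close>

lemma schwartz_smooth: "\<phi> \<in> schwartz \<Longrightarrow> smooth \<phi>"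
  by (simp add: schwartz_def)

lemma smooth_differentiable: "smooth \<phi> \<Longrightarrow> iter_partial is \<phi> differentiable (at x)"
  by (simp add: smooth_def)

lemma seminorm_less_iff_bounded:
  "schwartz_seminorm N is f < \<infinity> \<longleftrightarrow> (\<exists>C. \<forall>x. (1 + norm x) ^ N * cmod (iter_partial is f x) \<le> C)"
proof
  assume fin: "schwartz_seminorm N is f < \<infinity>"
  have "(1 + norm x) ^ N * cmod (iter_partial is f x) \<le> enn2real (schwartz_seminorm N is f)" for x
  proof -
    have "ennreal ((1 + norm x) ^ N * cmod (iter_partial is f x)) \<le> schwartz_seminorm N is f"
      unfolding schwartz_seminorm_def by (rule SUP_upper) simp
    then have "enn2real (ennreal ((1 + norm x) ^ N * cmod (iter_partial is f x))) \<le> enn2real (schwartz_seminorm N is f)"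
      using fin by (intro enn2real_mono) auto
    then show ?thesis by simp
  qed
  then show "\<exists>C. \<forall>x. (1 + norm x) ^ N * cmod (iter_partial is f x) \<le> C" by blast
next
  assume "\<exists>C. \<forall>x. (1 + norm x) ^ N * cmod (iter_partial is f x) \<le> C"
  then obtain C where C: "\<And>x. (1 + norm x) ^ N * cmod (iter_partial is f x) \<le> C" by blast
  have "schwartz_seminorm N is f \<le> ennreal C"
    unfolding schwartz_seminorm_def by (intro SUP_least ennreal_leI C)
  then show "schwartz_seminorm N is f < \<infinity>"
    by (rule order.strict_trans1) simp
qed

lemma schwartz_iff: "f \<in> schwartz \<longleftrightarrow> smooth f \<and> (\<forall>N is. \<exists>C. \<forall>x. (1 + norm x) ^ N * cmod (iter_partial is f x) \<le> C)"
  unfolding schwartz_def mem_Collect_eq seminorm_less_iff_bounded ..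

lemma schwartz_bound:
  assumes "f \<in> schwartz"
  obtains C where "0 \<le> C" "\<And>x. cmod (iter_partial is f x) \<le> C / (1 + norm x) ^ N"
proof -
  obtain C where C: "\<And>x. (1 + norm x) ^ N * cmod (iter_partial is f x) \<le> C"
    using assms unfolding schwartz_iff by blast
  have pos: "0 < 1 + norm x" for x :: "real ^ 'a" by (simp add: add_pos_nonneg)
  show ?thesis
  proof (rule that)
    show "0 \<le> C" using C[of 0] by (rule order_trans[rotated]) simp
    show "cmod (iter_partial is f x) \<le> C / (1 + norm x) ^ N" for x
      using C[of x] pos[of x] by (simp add: pos_le_divide_eq mult.commute)
  qed
qed

lemma schwartz_continuous: "f \<in> schwartz \<Longrightarrow> continuous_on A f"
  using smooth_differentiable[OF schwartz_smooth, of f "[]"]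
  by (auto intro!: continuous_at_imp_continuous_on differentiable_imp_continuous_within)

section \<open>Weights, integrability and moments\<close>

lemma one_plus_norm_le_prod: "1 + norm u \<le> (\<Prod>i\<in>UNIV. (1 + \<bar>u $ i\<bar>))" for u :: "real ^ 'n"
proof -
  have "1 + (\<Sum>i\<in>A. \<bar>u $ i\<bar>) \<le> (\<Prod>i\<in>A. (1 + \<bar>u $ i\<bar>))" if "finite A" for A
    using that
  proof (induction A rule: finite_induct)
    case (insert a A)
    have "1 + (\<Sum>i\<in>insert a A. \<bar>u $ i\<bar>) \<le> (1 + \<bar>u $ a\<bar>) * (1 + (\<Sum>i\<in>A. \<bar>u $ i\<bar>))"
      using insert(1,2) mult_nonneg_nonneg[of "\<bar>u $ a\<bar>" "\<Sum>i\<in>A. \<bar>u $ i\<bar>"]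
      by (simp add: algebra_simps sum_nonneg)
    also have "\<dots> \<le> (1 + \<bar>u $ a\<bar>) * (\<Prod>i\<in>A. (1 + \<bar>u $ i\<bar>))"
      by (intro mult_left_mono insert.IH) simp
    finally show ?case using insert(1,2) by simp
  qed simp
  then show ?thesis using norm_le_l1_cart[of u] by (meson add_left_mono finite order_trans)
qed

text \<open>Together with \<open>one_plus_norm_le_prod\<close> this trades radial weights for
  product weights at the cost of \<open>CARD('n)\<close> powers; product weights factor in sums and
  integrals.\<close>

lemma prod_one_plus_le: "(\<Prod>i\<in>UNIV. (1 + \<bar>u $ i\<bar>)) \<le> (1 + norm u) ^ CARD('n)" for u :: "real ^ 'n"
proof -
  have "(\<Prod>i\<in>UNIV. (1 + \<bar>u $ i\<bar>)) \<le> (\<Prod>i\<in>(UNIV :: 'n set). (1 + norm u))"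
    by (intro prod_mono) (auto simp: component_le_norm_cart)
  then show ?thesis by simp
qed

lemma integrable_inverse_square_real: "integrable lborel (\<lambda>t::real. complex_of_real (1 / (1 + \<bar>t\<bar>)\<^sup>2))"
proof -
  have "integrable lborel (\<lambda>t::real. inverse (1 + t\<^sup>2))"
    using integrable_inverse_1_plus_square by (simp add: set_integrable_def)
  then have "integrable lborel (\<lambda>t::real. 1 / (1 + \<bar>t\<bar>)\<^sup>2)"
  proof (rule Bochner_Integration.integrable_bound)
    show "AE t::real in lborel. norm (1 / (1 + \<bar>t\<bar>)\<^sup>2) \<le> norm (inverse (1 + t\<^sup>2))"
    proof (rule AE_I2)
      fix t :: real
      have "1 + t\<^sup>2 \<le> (1 + \<bar>t\<bar>)\<^sup>2" by (simp add: power2_sum)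
      moreover have "0 < 1 + t\<^sup>2" by (simp add: add_pos_nonneg)
      ultimately show "norm (1 / (1 + \<bar>t\<bar>)\<^sup>2) \<le> norm (inverse (1 + t\<^sup>2))"
        by (simp add: inverse_eq_divide frac_le)
    qed
  qed measurable
  then show ?thesis by (rule integrable_of_real)
qed

lemma schwartz_moment_integrable:
  fixes f :: "real ^ 'n \<Rightarrow> complex"
  assumes f: "f \<in> schwartz"
  shows "integrable lborel (\<lambda>x. (\<Prod>i\<in>UNIV. (x $ i) ^ \<gamma> i) *\<^sub>R f x)"
proof -
  define s where "s = sum \<gamma> UNIV"
  \<comment> \<open>\<open>s\<close> powers of the decay absorb the monomial, and the other
    \<open>2 * CARD('n)\<close> leave an inverse square in every coordinate.\<close>
  obtain C where C: "0 \<le> C" "\<And>x. cmod (f x) \<le> C / (1 + norm x) ^ (s + 2 * CARD('n))"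
    using schwartz_bound[OF f, of "[]" "s + 2 * CARD('n)"] by auto
  have [measurable]: "f \<in> borel_measurable borel"
    using schwartz_continuous[OF f] by (rule borel_measurable_continuous_onI)
  have "integrable lborel (\<lambda>x::real^'n. of_real C * (\<Prod>i\<in>UNIV. complex_of_real (1 / (1 + \<bar>x $ i\<bar>)\<^sup>2)))"
    by (intro integrable_mult_right lborel_prod_vec integrable_inverse_square_real)
  then show ?thesis
  proof (rule Bochner_Integration.integrable_bound)
    show "(\<lambda>x. (\<Prod>i\<in>UNIV. (x $ i) ^ \<gamma> i) *\<^sub>R f x) \<in> borel_measurable lborel" by measurable
    show "AE x in lborel. norm ((\<Prod>i\<in>UNIV. (x $ i) ^ \<gamma> i) *\<^sub>R f x) \<le>
        norm (of_real C * (\<Prod>i\<in>UNIV. complex_of_real (1 / (1 + \<bar>x $ i\<bar>)\<^sup>2)))"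
    proof (rule AE_I2)
      fix x :: "real ^ 'n"
      let ?N = "1 + norm x" and ?p = "\<Prod>i\<in>UNIV. (1 + \<bar>x $ i\<bar>)"
      have N: "0 < ?N" by (simp add: add_pos_nonneg)
      have p: "0 < ?p" by (intro prod_pos) (simp add: add_pos_nonneg)
      have "\<bar>\<Prod>i\<in>UNIV. (x $ i) ^ \<gamma> i\<bar> \<le> (\<Prod>i\<in>UNIV. ?N ^ \<gamma> i)"
        unfolding abs_prod power_abs
        by (intro prod_mono conjI power_mono) (auto intro: order_trans[OF component_le_norm_cart])
      also have "\<dots> = ?N ^ s" by (simp add: s_def power_sum)
      finally have "norm ((\<Prod>i\<in>UNIV. (x $ i) ^ \<gamma> i) *\<^sub>R f x) \<le> ?N ^ s * (C / ?N ^ (s + 2 * CARD('n)))"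
        using C N by (simp only: norm_scaleR real_norm_def) (intro mult_mono, auto)
      also have "\<dots> = C / (?N ^ CARD('n))\<^sup>2"
        using N by (simp add: power_add power_mult[symmetric] mult.commute[of 2])
      also have "\<dots> \<le> C / ?p\<^sup>2"
        using C(1) p N prod_one_plus_le[of x]
        by (intro divide_left_mono power_mono mult_pos_pos zero_less_power) auto
      also have "\<dots> = C * (\<Prod>i\<in>UNIV. 1 / (1 + \<bar>x $ i\<bar>)\<^sup>2)"
        by (simp add: prod_dividef prod_power_distrib)
      also have "\<dots> = norm (of_real C * (\<Prod>i\<in>UNIV. complex_of_real (1 / (1 + \<bar>x $ i\<bar>)\<^sup>2)))"
        using C(1) by (simp only: norm_mult norm_of_real prod_norm[symmetric]) (simp add: prod_nonneg)
      finally show "norm ((\<Prod>i\<in>UNIV. (x $ i) ^ \<gamma> i) *\<^sub>R f x) \<le>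
        norm (of_real C * (\<Prod>i\<in>UNIV. complex_of_real (1 / (1 + \<bar>x $ i\<bar>)\<^sup>2)))" .
    qed
  qed
qed

lemma schwartz_integrable: "f \<in> schwartz \<Longrightarrow> integrable lborel f"
  using schwartz_moment_integrable[of f "\<lambda>_. 0"] by simp

section \<open>Affine substitutions and linear combinations\<close>

lemma smooth_has_derivative:
  "smooth \<phi> \<Longrightarrow> (iter_partial is \<phi> has_derivative frechet_derivative (iter_partial is \<phi>) (at x)) (at x)"
  using smooth_differentiable frechet_derivative_works by blast

lemma iter_partial_affine:
  fixes \<phi> :: "real ^ 'n \<Rightarrow> complex"
  assumes \<phi>: "smooth \<phi>"
  shows "iter_partial is (\<lambda>y. c * \<phi> (a + b *\<^sub>R y)) =
    (\<lambda>y. c * of_real (b ^ length is) * iter_partial is \<phi> (a + b *\<^sub>R y))"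
proof (induction "is")
  case (Cons i "is")
  show ?case
  proof
    fix y
    let ?D = "frechet_derivative (iter_partial is \<phi>) (at (a + b *\<^sub>R y))"
    have D: "(iter_partial is \<phi> has_derivative ?D) (at (a + b *\<^sub>R y))" by (rule smooth_has_derivative[OF \<phi>])
    have "((\<lambda>y. a + b *\<^sub>R y) has_derivative (\<lambda>h. b *\<^sub>R h)) (at y)"
      by (auto intro!: derivative_eq_intros)
    from has_derivative_compose[OF this D]
    have "((\<lambda>y. c * of_real (b ^ length is) * iter_partial is \<phi> (a + b *\<^sub>R y)) has_derivative
        (\<lambda>h. c * of_real (b ^ length is) * ?D (b *\<^sub>R h))) (at y)"
      by (rule has_derivative_mult_right)
    then have "frechet_derivative (iter_partial is (\<lambda>y. c * \<phi> (a + b *\<^sub>R y))) (at y) =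
        (\<lambda>h. c * of_real (b ^ length is) * ?D (b *\<^sub>R h))"
      unfolding Cons.IH by (rule frechet_derivative_at[symmetric])
    moreover have "?D (b *\<^sub>R axis i 1) = b *\<^sub>R ?D (axis i 1)"
      using D by (intro linear_scale) (rule has_derivative_linear)
    ultimately show "iter_partial (i # is) (\<lambda>y. c * \<phi> (a + b *\<^sub>R y)) y =
        c * of_real (b ^ length (i # is)) * iter_partial (i # is) \<phi> (a + b *\<^sub>R y)"
      by (simp add: scaleR_conv_of_real mult_ac)
  qed
qed simp

lemma smooth_affine:
  fixes \<phi> :: "real ^ 'n \<Rightarrow> complex"
  assumes \<phi>: "smooth \<phi>"
  shows "smooth (\<lambda>y. c * \<phi> (a + b *\<^sub>R y))"
  unfolding smooth_def iter_partial_affine[OF \<phi>]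
proof (intro allI)
  fix "is" :: "'n list" and y
  have "((\<lambda>y. a + b *\<^sub>R y) has_derivative (\<lambda>h. b *\<^sub>R h)) (at y)"
    by (auto intro!: derivative_eq_intros)
  from has_derivative_compose[OF this smooth_has_derivative[OF \<phi>, of "is"]]
  show "(\<lambda>y. c * of_real (b ^ length is) * iter_partial is \<phi> (a + b *\<^sub>R y)) differentiable (at y)"
    by (intro differentiable_mult differentiable_const) (auto simp: differentiable_def)
qed

lemma one_plus_norm_affine_le:
  fixes a y :: "real ^ 'n"
  assumes "b \<noteq> 0"
  shows "1 + norm y \<le> (1 + (norm a + 1) / \<bar>b\<bar>) * (1 + norm (a + b *\<^sub>R y))"
proof -
  have "\<bar>b\<bar> * norm y = norm ((a + b *\<^sub>R y) - a)" by simp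
  also have "\<dots> \<le> norm (a + b *\<^sub>R y) + norm a" by (rule norm_triangle_ineq4)
  finally have "norm y \<le> (norm (a + b *\<^sub>R y) + norm a) / \<bar>b\<bar>"
    using assms by (simp add: pos_le_divide_eq mult.commute)
  also have "\<dots> \<le> (norm a + 1) / \<bar>b\<bar> * (1 + norm (a + b *\<^sub>R y))"
    by (simp add: divide_right_mono algebra_simps add_divide_distrib)
  finally show ?thesis
    using norm_ge_zero[of "a + b *\<^sub>R y"] by (simp only: distrib_right mult_1_left)
qed

lemma schwartz_affine:
  fixes \<phi> :: "real ^ 'n \<Rightarrow> complex"
  assumes \<phi>: "\<phi> \<in> schwartz" and b: "b \<noteq> 0"
  shows "(\<lambda>y. c * \<phi> (a + b *\<^sub>R y)) \<in> schwartz"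
  unfolding schwartz_iff
proof (intro conjI allI)
  note sm = schwartz_smooth[OF \<phi>]
  show "smooth (\<lambda>y. c * \<phi> (a + b *\<^sub>R y))" by (rule smooth_affine[OF sm])
  fix N and "is" :: "'n list"
  obtain C where C: "\<And>x. (1 + norm x) ^ N * cmod (iter_partial is \<phi> x) \<le> C"
    using \<phi> unfolding schwartz_iff by blast
  let ?K = "1 + (norm a + 1) / \<bar>b\<bar>" and ?c = "cmod (c * of_real (b ^ length is))"
  have K: "0 \<le> ?K" by simp
  have "(1 + norm y) ^ N * cmod (iter_partial is (\<lambda>y. c * \<phi> (a + b *\<^sub>R y)) y) \<le> ?K ^ N * ?c * C" for y
  proof -
    have "(1 + norm y) ^ N * cmod (iter_partial is (\<lambda>y. c * \<phi> (a + b *\<^sub>R y)) y) \<le>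
        (?K * (1 + norm (a + b *\<^sub>R y))) ^ N * (?c * cmod (iter_partial is \<phi> (a + b *\<^sub>R y)))"
      unfolding iter_partial_affine[OF sm] norm_mult[of "c * _"]
      by (intro mult_right_mono power_mono one_plus_norm_affine_le b) auto
    also have "\<dots> = ?K ^ N * ?c * ((1 + norm (a + b *\<^sub>R y)) ^ N * cmod (iter_partial is \<phi> (a + b *\<^sub>R y)))"
      by (simp only: power_mult_distrib mult_ac)
    also have "\<dots> \<le> ?K ^ N * ?c * C"
      using K by (intro mult_left_mono C mult_nonneg_nonneg zero_le_power) auto
    finally show ?thesis .
  qed
  then show "\<exists>C. \<forall>x. (1 + norm x) ^ N * cmod (iter_partial is (\<lambda>y. c * \<phi> (a + b *\<^sub>R y)) x) \<le> C" by blast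
qed

lemma iter_partial_scale: "smooth f \<Longrightarrow> iter_partial is (\<lambda>y. c * f y) = (\<lambda>y. c * iter_partial is f y)"
  using iter_partial_affine[of f "is" c 0 1] by simp

lemma schwartz_scale: "f \<in> schwartz \<Longrightarrow> (\<lambda>y. c * f y) \<in> schwartz"
  using schwartz_affine[of f 1 c 0] by simp

lemma iter_partial_add:
  assumes f: "smooth f" and g: "smooth g"
  shows "iter_partial is (\<lambda>x. f x + g x) = (\<lambda>x. iter_partial is f x + iter_partial is g x)"
proof (induction "is")
  case (Cons i "is")
  show ?case
  proof
    fix x
    have "((\<lambda>x. iter_partial is f x + iter_partial is g x) has_derivative
      (\<lambda>h. frechet_derivative (iter_partial is f) (at x) h + frechet_derivative (iter_partial is g) (at x) h)) (at x)"
      by (intro has_derivative_add smooth_has_derivative f g)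
    from frechet_derivative_at[OF this] show "iter_partial (i # is) (\<lambda>x. f x + g x) x = iter_partial (i # is) f x + iter_partial (i # is) g x"
      by (simp add: Cons.IH fun_eq_iff)
  qed
qed simp

lemma schwartz_add:
  fixes f g :: "real ^ 'n \<Rightarrow> complex"
  assumes f: "f \<in> schwartz" and g: "g \<in> schwartz"
  shows "(\<lambda>x. f x + g x) \<in> schwartz"
proof -
  note sm = schwartz_smooth[OF f] schwartz_smooth[OF g]
  note eq = iter_partial_add[OF sm]
  show ?thesis
    unfolding schwartz_iff smooth_def eq
  proof (intro conjI allI differentiable_add smooth_differentiable sm)
    fix N and "is" :: "'n list"
    obtain C1 where C1: "\<And>x. (1 + norm x) ^ N * cmod (iter_partial is f x) \<le> C1"
      using f unfolding schwartz_iff by blast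
    obtain C2 where C2: "\<And>x. (1 + norm x) ^ N * cmod (iter_partial is g x) \<le> C2"
      using g unfolding schwartz_iff by blast
    have "(1 + norm x) ^ N * cmod (iter_partial is f x + iter_partial is g x) \<le> C1 + C2" for x
    proof -
      have "(1 + norm x) ^ N * cmod (iter_partial is f x + iter_partial is g x) \<le>
          (1 + norm x) ^ N * (cmod (iter_partial is f x) + cmod (iter_partial is g x))"
        by (intro mult_left_mono norm_triangle_ineq) simp
      also have "\<dots> \<le> C1 + C2" unfolding distrib_left by (intro add_mono C1 C2)
      finally show ?thesis .
    qed
    then show "\<exists>C. \<forall>x. (1 + norm x) ^ N * cmod (iter_partial is f x + iter_partial is g x) \<le> C" by blast
  qed
qed

lemma schwartz_moment_lebesgue:
  assumes f: "f \<in> schwartz"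
  shows "(LINT x|lebesgue. (\<Prod>i\<in>UNIV. (x $ i) ^ \<gamma> i) *\<^sub>R f x) = (LINT x|lborel. (\<Prod>i\<in>UNIV. (x $ i) ^ \<gamma> i) *\<^sub>R f x)"
  using schwartz_moment_integrable[OF f, of \<gamma>] by (intro integral_completion) auto

lemma schwartz_inf_add:
  assumes "f \<in> schwartz_inf" "g \<in> schwartz_inf"
  shows "(\<lambda>x. f x + g x) \<in> schwartz_inf"
proof -
  have s: "f \<in> schwartz" "g \<in> schwartz" using assms by (auto simp: schwartz_inf_def)
  have "(LINT x|lebesgue. (\<Prod>i\<in>UNIV. (x $ i) ^ \<gamma> i) *\<^sub>R (f x + g x)) = 0" for \<gamma>
    unfolding schwartz_moment_lebesgue[OF schwartz_add[OF s]]
    using assms s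
    by (simp add: schwartz_inf_def schwartz_moment_lebesgue scaleR_add_right
        Bochner_Integration.integral_add schwartz_moment_integrable)
  then show ?thesis using s by (simp add: schwartz_inf_def schwartz_add)
qed

lemma schwartz_inf_scale:
  assumes "f \<in> schwartz_inf"
  shows "(\<lambda>x. c * f x) \<in> schwartz_inf"
proof -
  have s: "f \<in> schwartz" using assms by (auto simp: schwartz_inf_def)
  show ?thesis
    using assms s
    by (simp add: schwartz_inf_def schwartz_scale schwartz_moment_lebesgue mult_scaleR_right[symmetric]
        del: mult_scaleR_right)
qed

text \<open>Difference quotients along the steps \<open>1 / (m + 1)\<close> identify a derivative
  that is known to exist, and dominated convergence can be applied to such a sequence.\<close>

lemma derivative_sequence:
  fixes f :: "'a::real_normed_vector \<Rightarrow> 'b::real_normed_vector"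
  assumes D: "(f has_derivative D) (at x)" and v: "v \<noteq> 0"
  shows "(\<lambda>m. real (Suc m) *\<^sub>R (f (x + (1 / real (Suc m)) *\<^sub>R v) - f x)) \<longlonglongrightarrow> D v"
proof -
  define y where "y m = x + (1 / real (Suc m)) *\<^sub>R v" for m
  have e0: "(\<lambda>m. 1 / real (Suc m)) \<longlonglongrightarrow> 0" using LIMSEQ_Suc[OF lim_const_over_n[of 1]] by simp
  have "y \<longlonglongrightarrow> x + 0 *\<^sub>R v" unfolding y_def by (intro tendsto_intros e0)
  then have y: "filterlim y (at x) sequentially"
    using v by (auto simp: filterlim_at y_def)
  have lin: "D (r *\<^sub>R u) = r *\<^sub>R D u" for r u
    using has_derivative_linear[OF D] by (rule linear_scale)
  have "((\<lambda>y. norm (f y - f x - D (y - x)) / norm (y - x)) \<longlongrightarrow> 0) (at x)"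
    using D by (simp add: has_derivative_iff_norm)
  then have "(\<lambda>m. norm v * (norm (f (y m) - f x - D (y m - x)) / norm (y m - x))) \<longlonglongrightarrow> 0"
    by (intro tendsto_mult_right_zero filterlim_compose[OF _ y])
  also have "(\<lambda>m. norm v * (norm (f (y m) - f x - D (y m - x)) / norm (y m - x))) =
      (\<lambda>m. norm (real (Suc m) *\<^sub>R (f (y m) - f x) - D v))"
  proof
    fix m
    have "real (Suc m) *\<^sub>R (f (y m) - f x) - D v = real (Suc m) *\<^sub>R (f (y m) - f x - D (y m - x))"
      by (simp add: y_def lin scaleR_diff_right del: of_nat_Suc)
    then show "norm v * (norm (f (y m) - f x - D (y m - x)) / norm (y m - x)) =
      norm (real (Suc m) *\<^sub>R (f (y m) - f x) - D v)"
      using v by (simp add: y_def del: of_nat_Suc)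
  qed
  finally show ?thesis
    unfolding y_def by (rule LIM_zero_cancel[OF tendsto_norm_zero_cancel])
qed

lemma cis_difference_sequence: "(\<lambda>m. of_real (real (Suc m)) * (cis (t / real (Suc m)) - 1)) \<longlonglongrightarrow> \<i> * of_real t"
proof -
  have "((\<lambda>s. exp (\<i> * of_real t * of_real s)) has_vector_derivative (\<i> * of_real t * exp (\<i> * of_real t * of_real 0))) (at (0::real))"
    by (rule has_vector_derivative_real_field) (auto intro!: derivative_eq_intros)
  then have "((\<lambda>s. cis (t * s)) has_derivative (\<lambda>s. s *\<^sub>R (\<i> * of_real t))) (at 0)"
    by (simp add: has_vector_derivative_def cis_conv_exp mult.assoc)
  from derivative_sequence[OF this, of 1] show ?thesis by (simp add: scaleR_conv_of_real)
qed

text \<open>Differentiation under the integral: since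
  \<open>norm (cis t - 1) \<le> \<bar>t\<bar>\<close>, the quotients are dominated by the first
  moment. It serves in both directions, for moments of a Schwartz function and for derivatives of a
  band-limited one.\<close>

lemma fourier_difference_sequence:
  fixes H :: "real ^ 'n \<Rightarrow> complex"
  assumes H: "integrable lborel H" and H1: "integrable lborel (\<lambda>x. (x $ i) *\<^sub>R H x)"
  defines "E \<equiv> \<lambda>\<xi>. \<integral>x. H x * cis (\<xi> \<bullet> x) \<partial>lborel"
  shows "(\<lambda>m. real (Suc m) *\<^sub>R (E (\<xi> + (1 / real (Suc m)) *\<^sub>R axis i 1) - E \<xi>)) \<longlonglongrightarrow>
    (\<integral>x. (\<i> * of_real (x $ i)) * H x * cis (\<xi> \<bullet> x) \<partial>lborel)"
proof -
  have [measurable]: "H \<in> borel_measurable borel" using H by auto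
  have [measurable]: "(\<lambda>x. cis (\<zeta> \<bullet> x)) \<in> borel_measurable borel" for \<zeta> :: "real ^ 'n"
    by (intro borel_measurable_continuous_onI continuous_intros)
  define G where "G m x = H x * cis (\<xi> \<bullet> x) * (of_real (real (Suc m)) * (cis (x $ i / real (Suc m)) - 1))" for m x
  have [measurable]: "(\<lambda>x::real^'n. of_real (real (Suc m)) * (cis (x $ i / real (Suc m)) - 1)) \<in> borel_measurable borel" for m
    by (intro borel_measurable_continuous_onI continuous_intros) auto
  have "real (Suc m) *\<^sub>R (E (\<xi> + (1 / real (Suc m)) *\<^sub>R axis i 1) - E \<xi>) = (\<integral>x. G m x \<partial>lborel)" for m
  proof -
    have "E (\<xi> + (1 / real (Suc m)) *\<^sub>R axis i 1) - E \<xi> =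
        (\<integral>x. H x * cis ((\<xi> + (1 / real (Suc m)) *\<^sub>R axis i 1) \<bullet> x) - H x * cis (\<xi> \<bullet> x) \<partial>lborel)"
      unfolding E_def by (intro Bochner_Integration.integral_diff[symmetric] integrable_mult_cis H)
    then have "real (Suc m) *\<^sub>R (E (\<xi> + (1 / real (Suc m)) *\<^sub>R axis i 1) - E \<xi>) =
        (\<integral>x. real (Suc m) *\<^sub>R (H x * cis ((\<xi> + (1 / real (Suc m)) *\<^sub>R axis i 1) \<bullet> x) - H x * cis (\<xi> \<bullet> x)) \<partial>lborel)"
      by (simp only: integral_scaleR_right)
    also have "\<dots> = (\<integral>x. G m x \<partial>lborel)"
    proof (rule Bochner_Integration.integral_cong[OF refl])
      fix x :: "real ^ 'n"
      have "cis ((\<xi> + (1 / real (Suc m)) *\<^sub>R axis i 1) \<bullet> x) = cis (\<xi> \<bullet> x) * cis (x $ i / real (Suc m))"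
        by (simp add: cis_mult inner_add_left inner_axis')
      then show "real (Suc m) *\<^sub>R (H x * cis ((\<xi> + (1 / real (Suc m)) *\<^sub>R axis i 1) \<bullet> x) - H x * cis (\<xi> \<bullet> x)) = G m x"
        unfolding G_def scaleR_conv_of_real by (simp only: right_diff_distrib mult_1_right mult_1_left mult_ac)
    qed
    finally show ?thesis .
  qed
  moreover have "(\<lambda>m. \<integral>x. G m x \<partial>lborel) \<longlonglongrightarrow> (\<integral>x. (\<i> * of_real (x $ i)) * H x * cis (\<xi> \<bullet> x) \<partial>lborel)"
  proof (rule integral_dominated_convergence[where w="\<lambda>x. norm ((x $ i) *\<^sub>R H x)"])
    show "(\<lambda>x. (\<i> * of_real (x $ i)) * H x * cis (\<xi> \<bullet> x)) \<in> borel_measurable lborel" by measurable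
    show "G m \<in> borel_measurable lborel" for m unfolding G_def by measurable
    show "integrable lborel (\<lambda>x. norm ((x $ i) *\<^sub>R H x))" using H1 by (rule integrable_norm)
    have "(\<lambda>m. G m x) \<longlonglongrightarrow> H x * cis (\<xi> \<bullet> x) * (\<i> * of_real (x $ i))" for x
      unfolding G_def by (intro tendsto_intros cis_difference_sequence)
    then show "AE x in lborel. (\<lambda>m. G m x) \<longlonglongrightarrow> (\<i> * of_real (x $ i)) * H x * cis (\<xi> \<bullet> x)"
      by (simp add: mult_ac)
    show "AE x in lborel. norm (G m x) \<le> norm ((x $ i) *\<^sub>R H x)" for m
    proof (rule AE_I2)
      fix x :: "real ^ 'n"
      have "real (Suc m) * norm (cis (x $ i / real (Suc m)) - 1) \<le> real (Suc m) * \<bar>x $ i / real (Suc m)\<bar>"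
        by (intro mult_left_mono norm_cis_minus_1_le) simp
      also have "\<dots> = \<bar>x $ i\<bar>" by (simp add: abs_divide)
      finally have "norm (H x) * (real (Suc m) * norm (cis (x $ i / real (Suc m)) - 1)) \<le> norm (H x) * \<bar>x $ i\<bar>"
        by (intro mult_left_mono) auto
      then show "norm (G m x) \<le> norm ((x $ i) *\<^sub>R H x)"
        by (simp only: G_def norm_mult norm_cis norm_of_real norm_scaleR real_norm_def mult_1_right mult.commute abs_of_nat)
    qed
  qed
  ultimately show ?thesis by simp
qed

section \<open>Vanishing moments and band limitation\<close>

lemma schwartz_fourier:
  assumes f: "f \<in> schwartz"
  shows "fourier f \<xi> = (\<integral>y. f y * cis (- (y \<bullet> \<xi>)) \<partial>lborel)"
proof -
  have [measurable]: "f \<in> borel_measurable borel"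
    using schwartz_continuous[OF f] by (rule borel_measurable_continuous_onI)
  have [measurable]: "(\<lambda>y. cis (- (y \<bullet> \<xi>))) \<in> borel_measurable borel"
    by (intro borel_measurable_continuous_onI continuous_intros)
  have "fourier f \<xi> = (LINT y|lebesgue. f y * cis (- (y \<bullet> \<xi>)))"
    by (simp add: fourier_def cis_conv_exp)
  also have "\<dots> = (\<integral>y. f y * cis (- (y \<bullet> \<xi>)) \<partial>lborel)"
    by (rule integral_completion) measurable
  finally show ?thesis .
qed

lemma prod_power_fun_upd:
  fixes x :: "'n::finite \<Rightarrow> 'b::comm_monoid_mult"
  shows "(\<Prod>i\<in>UNIV. x i ^ (\<gamma>(a := Suc (\<gamma> a))) i) = x a * (\<Prod>i\<in>UNIV. x i ^ \<gamma> i)"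
proof -
  have "(\<Prod>i\<in>UNIV - {a}. x i ^ (\<gamma>(a := Suc (\<gamma> a))) i) = (\<Prod>i\<in>UNIV - {a}. x i ^ \<gamma> i)"
    by (intro prod.cong) auto
  then show ?thesis
    using prod.remove[of UNIV a "\<lambda>i. x i ^ (\<gamma>(a := Suc (\<gamma> a))) i"] prod.remove[of UNIV a "\<lambda>i. x i ^ \<gamma> i"]
    by (simp add: mult.assoc)
qed

text \<open>Moments are derivatives of the Fourier transform at the origin.\<close>

lemma schwartz_inf_if_fourier_zero:
  fixes h :: "real ^ 'n \<Rightarrow> complex"
  assumes h: "h \<in> schwartz" and r: "0 < r" and zero: "\<And>\<xi>. norm \<xi> < r \<Longrightarrow> fourier h \<xi> = 0"
  shows "h \<in> schwartz_inf"
proof -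
  define H where "H \<gamma> x = (\<Prod>i\<in>UNIV. (x $ i) ^ \<gamma> i) *\<^sub>R h x" for \<gamma> :: "'n \<Rightarrow> nat" and x
  have int: "integrable lborel (H \<gamma>)" for \<gamma>
    unfolding H_def by (rule schwartz_moment_integrable[OF h])
  \<comment> \<open>The claim is about a whole ball and not only the origin, because the induction
    on the degree differentiates.\<close>
  have E0: "(\<integral>x. H \<gamma> x * cis (\<xi> \<bullet> x) \<partial>lborel) = 0" if "norm \<xi> < r" for \<gamma> \<xi>
    using that
  proof (induction "sum \<gamma> UNIV" arbitrary: \<gamma> \<xi>)
    case 0
    have "\<gamma> i = 0" for i using 0(1) by simp
    then have "H \<gamma> = h" by (simp add: H_def fun_eq_iff)
    then show ?case
      using zero[of "- \<xi>"] 0(2) by (simp only: schwartz_fourier[OF h]) (simp add: inner_commute)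
  next
    case (Suc s)
    then obtain a where a: "\<gamma> a \<noteq> 0" by (metis Zero_not_Suc sum.neutral)
    define \<gamma>' where "\<gamma>' = \<gamma>(a := \<gamma> a - 1)"
    have \<gamma>: "\<gamma> = \<gamma>'(a := Suc (\<gamma>' a))" using a by (simp add: \<gamma>'_def fun_eq_iff)
    have "sum \<gamma> UNIV = Suc (sum \<gamma>' UNIV)"
    proof -
      have "sum \<gamma> (UNIV - {a}) = sum \<gamma>' (UNIV - {a})" by (intro sum.cong) (auto simp: \<gamma>'_def)
      then show ?thesis
        using sum.remove[of UNIV a \<gamma>] sum.remove[of UNIV a \<gamma>'] a by (simp add: \<gamma>'_def)
    qed
    then have s: "s = sum \<gamma>' UNIV" using Suc.hyps(2) by simp
    have HS: "H \<gamma> = (\<lambda>x. (x $ a) *\<^sub>R H \<gamma>' x)"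
      unfolding H_def \<gamma> prod_power_fun_upd by simp
    define E where "E \<zeta> = (\<integral>x. H \<gamma>' x * cis (\<zeta> \<bullet> x) \<partial>lborel)" for \<zeta>
    have "(\<lambda>m. real (Suc m) *\<^sub>R (E (\<xi> + (1 / real (Suc m)) *\<^sub>R axis a 1) - E \<xi>)) \<longlonglongrightarrow>
        (\<integral>x. (\<i> * of_real (x $ a)) * H \<gamma>' x * cis (\<xi> \<bullet> x) \<partial>lborel)"
      unfolding E_def by (rule fourier_difference_sequence) (use int[of \<gamma>'] int[of \<gamma>] in \<open>simp_all add: HS\<close>)
    \<comment> \<open>The difference quotients are exactly 0 once the step stays inside the open
      ball.\<close>
    moreover have "(\<lambda>m. real (Suc m) *\<^sub>R (E (\<xi> + (1 / real (Suc m)) *\<^sub>R axis a 1) - E \<xi>)) \<longlonglongrightarrow> 0"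
    proof (rule tendsto_eventually)
      have "(\<lambda>m. norm (\<xi> + (1 / real (Suc m)) *\<^sub>R axis a 1)) \<longlonglongrightarrow> norm (\<xi> + 0 *\<^sub>R axis a 1)"
        using LIMSEQ_Suc[OF lim_const_over_n[of 1]] by (intro tendsto_intros) simp
      then have "\<forall>\<^sub>F m in sequentially. norm (\<xi> + (1 / real (Suc m)) *\<^sub>R axis a 1) < r"
        using Suc.prems by (intro order_tendstoD(2)) auto
      then show "\<forall>\<^sub>F m in sequentially. real (Suc m) *\<^sub>R (E (\<xi> + (1 / real (Suc m)) *\<^sub>R axis a 1) - E \<xi>) = 0"
      proof eventually_elim
        fix m assume "norm (\<xi> + (1 / real (Suc m)) *\<^sub>R axis a 1) < r"
        then show "real (Suc m) *\<^sub>R (E (\<xi> + (1 / real (Suc m)) *\<^sub>R axis a 1) - E \<xi>) = 0"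
          using Suc.hyps(1)[OF s] Suc.prems unfolding E_def by simp
      qed
    qed
    ultimately have "(\<integral>x. (\<i> * of_real (x $ a)) * H \<gamma>' x * cis (\<xi> \<bullet> x) \<partial>lborel) = 0"
      by (rule LIMSEQ_unique)
    also have "(\<lambda>x. (\<i> * of_real (x $ a)) * H \<gamma>' x * cis (\<xi> \<bullet> x)) = (\<lambda>x. \<i> * (H \<gamma> x * cis (\<xi> \<bullet> x)))"
      by (simp add: HS scaleR_conv_of_real mult_ac)
    finally show ?case by simp
  qed
  have "(LINT x|lebesgue. (\<Prod>i\<in>UNIV. (x $ i) ^ \<gamma> i) *\<^sub>R h x) = 0" for \<gamma>
    unfolding schwartz_moment_lebesgue[OF h] using E0[of 0 \<gamma>] r by (simp add: H_def)
  then show ?thesis using h by (simp add: schwartz_inf_def)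
qed

text \<open>The transform of the composed function at \<open>\<xi>\<close> is a multiple of that of
  \<open>\<phi>\<close> at \<open>\<xi> / b\<close>, so it still vanishes near the origin. Negative
  \<open>b\<close> occurs because wavelets are reflected.\<close>

lemma schwartz_inf_affine:
  fixes \<phi> :: "real ^ 'n \<Rightarrow> complex"
  assumes \<phi>: "\<phi> \<in> schwartz" and r: "0 < r" and zero: "\<And>\<xi>. norm \<xi> < r \<Longrightarrow> fourier \<phi> \<xi> = 0"
    and b: "b \<noteq> 0"
  shows "(\<lambda>y. c * \<phi> (a + b *\<^sub>R y)) \<in> schwartz_inf"
proof (rule schwartz_inf_if_fourier_zero)
  show s: "(\<lambda>y. c * \<phi> (a + b *\<^sub>R y)) \<in> schwartz" by (rule schwartz_affine[OF \<phi> b])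
  show "0 < \<bar>b\<bar> * r" using r b by simp
  have [measurable]: "\<phi> \<in> borel_measurable borel"
    using schwartz_continuous[OF \<phi>] by (rule borel_measurable_continuous_onI)
  fix \<xi> :: "real ^ 'n" assume \<xi>: "norm \<xi> < \<bar>b\<bar> * r"
  have [measurable]: "(\<lambda>u. cis (- ((1 / b) *\<^sub>R (u - a) \<bullet> \<xi>))) \<in> borel_measurable borel"
    by (intro borel_measurable_continuous_onI continuous_intros)
  have "(\<integral>u. \<phi> u * cis (- ((1 / b) *\<^sub>R (u - a) \<bullet> \<xi>)) \<partial>lborel) =
      of_real (\<bar>b\<bar> ^ DIM(real ^ 'n)) * (\<integral>y. \<phi> (a + b *\<^sub>R y) * cis (- ((1 / b) *\<^sub>R ((a + b *\<^sub>R y) - a) \<bullet> \<xi>)) \<partial>lborel)"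
    by (rule lborel_integral_affine[OF _ b]) measurable
  also have "(\<lambda>y. \<phi> (a + b *\<^sub>R y) * cis (- ((1 / b) *\<^sub>R ((a + b *\<^sub>R y) - a) \<bullet> \<xi>))) =
      (\<lambda>y. \<phi> (a + b *\<^sub>R y) * cis (- (y \<bullet> \<xi>)))"
    using b by simp
  also have "(\<integral>u. \<phi> u * cis (- ((1 / b) *\<^sub>R (u - a) \<bullet> \<xi>)) \<partial>lborel) =
      (\<integral>u. cis ((1 / b) *\<^sub>R a \<bullet> \<xi>) * (\<phi> u * cis (- (u \<bullet> ((1 / b) *\<^sub>R \<xi>)))) \<partial>lborel)"
  proof (rule Bochner_Integration.integral_cong[OF refl])
    fix u
    have "cis (- ((1 / b) *\<^sub>R (u - a) \<bullet> \<xi>)) = cis ((1 / b) *\<^sub>R a \<bullet> \<xi>) * cis (- (u \<bullet> ((1 / b) *\<^sub>R \<xi>)))"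
      by (simp add: cis_mult inner_diff_left diff_divide_distrib)
    then show "\<phi> u * cis (- ((1 / b) *\<^sub>R (u - a) \<bullet> \<xi>)) = cis ((1 / b) *\<^sub>R a \<bullet> \<xi>) * (\<phi> u * cis (- (u \<bullet> ((1 / b) *\<^sub>R \<xi>))))"
      by (simp only: mult_ac)
  qed
  also have "\<dots> = cis ((1 / b) *\<^sub>R a \<bullet> \<xi>) * fourier \<phi> ((1 / b) *\<^sub>R \<xi>)"
    unfolding integral_mult_right_zero schwartz_fourier[OF \<phi>] ..
  also have "fourier \<phi> ((1 / b) *\<^sub>R \<xi>) = 0"
  proof (rule zero)
    show "norm ((1 / b) *\<^sub>R \<xi>) < r" using \<xi> b by (simp add: pos_divide_less_eq mult.commute)
  qed
  finally have "(\<integral>y. \<phi> (a + b *\<^sub>R y) * cis (- (y \<bullet> \<xi>)) \<partial>lborel) = 0"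
    using b by simp
  then show "fourier (\<lambda>y. c * \<phi> (a + b *\<^sub>R y)) \<xi> = 0"
    unfolding schwartz_fourier[OF s] by (simp only: mult.assoc integral_mult_right_zero mult_zero_right)
qed

lemma littlewood_paley_support:
  fixes \<phi> :: "real ^ 'n \<Rightarrow> complex"
  assumes "littlewood_paley \<phi>"
  obtains \<beta> C where "1 < \<beta>" "\<beta> < pi" "\<phi> \<in> schwartz"
    "\<And>\<xi>. norm \<xi> < 1 / \<beta> \<Longrightarrow> fourier \<phi> \<xi> = 0" "\<And>\<xi>. \<beta> < norm \<xi> \<Longrightarrow> fourier \<phi> \<xi> = 0"
    "\<And>\<xi>. cmod (fourier \<phi> \<xi>) \<le> C"
proof -
  obtain \<alpha> \<beta> C where *: "\<phi> \<in> schwartz" "sqrt 2 < \<alpha>" "\<alpha> < \<beta>" "\<beta> < pi" "0 < C"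
    "\<And>\<xi>. cmod (fourier \<phi> \<xi>) \<le> C * indicat_real {1 / \<beta>..\<beta>} (norm \<xi>)"
    using assms unfolding littlewood_paley_def by blast
  have "1 < sqrt 2" by simp
  then have "1 < \<beta>" using *(2,3) by linarith
  moreover have "fourier \<phi> \<xi> = 0" if "norm \<xi> < 1 / \<beta> \<or> \<beta> < norm \<xi>" for \<xi>
  proof -
    have "indicat_real {1 / \<beta>..\<beta>} (norm \<xi>) = 0" using that by auto
    then show ?thesis using *(6)[of \<xi>] by simp
  qed
  moreover have "cmod (fourier \<phi> \<xi>) \<le> C" for \<xi>
    using *(5) by (intro order_trans[OF *(6)]) (simp add: indicator_def)
  ultimately show ?thesis using *(1,4) by (intro that[of \<beta> C]) auto
qed

text \<open>Derivatives are included because the sampling series has to converge in Schwartz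
  seminorms. Differentiating multiplies the density by \<open>\<i> * \<xi> $ i\<close>, where
  \<open>\<bar>\<xi> $ i\<bar> \<le> \<beta>\<close> on the support.\<close>

lemma littlewood_paley_box_limited:
  fixes \<phi> :: "real ^ 'n \<Rightarrow> complex"
  assumes \<phi>: "\<phi> \<in> schwartz" and supp: "\<And>\<xi>. \<beta> < norm \<xi> \<Longrightarrow> fourier \<phi> \<xi> = 0"
    and bdd: "\<And>\<xi>. cmod (fourier \<phi> \<xi>) \<le> C"
  shows "\<exists>m. box_limited \<beta> m (iter_partial is \<phi>)"
proof (induction "is")
  case Nil
  have [measurable]: "\<phi> \<in> borel_measurable borel"
    using schwartz_continuous[OF \<phi>] by (rule borel_measurable_continuous_onI)
  have [measurable]: "fourier \<phi> \<in> borel_measurable borel"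
  proof -
    have "(\<lambda>p::(real^'n) \<times> (real^'n). cis (- (snd p \<bullet> fst p))) \<in> borel_measurable borel"
      by (intro borel_measurable_continuous_onI continuous_intros)
    moreover have eqs: "sets ((borel :: (real ^ 'n) measure) \<Otimes>\<^sub>M (lborel :: (real ^ 'n) measure)) = sets borel"
      by (metis borel_prod sets_lborel sets_pair_measure_cong)
    ultimately have [measurable]: "(\<lambda>p::(real^'n) \<times> (real^'n). cis (- (snd p \<bullet> fst p))) \<in> borel_measurable (borel \<Otimes>\<^sub>M lborel)"
      unfolding measurable_cong_sets[OF eqs refl] by simp
    have "(\<lambda>\<xi>. \<integral>y. \<phi> y * cis (- (y \<bullet> \<xi>)) \<partial>lborel) \<in> borel_measurable borel"
      by (rule lborel.borel_measurable_lebesgue_integral) (simp add: split_beta')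
    then show ?thesis using schwartz_fourier[OF \<phi>] by (simp add: fun_eq_iff cong: measurable_cong)
  qed
  have intF: "integrable lborel (fourier \<phi>)"
  proof (rule Bochner_Integration.integrable_bound)
    show "integrable lborel (\<lambda>\<xi>::real^'n. C * indicat_real (cball 0 \<beta>) \<xi>)"
      by (intro integrable_mult_right integrable_real_indicator emeasure_lborel_cball_finite) auto
    show "AE \<xi> in lborel. norm (fourier \<phi> \<xi>) \<le> norm (C * indicat_real (cball 0 \<beta>) \<xi>)"
      using bdd supp by (auto simp: indicator_def not_le intro!: AE_I2 order_trans[OF bdd])
  qed measurable
  obtain B where B: "\<And>x. cmod (\<phi> x) \<le> B"
    using schwartz_bound[OF \<phi>, of "[]" 0] by auto
  have "\<phi> x = (\<integral>\<xi>. (of_real (1 / (2 * pi) ^ CARD('n)) * fourier \<phi> \<xi>) * cis (x \<bullet> \<xi>) \<partial>lborel)" for x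
    by (rule fourier_inversion[OF schwartz_continuous[OF \<phi>] schwartz_integrable[OF \<phi>] B schwartz_fourier[OF \<phi>] intF])
  moreover have "fourier \<phi> \<xi> = 0" if "\<beta> < \<bar>\<xi> $ i\<bar>" for \<xi> i
    using that component_le_norm_cart[of \<xi> i] by (intro supp) linarith
  ultimately have "box_limited \<beta> (\<lambda>\<xi>. of_real (1 / (2 * pi) ^ CARD('n)) * fourier \<phi> \<xi>) \<phi>"
    unfolding box_limited_def using intF by auto
  then show ?case by auto
next
  case (Cons i "is")
  then obtain m where m: "box_limited \<beta> m (iter_partial is \<phi>)" by blast
  then have im: "integrable lborel m" and m0: "\<And>\<xi> k. \<beta> < \<bar>\<xi> $ k\<bar> \<Longrightarrow> m \<xi> = 0"
    and eq: "\<And>x. iter_partial is \<phi> x = (\<integral>\<xi>. m \<xi> * cis (x \<bullet> \<xi>) \<partial>lborel)"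
    unfolding box_limited_def by blast+
  have [measurable]: "m \<in> borel_measurable borel" using im by auto
  have im1: "integrable lborel (\<lambda>\<xi>. (\<xi> $ i) *\<^sub>R m \<xi>)"
  proof (rule Bochner_Integration.integrable_bound)
    show "integrable lborel (\<lambda>\<xi>. \<beta> *\<^sub>R m \<xi>)" using im by simp
    show "AE \<xi> in lborel. norm ((\<xi> $ i) *\<^sub>R m \<xi>) \<le> norm (\<beta> *\<^sub>R m \<xi>)"
    proof (rule AE_I2)
      fix \<xi>
      show "norm ((\<xi> $ i) *\<^sub>R m \<xi>) \<le> norm (\<beta> *\<^sub>R m \<xi>)"
        using m0[of \<xi> i] by (cases "\<beta> < \<bar>\<xi> $ i\<bar>") (auto intro!: mult_right_mono)
    qed
  qed measurable
  have "iter_partial (i # is) \<phi> x = (\<integral>\<xi>. (\<i> * of_real (\<xi> $ i) * m \<xi>) * cis (x \<bullet> \<xi>) \<partial>lborel)" for x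
  proof (rule LIMSEQ_unique)
    let ?D = "iter_partial is \<phi>"
    show "(\<lambda>k. real (Suc k) *\<^sub>R (?D (x + (1 / real (Suc k)) *\<^sub>R axis i 1) - ?D x)) \<longlonglongrightarrow> iter_partial (i # is) \<phi> x"
      using derivative_sequence[OF smooth_has_derivative[OF schwartz_smooth[OF \<phi>]], of "axis i 1"]
      by (simp add: axis_eq_0_iff)
    show "(\<lambda>k. real (Suc k) *\<^sub>R (?D (x + (1 / real (Suc k)) *\<^sub>R axis i 1) - ?D x)) \<longlonglongrightarrow>
      (\<integral>\<xi>. (\<i> * of_real (\<xi> $ i) * m \<xi>) * cis (x \<bullet> \<xi>) \<partial>lborel)"
      unfolding eq by (rule fourier_difference_sequence[OF im im1])
  qed
  moreover have "integrable lborel (\<lambda>\<xi>. \<i> * of_real (\<xi> $ i) * m \<xi>)"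
    using integrable_mult_right[OF im1, of \<i>] by (simp add: scaleR_conv_of_real mult.assoc)
  ultimately have "box_limited \<beta> (\<lambda>\<xi>. \<i> * of_real (\<xi> $ i) * m \<xi>) (iter_partial (i # is) \<phi>)"
    unfolding box_limited_def using m0 by auto
  then show ?case by blast
qed

text \<open>Induction over the generation of the topology. A single \<open>N\<close> limits both the
  weight and the number of derivatives, which makes the conditions directed: an intersection takes
  the larger \<open>N\<close> and the smaller \<open>\<epsilon>\<close>.\<close>

lemma schwartz_topology_nbhd_0:
  fixes U :: "(real ^ 'n \<Rightarrow> complex) set"
  assumes "openin schwartz_topology U" "(\<lambda>_. 0) \<in> U"
  shows "\<exists>N \<epsilon>. 0 < \<epsilon> \<and> (\<forall>h\<in>schwartz. (\<forall>is z. length is \<le> N \<longrightarrow>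
    (1 + norm z) ^ N * cmod (iter_partial is h z) \<le> \<epsilon>) \<longrightarrow> h \<in> U)"
proof -
  let ?S = "{{g \<in> schwartz. schwartz_seminorm N is (\<lambda>x. g x - f x) < ennreal \<epsilon>} | N is f \<epsilon>.
      f \<in> (schwartz :: (real ^ 'n \<Rightarrow> complex) set) \<and> \<epsilon> > 0}"
  have "generate_topology_on ?S U"
    using assms(1) unfolding schwartz_topology_def openin_topology_generated_by_iff .
  then show ?thesis
    using assms(2)
  proof (induction rule: generate_topology_on.induct)
    case Empty
    then show ?case by simp
  next
    case (Int A B)
    obtain N1 e1 where 1: "0 < e1"
      "\<forall>h\<in>schwartz. (\<forall>is z. length is \<le> N1 \<longrightarrow> (1 + norm z) ^ N1 * cmod (iter_partial is h z) \<le> e1) \<longrightarrow> h \<in> A"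
      using Int.IH(1) Int.prems by blast
    obtain N2 e2 where 2: "0 < e2"
      "\<forall>h\<in>schwartz. (\<forall>is z. length is \<le> N2 \<longrightarrow> (1 + norm z) ^ N2 * cmod (iter_partial is h z) \<le> e2) \<longrightarrow> h \<in> B"
      using Int.IH(2) Int.prems by blast
    define N where "N = max N1 N2"
    define e where "e = min e1 e2"
    have "h \<in> A \<inter> B" if h: "h \<in> schwartz"
      "\<forall>is z. length is \<le> N \<longrightarrow> (1 + norm z) ^ N * cmod (iter_partial is h z) \<le> e" for h
    proof -
      have le: "(1 + norm z) ^ k * cmod (iter_partial is h z) \<le> e" if "length is \<le> k" "k \<le> N" for "is" z k
      proof -
        have "(1 + norm z) ^ k * cmod (iter_partial is h z) \<le> (1 + norm z) ^ N * cmod (iter_partial is h z)"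
          using that(2) by (intro mult_right_mono power_increasing) auto
        also have "\<dots> \<le> e" using h(2) that by auto
        finally show ?thesis .
      qed
      have "(1 + norm z) ^ N1 * cmod (iter_partial is h z) \<le> e1" if "length is \<le> N1" for "is" z
        using le[OF that, of z] by (simp add: N_def e_def)
      then have "h \<in> A" using 1(2) h(1) by blast
      have "(1 + norm z) ^ N2 * cmod (iter_partial is h z) \<le> e2" if "length is \<le> N2" for "is" z
        using le[OF that, of z] by (simp add: N_def e_def)
      then have "h \<in> B" using 2(2) h(1) by blast
      with \<open>h \<in> A\<close> show ?thesis by blast
    qed
    moreover have "0 < e" using 1(1) 2(1) by (simp add: e_def)
    ultimately show ?case by blast
  next
    case (UN K)
    then obtain k where "k \<in> K" "(\<lambda>_. 0) \<in> k" by blast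
    with UN.IH[of k] show ?case by (meson UnionI)
  next
    case (Basis s)
    then obtain N0 is0 f0 e0 where s: "s = {g \<in> schwartz. schwartz_seminorm N0 is0 (\<lambda>x. g x - f0 x) < ennreal e0}"
      and f0: "f0 \<in> schwartz" and e0: "0 < e0" by blast
    let ?sem = "schwartz_seminorm N0 is0 (\<lambda>x. 0 - f0 x)"
    have "?sem < ennreal e0" using Basis.prems s by simp
    then obtain \<sigma> where \<sigma>: "?sem = ennreal \<sigma>" "0 \<le> \<sigma>" "\<sigma> < e0"
      by (cases ?sem) (auto simp: ennreal_less_iff)
    have m: "smooth (\<lambda>x. 0 - f0 x)"
      using smooth_affine[OF schwartz_smooth[OF f0], of "-1" 0 1] by simp
    have le\<sigma>: "(1 + norm z) ^ N0 * cmod (iter_partial is0 (\<lambda>x. 0 - f0 x) z) \<le> \<sigma>" for z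
    proof -
      have "ennreal ((1 + norm z) ^ N0 * cmod (iter_partial is0 (\<lambda>x. 0 - f0 x) z)) \<le> ennreal \<sigma>"
        unfolding \<sigma>(1)[symmetric] schwartz_seminorm_def by (rule SUP_upper) simp
      then show ?thesis using \<sigma>(2) by (simp add: ennreal_le_iff)
    qed
    define N where "N = max N0 (length is0)"
    \<comment> \<open>The generating set is a ball about \<open>f0\<close>, at seminorm distance
      \<open>\<sigma>\<close> from 0. What is left of its radius is \<open>e0 - \<sigma>\<close>,
      and half of that keeps the inequality strict.\<close>
    define e where "e = (e0 - \<sigma>) / 2"
    have "h \<in> s" if h: "h \<in> schwartz"
      "\<forall>is z. length is \<le> N \<longrightarrow> (1 + norm z) ^ N * cmod (iter_partial is h z) \<le> e" for h
    proof -
      have "(1 + norm z) ^ N0 * cmod (iter_partial is0 (\<lambda>x. h x - f0 x) z) \<le> e + \<sigma>" for z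
      proof -
        have "iter_partial is0 (\<lambda>x. h x + (0 - f0 x)) z = iter_partial is0 h z + iter_partial is0 (\<lambda>x. 0 - f0 x) z"
          using iter_partial_add[OF schwartz_smooth[OF h(1)] m] by (rule fun_cong)
        then have "cmod (iter_partial is0 (\<lambda>x. h x - f0 x) z) \<le> cmod (iter_partial is0 h z) + cmod (iter_partial is0 (\<lambda>x. 0 - f0 x) z)"
          using norm_triangle_ineq by simp
        then have "(1 + norm z) ^ N0 * cmod (iter_partial is0 (\<lambda>x. h x - f0 x) z) \<le>
            (1 + norm z) ^ N0 * cmod (iter_partial is0 h z) + (1 + norm z) ^ N0 * cmod (iter_partial is0 (\<lambda>x. 0 - f0 x) z)"
          unfolding distrib_left[symmetric] by (intro mult_left_mono) auto
        also have "(1 + norm z) ^ N0 * cmod (iter_partial is0 h z) \<le> (1 + norm z) ^ N * cmod (iter_partial is0 h z)"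
          by (intro mult_right_mono power_increasing) (auto simp: N_def)
        also have "\<dots> \<le> e" using h(2) by (simp add: N_def)
        finally show ?thesis using le\<sigma>[of z] by linarith
      qed
      then have "schwartz_seminorm N0 is0 (\<lambda>x. h x - f0 x) \<le> ennreal (e + \<sigma>)"
        unfolding schwartz_seminorm_def by (intro SUP_least ennreal_leI)
      also have "\<dots> < ennreal e0" using \<sigma> by (intro ennreal_lessI) (auto simp: e_def field_simps)
      finally show ?thesis using h(1) by (simp add: s)
    qed
    moreover have "0 < e" using \<sigma> by (simp add: e_def)
    ultimately show ?case by blast
  qed
qed

text \<open>The preimage of the unit ball contains a neighbourhood of 0 described by one seminorm
  bound, and scaling turns this into an estimate. The order \<open>N\<close> depends on
  \<open>f\<close>, which is why later constants must avoid it.\<close>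

lemma distribution_finite_order:
  fixes f :: "(real ^ 'n \<Rightarrow> complex) \<Rightarrow> 'a::{complex_normed_vector, banach}"
  assumes f: "f \<in> distributions_inf"
  shows "\<exists>N C. 0 \<le> C \<and> (\<forall>h\<in>schwartz_inf. \<forall>A\<ge>0.
    (\<forall>is z. length is \<le> N \<longrightarrow> (1 + norm z) ^ N * cmod (iter_partial is h z) \<le> A) \<longrightarrow> norm (f h) \<le> C * A)"
proof (cases "(schwartz_inf :: (real ^ 'n \<Rightarrow> complex) set) = {}")
  case True
  then show ?thesis by auto
next
  case False
  let ?X = "subtopology schwartz_topology (schwartz_inf :: (real ^ 'n \<Rightarrow> complex) set)"
  have scale: "f (\<lambda>x. c * g x) = c *\<^sub>C f g" if "g \<in> schwartz_inf" for c g
    using f that by (auto simp: distributions_inf_def)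
  have cont: "continuous_map ?X euclidean f" using f by (simp add: distributions_inf_def)
  obtain g0 :: "real ^ 'n \<Rightarrow> complex" where g0: "g0 \<in> schwartz_inf" using False by blast
  have z: "(\<lambda>_::real^'n. 0::complex) \<in> schwartz_inf" "f (\<lambda>_. 0) = 0"
    using schwartz_inf_scale[OF g0, of 0] scale[OF g0, of 0] scaleC_of_real[of 0 "f g0"] by auto
  have top: "(schwartz_inf :: (real ^ 'n \<Rightarrow> complex) set) \<subseteq> topspace schwartz_topology"
  proof
    fix g :: "real ^ 'n \<Rightarrow> complex" assume "g \<in> schwartz_inf"
    then have g: "g \<in> schwartz" by (simp add: schwartz_inf_def)
    have "iter_partial [] (\<lambda>x. g x - g x) = (\<lambda>_. 0)" by simp
    then have "schwartz_seminorm 0 [] (\<lambda>x. g x - g x) < ennreal 1"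
      by (simp add: schwartz_seminorm_def)
    then have "g \<in> {k \<in> schwartz. schwartz_seminorm 0 [] (\<lambda>x. k x - g x) < ennreal 1}" using g by simp
    then show "g \<in> topspace schwartz_topology"
      unfolding schwartz_topology_def topology_generated_by_topspace
      by (rule UnionI[rotated]) (use g zero_less_one in blast)
  qed
  have "openin ?X {x \<in> topspace ?X. f x \<in> ball 0 1}"
    by (rule openin_continuous_map_preimage[OF cont]) simp
  then obtain U where U: "openin schwartz_topology U" "{x \<in> topspace ?X. f x \<in> ball 0 1} = U \<inter> schwartz_inf"
    unfolding openin_subtopology by blast
  have "(\<lambda>_. 0) \<in> {x \<in> topspace ?X. f x \<in> ball 0 1}" using z top by auto
  then have "(\<lambda>_. 0) \<in> U" unfolding U(2) by blast
  then obtain N e where e: "0 < e" "\<And>h. h \<in> schwartz \<Longrightarrow> (\<And>is z. length is \<le> N \<Longrightarrow>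
    (1 + norm z) ^ N * cmod (iter_partial is h z) \<le> e) \<Longrightarrow> h \<in> U"
    using schwartz_topology_nbhd_0[OF U(1)] by blast
  show ?thesis
  proof (intro exI[of _ N] exI[of _ "1 / e"] conjI ballI allI impI)
    show "0 \<le> 1 / e" using e by simp
    fix h :: "real ^ 'n \<Rightarrow> complex" and A :: real
    assume h: "h \<in> schwartz_inf" and A: "0 \<le> A"
      and "\<forall>is z. length is \<le> N \<longrightarrow> (1 + norm z) ^ N * cmod (iter_partial is h z) \<le> A"
    then have le: "\<And>is z. length is \<le> N \<Longrightarrow> (1 + norm z) ^ N * cmod (iter_partial is h z) \<le> A" by blast
    have hs: "h \<in> schwartz" using h by (simp add: schwartz_inf_def)
    \<comment> \<open>A strict upper bound \<open>B\<close> keeps the scaling factor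
      \<open>e / B\<close> meaningful when \<open>A = 0\<close>; \<open>dense_ge\<close> returns to
      \<open>A\<close>.\<close>
    have "norm (f h) \<le> B / e" if B: "A < B" for B
    proof -
      have B0: "0 < B" using A B by simp
      define r where "r = e / B"
      have r0: "0 < r" using e(1) B0 by (simp add: r_def)
      let ?c = "complex_of_real r"
      have "(\<lambda>x. ?c * h x) \<in> U"
      proof (rule e(2))
        show "(\<lambda>x. ?c * h x) \<in> schwartz" by (rule schwartz_scale[OF hs])
        fix "is" :: "'n list" and z :: "real ^ 'n" assume "length is \<le> N"
        from le[OF this, of z] have "r * ((1 + norm z) ^ N * cmod (iter_partial is h z)) \<le> r * A"
          using r0 by (intro mult_left_mono) auto
        also have "\<dots> \<le> e" using e(1) B0 B by (simp add: r_def field_simps)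
        finally show "(1 + norm z) ^ N * cmod (iter_partial is (\<lambda>x. ?c * h x) z) \<le> e"
          using r0 by (simp add: iter_partial_scale[OF schwartz_smooth[OF hs]] norm_mult mult_ac)
      qed
      then have "(\<lambda>x. ?c * h x) \<in> {x \<in> topspace ?X. f x \<in> ball 0 1}"
        unfolding U(2) using schwartz_inf_scale[OF h] by blast
      then have "norm (?c *\<^sub>C f h) < 1" by (simp add: scale[OF h])
      then have "r * norm (f h) < 1" using r0 by (simp add: norm_scaleC)
      then show ?thesis using e(1) B0 by (simp add: r_def field_simps)
    qed
    then have "e * norm (f h) \<le> B" if "A < B" for B using that e(1) by (simp add: field_simps)
    then have "e * norm (f h) \<le> A" by (rule dense_ge)
    then show "norm (f h) \<le> 1 / e * A" using e(1) by (simp add: field_simps)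
  qed
qed

text \<open>The shape, \<open>p0\<close> plus a finite sum, is that of a remainder of the sampling
  series. The three facts share one induction because each step uses membership in
  \<open>schwartz_inf\<close>.\<close>

lemma distribution_sum:
  fixes f :: "(real ^ 'n \<Rightarrow> complex) \<Rightarrow> 'a::{complex_normed_vector, banach}"
  assumes f: "f \<in> distributions_inf" and F: "finite F"
    and p0: "p0 \<in> schwartz_inf" and p: "\<And>k. p k \<in> schwartz_inf"
  shows "(\<lambda>y. p0 y + (\<Sum>k\<in>F. c k * p k y)) \<in> schwartz_inf"
    and "f (\<lambda>y. p0 y + (\<Sum>k\<in>F. c k * p k y)) = f p0 + (\<Sum>k\<in>F. c k *\<^sub>C f (p k))"
    and "iter_partial is (\<lambda>y. p0 y + (\<Sum>k\<in>F. c k * p k y)) =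
      (\<lambda>y. iter_partial is p0 y + (\<Sum>k\<in>F. c k * iter_partial is (p k) y))"
proof -
  have sm: "smooth g" if "g \<in> schwartz_inf" for g :: "real ^ 'n \<Rightarrow> complex"
    using that by (simp add: schwartz_inf_def schwartz_smooth)
  have add: "f (\<lambda>x. g x + h x) = f g + f h" if "g \<in> schwartz_inf" "h \<in> schwartz_inf" for g h
    using f that by (auto simp: distributions_inf_def)
  have scale: "f (\<lambda>x. c * g x) = c *\<^sub>C f g" if "g \<in> schwartz_inf" for c g
    using f that by (auto simp: distributions_inf_def)
  have "(\<lambda>y. p0 y + (\<Sum>k\<in>F. c k * p k y)) \<in> schwartz_inf \<and>
    f (\<lambda>y. p0 y + (\<Sum>k\<in>F. c k * p k y)) = f p0 + (\<Sum>k\<in>F. c k *\<^sub>C f (p k)) \<and>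
    iter_partial is (\<lambda>y. p0 y + (\<Sum>k\<in>F. c k * p k y)) =
      (\<lambda>y. iter_partial is p0 y + (\<Sum>k\<in>F. c k * iter_partial is (p k) y))"
    using F
  proof (induction F rule: finite_induct)
    case empty
    then show ?case using p0 by simp
  next
    case (insert a F)
    let ?g = "\<lambda>y. p0 y + (\<Sum>k\<in>F. c k * p k y)"
    have eq: "(\<lambda>y. p0 y + (\<Sum>k\<in>insert a F. c k * p k y)) = (\<lambda>y. ?g y + c a * p a y)"
      using insert(1,2) by (simp add: algebra_simps)
    have ca: "(\<lambda>y. c a * p a y) \<in> schwartz_inf" by (rule schwartz_inf_scale[OF p])
    have g: "?g \<in> schwartz_inf" using insert.IH by blast
    have "f (\<lambda>y. ?g y + c a * p a y) = f ?g + c a *\<^sub>C f (p a)"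
      using add[OF g ca] scale[OF p] by simp
    moreover have "iter_partial is (\<lambda>y. ?g y + c a * p a y) = (\<lambda>y. iter_partial is ?g y + c a * iter_partial is (p a) y)"
      using iter_partial_add[OF sm[OF g] sm[OF ca]] iter_partial_scale[OF sm[OF p]] by simp
    ultimately show ?case
      unfolding eq using insert schwartz_inf_add[OF g ca] by (simp add: algebra_simps)
  qed
  then show "(\<lambda>y. p0 y + (\<Sum>k\<in>F. c k * p k y)) \<in> schwartz_inf"
    "f (\<lambda>y. p0 y + (\<Sum>k\<in>F. c k * p k y)) = f p0 + (\<Sum>k\<in>F. c k *\<^sub>C f (p k))"
    "iter_partial is (\<lambda>y. p0 y + (\<Sum>k\<in>F. c k * p k y)) =
      (\<lambda>y. iter_partial is p0 y + (\<Sum>k\<in>F. c k * iter_partial is (p k) y))"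
    by blast+
qed

section \<open>The convolution as a band-limited function\<close>

text \<open>The test function of \<open>y\<close> at which
  \<open>convolve (dilate j \<phi>) f x\<close> evaluates \<open>f\<close>. Sampling takes place in
  the parameter \<open>x\<close>.\<close>

definition wavelet :: "(real ^ 'n \<Rightarrow> complex) \<Rightarrow> int \<Rightarrow> real ^ 'n \<Rightarrow> real ^ 'n \<Rightarrow> complex" where
  "wavelet \<phi> j x y = dilate j \<phi> (x - y)"

lemma wavelet_affine:
  fixes \<phi> :: "real ^ 'n \<Rightarrow> complex"
  shows "wavelet \<phi> j x = (\<lambda>y. complex_of_real (2 powi (j * int CARD('n))) *
    \<phi> ((2 powi j) *\<^sub>R x + (- (2 powi j)) *\<^sub>R y))"
  by (simp add: wavelet_def dilate_def fun_eq_iff scaleR_diff_right)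

lemma convolve_wavelet: "convolve (dilate j \<phi>) f x = f (wavelet \<phi> j x)"
  by (simp add: convolve_def wavelet_def[abs_def])

lemma littlewood_paley_wavelet:
  fixes \<phi> :: "real ^ 'n \<Rightarrow> complex"
  assumes "littlewood_paley \<phi>"
  shows "wavelet \<phi> j x \<in> schwartz_inf"
proof -
  obtain \<beta> C where lp: "1 < \<beta>" "\<beta> < pi" "\<phi> \<in> schwartz"
    "\<And>\<xi>. norm \<xi> < 1 / \<beta> \<Longrightarrow> fourier \<phi> \<xi> = 0"
    using littlewood_paley_support[OF assms] by metis
  show ?thesis
    unfolding wavelet_affine by (rule schwartz_inf_affine[OF lp(3), of "1 / \<beta>"]) (use lp in auto)
qed

lemma wavelet_iter_partial:
  fixes \<phi> :: "real ^ 'n \<Rightarrow> complex"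
  assumes "smooth \<phi>"
  shows "iter_partial is (wavelet \<phi> j x) y =
    complex_of_real (2 powi (j * int CARD('n))) * of_real ((- (2 powi j)) ^ length is) *
      iter_partial is \<phi> ((2 powi j) *\<^sub>R x - (2 powi j) *\<^sub>R y)"
  unfolding wavelet_affine iter_partial_affine[OF assms] by simp

lemma schwartz_bound_finite_order:
  fixes \<phi> :: "real ^ 'n \<Rightarrow> complex"
  assumes "\<phi> \<in> schwartz"
  obtains C where "0 < C" "\<And>is v. length is \<le> N \<Longrightarrow> cmod (iter_partial is \<phi> v) \<le> C / (1 + norm v) ^ N"
proof -
  define c where "c is = (SOME C. 0 \<le> C \<and> (\<forall>v. cmod (iter_partial is \<phi> v) \<le> C / (1 + norm v) ^ N))" for "is"
  have c: "0 \<le> c is \<and> (\<forall>v. cmod (iter_partial is \<phi> v) \<le> c is / (1 + norm v) ^ N)" for "is"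
    unfolding c_def by (rule someI_ex) (use schwartz_bound[OF assms, of "is" N] in blast)
  let ?L = "{is :: 'n list. length is \<le> N}"
  have fin: "finite ?L" using finite_lists_length_le[of "UNIV :: 'n set" N] by simp
  define C where "C = 1 + sum c ?L"
  have cC: "c is \<le> C" if "length is \<le> N" for "is"
    using member_le_sum[of "is" ?L c] that c fin by (simp add: C_def)
  show ?thesis
  proof (rule that[of C])
    show "0 < C" unfolding C_def using c by (simp add: add_pos_nonneg sum_nonneg)
    fix "is" :: "'n list" and v :: "real ^ 'n" assume "length is \<le> N"
    then have "c is / (1 + norm v) ^ N \<le> C / (1 + norm v) ^ N"
      by (intro divide_right_mono cC) auto
    then show "cmod (iter_partial is \<phi> v) \<le> C / (1 + norm v) ^ N"
      by (rule order_trans[OF spec[OF conjunct2[OF c]]])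
  qed
qed

text \<open>The series is summed for test functions: the wavelet at \<open>x\<close> is expanded
  into those at the grid points, and \<open>f\<close> is applied to the remainder of a finite
  partial sum, which is small in the seminorms of the order \<open>N\<close> of \<open>f\<close>.
  \<open>C\<close> is fixed before \<open>f\<close>, while the coefficients \<open>P\<close> come
  from a kernel matched to \<open>N\<close>.\<close>

lemma convolve_sampling:
  fixes \<phi> :: "real ^ 'n \<Rightarrow> complex"
  assumes \<phi>: "littlewood_paley \<phi>"
  obtains C where "0 < C" "\<And>(f :: (real ^ 'n \<Rightarrow> complex) \<Rightarrow> 'a::{complex_normed_vector, banach}) j x t.
    f \<in> distributions_inf \<Longrightarrow> \<exists>P. (\<forall>k. \<bar>P k\<bar> \<le> (\<Prod>i\<in>UNIV. C / (2 + \<bar>(2 powi j) * (x $ i - t $ i) - of_int (k i)\<bar>) ^ M)) \<and>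
      ((\<lambda>k. P k *\<^sub>R convolve (dilate j \<phi>) f ((2 powi (- j)) *\<^sub>R lat k + t)) has_sum convolve (dilate j \<phi>) f x) UNIV"
proof -
  obtain \<beta> B where lp: "1 < \<beta>" "\<beta> < pi" "\<phi> \<in> schwartz"
    "\<And>\<xi>. \<beta> < norm \<xi> \<Longrightarrow> fourier \<phi> \<xi> = 0" "\<And>\<xi>. cmod (fourier \<phi> \<xi>) \<le> B"
    using littlewood_paley_support[OF \<phi>] by metis
  note sm = schwartz_smooth[OF lp(3)]
  have \<beta>0: "0 < \<beta>" using lp by simp
  obtain C where C: "0 < C" "\<And>K. \<exists>X C'. 0 < C' \<and> (\<forall>y. \<bar>X y\<bar> \<le> C / (2 + \<bar>y\<bar>) ^ M) \<and>
    (\<forall>y. \<bar>X y\<bar> \<le> C' / (2 + \<bar>y\<bar>) ^ K) \<and>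
    (\<forall>x w. \<bar>w\<bar> \<le> \<beta> \<longrightarrow> ((\<lambda>k::int. of_real (X (x - of_int k)) * cis (- ((x - of_int k) * w))) has_sum 1) UNIV)"
    by (rule sampling_kernel_1d[OF \<beta>0 lp(2), where M=M]) (rule that)
  show ?thesis
  proof (rule that[OF C(1)])
    fix f :: "(real ^ 'n \<Rightarrow> complex) \<Rightarrow> 'a" and j x and t :: "real ^ 'n"
    assume f: "f \<in> distributions_inf"
    obtain N Cf where Cf0: "0 \<le> Cf" "\<forall>h\<in>schwartz_inf. \<forall>A\<ge>0.
      (\<forall>is z. length is \<le> N \<longrightarrow> (1 + norm z) ^ N * cmod (iter_partial is h z) \<le> A) \<longrightarrow> norm (f h) \<le> Cf * A"
      using distribution_finite_order[OF f] by (elim exE conjE)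
    have Cf: "norm (f h) \<le> Cf * A" if "h \<in> schwartz_inf" "0 \<le> A"
        "\<And>is z. length is \<le> N \<Longrightarrow> (1 + norm z) ^ N * cmod (iter_partial is h z) \<le> A" for h A
      using Cf0(2) that by blast
    \<comment> \<open>In these seminorms the test function at a grid point may grow with
      \<open>N\<close> powers of its distance from 0. Two further powers in each coordinate make the
      sum converge.\<close>
    obtain X C' where X: "0 < C'" "\<And>y. \<bar>X y\<bar> \<le> C / (2 + \<bar>y\<bar>) ^ M" "\<And>y. \<bar>X y\<bar> \<le> C' / (2 + \<bar>y\<bar>) ^ (N + 2)"
      "\<And>x w. \<bar>w\<bar> \<le> \<beta> \<Longrightarrow> ((\<lambda>k::int. of_real (X (x - of_int k)) * cis (- ((x - of_int k) * w))) has_sum 1) UNIV"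
      using C(2)[of "N + 2"] by (elim exE conjE) (rule that, auto)
    have sX: "(\<lambda>k::int. \<bar>X (y - of_int k)\<bar>) summable_on UNIV" for y
    proof (rule summable_on_comparison_test)
      show "(\<lambda>k::int. C' * (1 / (2 + \<bar>y - real_of_int k\<bar>)\<^sup>2)) summable_on UNIV"
        by (intro summable_on_cmult_right summable_on_int_shift_square)
      fix k :: int
      have "\<bar>X (y - of_int k)\<bar> \<le> C' / (2 + \<bar>y - of_int k\<bar>) ^ (N + 2)" by (rule X)
      also have "\<dots> \<le> C' / (2 + \<bar>y - of_int k\<bar>)\<^sup>2"
        using X(1) by (intro divide_left_mono power_increasing) auto
      finally show "\<bar>X (y - of_int k)\<bar> \<le> C' * (1 / (2 + \<bar>y - real_of_int k\<bar>)\<^sup>2)" by simp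
    qed auto
    obtain CD where CD: "0 < CD" "\<And>is v. length is \<le> N \<Longrightarrow> cmod (iter_partial is \<phi> v) \<le> CD / (1 + norm v) ^ N"
      by (rule schwartz_bound_finite_order[OF lp(3)]) (rule that)
    define a :: real where "a = 2 powi j"
    have a: "0 < a" by (simp add: a_def)
    have a': "2 powi (- j) = 1 / a" by (simp add: a_def power_int_minus_divide)
    define \<kappa> :: real where "\<kappa> = 2 powi (j * int CARD('n))"
    have \<kappa>: "0 < \<kappa>" by (simp add: \<kappa>_def)
    define z where "z = a *\<^sub>R (x - t)"
    define P where "P k = (\<Prod>i\<in>UNIV. X (z $ i - of_int (k i)))" for k :: "'n \<Rightarrow> int"
    define y where "y k = (2 powi (- j)) *\<^sub>R lat k + t" for k :: "'n \<Rightarrow> int"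
    have ay: "a *\<^sub>R y k = lat k + a *\<^sub>R t" for k using a by (simp add: y_def a' scaleR_add_right)
    \<comment> \<open>The size of the \<open>k\<close>-th term in the seminorms of order
      \<open>N\<close>, up to a factor independent of \<open>k\<close>.\<close>
    define w where "w k = \<bar>P k\<bar> * (1 + norm (a *\<^sub>R y k)) ^ N" for k
    have w0: "0 \<le> w k" for k by (simp add: w_def)
    have sw: "w summable_on UNIV"
    proof (rule summable_on_comparison_test)
      show "(\<lambda>k. (1 + norm (a *\<^sub>R x)) ^ N * (\<Prod>i\<in>UNIV. C' * (1 / (2 + \<bar>z $ i - real_of_int (k i)\<bar>)\<^sup>2))) summable_on UNIV"
        using X(1) by (intro summable_on_cmult_right summable_on_prod_UNIV[where f="\<lambda>i k. C' * (1 / (2 + \<bar>z $ i - real_of_int k\<bar>)\<^sup>2)"]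
            summable_on_int_shift_square) auto
      fix k :: "'n \<Rightarrow> int"
      let ?u = "z - lat k" and ?q = "\<Prod>i\<in>UNIV. (2 + \<bar>z $ i - real_of_int (k i)\<bar>)"
      have "a *\<^sub>R y k = a *\<^sub>R x - ?u" by (simp add: ay z_def scaleR_diff_right)
      then have "1 + norm (a *\<^sub>R y k) \<le> 1 + (norm (a *\<^sub>R x) + norm ?u)"
        using norm_triangle_ineq4[of "a *\<^sub>R x" ?u] by simp
      also have "\<dots> \<le> (1 + norm (a *\<^sub>R x)) * (1 + norm ?u)"
        using mult_nonneg_nonneg[of "norm (a *\<^sub>R x)" "norm ?u"] by (simp add: algebra_simps del: norm_scaleR)
      also have "\<dots> \<le> (1 + norm (a *\<^sub>R x)) * ?q"
      proof (intro mult_left_mono order_trans[OF one_plus_norm_le_prod])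
        show "(\<Prod>i\<in>UNIV. 1 + \<bar>?u $ i\<bar>) \<le> ?q" by (intro prod_mono) auto
      qed simp
      finally have le1: "1 + norm (a *\<^sub>R y k) \<le> (1 + norm (a *\<^sub>R x)) * ?q" .
      have "\<bar>P k\<bar> \<le> (\<Prod>i\<in>UNIV. C' / (2 + \<bar>z $ i - real_of_int (k i)\<bar>) ^ (N + 2))"
        unfolding P_def abs_prod by (intro prod_mono conjI X(3) abs_ge_zero)
      then have "w k \<le> (\<Prod>i\<in>UNIV. C' / (2 + \<bar>z $ i - real_of_int (k i)\<bar>) ^ (N + 2)) * ((1 + norm (a *\<^sub>R x)) * ?q) ^ N"
        unfolding w_def using X(1) by (intro mult_mono power_mono le1) (auto intro!: prod_nonneg)
      also have "\<dots> = (1 + norm (a *\<^sub>R x)) ^ N * (\<Prod>i\<in>UNIV. C' / (2 + \<bar>z $ i - real_of_int (k i)\<bar>) ^ (N + 2) * (2 + \<bar>z $ i - real_of_int (k i)\<bar>) ^ N)"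
        by (simp only: power_mult_distrib prod.distrib prod_power_distrib mult_ac)
      also have "(\<Prod>i\<in>UNIV. C' / (2 + \<bar>z $ i - real_of_int (k i)\<bar>) ^ (N + 2) * (2 + \<bar>z $ i - real_of_int (k i)\<bar>) ^ N) =
          (\<Prod>i\<in>UNIV. C' * (1 / (2 + \<bar>z $ i - real_of_int (k i)\<bar>)\<^sup>2))"
      proof (rule prod.cong[OF refl])
        fix i
        have "c > 0 \<Longrightarrow> C' / c ^ (N + 2) * c ^ N = C' * (1 / c\<^sup>2)" for c :: real
          by (simp add: power_add power2_eq_square)
        then show "C' / (2 + \<bar>z $ i - real_of_int (k i)\<bar>) ^ (N + 2) * (2 + \<bar>z $ i - real_of_int (k i)\<bar>) ^ N =
          C' * (1 / (2 + \<bar>z $ i - real_of_int (k i)\<bar>)\<^sup>2)" by (simp add: add_pos_nonneg)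
      qed
      finally show "w k \<le> (1 + norm (a *\<^sub>R x)) ^ N * (\<Prod>i\<in>UNIV. C' * (1 / (2 + \<bar>z $ i - real_of_int (k i)\<bar>)\<^sup>2))" .
    qed (use w0 in auto)
    define W where "W = infsum w UNIV"
    have hsW: "(w has_sum W) UNIV" unfolding W_def using sw by (rule has_sum_infsum)
    \<comment> \<open>\<open>\<kappa>\<close> is the normalisation of the dilation,
      \<open>(1 + a) ^ N\<close> bounds the chain rule factors, and the rest is the decay of
      \<open>\<phi>\<close>. Dependence on \<open>j\<close> and \<open>f\<close> is harmless, as
      \<open>G\<close> only multiplies a remainder that tends to 0.\<close>
    define G where "G = \<kappa> * (1 + a) ^ N * ((1 + 1 / a) ^ N * CD)"
    have G: "0 \<le> G" using \<kappa> a CD(1) by (simp add: G_def)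
    have wav: "wavelet \<phi> j v \<in> schwartz_inf" for v by (rule littlewood_paley_wavelet[OF \<phi>])
    have bound: "norm (f (wavelet \<phi> j x) - (\<Sum>k\<in>F. P k *\<^sub>R f (wavelet \<phi> j (y k)))) \<le> Cf * (G * (W - sum w F))"
      if F: "finite F" for F
    proof -
      define c where "c k = complex_of_real (- P k)" for k
      let ?h = "\<lambda>v. wavelet \<phi> j x v + (\<Sum>k\<in>F. c k * wavelet \<phi> j (y k) v)"
      have "f ?h = f (wavelet \<phi> j x) + (\<Sum>k\<in>F. c k *\<^sub>C f (wavelet \<phi> j (y k)))"
        by (rule distribution_sum(2)[OF f F wav wav])
      then have fh: "f ?h = f (wavelet \<phi> j x) - (\<Sum>k\<in>F. P k *\<^sub>R f (wavelet \<phi> j (y k)))"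
        by (simp only: c_def scaleC_of_real scaleR_minus_left sum_negf diff_conv_add_uminus)
      have "norm (f ?h) \<le> Cf * (G * (W - sum w F))"
      proof (rule Cf)
        show "?h \<in> schwartz_inf" by (rule distribution_sum(1)[OF f F wav wav])
        have "sum w F \<le> W" using finite_sum_le_has_sum[OF hsW] F w0 by blast
        then show "0 \<le> G * (W - sum w F)" using G by simp
        fix "is" :: "'n list" and v :: "real ^ 'n" assume len: "length is \<le> N"
        let ?D = "iter_partial is \<phi>"
        let ?f = "\<lambda>k. of_real (P k) * ?D (a *\<^sub>R y k - a *\<^sub>R v)"
        obtain m where m: "box_limited \<beta> m ?D"
          using littlewood_paley_box_limited[OF lp(3-5)] by blast
        \<comment> \<open>Shifting the grid by \<open>- a *\<^sub>R v\<close> together with the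
          point keeps the coefficients free of \<open>v\<close>, so one series serves for all
          \<open>v\<close> and all derivatives.\<close>
        have "((\<lambda>k. of_real (\<Prod>i\<in>UNIV. X (((a *\<^sub>R x - a *\<^sub>R v) - (a *\<^sub>R t - a *\<^sub>R v)) $ i - of_int (k i))) * ?D (lat k + (a *\<^sub>R t - a *\<^sub>R v)))
            has_sum ?D (a *\<^sub>R x - a *\<^sub>R v)) UNIV"
          by (rule sampling_formula[OF m sX X(4)])
        also have "(a *\<^sub>R x - a *\<^sub>R v) - (a *\<^sub>R t - a *\<^sub>R v) = z" by (simp add: z_def scaleR_diff_right)
        also have "(\<lambda>k. of_real (\<Prod>i\<in>UNIV. X (z $ i - of_int (k i))) * ?D (lat k + (a *\<^sub>R t - a *\<^sub>R v))) = ?f"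
          by (simp add: P_def ay add_diff_eq)
        finally have hs: "(?f has_sum ?D (a *\<^sub>R x - a *\<^sub>R v)) UNIV" .
        have 1: "(?f has_sum (?D (a *\<^sub>R x - a *\<^sub>R v) - sum ?f F)) (- F)"
          using has_sum_Diff[OF hs has_sum_finite[OF F]] by (simp add: Compl_eq_Diff_UNIV)
        let ?A = "(1 + 1 / a) ^ N * CD / (1 + norm v) ^ N"
        have 2: "((\<lambda>k. ?A * w k) has_sum (?A * (W - sum w F))) (- F)"
          using has_sum_Diff[OF hsW has_sum_finite[OF F]]
          by (intro has_sum_cmult_right) (simp add: Compl_eq_Diff_UNIV)
        have tail: "norm (?D (a *\<^sub>R x - a *\<^sub>R v) - sum ?f F) \<le> ?A * (W - sum w F)"
        proof (rule norm_infsum_le[OF 1 2])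
          fix k
          let ?V = "a *\<^sub>R y k - a *\<^sub>R v" and ?r = "norm (a *\<^sub>R y k)"
          have pos: "0 < 1 + norm v" "0 < 1 + norm ?V" by (auto intro: add_pos_nonneg)
          have "1 + norm v \<le> (1 + (?r + 1) / a) * (1 + norm ?V)"
            using one_plus_norm_affine_le[of "- a" v "a *\<^sub>R y k"] a by (simp del: norm_scaleR)
          also have "\<dots> \<le> ((1 + 1 / a) * (1 + ?r)) * (1 + norm ?V)"
            using a by (intro mult_right_mono) (auto simp: algebra_simps add_divide_distrib)
          finally have "(1 + norm v) ^ N \<le> ((1 + 1 / a) * (1 + ?r)) ^ N * (1 + norm ?V) ^ N"
            unfolding power_mult_distrib[symmetric] by (intro power_mono) auto
          then have "(1 + norm v) ^ N * CD \<le> ((1 + 1 / a) * (1 + ?r)) ^ N * (1 + norm ?V) ^ N * CD"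
            using CD(1) by (intro mult_right_mono) auto
          then have "CD / (1 + norm ?V) ^ N \<le> ((1 + 1 / a) * (1 + ?r)) ^ N * CD / (1 + norm v) ^ N"
            using pos by (simp add: divide_simps mult_ac del: norm_scaleR)
          with CD(2)[OF len, of ?V]
          have "cmod (?D ?V) \<le> ((1 + 1 / a) * (1 + ?r)) ^ N * CD / (1 + norm v) ^ N" by linarith
          then have "\<bar>P k\<bar> * cmod (?D ?V) \<le> \<bar>P k\<bar> * (((1 + 1 / a) * (1 + ?r)) ^ N * CD / (1 + norm v) ^ N)"
            by (intro mult_left_mono) auto
          also have "\<dots> = ?A * w k" by (simp add: w_def power_mult_distrib del: norm_scaleR)
          finally show "norm (?f k) \<le> ?A * w k" by (simp add: norm_mult)
        qed
        have "iter_partial is ?h v = iter_partial is (wavelet \<phi> j x) v + (\<Sum>k\<in>F. c k * iter_partial is (wavelet \<phi> j (y k)) v)"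
          by (simp only: distribution_sum(3)[OF f F wav wav])
        also have "\<dots> = of_real \<kappa> * of_real ((- a) ^ length is) * (?D (a *\<^sub>R x - a *\<^sub>R v) - sum ?f F)"
          unfolding wavelet_iter_partial[OF sm] a_def[symmetric] \<kappa>_def[symmetric]
          by (simp add: c_def right_diff_distrib sum_distrib_left sum_negf mult_ac)
        finally have "cmod (iter_partial is ?h v) = \<kappa> * a ^ length is * cmod (?D (a *\<^sub>R x - a *\<^sub>R v) - sum ?f F)"
          using \<kappa> a by (simp add: norm_mult norm_power power_abs[symmetric])
        also have "\<dots> \<le> \<kappa> * (1 + a) ^ N * (?A * (W - sum w F))"
        proof (intro mult_mono tail order_refl)
          have "a ^ length is \<le> (1 + a) ^ length is" using a by (intro power_mono) auto
          also have "\<dots> \<le> (1 + a) ^ N" using a len by (intro power_increasing) auto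
          finally show "a ^ length is \<le> (1 + a) ^ N" .
        qed (use \<kappa> a in auto)
        finally have "(1 + norm v) ^ N * cmod (iter_partial is ?h v) \<le> (1 + norm v) ^ N * (\<kappa> * (1 + a) ^ N * (?A * (W - sum w F)))"
          by (intro mult_left_mono) auto
        also have "\<dots> = G * (W - sum w F)"
        proof -
          have "(1 + norm v) ^ N \<noteq> 0" by (simp add: add_pos_nonneg less_imp_neq[symmetric])
          then show ?thesis by (simp add: G_def)
        qed
        finally show "(1 + norm v) ^ N * cmod (iter_partial is ?h v) \<le> G * (W - sum w F)" .
      qed
      then show ?thesis unfolding fh .
    qed
    have "((\<lambda>k. P k *\<^sub>R f (wavelet \<phi> j (y k))) has_sum f (wavelet \<phi> j x)) UNIV"
      unfolding has_sum_def
    proof (rule LIM_zero_cancel, rule Lim_null_comparison)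
      show "\<forall>\<^sub>F F in finite_subsets_at_top UNIV. norm ((\<Sum>k\<in>F. P k *\<^sub>R f (wavelet \<phi> j (y k))) - f (wavelet \<phi> j x)) \<le> Cf * (G * (W - sum w F))"
        using bound by (intro eventually_finite_subsets_at_top_weakI) (simp add: norm_minus_commute)
      have "((\<lambda>F. W - sum w F) \<longlongrightarrow> W - W) (finite_subsets_at_top UNIV)"
        using hsW unfolding has_sum_def by (intro tendsto_intros)
      then show "((\<lambda>F. Cf * (G * (W - sum w F))) \<longlongrightarrow> 0) (finite_subsets_at_top UNIV)"
        by (intro tendsto_mult_right_zero) simp
    qed
    moreover have "\<bar>P k\<bar> \<le> (\<Prod>i\<in>UNIV. C / (2 + \<bar>(2 powi j) * (x $ i - t $ i) - of_int (k i)\<bar>) ^ M)" for k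
      unfolding P_def abs_prod z_def a_def
      by (intro prod_mono) (use X(2) in \<open>auto simp: right_diff_distrib\<close>)
    ultimately show "\<exists>P. (\<forall>k. \<bar>P k\<bar> \<le> (\<Prod>i\<in>UNIV. C / (2 + \<bar>(2 powi j) * (x $ i - t $ i) - of_int (k i)\<bar>) ^ M)) \<and>
      ((\<lambda>k. P k *\<^sub>R convolve (dilate j \<phi>) f ((2 powi (- j)) *\<^sub>R lat k + t)) has_sum convolve (dilate j \<phi>) f x) UNIV"
      unfolding convolve_wavelet y_def by blast
  qed
qed

text \<open>The measurability of the composed weight and of the averages rests on this. The finite
  order of \<open>f\<close> reduces it to Schwartz seminorms of a difference of two translates,
  which the mean value inequality bounds at the cost of one more derivative.\<close>

lemma convolve_continuous:
  fixes \<phi> :: "real ^ 'n \<Rightarrow> complex" and f :: "(real ^ 'n \<Rightarrow> complex) \<Rightarrow> 'a::{complex_normed_vector, banach}"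
  assumes \<phi>: "littlewood_paley \<phi>" and f: "f \<in> distributions_inf"
  shows "continuous_on UNIV (convolve (dilate j \<phi>) f)"
proof -
  have \<phi>s: "\<phi> \<in> schwartz" using \<phi> by (simp add: littlewood_paley_def)
  note sm = schwartz_smooth[OF \<phi>s]
  obtain N Cf where Cf0: "0 \<le> Cf" "\<forall>h\<in>schwartz_inf. \<forall>A\<ge>0.
    (\<forall>is z. length is \<le> N \<longrightarrow> (1 + norm z) ^ N * cmod (iter_partial is h z) \<le> A) \<longrightarrow> norm (f h) \<le> Cf * A"
    using distribution_finite_order[OF f] by (elim exE conjE)
  have Cf: "norm (f h) \<le> Cf * A" if "h \<in> schwartz_inf" "0 \<le> A"
      "\<And>is z. length is \<le> N \<Longrightarrow> (1 + norm z) ^ N * cmod (iter_partial is h z) \<le> A" for h A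
    using Cf0(2) that by blast
  obtain CD where CD: "0 < CD" "\<And>is v. length is \<le> Suc N \<Longrightarrow> cmod (iter_partial is \<phi> v) \<le> CD / (1 + norm v) ^ Suc N"
    by (rule schwartz_bound_finite_order[OF \<phi>s]) (rule that)
  define a :: real where "a = 2 powi j"
  have a: "0 < a" by (simp add: a_def)
  define \<kappa> :: real where "\<kappa> = 2 powi (j * int CARD('n))"
  have \<kappa>: "0 < \<kappa>" by (simp add: \<kappa>_def)
  define n where "n = real CARD('n)"
  have n: "0 < n" by (simp add: n_def)
  have wav: "wavelet \<phi> j v \<in> schwartz_inf" for v by (rule littlewood_paley_wavelet[OF \<phi>])
  have dir: "cmod (frechet_derivative (iter_partial is \<phi>) (at v) u) \<le> n * (CD / (1 + norm v) ^ N) * norm u"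
    if len: "length is \<le> N" for "is" and v u :: "real ^ 'n"
  proof -
    let ?D = "frechet_derivative (iter_partial is \<phi>) (at v)"
    have lin: "linear ?D" by (rule has_derivative_linear[OF smooth_has_derivative[OF sm]])
    have "?D u = ?D (\<Sum>i\<in>UNIV. (u $ i) *\<^sub>R axis i 1)"
      by (simp add: basis_expansion scalar_mult_eq_scaleR[symmetric])
    also have "\<dots> = (\<Sum>i\<in>UNIV. (u $ i) *\<^sub>R iter_partial (i # is) \<phi> v)"
      using lin by (simp add: linear_sum linear_scale)
    finally have "cmod (?D u) \<le> (\<Sum>i\<in>UNIV. cmod ((u $ i) *\<^sub>R iter_partial (i # is) \<phi> v))"
      using norm_sum by metis
    also have "\<dots> \<le> (\<Sum>i\<in>(UNIV :: 'n set). norm u * (CD / (1 + norm v) ^ N))"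
    proof (intro sum_mono)
      fix i
      have "cmod (iter_partial (i # is) \<phi> v) \<le> CD / (1 + norm v) ^ Suc N" by (rule CD(2)) (use len in simp)
      also have "\<dots> \<le> CD / (1 + norm v) ^ N"
        using CD(1) by (intro divide_left_mono power_increasing mult_pos_pos zero_less_power) (auto intro: add_pos_nonneg)
      finally show "cmod ((u $ i) *\<^sub>R iter_partial (i # is) \<phi> v) \<le> norm u * (CD / (1 + norm v) ^ N)"
        unfolding norm_scaleR real_norm_def by (intro mult_mono component_le_norm_cart) auto
    qed
    finally show ?thesis by (simp add: n_def mult_ac)
  qed
  have lip: "norm (convolve (dilate j \<phi>) f x' - convolve (dilate j \<phi>) f x) \<le>
      Cf * (\<kappa> * (1 + a) ^ N * n * (2 * (1 + (norm (a *\<^sub>R x) + 1) / a)) ^ N * CD * a * norm (x' - x))"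
    if close: "norm (a *\<^sub>R (x' - x)) \<le> 1" for x x' :: "real ^ 'n"
  proof -
    let ?K = "1 + (norm (a *\<^sub>R x) + 1) / a"
    let ?A = "\<kappa> * (1 + a) ^ N * n * (2 * ?K) ^ N * CD * a * norm (x' - x)"
    \<comment> \<open>The one-element sum fits the difference into the form of
      \<open>distribution_sum\<close>.\<close>
    let ?h = "\<lambda>v. wavelet \<phi> j x' v + (\<Sum>k\<in>{()}. (- 1) * wavelet \<phi> j x v)"
    have "f ?h = f (wavelet \<phi> j x') + (\<Sum>k\<in>{()}. (- 1) *\<^sub>C f (wavelet \<phi> j x))"
      by (rule distribution_sum(2)[OF f _ wav wav]) simp
    then have fh: "f ?h = f (wavelet \<phi> j x') - f (wavelet \<phi> j x)"
      using scaleC_of_real[of "-1" "f (wavelet \<phi> j x)"] by simp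
    have K: "0 \<le> ?K" using a by simp
    have "norm (f ?h) \<le> Cf * ?A"
    proof (rule Cf)
      show "?h \<in> schwartz_inf" by (rule distribution_sum(1)[OF f _ wav wav]) simp
      show "0 \<le> ?A" using \<kappa> a n CD(1) K by (intro mult_nonneg_nonneg zero_le_power) auto
      fix "is" :: "'n list" and v :: "real ^ 'n" assume len: "length is \<le> N"
      let ?D = "iter_partial is \<phi>"
      let ?p = "a *\<^sub>R x - a *\<^sub>R v" and ?p' = "a *\<^sub>R x' - a *\<^sub>R v"
      have pos: "0 < 1 + norm v" by (simp add: add_pos_nonneg)
      have "norm (?D ?p' - ?D ?p) \<le> n * ((2 * ?K) ^ N * CD / (1 + norm v) ^ N) * norm (?p' - ?p)"
      proof (rule differentiable_bound)
        show "convex (closed_segment ?p ?p')" by (rule convex_closed_segment)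
        show "?p' \<in> closed_segment ?p ?p'" "?p \<in> closed_segment ?p ?p'" by auto
        fix q assume q: "q \<in> closed_segment ?p ?p'"
        show "(?D has_derivative frechet_derivative ?D (at q)) (at q within closed_segment ?p ?p')"
          by (rule has_derivative_at_withinI[OF smooth_has_derivative[OF sm]])
        have "norm (q - ?p) \<le> norm (?p' - ?p)" using segment_bound(1)[OF q] .
        also have "?p' - ?p = a *\<^sub>R (x' - x)" by (simp add: scaleR_diff_right)
        finally have "norm (q - ?p) \<le> 1" using close by simp
        \<comment> \<open>Along a segment of length at most 1 the weight \<open>1 + norm\<close>
          changes by a factor of at most 2, so the weight at one end serves for all of it.\<close>
        then have "norm ?p \<le> norm q + 1" using norm_triangle_sub[of ?p q] by (simp add: norm_minus_commute)
        moreover have "1 + r \<le> 2 * (1 + s)" if "r \<le> s + 1" "0 \<le> s" for r s :: real using that by simp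
        ultimately have "1 + norm ?p \<le> 2 * (1 + norm q)" using norm_ge_zero[of q] by blast
        then have "?K * (1 + norm ?p) \<le> ?K * (2 * (1 + norm q))" using K by (intro mult_left_mono) auto
        moreover have "1 + norm v \<le> ?K * (1 + norm ?p)"
          using one_plus_norm_affine_le[of "- a" v "a *\<^sub>R x"] a by (simp del: norm_scaleR)
        ultimately have "1 + norm v \<le> ?K * (2 * (1 + norm q))" by (rule order_trans[rotated])
        also have "\<dots> = (2 * ?K) * (1 + norm q)" by (simp only: mult_ac)
        finally have "1 + norm v \<le> (2 * ?K) * (1 + norm q)" .
        then have "(1 + norm v) ^ N \<le> (2 * ?K) ^ N * (1 + norm q) ^ N"
          unfolding power_mult_distrib[symmetric] by (intro power_mono) auto
        then have "(1 + norm v) ^ N * CD \<le> (2 * ?K) ^ N * (1 + norm q) ^ N * CD"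
          using CD(1) by (intro mult_right_mono) auto
        moreover have "0 < 1 + norm q" by (simp add: add_pos_nonneg)
        ultimately have le: "CD / (1 + norm q) ^ N \<le> (2 * ?K) ^ N * CD / (1 + norm v) ^ N"
          using pos by (simp add: pos_divide_le_eq pos_le_divide_eq mult_ac)
        show "onorm (frechet_derivative ?D (at q)) \<le> n * ((2 * ?K) ^ N * CD / (1 + norm v) ^ N)"
        proof (rule onorm_bound)
          show "0 \<le> n * ((2 * ?K) ^ N * CD / (1 + norm v) ^ N)"
            using n CD(1) K pos by (intro mult_nonneg_nonneg divide_nonneg_nonneg zero_le_power) auto
          fix u :: "real ^ 'n"
          have "n * (CD / (1 + norm q) ^ N) * norm u \<le> n * ((2 * ?K) ^ N * CD / (1 + norm v) ^ N) * norm u"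
            using n by (intro mult_right_mono mult_left_mono le) auto
          then show "norm (frechet_derivative ?D (at q) u) \<le> n * ((2 * ?K) ^ N * CD / (1 + norm v) ^ N) * norm u"
            using dir[OF len, of q u] by linarith
        qed
      qed
      also have "norm (?p' - ?p) = a * norm (x' - x)" using a by (simp add: scaleR_diff_right[symmetric])
      finally have D: "cmod (?D ?p' - ?D ?p) \<le> n * ((2 * ?K) ^ N * CD / (1 + norm v) ^ N) * (a * norm (x' - x))" .
      have "iter_partial is ?h v = iter_partial is (wavelet \<phi> j x') v + (\<Sum>k\<in>{()}. (- 1) * iter_partial is (wavelet \<phi> j x) v)"
        by (subst distribution_sum(3)[OF f _ wav wav]) auto
      also have "\<dots> = of_real \<kappa> * of_real ((- a) ^ length is) * (?D ?p' - ?D ?p)"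
        unfolding wavelet_iter_partial[OF sm] a_def[symmetric] \<kappa>_def[symmetric] by (simp add: right_diff_distrib)
      finally have "cmod (iter_partial is ?h v) = \<kappa> * a ^ length is * cmod (?D ?p' - ?D ?p)"
        using \<kappa> a by (simp add: norm_mult norm_power power_abs[symmetric])
      also have "\<dots> \<le> \<kappa> * (1 + a) ^ N * (n * ((2 * ?K) ^ N * CD / (1 + norm v) ^ N) * (a * norm (x' - x)))"
      proof (intro mult_mono D order_refl)
        have "a ^ length is \<le> (1 + a) ^ length is" using a by (intro power_mono) auto
        also have "\<dots> \<le> (1 + a) ^ N" using a len by (intro power_increasing) auto
        finally show "a ^ length is \<le> (1 + a) ^ N" .
      qed (use \<kappa> a in auto)
      finally have "(1 + norm v) ^ N * cmod (iter_partial is ?h v) \<le>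
          (1 + norm v) ^ N * (\<kappa> * (1 + a) ^ N * (n * ((2 * ?K) ^ N * CD / (1 + norm v) ^ N) * (a * norm (x' - x))))"
        by (intro mult_left_mono) auto
      also have "\<dots> = ?A"
      proof -
        have "(1 + norm v) ^ N \<noteq> 0" using pos by simp
        then show ?thesis by simp
      qed
      finally show "(1 + norm v) ^ N * cmod (iter_partial is ?h v) \<le> ?A" .
    qed
    then show ?thesis unfolding fh convolve_wavelet .
  qed
  have "isCont (convolve (dilate j \<phi>) f) x" for x
  proof -
    define L where "L = Cf * (\<kappa> * (1 + a) ^ N * n * (2 * (1 + (norm (a *\<^sub>R x) + 1) / a)) ^ N * CD * a)"
    have "\<forall>\<^sub>F x' in at x. norm (convolve (dilate j \<phi>) f x' - convolve (dilate j \<phi>) f x) \<le> L * norm (x' - x)"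
      unfolding eventually_at
    proof (intro exI[of _ "1 / a"] conjI ballI impI)
      fix x' assume "x' \<noteq> x \<and> dist x' x < 1 / a"
      then have "norm (a *\<^sub>R (x' - x)) \<le> 1" using a by (simp add: dist_norm pos_less_divide_eq mult.commute)
      from lip[OF this] show "norm (convolve (dilate j \<phi>) f x' - convolve (dilate j \<phi>) f x) \<le> L * norm (x' - x)"
        by (simp only: L_def mult.assoc)
    qed (use a in simp)
    moreover have "((\<lambda>x'. L * norm (x' - x)) \<longlongrightarrow> 0) (at x)"
      by (rule tendsto_mult_right_zero, rule tendsto_norm_zero, rule LIM_zero) simp
    ultimately have "((\<lambda>x'. convolve (dilate j \<phi>) f x' - convolve (dilate j \<phi>) f x) \<longlongrightarrow> 0) (at x)"
      by (rule Lim_null_comparison)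
    then show ?thesis unfolding isCont_def by (rule LIM_zero_cancel)
  qed
  then show ?thesis by (intro continuous_at_imp_continuous_on) auto
qed

section \<open>Sums over dyadic cubes\<close>

text \<open>Lattice sums are written as integrals for counting measure, so that exchanging them with
  Lebesgue integrals is Tonelli's theorem and infinite values do no harm.\<close>

lemma has_sum_norm_le_nn_integral:
  fixes u :: "'i \<Rightarrow> 'b::real_normed_vector"
  assumes "(u has_sum v) UNIV"
  shows "ennreal (norm v) \<le> (\<integral>\<^sup>+l. ennreal (norm (u l)) \<partial>count_space UNIV)"
proof (rule tendsto_upperbound)
  show "((\<lambda>F. ennreal (norm (sum u F))) \<longlongrightarrow> ennreal (norm v)) (finite_subsets_at_top UNIV)"
    using assms unfolding has_sum_def by (intro tendsto_ennrealI tendsto_norm)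
  have "ennreal (norm (sum u F)) \<le> (\<integral>\<^sup>+l. ennreal (norm (u l)) \<partial>count_space UNIV)" if F: "finite F" for F
  proof -
    have "ennreal (norm (sum u F)) \<le> ennreal (\<Sum>l\<in>F. norm (u l))" by (intro ennreal_leI norm_sum)
    also have "\<dots> = (\<Sum>l\<in>F. ennreal (norm (u l)))" by simp
    also have "\<dots> = (\<integral>\<^sup>+l. ennreal (norm (u l)) \<partial>count_space F)"
      using F by (simp add: nn_integral_count_space_finite)
    also have "\<dots> \<le> (\<integral>\<^sup>+l. ennreal (norm (u l)) \<partial>count_space UNIV)"
      by (subst nn_integral_count_space_indicator) (auto intro!: nn_integral_mono simp: indicator_def)
    finally show ?thesis .
  qed
  then show "\<forall>\<^sub>F F in finite_subsets_at_top UNIV. ennreal (norm (sum u F)) \<le> (\<integral>\<^sup>+l. ennreal (norm (u l)) \<partial>count_space UNIV)"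
    by (intro eventually_finite_subsets_at_top_weakI)
qed simp

text \<open>A product of coordinate distances, each shifted by 1: it dominates every single one of
  them, and its power \<open>-2\<close> is summable in any dimension as a product of one-dimensional
  sums.\<close>

definition ldist :: "('n::finite \<Rightarrow> int) \<Rightarrow> ('n \<Rightarrow> int) \<Rightarrow> real" where
  "ldist k l = (\<Prod>i\<in>UNIV. 1 + \<bar>real_of_int (k i - l i)\<bar>)"

lemma ldist_commute: "ldist k l = ldist l k"
  by (simp add: ldist_def abs_minus_commute)

lemma ldist_ge_1: "1 \<le> ldist k l"
  unfolding ldist_def by (rule prod_ge_1) simp

lemma ldist_pos: "0 < ldist k l"
  using ldist_ge_1[of k l] by linarith

lemma ldist_ge_component: "1 + \<bar>real_of_int (k i - l i)\<bar> \<le> ldist k l"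
proof -
  have "(1 + \<bar>real_of_int (k i - l i)\<bar>) * 1 \<le> (1 + \<bar>real_of_int (k i - l i)\<bar>) * (\<Prod>i\<in>UNIV - {i}. 1 + \<bar>real_of_int (k i - l i)\<bar>)"
    by (intro mult_left_mono prod_ge_1) auto
  then show ?thesis unfolding ldist_def by (subst prod.remove[of _ i]) auto
qed

lemma ldist_sum_bound:
  obtains S where "0 < S" "\<And>k :: 'n::finite \<Rightarrow> int. (\<integral>\<^sup>+l. ennreal (ldist k l powr - 2) \<partial>count_space UNIV) \<le> ennreal S"
proof -
  let ?f = "\<lambda>l :: 'n \<Rightarrow> int. \<Prod>i\<in>UNIV. 1 / (1 + \<bar>real_of_int (l i)\<bar>)\<^sup>2"
  have f0: "0 \<le> ?f l" for l by (simp add: prod_nonneg)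
  have "?f summable_on UNIV"
    by (rule summable_on_prod_UNIV[where f="\<lambda>i m. 1 / (1 + \<bar>real_of_int m\<bar>)\<^sup>2"]) (auto intro: summable_on_int_inverse_square)
  then have "(\<lambda>l. norm (?f l)) summable_on UNIV" using f0 by simp
  then have "Infinite_Set_Sum.abs_summable_on ?f UNIV" unfolding abs_summable_equivalent .
  then have eq: "(\<integral>\<^sup>+l. ennreal (?f l) \<partial>count_space UNIV) = ennreal (infsetsum ?f UNIV)"
    using f0 by (intro nn_integral_conv_infsetsum) auto
  have pw: "ldist k l powr - 2 = ?f (\<lambda>i. l i - k i)" for k l :: "'n \<Rightarrow> int"
  proof -
    have "ldist k l powr - 2 = 1 / (ldist k l)\<^sup>2"
      using ldist_pos[of k l] by (simp add: powr_minus_divide powr_numeral)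
    also have "\<dots> = ?f (\<lambda>i. l i - k i)"
      by (simp add: ldist_def prod_power_distrib prod_dividef abs_minus_commute)
    finally show ?thesis .
  qed
  show ?thesis
  proof (rule that[of "max 1 (infsetsum ?f UNIV)"])
    fix k :: "'n \<Rightarrow> int"
    have "bij_betw (\<lambda>l. (\<lambda>i. l i - k i)) UNIV (UNIV :: ('n \<Rightarrow> int) set)"
      by (rule bij_betwI[where g="\<lambda>l i. l i + k i"]) auto
    from nn_integral_bij_count_space[OF this, of "\<lambda>l. ennreal (?f l)"]
    have "(\<integral>\<^sup>+l. ennreal (ldist k l powr - 2) \<partial>count_space UNIV) = (\<integral>\<^sup>+l. ennreal (?f l) \<partial>count_space UNIV)"
      unfolding pw by simp
    also have "\<dots> \<le> ennreal (max 1 (infsetsum ?f UNIV))" unfolding eq by (intro ennreal_leI) simp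
    finally show "(\<integral>\<^sup>+l. ennreal (ldist k l powr - 2) \<partial>count_space UNIV) \<le> ennreal (max 1 (infsetsum ?f UNIV))" .
  qed simp
qed

text \<open>Dominating a sum by \<open>\<Sum> ldist\<^sup>-\<^sup>2\<close> times a supremum makes one estimate serve both \<open>\<theta> \<le> 1\<close> and \<open>\<theta> \<ge> 1\<close>.\<close>

lemma ldist_sum_power_le:
  assumes S: "0 < S" "\<And>k :: 'n::finite \<Rightarrow> int. (\<integral>\<^sup>+l. ennreal (ldist k l powr - 2) \<partial>count_space UNIV) \<le> ennreal S"
    and \<theta>: "0 < \<theta>"
  shows "ennpowr (\<integral>\<^sup>+l. ennreal (ldist (k :: 'n \<Rightarrow> int) l powr - (M + 2)) * b l \<partial>count_space UNIV) \<theta> \<le>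
    ennreal (S powr \<theta>) * (\<integral>\<^sup>+l. ennreal (ldist k l powr - (M * \<theta>)) * ennpowr (b l) \<theta> \<partial>count_space UNIV)"
proof -
  let ?I = "\<integral>\<^sup>+l. ennreal (ldist k l powr - (M * \<theta>)) * ennpowr (b l) \<theta> \<partial>count_space UNIV"
  have le: "ennreal (ldist k l powr - M) * b l \<le> ennpowr ?I (1 / \<theta>)" for l
  proof -
    have "ennpowr (ennreal (ldist k l powr - M) * b l) \<theta> = ennreal (ldist k l powr - (M * \<theta>)) * ennpowr (b l) \<theta>"
      using \<theta> by (simp add: ennpowr_mult ennpowr_ennreal powr_powr)
    also have "\<dots> \<le> ?I" by (rule nn_integral_ge_point) simp
    finally show ?thesis using \<theta> by (simp add: ennpowr_le_iff)
  qed
  have "(\<integral>\<^sup>+l. ennreal (ldist k l powr - (M + 2)) * b l \<partial>count_space UNIV) \<le>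
      (\<integral>\<^sup>+l. ennreal (ldist k l powr - 2) * ennpowr ?I (1 / \<theta>) \<partial>count_space UNIV)"
  proof (rule nn_integral_mono)
    fix l
    have "- (M + 2) = - 2 + - M" by simp
    then have "ldist k l powr - (M + 2) = ldist k l powr - 2 * ldist k l powr - M"
      by (simp only: powr_add)
    then have "ennreal (ldist k l powr - (M + 2)) * b l = ennreal (ldist k l powr - 2) * (ennreal (ldist k l powr - M) * b l)"
      by (simp only: ennreal_mult powr_ge_zero mult.assoc)
    also have "\<dots> \<le> ennreal (ldist k l powr - 2) * ennpowr ?I (1 / \<theta>)"
      by (intro mult_left_mono le) simp
    finally show "ennreal (ldist k l powr - (M + 2)) * b l \<le> ennreal (ldist k l powr - 2) * ennpowr ?I (1 / \<theta>)" .
  qed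
  also have "\<dots> = (\<integral>\<^sup>+l. ennreal (ldist k l powr - 2) \<partial>count_space UNIV) * ennpowr ?I (1 / \<theta>)"
    by (rule nn_integral_multc) simp
  also have "\<dots> \<le> ennreal S * ennpowr ?I (1 / \<theta>)"
    by (intro mult_right_mono S) simp
  finally have "ennpowr (\<integral>\<^sup>+l. ennreal (ldist k l powr - (M + 2)) * b l \<partial>count_space UNIV) \<theta> \<le>
      ennpowr (ennreal S * ennpowr ?I (1 / \<theta>)) \<theta>"
    using \<theta> by (intro ennpowr_mono)
  also have "\<dots> = ennreal (S powr \<theta>) * ?I"
    using \<theta> S(1) by (simp add: ennpowr_mult ennpowr_ennreal ennpowr_ennpowr)
  finally show ?thesis .
qed

section \<open>Indexing of dyadic cubes and integrals over them\<close>

definition dcube :: "int \<Rightarrow> ('n \<Rightarrow> int) \<Rightarrow> (real ^ 'n) set" where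
  "dcube j k = cube ((2 powi (- j)) *\<^sub>R lat k) (2 powi (- j))"

definition dindex :: "int \<Rightarrow> real ^ 'n \<Rightarrow> ('n \<Rightarrow> int)" where
  "dindex j x = (\<lambda>i. \<lfloor>2 powi j * x $ i\<rfloor>)"

lemma mem_dcube_iff: "x \<in> dcube j k \<longleftrightarrow> dindex j x = k"
proof -
  have a: "2 powi (- j) = 1 / (2 powi j :: real)" by (simp add: power_int_minus_divide)
  have "x \<in> dcube j k \<longleftrightarrow> (\<forall>i. of_int (k i) \<le> 2 powi j * x $ i \<and> 2 powi j * x $ i < of_int (k i) + 1)"
    unfolding dcube_def cube_def a by (simp add: divide_le_eq less_divide_eq add_divide_distrib[symmetric] mult.commute)
  also have "\<dots> \<longleftrightarrow> (\<forall>i. dindex j x i = k i)"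
    by (simp add: dindex_def floor_eq_iff)
  finally show ?thesis by (simp add: fun_eq_iff)
qed

lemma dyadic_cubes_dcube: "dyadic_cubes j = range (dcube j :: ('n::finite \<Rightarrow> int) \<Rightarrow> (real ^ 'n) set)"
proof -
  have eq: "(\<chi> i. 2 powi (- j) * real_of_int (k i)) = (2 powi (- j)) *\<^sub>R lat k" for k :: "'n \<Rightarrow> int"
    by (simp add: vec_eq_iff)
  show ?thesis unfolding dyadic_cubes_def eq dcube_def by auto
qed

lemma dyadic_cube_at_eq: "dyadic_cube_at j x = dcube j (dindex j x)"
  unfolding dyadic_cube_at_def dyadic_cubes_dcube
  by (rule the_equality) (auto simp: mem_dcube_iff)

lemma dcube_measurable [measurable, simp]: "dcube j k \<in> sets borel"
  by (simp add: dcube_def)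

lemma dindex_measurable [measurable]: "dindex j \<in> borel \<rightarrow>\<^sub>M count_space UNIV"
proof -
  have "dindex j -` {k} = dcube j k" for k :: "'a \<Rightarrow> int" by (auto simp: mem_dcube_iff)
  then show ?thesis
    by (subst measurable_count_space_eq_countable) auto
qed

lemma dindex_measurable_lebesgue [measurable]: "dindex j \<in> lebesgue \<rightarrow>\<^sub>M count_space UNIV"
  by (rule measurable_completion) (simp add: dindex_measurable)

lemma nn_integral_dyadic:
  fixes F :: "real ^ 'n \<Rightarrow> ennreal"
  assumes [measurable]: "F \<in> borel_measurable lebesgue"
  shows "(\<integral>\<^sup>+x. F x \<partial>lebesgue) = (\<integral>\<^sup>+k. (\<integral>\<^sup>+x\<in>dcube j k. F x \<partial>lebesgue) \<partial>count_space UNIV)"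
proof -
  have "(\<integral>\<^sup>+k. F x * indicator (dcube j k) x \<partial>count_space UNIV) = F x" for x
  proof -
    have "(\<integral>\<^sup>+k. F x * indicator (dcube j k) x \<partial>count_space UNIV) =
        (\<integral>\<^sup>+k. F x * indicator {dindex j x} k \<partial>count_space UNIV)"
      by (intro nn_integral_cong) (auto simp: indicator_def mem_dcube_iff)
    then show ?thesis by (simp add: nn_integral_cmult)
  qed
  then have "(\<integral>\<^sup>+x. F x \<partial>lebesgue) = (\<integral>\<^sup>+x. (\<integral>\<^sup>+k. F x * indicator (dcube j k) x \<partial>count_space UNIV) \<partial>lebesgue)"
    by simp
  also have "\<dots> = (\<integral>\<^sup>+k. (\<integral>\<^sup>+x\<in>dcube j k. F x \<partial>lebesgue) \<partial>count_space UNIV)"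
    by (rule nn_integral_count_space_nn_integral)
      (use assms in \<open>auto intro!: borel_measurable_times_ennreal borel_measurable_indicator\<close>)
  finally show ?thesis .
qed

lemma nn_integral_lebesgue_translate:
  fixes F :: "real ^ 'n \<Rightarrow> ennreal"
  assumes F: "F \<in> borel_measurable lebesgue"
  shows "(\<lambda>x. F (a + x)) \<in> borel_measurable lebesgue"
    and "(\<integral>\<^sup>+x. F x \<partial>lebesgue) = (\<integral>\<^sup>+x. F (a + x) \<partial>lebesgue)"
proof -
  have T: "(\<lambda>x. a + (\<Sum>j\<in>Basis. (1 * (x \<bullet> j)) *\<^sub>R j)) = (\<lambda>x. a + x)"
    by (simp add: euclidean_representation)
  have m: "(\<lambda>x. a + x) \<in> lebesgue \<rightarrow>\<^sub>M lebesgue"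
    using lebesgue_affine_measurable[of "\<lambda>_. 1" a] unfolding T by simp
  then show "(\<lambda>x. F (a + x)) \<in> borel_measurable lebesgue"
    using F by (rule measurable_compose)
  have "lebesgue = density (distr lebesgue lebesgue (\<lambda>x. a + x)) (\<lambda>_. 1)"
    using lebesgue_affine_euclidean[of "\<lambda>_. 1" a] unfolding T by simp
  then have "(\<integral>\<^sup>+x. F x \<partial>lebesgue) = (\<integral>\<^sup>+x. F x \<partial>(distr lebesgue lebesgue (\<lambda>x. a + x)))"
    by (simp add: density_1)
  also have "\<dots> = (\<integral>\<^sup>+x. F (a + x) \<partial>lebesgue)"
    using F by (subst nn_integral_distr[OF m]) auto
  finally show "(\<integral>\<^sup>+x. F x \<partial>lebesgue) = (\<integral>\<^sup>+x. F (a + x) \<partial>lebesgue)" .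
qed

lemma nn_integral_dcube_translate:
  fixes F :: "real ^ 'n \<Rightarrow> ennreal"
  assumes F [measurable]: "F \<in> borel_measurable lebesgue"
  shows "(\<integral>\<^sup>+x\<in>dcube j k. F x \<partial>lebesgue) =
    (\<integral>\<^sup>+t\<in>cube 0 (2 powi (- j)). F ((2 powi (- j)) *\<^sub>R lat k + t) \<partial>lebesgue)"
proof -
  have "(\<lambda>x. F x * indicator (dcube j k) x) \<in> borel_measurable lebesgue"
    using F by (intro borel_measurable_times_ennreal borel_measurable_indicator) auto
  from nn_integral_lebesgue_translate(2)[OF this, of "(2 powi (- j)) *\<^sub>R lat k"]
  show ?thesis
    by (simp add: indicator_def dcube_def cube_def cong: if_cong)
qed

lemma emeasure_dcube: "emeasure lebesgue (dcube j k :: (real ^ 'n) set) = ennreal ((2 powi (- j)) ^ CARD('n))"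
  unfolding dcube_def by (rule emeasure_cube) simp

text \<open>The operator is a parameter so that it can be \<open>V x\<close> at a single point, or a
  functional. The decay \<open>L\<close> is at the caller's disposal and is paid for by the number
  of sinc factors.\<close>

lemma convolve_operator_le:
  fixes \<phi> :: "real ^ 'n \<Rightarrow> complex"
  assumes \<phi>: "littlewood_paley \<phi>" and \<delta>: "0 < \<delta>"
  obtains C where "0 < C" "\<And>(f :: (real ^ 'n \<Rightarrow> complex) \<Rightarrow> 'a::{complex_normed_vector, banach})
      (T :: ('a, 'b::complex_normed_vector) cblinfun) j k x t.
    f \<in> distributions_inf \<Longrightarrow> x \<in> dcube j k \<Longrightarrow> t \<in> cube 0 (2 powi (- j)) \<Longrightarrow>
    ennpowr (ennreal (norm (T (convolve (dilate j \<phi>) f x)))) \<delta> \<le>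
      ennreal C * (\<integral>\<^sup>+l. ennreal (ldist k l powr - L) *
        ennpowr (ennreal (norm (T (convolve (dilate j \<phi>) f ((2 powi (- j)) *\<^sub>R lat l + t))))) \<delta> \<partial>count_space UNIV)"
proof -
  \<comment> \<open>The power \<open>\<delta>\<close> reduces a decay \<open>M\<close> to
    \<open>M * \<delta>\<close>, which has to reach \<open>L\<close>. The additional 2 in
    \<open>M + 2\<close> below is spent by \<open>ldist_sum_power_le\<close>.\<close>
  define M where "M = nat \<lceil>L / \<delta>\<rceil>"
  have "L / \<delta> \<le> real M" unfolding M_def by linarith
  then have M: "L \<le> real M * \<delta>" using \<delta> by (simp add: pos_divide_le_eq)
  obtain C where C: "0 < C" "\<And>(f :: (real ^ 'n \<Rightarrow> complex) \<Rightarrow> 'a) j x t.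
    f \<in> distributions_inf \<Longrightarrow> \<exists>P. (\<forall>k. \<bar>P k\<bar> \<le> (\<Prod>i\<in>UNIV. C / (2 + \<bar>(2 powi j) * (x $ i - t $ i) - of_int (k i)\<bar>) ^ (M + 2))) \<and>
      ((\<lambda>k. P k *\<^sub>R convolve (dilate j \<phi>) f ((2 powi (- j)) *\<^sub>R lat k + t)) has_sum convolve (dilate j \<phi>) f x) UNIV"
    by (rule convolve_sampling[OF \<phi>, where M="M + 2"]) (rule that)
  obtain S where S: "0 < S" "\<And>k :: 'n \<Rightarrow> int. (\<integral>\<^sup>+l. ennreal (ldist k l powr - 2) \<partial>count_space UNIV) \<le> ennreal S"
    by (rule ldist_sum_bound) (rule that)
  define c where "c = C ^ CARD('n)"
  have c: "0 < c" using C(1) by (simp add: c_def)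
  show ?thesis
  proof (rule that[of "c powr \<delta> * S powr \<delta>"])
    show "0 < c powr \<delta> * S powr \<delta>" using c S(1) by simp
    fix f :: "(real ^ 'n \<Rightarrow> complex) \<Rightarrow> 'a" and T :: "('a, 'b) cblinfun" and j k and x t :: "real ^ 'n"
    assume f: "f \<in> distributions_inf" and x: "x \<in> dcube j k" and t: "t \<in> cube 0 (2 powi (- j))"
    define y where "y l = (2 powi (- j)) *\<^sub>R lat l + t" for l :: "'n \<Rightarrow> int"
    let ?g = "convolve (dilate j \<phi>) f"
    obtain P where P: "\<And>l. \<bar>P l\<bar> \<le> (\<Prod>i\<in>UNIV. C / (2 + \<bar>(2 powi j) * (x $ i - t $ i) - of_int (l i)\<bar>) ^ (M + 2))"
      "((\<lambda>l. P l *\<^sub>R ?g (y l)) has_sum ?g x) UNIV"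
      using C(2)[OF f, of j x t, folded y_def] by (elim exE conjE) (rule that, blast, assumption)
    have "(\<lambda>l. T (P l *\<^sub>R ?g (y l))) = (\<lambda>l. P l *\<^sub>R T (?g (y l)))"
      by (simp add: linear_scale[OF bounded_linear.linear[OF bounded_linear_cblinfun_apply]])
    with has_sum_bounded_linear[OF bounded_linear_cblinfun_apply P(2), of T]
    have hs: "((\<lambda>l. P l *\<^sub>R T (?g (y l))) has_sum T (?g x)) UNIV" by simp
    have Pl: "\<bar>P l\<bar> \<le> c * ldist k l powr - (real M + 2)" for l
    proof -
      have "(\<Prod>i\<in>UNIV. C / (2 + \<bar>(2 powi j) * (x $ i - t $ i) - of_int (l i)\<bar>) ^ (M + 2)) \<le>
          (\<Prod>i\<in>UNIV. C / (1 + \<bar>real_of_int (k i - l i)\<bar>) ^ (M + 2))"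
      proof (intro prod_mono conjI divide_left_mono power_mono mult_pos_pos zero_less_power)
        fix i
        \<comment> \<open>Rescaled, \<open>x\<close> lies in the unit cell at \<open>k\<close> and
          \<open>t\<close> in the one at 0, so each coordinate of \<open>x - t\<close> differs from
          that of \<open>k\<close> by at most 1; the \<open>2\<close> in the kernel bound absorbs
          this.\<close>
        have "of_int (k i) \<le> 2 powi j * x $ i" "2 powi j * x $ i < of_int (k i) + 1"
          using x by (auto simp: mem_dcube_iff dindex_def)
        moreover have "0 \<le> 2 powi j * t $ i" "2 powi j * t $ i < 1"
          using t by (auto simp: cube_def power_int_minus_divide less_divide_eq mult.commute)
        ultimately have "\<bar>real_of_int (k i - l i)\<bar> \<le> \<bar>(2 powi j) * (x $ i - t $ i) - of_int (l i)\<bar> + 1"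
          unfolding right_diff_distrib of_int_diff by linarith
        then show "1 + \<bar>real_of_int (k i - l i)\<bar> \<le> 2 + \<bar>(2 powi j) * (x $ i - t $ i) - of_int (l i)\<bar>" by linarith
      qed (use C(1) in auto)
      also have "\<dots> = c / ldist k l ^ (M + 2)"
        by (simp only: prod_dividef prod_constant c_def ldist_def prod_power_distrib)
      also have "\<dots> = c * ldist k l powr - (real M + 2)"
      proof -
        have "real M + 2 = real (M + 2)" by simp
        then have "ldist k l powr - (real M + 2) = 1 / ldist k l ^ (M + 2)"
          by (simp only: powr_minus_divide powr_realpow[OF ldist_pos])
        then show ?thesis by simp
      qed
      finally show ?thesis using P(1)[of l] by linarith
    qed
    let ?b = "\<lambda>l. ennreal (norm (T (?g (y l))))"
    have "ennreal (norm (T (?g x))) \<le> (\<integral>\<^sup>+l. ennreal (norm (P l *\<^sub>R T (?g (y l)))) \<partial>count_space UNIV)"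
      by (rule has_sum_norm_le_nn_integral[OF hs])
    also have "\<dots> \<le> (\<integral>\<^sup>+l. ennreal c * (ennreal (ldist k l powr - (real M + 2)) * ?b l) \<partial>count_space UNIV)"
    proof (rule nn_integral_mono)
      fix l
      have "ennreal (norm (P l *\<^sub>R T (?g (y l)))) \<le> ennreal ((c * ldist k l powr - (real M + 2)) * norm (T (?g (y l))))"
        unfolding norm_scaleR real_norm_def by (intro ennreal_leI mult_right_mono Pl) simp
      also have "\<dots> = ennreal c * (ennreal (ldist k l powr - (real M + 2)) * ?b l)"
        using c by (simp add: ennreal_mult mult.assoc)
      finally show "ennreal (norm (P l *\<^sub>R T (?g (y l)))) \<le> ennreal c * (ennreal (ldist k l powr - (real M + 2)) * ?b l)" .
    qed
    also have "\<dots> = ennreal c * (\<integral>\<^sup>+l. ennreal (ldist k l powr - (real M + 2)) * ?b l \<partial>count_space UNIV)"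
      by (rule nn_integral_cmult) simp
    finally have "ennpowr (ennreal (norm (T (?g x)))) \<delta> \<le>
        ennpowr (ennreal c * (\<integral>\<^sup>+l. ennreal (ldist k l powr - (real M + 2)) * ?b l \<partial>count_space UNIV)) \<delta>"
      using \<delta> by (intro ennpowr_mono)
    also have "\<dots> = ennreal (c powr \<delta>) * ennpowr (\<integral>\<^sup>+l. ennreal (ldist k l powr - (real M + 2)) * ?b l \<partial>count_space UNIV) \<delta>"
      using \<delta> c by (simp add: ennpowr_mult ennpowr_ennreal)
    also have "\<dots> \<le> ennreal (c powr \<delta>) * (ennreal (S powr \<delta>) *
        (\<integral>\<^sup>+l. ennreal (ldist k l powr - (real M * \<delta>)) * ennpowr (?b l) \<delta> \<partial>count_space UNIV))"
      by (intro mult_left_mono ldist_sum_power_le[OF S \<delta>]) simp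
    also have "\<dots> \<le> ennreal (c powr \<delta>) * (ennreal (S powr \<delta>) *
        (\<integral>\<^sup>+l. ennreal (ldist k l powr - L) * ennpowr (?b l) \<delta> \<partial>count_space UNIV))"
      using M ldist_ge_1 by (intro mult_left_mono nn_integral_mono mult_right_mono ennreal_leI powr_mono) auto
    also have "\<dots> = ennreal (c powr \<delta> * S powr \<delta>) * (\<integral>\<^sup>+l. ennreal (ldist k l powr - L) * ennpowr (?b l) \<delta> \<partial>count_space UNIV)"
      by (simp add: ennreal_mult mult.assoc)
    finally show "ennpowr (ennreal (norm (T (?g x)))) \<delta> \<le> ennreal (c powr \<delta> * S powr \<delta>) * (\<integral>\<^sup>+l. ennreal (ldist k l powr - L) *
        ennpowr (ennreal (norm (T (?g ((2 powi (- j)) *\<^sub>R lat l + t))))) \<delta> \<partial>count_space UNIV)"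
      unfolding y_def .
  qed
qed

section \<open>Comparison of the two integrals\<close>

text \<open>Hoelder's inequality against the indicator of the cube; the powers of the volume
  recombine because \<open>\<rho>\<close> is an average.\<close>

lemma rho_exponent_mono:
  fixes V :: "real ^ 'n \<Rightarrow> ('a::{complex_normed_vector, banach}, 'a) cblinfun"
  assumes V: "weight V" and t: "0 < t" "t \<le> P" and l: "0 < l"
  shows "\<rho> V t (cube a l) e \<le> \<rho> V P (cube a l) e"
proof (cases "t = P")
  case False
  then have tP: "t < P" and P: "0 < P" using t by auto
  note [measurable] = weight_measurable[OF V]
  let ?n = "l ^ CARD('n)" and ?Q = "cube a l"
  define F where "F x = ennpowr (ennreal (norm (V x e))) P * indicator ?Q x" for x
  have [measurable]: "F \<in> borel_measurable lebesgue" unfolding F_def by measurable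
  have tt: "0 < t / P" "t / P < 1" using t tP P by auto
  have "wint V t ?Q e = (\<integral>\<^sup>+x. ennpowr (F x) (t / P) * ennpowr (indicator ?Q x) (1 - t / P) \<partial>lebesgue)"
    unfolding wint_def F_def
    by (intro nn_integral_cong) (use P in \<open>auto simp: indicator_def ennpowr_ennpowr ennpowr_ennreal[of 1, simplified]\<close>)
  also have "\<dots> \<le> ennpowr (\<integral>\<^sup>+x. F x \<partial>lebesgue) (t / P) * ennpowr (\<integral>\<^sup>+x. indicator ?Q x \<partial>lebesgue) (1 - t / P)"
    by (rule nn_integral_hoelder[OF tt]) measurable
  also have "\<dots> = ennpowr (ennreal ?n * ennpowr (\<rho> V P ?Q e) P) (t / P) * ennpowr (ennreal ?n) (1 - t / P)"
    using wint_rho[OF l P, of V a e] l by (simp add: F_def wint_def emeasure_cube)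
  also have "\<dots> = ennreal (?n powr (t / P)) * ennpowr (\<rho> V P ?Q e) t * ennreal (?n powr (1 - t / P))"
    using tt P l by (simp add: ennpowr_mult ennpowr_ennpowr ennpowr_ennreal)
  also have "\<dots> = ennreal (?n powr (t / P) * ?n powr (1 - t / P)) * ennpowr (\<rho> V P ?Q e) t"
    by (simp only: ennreal_mult powr_ge_zero mult_ac)
  also have "?n powr (t / P) * ?n powr (1 - t / P) = ?n"
    using l by (simp flip: powr_add)
  finally show ?thesis using rho_le_iff[OF l t(1)] by blast
qed simp

text \<open>Both cubes lie in one cube of side \<open>h * ldist k l\<close>. Going up to it costs
  the volume ratio to the power \<open>1 / P\<close>, coming down to the other cube costs the
  exponent \<open>\<gamma>0\<close>.\<close>

lemma A_class_dcube_doubling: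
  fixes V :: "real ^ 'n \<Rightarrow> ('a::{complex_normed_vector, banach}, 'a) cblinfun"
  assumes V: "V \<in> A_class P" and P: "0 < P"
  obtains \<gamma> where "0 \<le> \<gamma>" "\<And>t. 0 < t \<Longrightarrow> \<exists>C\<ge>0. \<forall>j k l e.
    \<rho> V P (dcube j k) e \<le> ennreal (C * ldist k l powr \<gamma>) * \<rho> V t (dcube j l) e"
proof -
  obtain \<gamma>0 where \<gamma>0: "0 \<le> \<gamma>0" "\<And>t. 0 < t \<Longrightarrow> \<exists>C\<ge>0. \<forall>b m c l e. 0 < m \<longrightarrow> 0 < l \<longrightarrow> cube b m \<subseteq> cube c l \<longrightarrow>
    \<rho> V P (cube c l) e \<le> ennreal (C * (l / m) powr \<gamma>0) * \<rho> V t (cube b m) e"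
    using A_class_rho_le[OF V P] by blast
  define \<gamma> where "\<gamma> = CARD('n) / P + \<gamma>0"
  have "\<exists>C\<ge>0. \<forall>j k l e. \<rho> V P (dcube j k) e \<le> ennreal (C * ldist k l powr \<gamma>) * \<rho> V t (dcube j l) e" if t: "0 < t" for t
  proof -
    obtain C where C: "0 \<le> C" "\<And>b m c l e. 0 < m \<Longrightarrow> 0 < l \<Longrightarrow> cube b m \<subseteq> cube c l \<Longrightarrow>
      \<rho> V P (cube c l) e \<le> ennreal (C * (l / m) powr \<gamma>0) * \<rho> V t (cube b m) e"
      using \<gamma>0(2)[OF t] by blast
    have "\<rho> V P (dcube j k) e \<le> ennreal (C * ldist k l powr \<gamma>) * \<rho> V t (dcube j l) e" for j k l e
    proof -
      define h :: real where "h = 2 powi (- j)"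
      have h: "0 < h" by (simp add: h_def)
      let ?D = "ldist k l"
      have D: "0 < ?D" by (rule ldist_pos)
      \<comment> \<open>The corner is the coordinatewise minimum; \<open>ldist\<close> is at least
        every coordinate distance plus 1, the 1 being the width of a cell.\<close>
      define S where "S = cube (\<chi> i. h * of_int (min (k i) (l i))) (h * ?D)"
      have sub: "dcube j m \<subseteq> S" if "m = k \<or> m = l" for m
      proof
        fix x assume x: "x \<in> dcube j m"
        show "x \<in> S"
          unfolding S_def cube_def mem_Collect_eq
        proof (intro allI conjI)
          fix i
          have x1: "h * of_int (m i) \<le> x $ i" and x2: "x $ i < h * of_int (m i) + h"
            using x by (auto simp: dcube_def cube_def h_def)
          have "h * of_int (min (k i) (l i)) \<le> h * of_int (m i)"
            using that h by (intro mult_left_mono) auto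
          then show "(\<chi> i. h * of_int (min (k i) (l i))) $ i \<le> x $ i" using x1 by simp
          have "of_int (m i) + 1 \<le> of_int (min (k i) (l i)) + (1 + \<bar>real_of_int (k i - l i)\<bar>)"
            using that by auto
          also have "\<dots> \<le> of_int (min (k i) (l i)) + ?D" by (intro add_left_mono ldist_ge_component)
          finally have "h * (of_int (m i) + 1) \<le> h * (of_int (min (k i) (l i)) + ?D)"
            using h by (intro mult_left_mono) auto
          then show "x $ i < (\<chi> i. h * of_int (min (k i) (l i))) $ i + h * ?D"
            using x2 by (simp add: distrib_left)
        qed
      qed
      have "wint V P (dcube j k) e \<le> wint V P S e"
        unfolding wint_def using sub[of k] by (intro nn_integral_mono) (auto simp: indicator_def)
      also have "\<dots> = ennreal ((h * ?D) ^ CARD('n)) * ennpowr (\<rho> V P S e) P"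
        unfolding S_def using h D P by (intro wint_rho) auto
      also have "\<dots> = ennreal (h ^ CARD('n)) * ennpowr (ennreal (?D powr (CARD('n) / P)) * \<rho> V P S e) P"
        using h D P by (simp add: ennpowr_mult ennpowr_ennreal powr_powr powr_realpow power_mult_distrib ennreal_mult mult.assoc)
      finally have "\<rho> V P (dcube j k) e \<le> ennreal (?D powr (CARD('n) / P)) * \<rho> V P S e"
        using rho_le_iff[OF h P] unfolding dcube_def h_def[symmetric] by blast
      also have "\<rho> V P S e \<le> ennreal (C * (h * ?D / h) powr \<gamma>0) * \<rho> V t (dcube j l) e"
        using sub[of l] h D unfolding S_def dcube_def h_def[symmetric] by (intro C(2)) auto
      also have "h * ?D / h = ?D" using h by simp
      finally have "\<rho> V P (dcube j k) e \<le> ennreal (?D powr (CARD('n) / P)) * (ennreal (C * ?D powr \<gamma>0) * \<rho> V t (dcube j l) e)"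
        by (simp add: mult_left_mono)
      also have "\<dots> = ennreal (?D powr (CARD('n) / P) * (C * ?D powr \<gamma>0)) * \<rho> V t (dcube j l) e"
        using C(1) by (simp add: ennreal_mult mult.assoc)
      also have "?D powr (CARD('n) / P) * (C * ?D powr \<gamma>0) = C * ?D powr \<gamma>"
        by (simp add: \<gamma>_def powr_add)
      finally show ?thesis .
    qed
    then show ?thesis using C(1) by blast
  qed
  moreover have "0 \<le> \<gamma>" using \<gamma>0(1) P by (simp add: \<gamma>_def)
  ultimately show ?thesis by (rule that[rotated])
qed

text \<open>Sublevel sets are closed by lower semicontinuity; this works in a space without a
  countable dense set.\<close>

lemma rho_compose_measurable:
  fixes V :: "real ^ 'n \<Rightarrow> ('a::{complex_normed_vector, banach}, 'a) cblinfun" and g :: "real ^ 'm \<Rightarrow> 'a"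
  assumes V: "weight V" and t: "0 < t" and g: "continuous_on UNIV g"
  shows "(\<lambda>x. \<rho> V t (cube a l) (g x)) \<in> borel_measurable borel"
proof -
  have "(\<lambda>x. wint V t (cube a l) (g x)) \<in> borel_measurable borel"
  proof (rule borel_measurableI_greater)
    fix y
    have "closed {x. wint V t (cube a l) (g x) \<le> y}"
      unfolding closed_sequential_limits
    proof (intro allI impI, elim conjE)
      fix u x assume u: "\<forall>n. u n \<in> {x. wint V t (cube a l) (g x) \<le> y}" "u \<longlonglongrightarrow> x"
      have "(\<lambda>n. g (u n)) \<longlonglongrightarrow> g x"
        using continuous_on_tendsto_compose[OF g u(2)] by simp
      then have "wint V t (cube a l) (g x) \<le> liminf (\<lambda>n. wint V t (cube a l) (g (u n)))"
        by (rule wint_lsc[OF V t]) simp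
      also have "\<dots> \<le> liminf (\<lambda>n. y)" using u(1) by (intro Liminf_mono always_eventually) auto
      also have "\<dots> = y" by (simp add: Liminf_const)
      finally show "x \<in> {x. wint V t (cube a l) (g x) \<le> y}" by simp
    qed
    then have "open (- {x. wint V t (cube a l) (g x) \<le> y})" by (simp add: open_Compl)
    also have "- {x. wint V t (cube a l) (g x) \<le> y} = {x \<in> space borel. y < wint V t (cube a l) (g x)}" by auto
    finally show "{x \<in> space borel. y < wint V t (cube a l) (g x)} \<in> sets borel" by simp
  qed
  then show ?thesis unfolding avg_qnorm_def wint_def[symmetric] by measurable
qed

lemma rho_dyadic_measurable:
  fixes V :: "real ^ 'n \<Rightarrow> ('a::{complex_normed_vector, banach}, 'a) cblinfun"
  assumes V: "weight V" and t: "0 < t" and g: "continuous_on UNIV g"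
  shows "(\<lambda>x. \<rho> V t (dyadic_cube_at j x) (g x)) \<in> borel_measurable lebesgue"
  unfolding dyadic_cube_at_eq
proof (rule measurable_compose_countable'[where g="dindex j" and I=UNIV])
  show "(\<lambda>x. \<rho> V t (dcube j k) (g x)) \<in> borel_measurable lebesgue" for k
    unfolding dcube_def using rho_compose_measurable[OF V t g] by (intro measurable_completion) simp
qed auto

text \<open>\<open>V\<close> is measurable only against fixed vectors. Replacing the argument of
  \<open>g\<close> by the corner of its dyadic cube leaves countably many vectors, and continuity of
  \<open>g\<close> gives the limit as the cubes shrink.\<close>

lemma weight_compose_measurable:
  fixes V :: "real ^ 'n \<Rightarrow> ('a::{complex_normed_vector, banach}, 'a) cblinfun"
  assumes V: "weight V" and g: "continuous_on UNIV g"
  shows "(\<lambda>x. norm (V x (g x))) \<in> borel_measurable lebesgue"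
proof (rule borel_measurable_LIMSEQ_real)
  define q where "q m x = (2 powi (- int m)) *\<^sub>R lat (dindex (int m) x)" for m and x :: "real ^ 'n"
  show "(\<lambda>x. norm (V x (g (q m x)))) \<in> borel_measurable lebesgue" for m
    unfolding q_def
    by (rule measurable_compose_countable'[where g="dindex (int m)" and I=UNIV and f="\<lambda>k x. norm (V x (g ((2 powi (- int m)) *\<^sub>R lat k)))"])
      (auto intro: weight_measurable[OF V])
  fix x :: "real ^ 'n"
  have "(\<lambda>m. q m x) \<longlonglongrightarrow> x"
  proof (rule vec_tendstoI)
    fix i
    have le: "\<bar>q m x $ i - x $ i\<bar> \<le> (1 / 2) ^ m" for m
    proof -
      have "\<bar>of_int \<lfloor>2 ^ m * x $ i\<rfloor> - 2 ^ m * x $ i\<bar> \<le> 1" by linarith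
      then have "(1 / 2) ^ m * \<bar>of_int \<lfloor>2 ^ m * x $ i\<rfloor> - 2 ^ m * x $ i\<bar> \<le> (1 / 2) ^ m * 1"
        by (intro mult_left_mono) auto
      also have "(1 / 2) ^ m * \<bar>of_int \<lfloor>2 ^ m * x $ i\<rfloor> - 2 ^ m * x $ i\<bar> = \<bar>(1 / 2) ^ m * (of_int \<lfloor>2 ^ m * x $ i\<rfloor> - 2 ^ m * x $ i)\<bar>"
        by (simp add: abs_mult)
      also have "(1 / 2) ^ m * (of_int \<lfloor>2 ^ m * x $ i\<rfloor> - 2 ^ m * x $ i) = q m x $ i - x $ i"
        by (simp add: q_def dindex_def power_int_minus right_diff_distrib power_one_over inverse_eq_divide)
      finally show ?thesis by simp
    qed
    have "(\<lambda>m. q m x $ i - x $ i) \<longlonglongrightarrow> 0"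
    proof (rule Lim_null_comparison)
      show "(\<lambda>m. (1 / 2 :: real) ^ m) \<longlonglongrightarrow> 0" by (rule LIMSEQ_power_zero) simp
      show "\<forall>\<^sub>F m in sequentially. norm (q m x $ i - x $ i) \<le> (1 / 2) ^ m"
        unfolding real_norm_def by (intro always_eventually allI le)
    qed
    then show "(\<lambda>m. q m x $ i) \<longlonglongrightarrow> x $ i" by (rule LIM_zero_cancel)
  qed
  then have "(\<lambda>m. g (q m x)) \<longlonglongrightarrow> g x" using continuous_on_tendsto_compose[OF g] by simp
  then show "(\<lambda>m. norm (V x (g (q m x)))) \<longlonglongrightarrow> norm (V x (g x))"
    by (intro tendsto_norm bounded_linear.tendsto[OF bounded_linear_cblinfun_apply])
qed

text \<open>Schur's test in its simplest form: the kernel is symmetric, so the row bound serves for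
  the columns.\<close>

lemma ldist_double_sum_le:
  assumes S: "\<And>k :: 'n::finite \<Rightarrow> int. (\<integral>\<^sup>+l. ennreal (ldist k l powr - 2) \<partial>count_space UNIV) \<le> ennreal S"
  shows "(\<integral>\<^sup>+k. (\<integral>\<^sup>+l. ennreal (ldist (k :: 'n \<Rightarrow> int) l powr - 2) * b l \<partial>count_space UNIV) \<partial>count_space UNIV) \<le>
    ennreal S * (\<integral>\<^sup>+l. b l \<partial>count_space UNIV)"
proof -
  have "(\<integral>\<^sup>+k. (\<integral>\<^sup>+l. ennreal (ldist k l powr - 2) * b l \<partial>count_space UNIV) \<partial>count_space UNIV) =
      (\<integral>\<^sup>+l. (\<integral>\<^sup>+k. ennreal (ldist k l powr - 2) * b l \<partial>count_space UNIV) \<partial>count_space UNIV)"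
    by (rule nn_integral_count_space_nn_integral) auto
  also have "\<dots> = (\<integral>\<^sup>+l. (\<integral>\<^sup>+k. ennreal (ldist l k powr - 2) \<partial>count_space UNIV) * b l \<partial>count_space UNIV)"
    by (simp add: nn_integral_multc ldist_commute)
  also have "\<dots> \<le> (\<integral>\<^sup>+l. ennreal S * b l \<partial>count_space UNIV)"
    by (intro nn_integral_mono mult_right_mono S) simp
  also have "\<dots> = ennreal S * (\<integral>\<^sup>+l. b l \<partial>count_space UNIV)"
    by (simp add: nn_integral_cmult)
  finally show ?thesis .
qed

text \<open>The sampling bound holds for every offset \<open>t\<close> in one cell. Averaging over
  \<open>t\<close> sweeps each sample point across its dyadic cube and turns point values into
  integrals, with the volume of the cell on the left.\<close>

lemma shift_average_le:
  fixes R :: "('n::finite \<Rightarrow> int) \<Rightarrow> real ^ 'n \<Rightarrow> ennreal" and j :: int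
  defines "h \<equiv> 2 powi (- j) :: real"
  assumes R: "\<And>l. R l \<in> borel_measurable lebesgue"
    and le: "\<And>t. t \<in> cube 0 h \<Longrightarrow> A \<le> (\<integral>\<^sup>+l. c l * R l (h *\<^sub>R lat l + t) \<partial>count_space UNIV)"
  shows "ennreal (h ^ CARD('n)) * A \<le> (\<integral>\<^sup>+l. c l * (\<integral>\<^sup>+x\<in>dcube j l. R l x \<partial>lebesgue) \<partial>count_space UNIV)"
proof -
  have h: "0 < h" by (simp add: h_def)
  have m: "(\<lambda>t. R l (h *\<^sub>R lat l + t) * indicator (cube 0 h) t) \<in> borel_measurable lebesgue" for l
    using nn_integral_lebesgue_translate(1)[OF R] by (intro borel_measurable_times_ennreal borel_measurable_indicator) simp_all
  have "ennreal (h ^ CARD('n)) * A = (\<integral>\<^sup>+t. A * indicator (cube 0 h) t \<partial>(lebesgue :: (real ^ 'n) measure))"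
    using h by (subst nn_integral_cmult_indicator) (auto simp: emeasure_cube mult.commute)
  also have "\<dots> \<le> (\<integral>\<^sup>+t. (\<integral>\<^sup>+l. c l * (R l (h *\<^sub>R lat l + t) * indicator (cube 0 h) t) \<partial>count_space UNIV) \<partial>lebesgue)"
    by (intro nn_integral_mono) (auto simp: le split: split_indicator)
  also have "\<dots> = (\<integral>\<^sup>+l. (\<integral>\<^sup>+t. c l * (R l (h *\<^sub>R lat l + t) * indicator (cube 0 h) t) \<partial>lebesgue) \<partial>count_space UNIV)"
    by (rule nn_integral_count_space_nn_integral) (use m in \<open>auto intro!: borel_measurable_times_ennreal\<close>)
  also have "\<dots> = (\<integral>\<^sup>+l. c l * (\<integral>\<^sup>+t\<in>cube 0 h. R l (h *\<^sub>R lat l + t) \<partial>lebesgue) \<partial>count_space UNIV)"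
    by (intro nn_integral_cong nn_integral_cmult m)
  also have "\<dots> = (\<integral>\<^sup>+l. c l * (\<integral>\<^sup>+x\<in>dcube j l. R l x \<partial>lebesgue) \<partial>count_space UNIV)"
    unfolding h_def nn_integral_dcube_translate[OF R] ..
  finally show ?thesis .
qed

text \<open>In each term the sampled vector is fixed while \<open>x\<close> runs through cube
  \<open>k\<close>, so the integral is an average of that vector over cube \<open>k\<close>.
  Doubling moves it to cube \<open>l\<close>, where the sample lies, at the price of a power of
  \<open>ldist\<close> that the kernel absorbs.\<close>

lemma weight_integral_le_avg:
  fixes V :: "real ^ 'n \<Rightarrow> ('a::{complex_normed_vector, banach}, 'a) cblinfun"
  assumes p: "0 < p" "p \<le> P" and r: "0 < r" and \<phi>: "littlewood_paley \<phi>" and V: "V \<in> A_class P"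
  obtains K where "0 < K" "\<And>f j. f \<in> distributions_inf \<Longrightarrow>
    (\<integral>\<^sup>+x. ennpowr (ennreal (norm (V x (convolve (dilate j \<phi>) f x)))) p \<partial>lebesgue) \<le>
    ennreal K * (\<integral>\<^sup>+x. ennpowr (\<rho> V r (dyadic_cube_at j x) (convolve (dilate j \<phi>) f x)) p \<partial>lebesgue)"
proof -
  have P: "0 < P" using p by simp
  have w: "weight V" using V by (simp add: A_class_def p_weight_def)
  obtain \<gamma> where \<gamma>: "0 \<le> \<gamma>" "\<And>t. 0 < t \<Longrightarrow> \<exists>C\<ge>0. \<forall>j k l e.
    \<rho> V P (dcube j k) e \<le> ennreal (C * ldist k l powr \<gamma>) * \<rho> V t (dcube j l) e"
    using A_class_dcube_doubling[OF V P] by blast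
  obtain C2 where C2: "0 \<le> C2" "\<And>j k l e. \<rho> V P (dcube j k) e \<le> ennreal (C2 * ldist k l powr \<gamma>) * \<rho> V r (dcube j l) e"
    using \<gamma>(2)[OF r] by blast
  \<comment> \<open>Of the decay, \<open>\<gamma> * p\<close> is used up by doubling, and the
    remaining 2 makes the lattice sums converge.\<close>
  obtain C1 where C1: "0 < C1" "\<And>(f :: (real ^ 'n \<Rightarrow> complex) \<Rightarrow> 'a) (T :: ('a, 'a) cblinfun) j k x t.
    f \<in> distributions_inf \<Longrightarrow> x \<in> dcube j k \<Longrightarrow> t \<in> cube 0 (2 powi (- j)) \<Longrightarrow>
    ennpowr (ennreal (norm (T (convolve (dilate j \<phi>) f x)))) p \<le>
      ennreal C1 * (\<integral>\<^sup>+l. ennreal (ldist k l powr - (\<gamma> * p + 2)) *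
        ennpowr (ennreal (norm (T (convolve (dilate j \<phi>) f ((2 powi (- j)) *\<^sub>R lat l + t))))) p \<partial>count_space UNIV)"
    by (rule convolve_operator_le[OF \<phi> p(1), where L="\<gamma> * p + 2"]) (rule that)
  obtain S where S: "0 < S" "\<And>k :: 'n \<Rightarrow> int. (\<integral>\<^sup>+l. ennreal (ldist k l powr - 2) \<partial>count_space UNIV) \<le> ennreal S"
    by (rule ldist_sum_bound) (rule that)
  define K where "K = C1 * C2 powr p * S"
  have K: "0 \<le> K" using C1(1) S(1) by (simp add: K_def)
  have main: "(\<integral>\<^sup>+x. ennpowr (ennreal (norm (V x (convolve (dilate j \<phi>) f x)))) p \<partial>lebesgue) \<le>
    ennreal K * (\<integral>\<^sup>+x. ennpowr (\<rho> V r (dyadic_cube_at j x) (convolve (dilate j \<phi>) f x)) p \<partial>lebesgue)"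
    if f: "f \<in> distributions_inf" for f j
  proof -
    define g where "g = convolve (dilate j \<phi>) f"
    have gc: "continuous_on UNIV g" unfolding g_def by (rule convolve_continuous[OF \<phi> f])
    define h :: real where "h = 2 powi (- j)"
    have h: "0 < h" by (simp add: h_def)
    define H where "H = h ^ CARD('n)"
    have H: "0 < H" using h by (simp add: H_def)
    have mI: "(\<lambda>x. ennpowr (ennreal (norm (V x (g x)))) p) \<in> borel_measurable lebesgue"
      by (rule measurable_ennpowr[OF measurable_compose[OF weight_compose_measurable[OF w gc] measurable_ennreal]])
    have mR: "(\<lambda>x. ennpowr (\<rho> V r (dyadic_cube_at j x) (g x)) p) \<in> borel_measurable lebesgue"
      by (rule measurable_ennpowr[OF rho_dyadic_measurable[OF w r gc]])
    have mV: "(\<lambda>x. c * (d * (ennpowr (ennreal (norm (V x e))) p * indicator (dcube j k) x))) \<in> borel_measurable lebesgue"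
      for c d e k
      by (intro borel_measurable_times_ennreal borel_measurable_const borel_measurable_indicator
          measurable_ennpowr measurable_compose[OF weight_measurable[OF w] measurable_ennreal]) simp
    let ?I = "\<integral>\<^sup>+x. ennpowr (ennreal (norm (V x (g x)))) p \<partial>lebesgue"
    define R where "R l y = ennpowr (\<rho> V r (dcube j l) (g y)) p" for l y
    have R_meas: "R l \<in> borel_measurable lebesgue" for l
    proof -
      have "(\<lambda>y. \<rho> V r (dcube j l) (g y)) \<in> borel_measurable lebesgue"
        unfolding dcube_def using rho_compose_measurable[OF w r gc] by (intro measurable_completion) simp
      then show ?thesis unfolding R_def by measurable
    qed
    \<comment> \<open>The exponent is first raised from \<open>p\<close> to \<open>P\<close>;
      doubling then passes to cube \<open>l\<close> and to the exponent \<open>r\<close> in one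
      step.\<close>
    have cell: "wint V p (dcube j k) e \<le> ennreal H * (ennreal (C2 powr p * ldist k l powr (\<gamma> * p)) * ennpowr (\<rho> V r (dcube j l) e) p)" for k l e
    proof -
      have "\<rho> V p (dcube j k) e \<le> \<rho> V P (dcube j k) e"
        unfolding dcube_def h_def[symmetric] by (rule rho_exponent_mono[OF w p h])
      also have "\<dots> \<le> ennreal (C2 * ldist k l powr \<gamma>) * \<rho> V r (dcube j l) e" by (rule C2(2))
      finally have "wint V p (dcube j k) e \<le> ennreal H * ennpowr (ennreal (C2 * ldist k l powr \<gamma>) * \<rho> V r (dcube j l) e) p"
        unfolding H_def using rho_le_iff[OF h p(1)] unfolding dcube_def h_def[symmetric] by blast
      also have "ennpowr (ennreal (C2 * ldist k l powr \<gamma>) * \<rho> V r (dcube j l) e) p =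
          ennreal (C2 powr p * ldist k l powr (\<gamma> * p)) * ennpowr (\<rho> V r (dcube j l) e) p"
        using p(1) C2(1) by (subst ennpowr_mult) (simp_all add: ennpowr_ennreal powr_mult powr_powr)
      finally show ?thesis .
    qed
    \<comment> \<open>For a fixed offset the right side consists of point values of
      \<open>R\<close>; \<open>shift_average_le\<close> integrates them.\<close>
    have tau: "?I \<le> ennreal (H * K) * (\<integral>\<^sup>+l. R l (h *\<^sub>R lat l + t) \<partial>count_space UNIV)" if t: "t \<in> cube 0 h" for t
    proof -
      let ?y = "\<lambda>l. h *\<^sub>R lat l + t"
      have "?I = (\<integral>\<^sup>+k. (\<integral>\<^sup>+x\<in>dcube j k. ennpowr (ennreal (norm (V x (g x)))) p \<partial>lebesgue) \<partial>count_space UNIV)"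
        by (rule nn_integral_dyadic[OF mI])
      also have "\<dots> \<le> (\<integral>\<^sup>+k. (\<integral>\<^sup>+l. ennreal (ldist k l powr - 2) * (ennreal (H * (C1 * C2 powr p)) * R l (?y l)) \<partial>count_space UNIV) \<partial>count_space UNIV)"
      proof (rule nn_integral_mono)
        fix k
        have "(\<integral>\<^sup>+x\<in>dcube j k. ennpowr (ennreal (norm (V x (g x)))) p \<partial>lebesgue) \<le>
            (\<integral>\<^sup>+x. (\<integral>\<^sup>+l. ennreal C1 * (ennreal (ldist k l powr - (\<gamma> * p + 2)) *
              (ennpowr (ennreal (norm (V x (g (?y l))))) p * indicator (dcube j k) x)) \<partial>count_space UNIV) \<partial>lebesgue)"
        proof (rule nn_integral_mono)
          fix x
          show "ennpowr (ennreal (norm (V x (g x)))) p * indicator (dcube j k) x \<le>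
            (\<integral>\<^sup>+l. ennreal C1 * (ennreal (ldist k l powr - (\<gamma> * p + 2)) *
              (ennpowr (ennreal (norm (V x (g (?y l))))) p * indicator (dcube j k) x)) \<partial>count_space UNIV)"
          proof (cases "x \<in> dcube j k")
            case True
            then show ?thesis
              using C1(2)[OF f True, of t "V x"] t unfolding g_def h_def by (simp add: nn_integral_cmult)
          qed simp
        qed
        also have "\<dots> = (\<integral>\<^sup>+l. (\<integral>\<^sup>+x. ennreal C1 * (ennreal (ldist k l powr - (\<gamma> * p + 2)) *
              (ennpowr (ennreal (norm (V x (g (?y l))))) p * indicator (dcube j k) x)) \<partial>lebesgue) \<partial>count_space UNIV)"
          by (rule nn_integral_count_space_nn_integral[OF _ mV]) simp
        also have "\<dots> = (\<integral>\<^sup>+l. ennreal C1 * (ennreal (ldist k l powr - (\<gamma> * p + 2)) * wint V p (dcube j k) (g (?y l))) \<partial>count_space UNIV)"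
        proof (rule nn_integral_cong)
          fix l
          have m: "(\<lambda>x. ennpowr (ennreal (norm (V x (g (?y l))))) p * indicator (dcube j k) x) \<in> borel_measurable lebesgue"
            using mV[of 1 1 "g (?y l)" k] by simp
          then have m': "(\<lambda>x. c * (ennpowr (ennreal (norm (V x (g (?y l))))) p * indicator (dcube j k) x)) \<in> borel_measurable lebesgue" for c
            using mV[of 1 c "g (?y l)" k] by simp
          show "(\<integral>\<^sup>+x. ennreal C1 * (ennreal (ldist k l powr - (\<gamma> * p + 2)) *
              (ennpowr (ennreal (norm (V x (g (?y l))))) p * indicator (dcube j k) x)) \<partial>lebesgue) =
              ennreal C1 * (ennreal (ldist k l powr - (\<gamma> * p + 2)) * wint V p (dcube j k) (g (?y l)))"
            unfolding nn_integral_cmult[OF m'] nn_integral_cmult[OF m] wint_def ..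
        qed
        also have "\<dots> \<le> (\<integral>\<^sup>+l. ennreal (ldist k l powr - 2) * (ennreal (H * (C1 * C2 powr p)) * R l (?y l)) \<partial>count_space UNIV)"
        proof (rule nn_integral_mono)
          fix l
          let ?D = "ldist k l"
          have "ennreal C1 * (ennreal (?D powr - (\<gamma> * p + 2)) * wint V p (dcube j k) (g (?y l))) \<le>
              ennreal C1 * (ennreal (?D powr - (\<gamma> * p + 2)) * (ennreal H * (ennreal (C2 powr p * ?D powr (\<gamma> * p)) * R l (?y l))))"
            unfolding R_def by (intro mult_left_mono cell) auto
          also have "\<dots> = ennreal (C1 * (?D powr - (\<gamma> * p + 2) * (H * (C2 powr p * ?D powr (\<gamma> * p))))) * R l (?y l)"
            using C1(1) H by (simp add: ennreal_mult mult.assoc)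
          also have "C1 * (?D powr - (\<gamma> * p + 2) * (H * (C2 powr p * ?D powr (\<gamma> * p)))) =
              (?D powr - (\<gamma> * p + 2) * ?D powr (\<gamma> * p)) * (H * (C1 * C2 powr p))" by simp
          also have "?D powr - (\<gamma> * p + 2) * ?D powr (\<gamma> * p) = ?D powr - 2"
            by (simp flip: powr_add)
          also have "ennreal (?D powr - 2 * (H * (C1 * C2 powr p))) * R l (?y l) =
              ennreal (?D powr - 2) * (ennreal (H * (C1 * C2 powr p)) * R l (?y l))"
            using C1(1) H by (simp add: ennreal_mult mult.assoc)
          finally show "ennreal C1 * (ennreal (?D powr - (\<gamma> * p + 2)) * wint V p (dcube j k) (g (?y l))) \<le>
            ennreal (?D powr - 2) * (ennreal (H * (C1 * C2 powr p)) * R l (?y l))" .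
        qed
        finally show "(\<integral>\<^sup>+x\<in>dcube j k. ennpowr (ennreal (norm (V x (g x)))) p \<partial>lebesgue) \<le>
            (\<integral>\<^sup>+l. ennreal (ldist k l powr - 2) * (ennreal (H * (C1 * C2 powr p)) * R l (?y l)) \<partial>count_space UNIV)" .
      qed
      also have "\<dots> \<le> ennreal S * (\<integral>\<^sup>+l. ennreal (H * (C1 * C2 powr p)) * R l (?y l) \<partial>count_space UNIV)"
        by (rule ldist_double_sum_le[OF S(2)])
      also have "\<dots> = ennreal S * (ennreal (H * (C1 * C2 powr p)) * (\<integral>\<^sup>+l. R l (?y l) \<partial>count_space UNIV))"
        by (simp add: nn_integral_cmult)
      also have "\<dots> = ennreal (S * (H * (C1 * C2 powr p))) * (\<integral>\<^sup>+l. R l (?y l) \<partial>count_space UNIV)"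
        using S(1) H C1(1) by (simp add: ennreal_mult mult.assoc)
      also have "S * (H * (C1 * C2 powr p)) = H * K" by (simp add: K_def)
      finally show ?thesis .
    qed
    have "ennreal H * ?I \<le> (\<integral>\<^sup>+l. ennreal (H * K) * (\<integral>\<^sup>+x\<in>dcube j l. R l x \<partial>lebesgue) \<partial>count_space UNIV)"
      unfolding H_def h_def
      by (rule shift_average_le[OF R_meas]) (use tau in \<open>simp add: nn_integral_cmult H_def h_def\<close>)
    also have "\<dots> = ennreal (H * K) * (\<integral>\<^sup>+l. (\<integral>\<^sup>+x\<in>dcube j l. R l x \<partial>lebesgue) \<partial>count_space UNIV)"
      by (simp add: nn_integral_cmult)
    also have "(\<integral>\<^sup>+l. (\<integral>\<^sup>+x\<in>dcube j l. R l x \<partial>lebesgue) \<partial>count_space UNIV) =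
        (\<integral>\<^sup>+l. (\<integral>\<^sup>+x\<in>dcube j l. ennpowr (\<rho> V r (dyadic_cube_at j x) (g x)) p \<partial>lebesgue) \<partial>count_space UNIV)"
      by (intro nn_integral_cong) (auto simp: R_def dyadic_cube_at_eq mem_dcube_iff indicator_def)
    also have "\<dots> = (\<integral>\<^sup>+x. ennpowr (\<rho> V r (dyadic_cube_at j x) (g x)) p \<partial>lebesgue)"
      by (rule nn_integral_dyadic[OF mR, symmetric])
    finally have "ennreal H * ?I \<le> ennreal H * (ennreal K * (\<integral>\<^sup>+x. ennpowr (\<rho> V r (dyadic_cube_at j x) (g x)) p \<partial>lebesgue))"
      using H K by (simp add: ennreal_mult mult.assoc)
    then show ?thesis
      using H by (subst (asm) ennreal_mult_le_mult_iff) (auto simp: ennreal_eq_0_iff not_le g_def)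
  qed
  \<comment> \<open>\<open>C2\<close> is only known to be nonnegative, so \<open>K\<close> may be
    0.\<close>
  show ?thesis
  proof (rule that[of "K + 1"])
    show "0 < K + 1" using K by simp
    fix f j assume f: "f \<in> (distributions_inf :: ((real ^ 'n \<Rightarrow> complex) \<Rightarrow> 'a) set)"
    show "(\<integral>\<^sup>+x. ennpowr (ennreal (norm (V x (convolve (dilate j \<phi>) f x)))) p \<partial>lebesgue) \<le>
      ennreal (K + 1) * (\<integral>\<^sup>+x. ennpowr (\<rho> V r (dyadic_cube_at j x) (convolve (dilate j \<phi>) f x)) p \<partial>lebesgue)"
      by (rule order_trans[OF main[OF f]]) (intro mult_right_mono ennreal_leI, auto)
  qed
qed

text \<open>The pointwise bound has a null set for each vector, and \<open>g y\<close> changes with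
  \<open>y\<close>. Continuity puts all values of \<open>g\<close> into the closure of a countable
  set. The bound extends there since, for fixed \<open>y\<close>, its right side is continuous and
  its left side lower semicontinuous in the vector.\<close>

lemma avg_integral_le_weight_le_1:
  fixes V :: "real ^ 'n \<Rightarrow> ('a::{complex_normed_vector, banach}, 'a) cblinfun"
  assumes p: "0 < p" and r: "0 < r" "r \<le> P" and P: "P \<le> 1" and \<phi>: "littlewood_paley \<phi>" and V: "V \<in> A_class P"
  obtains K where "0 < K" "\<And>f j. f \<in> distributions_inf \<Longrightarrow>
    (\<integral>\<^sup>+x. ennpowr (\<rho> V r (dyadic_cube_at j x) (convolve (dilate j \<phi>) f x)) p \<partial>lebesgue) \<le>
    ennreal K * (\<integral>\<^sup>+x. ennpowr (ennreal (norm (V x (convolve (dilate j \<phi>) f x)))) p \<partial>lebesgue)"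
proof -
  have P0: "0 < P" using r by simp
  have w: "weight V" using V by (simp add: A_class_def p_weight_def)
  obtain C where C: "0 \<le> C" "\<And>a l e. 0 < l \<Longrightarrow>
    AE y in lebesgue. y \<in> cube a l \<longrightarrow> \<rho> V P (cube a l) e \<le> ennreal (C * norm (V y e))"
    using A_class_le_1_pointwise[OF V P0 P] by blast
  have main: "(\<integral>\<^sup>+x. ennpowr (\<rho> V r (dyadic_cube_at j x) (convolve (dilate j \<phi>) f x)) p \<partial>lebesgue) \<le>
    ennreal (C powr p) * (\<integral>\<^sup>+x. ennpowr (ennreal (norm (V x (convolve (dilate j \<phi>) f x)))) p \<partial>lebesgue)"
    if f: "f \<in> distributions_inf" for f j
  proof -
    define g where "g = convolve (dilate j \<phi>) f"
    have gc: "continuous_on UNIV g" unfolding g_def by (rule convolve_continuous[OF \<phi> f])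
    define h :: real where "h = 2 powi (- j)"
    have h: "0 < h" by (simp add: h_def)
    obtain D :: "(real ^ 'n) set" where D: "countable D" "\<And>X. open X \<Longrightarrow> X \<noteq> {} \<Longrightarrow> \<exists>d\<in>D. d \<in> X"
      using countable_dense_exists by blast
    have "closure D = UNIV"
    proof (rule ccontr)
      assume "closure D \<noteq> UNIV"
      then obtain d where "d \<in> D" "d \<in> - closure D" using D(2)[of "- closure D"] by auto
      then show False using closure_subset by blast
    qed
    then have gD: "g y \<in> closure (g ` D)" for y
      using image_closure_subset[of D g "closure (g ` D)"] gc closure_subset[of "g ` D"]
      by (auto simp: image_subset_iff)
    have cD: "countable (g ` D)" using D(1) by simp
    have cell: "AE y in lebesgue. y \<in> dcube j k \<longrightarrow> \<rho> V P (dcube j k) (g y) \<le> ennreal (C * norm (V y (g y)))" for k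
    proof -
      have "AE y in lebesgue. \<forall>e\<in>g ` D. y \<in> dcube j k \<longrightarrow> \<rho> V P (dcube j k) e \<le> ennreal (C * norm (V y e))"
        unfolding AE_ball_countable[OF cD] dcube_def h_def[symmetric] using C(2)[OF h] by blast
      then show ?thesis
      proof eventually_elim
        fix y assume y: "\<forall>e\<in>g ` D. y \<in> dcube j k \<longrightarrow> \<rho> V P (dcube j k) e \<le> ennreal (C * norm (V y e))"
        have rl: "\<rho> V P (dcube j k) u \<le> ennreal (C * norm (V y u)) \<longleftrightarrow>
            wint V P (dcube j k) u \<le> ennreal (h ^ CARD('n) * (C * norm (V y u)) powr P)" for u
          unfolding dcube_def h_def[symmetric] rho_le_iff[OF h P0]
          by (subst ennpowr_ennreal, simp add: C, subst ennreal_mult, use h in simp_all)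
        show "y \<in> dcube j k \<longrightarrow> \<rho> V P (dcube j k) (g y) \<le> ennreal (C * norm (V y (g y)))"
        proof
          assume yk: "y \<in> dcube j k"
          show "\<rho> V P (dcube j k) (g y) \<le> ennreal (C * norm (V y (g y)))"
            unfolding rl
          proof (rule wint_closure[OF w P0 _ gD, where h="\<lambda>u. u" and b="\<lambda>u. h ^ CARD('n) * (C * norm (V y u)) powr P"])
            have "continuous_on UNIV (cblinfun_apply (V y))"
              using bounded_linear_cblinfun_apply by (rule linear_continuous_on)
            then show "continuous_on UNIV (\<lambda>u. h ^ CARD('n) * (C * norm (V y u)) powr P)"
              using P0 C(1) by (intro continuous_intros continuous_on_powr') auto
            show "wint V P (dcube j k) u \<le> ennreal (h ^ CARD('n) * (C * norm (V y u)) powr P)" if "u \<in> g ` D" for u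
              using y that yk rl by blast
          qed auto
        qed
      qed
    qed
    have "AE y in lebesgue. \<forall>k. y \<in> dcube j k \<longrightarrow> \<rho> V P (dcube j k) (g y) \<le> ennreal (C * norm (V y (g y)))"
      using cell by (simp add: AE_all_countable)
    then have "AE y in lebesgue. ennpowr (\<rho> V r (dyadic_cube_at j y) (g y)) p \<le>
        ennreal (C powr p) * ennpowr (ennreal (norm (V y (g y)))) p"
    proof eventually_elim
      fix y assume y: "\<forall>k. y \<in> dcube j k \<longrightarrow> \<rho> V P (dcube j k) (g y) \<le> ennreal (C * norm (V y (g y)))"
      have "\<rho> V r (dyadic_cube_at j y) (g y) \<le> \<rho> V P (dyadic_cube_at j y) (g y)"
        unfolding dyadic_cube_at_eq dcube_def h_def[symmetric] by (rule rho_exponent_mono[OF w r h])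
      also have "\<dots> \<le> ennreal (C * norm (V y (g y)))"
        using y by (simp add: dyadic_cube_at_eq mem_dcube_iff)
      finally have "ennpowr (\<rho> V r (dyadic_cube_at j y) (g y)) p \<le> ennpowr (ennreal (C * norm (V y (g y)))) p"
        using p by (intro ennpowr_mono)
      then show "ennpowr (\<rho> V r (dyadic_cube_at j y) (g y)) p \<le> ennreal (C powr p) * ennpowr (ennreal (norm (V y (g y)))) p"
        using p C(1) by (simp add: ennreal_mult ennpowr_mult ennpowr_ennreal)
    qed
    then have "(\<integral>\<^sup>+x. ennpowr (\<rho> V r (dyadic_cube_at j x) (g x)) p \<partial>lebesgue) \<le>
        (\<integral>\<^sup>+x. ennreal (C powr p) * ennpowr (ennreal (norm (V x (g x)))) p \<partial>lebesgue)"
      by (rule nn_integral_mono_AE)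
    also have "\<dots> = ennreal (C powr p) * (\<integral>\<^sup>+x. ennpowr (ennreal (norm (V x (g x)))) p \<partial>lebesgue)"
      by (rule nn_integral_cmult)
        (rule measurable_ennpowr[OF measurable_compose[OF weight_compose_measurable[OF w gc] measurable_ennreal]])
    finally show ?thesis unfolding g_def .
  qed
  show ?thesis
  proof (rule that[of "C powr p + 1"])
    show "0 < C powr p + 1" by (simp add: add_nonneg_pos)
    fix f j assume f: "f \<in> (distributions_inf :: ((real ^ 'n \<Rightarrow> complex) \<Rightarrow> 'a) set)"
    show "(\<integral>\<^sup>+x. ennpowr (\<rho> V r (dyadic_cube_at j x) (convolve (dilate j \<phi>) f x)) p \<partial>lebesgue) \<le>
      ennreal (C powr p + 1) * (\<integral>\<^sup>+x. ennpowr (ennreal (norm (V x (convolve (dilate j \<phi>) f x)))) p \<partial>lebesgue)"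
      by (rule order_trans[OF main[OF f]]) (intro mult_right_mono ennreal_leI, auto)
  qed
qed

text \<open>The functional is chosen for one \<open>x\<close> and one cube, and the average over the
  grid offsets is taken before \<open>x\<close> moves; so no measurable choice of functionals
  arises.\<close>

lemma rho_convolve_le_weight_integral:
  fixes V :: "real ^ 'n \<Rightarrow> ('a::{complex_normed_vector, banach}, 'a) cblinfun"
  assumes p: "0 < p" and P: "1 < P" and \<phi>: "littlewood_paley \<phi>" and V: "V \<in> A_class P"
  obtains K where "0 < K" "\<And>f j k x. f \<in> distributions_inf \<Longrightarrow> x \<in> dcube j k \<Longrightarrow>
    ennpowr (\<rho> V P (dcube j k) (convolve (dilate j \<phi>) f x)) p \<le>
    ennreal (K / (2 powi (- j)) ^ CARD('n)) * (\<integral>\<^sup>+l. ennreal (ldist k l powr - 2) *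
      (\<integral>\<^sup>+x\<in>dcube j l. ennpowr (ennreal (norm (V x (convolve (dilate j \<phi>) f x)))) p \<partial>lebesgue) \<partial>count_space UNIV)"
proof -
  have P0: "0 < P" using P by simp
  have w: "weight V" and pw: "p_weight (ennreal P) V" and W: "weight (inv_adjoint_weight V)"
    using V P by (auto simp: A_class_def p_weight_def)
  let ?W = "inv_adjoint_weight V"
  define p' where "p' = P / (P - 1)"
  have p': "0 < p'" using P by (simp add: p'_def)
  \<comment> \<open>Hoelder's inequality with this exponent leaves \<open>V g\<close> in the
    exponent \<open>p\<close> and the dual weight in \<open>p'\<close>.\<close>
  define \<delta> where "\<delta> = 1 / (1 / p' + 1 / p)"
  have \<delta>: "0 < \<delta>" "1 / \<delta> = 1 / p' + 1 / p"
    using p' p by (auto simp: \<delta>_def add_pos_pos)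
  \<comment> \<open>The power that brings the exponent back from \<open>\<delta>\<close> to
    \<open>p\<close> at the end.\<close>
  define \<theta> where "\<theta> = p / \<delta>"
  have \<theta>: "0 < \<theta>" using p \<delta> by (simp add: \<theta>_def)
  have \<delta>\<theta>: "\<delta> * \<theta> = p" "\<delta> / p * \<theta> = 1" using p \<delta>(1) by (simp_all add: \<theta>_def)
  have "\<delta> * (1 / \<delta>) = \<delta> * (1 / p' + 1 / p)" by (simp only: \<delta>(2))
  then have \<delta>1: "\<delta> / p' + \<delta> / p = 1" using \<delta>(1) by (simp add: distrib_left)
  obtain \<gamma> where \<gamma>: "0 \<le> \<gamma>" "\<And>t. 0 < t \<Longrightarrow> \<exists>C\<ge>0. \<forall>j k l e.
    \<rho> V P (dcube j k) e \<le> ennreal (C * ldist k l powr \<gamma>) * \<rho> V t (dcube j l) e"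
    using A_class_dcube_doubling[OF V P0] by blast
  obtain C2 where C2: "0 \<le> C2" "\<And>j k l e. \<rho> V P (dcube j k) e \<le> ennreal (C2 * ldist k l powr \<gamma>) * \<rho> V P (dcube j l) e"
    using \<gamma>(2)[OF P0] by blast
  obtain C3 where C3: "0 \<le> C3" "\<And>a l e' K. 0 < l \<Longrightarrow>
    (\<And>u. ennreal (cmod (cblinfun_apply e' u)) \<le> K * \<rho> V P (cube a l) u) \<Longrightarrow>
    \<rho> ?W p' (cube a l) e' \<le> ennreal C3 * K"
    using A_class_gt_1_dual[OF V P] unfolding p'_def by blast
  \<comment> \<open>The decay budget: \<open>M * \<theta> = 2\<close> has to remain after the power
    \<open>\<theta>\<close>, another 2 is spent by \<open>ldist_sum_power_le\<close>, and
    \<open>\<gamma> * \<delta>\<close> pays for doubling.\<close>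
  define M where "M = 2 / \<theta>"
  have M\<theta>: "M * \<theta> = 2" using \<theta> by (simp add: M_def)
  obtain C1 where C1: "0 < C1" "\<And>(f :: (real ^ 'n \<Rightarrow> complex) \<Rightarrow> 'a) (T :: 'a cdual) j k x t.
    f \<in> distributions_inf \<Longrightarrow> x \<in> dcube j k \<Longrightarrow> t \<in> cube 0 (2 powi (- j)) \<Longrightarrow>
    ennpowr (ennreal (norm (T (convolve (dilate j \<phi>) f x)))) \<delta> \<le>
      ennreal C1 * (\<integral>\<^sup>+l. ennreal (ldist k l powr - (\<gamma> * \<delta> + (M + 2))) *
        ennpowr (ennreal (norm (T (convolve (dilate j \<phi>) f ((2 powi (- j)) *\<^sub>R lat l + t))))) \<delta> \<partial>count_space UNIV)"
    by (rule convolve_operator_le[OF \<phi> \<delta>(1), where L="\<gamma> * \<delta> + (M + 2)"]) (rule that)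
  obtain S where S: "0 < S" "\<And>k :: 'n \<Rightarrow> int. (\<integral>\<^sup>+l. ennreal (ldist k l powr - 2) \<partial>count_space UNIV) \<le> ennreal S"
    by (rule ldist_sum_bound) (rule that)
  define B where "B = C1 * (C3 * C2) powr \<delta>"
  have B: "0 \<le> B" using C1(1) by (simp add: B_def)
  show ?thesis
  proof (rule that[of "B powr \<theta> * S powr \<theta> + 1"])
    show "0 < B powr \<theta> * S powr \<theta> + 1" by (simp add: add_nonneg_pos)
    fix f j and k :: "'n \<Rightarrow> int" and x
    assume f: "f \<in> (distributions_inf :: ((real ^ 'n \<Rightarrow> complex) \<Rightarrow> 'a) set)" and x: "x \<in> dcube j k"
    define g where "g = convolve (dilate j \<phi>) f"
    have gc: "continuous_on UNIV g" unfolding g_def by (rule convolve_continuous[OF \<phi> f])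
    define h :: real where "h = 2 powi (- j)"
    have h: "0 < h" by (simp add: h_def)
    define H where "H = h ^ CARD('n)"
    have H: "0 < H" using h by (simp add: H_def)
    have Vg: "(\<lambda>x. norm (V x (g x))) \<in> borel_measurable lebesgue" by (rule weight_compose_measurable[OF w gc])
    define b where "b l = (\<integral>\<^sup>+x\<in>dcube j l. ennpowr (ennreal (norm (V x (g x)))) p \<partial>lebesgue)" for l
    obtain e' :: "'a cdual" where e': "\<And>u. ennreal (cmod (e' u)) \<le> \<rho> V P (dcube j k) u"
      "ennreal (cmod (e' (g x))) = \<rho> V P (dcube j k) (g x)"
      using rho_norming_functional[OF pw less_imp_le[OF P] h] unfolding dcube_def h_def[symmetric] by blast
    let ?X = "\<rho> V P (dcube j k) (g x)"
    define R where "R y = ennpowr (ennreal (cmod (e' (g y)))) \<delta>" for y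
    have R_meas: "R \<in> borel_measurable lebesgue"
    proof -
      have "continuous_on UNIV (\<lambda>y. cmod (e' (g y)))"
        using linear_continuous_on[OF bounded_linear_cblinfun_apply] gc
        by (intro continuous_on_norm continuous_on_compose2[of UNIV "cblinfun_apply e'" UNIV g]) auto
      then have "(\<lambda>y. cmod (e' (g y))) \<in> borel_measurable lebesgue"
        using borel_measurable_continuous_onI by (intro measurable_completion) simp
      then show ?thesis
        unfolding R_def by (intro measurable_ennpowr measurable_compose[OF _ measurable_ennreal])
    qed
    let ?D = "\<lambda>l. ldist k l"
    \<comment> \<open>\<open>e'\<close> is dominated by the average over cube \<open>k\<close>,
      hence by doubling also by the one over cube \<open>l\<close>. The dual condition is used on
      cube \<open>l\<close>, where the sample lies.\<close>
    have cell: "(\<integral>\<^sup>+y\<in>dcube j l. R y \<partial>lebesgue) \<le>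
        ennreal (H powr (\<delta> / p') * ((C3 * C2) powr \<delta> * ?D l powr (\<gamma> * \<delta>))) * ennpowr (b l) (\<delta> / p)" for l
    proof -
      have "\<rho> ?W p' (dcube j l) e' \<le> ennreal C3 * ennreal (C2 * ?D l powr \<gamma>)"
        unfolding dcube_def h_def[symmetric]
      proof (rule C3(2)[OF h])
        fix u
        show "ennreal (cmod (cblinfun_apply e' u)) \<le> ennreal (C2 * ?D l powr \<gamma>) * \<rho> V P (cube (h *\<^sub>R lat l) h) u"
          using order_trans[OF e'(1) C2(2)[of j k u l]] unfolding dcube_def h_def[symmetric] .
      qed
      also have "\<dots> = ennreal (C3 * C2 * ?D l powr \<gamma>)"
        using C3(1) C2(1) by (simp add: ennreal_mult mult.assoc)
      finally have "wint ?W p' (dcube j l) e' \<le> ennreal H * ennpowr (ennreal (C3 * C2 * ?D l powr \<gamma>)) p'"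
        unfolding H_def using rho_le_iff[OF h p'] unfolding dcube_def h_def[symmetric] by blast
      then have "ennpowr (wint ?W p' (dcube j l) e') (\<delta> / p') \<le>
          ennpowr (ennreal H * ennpowr (ennreal (C3 * C2 * ?D l powr \<gamma>)) p') (\<delta> / p')"
        using \<delta>(1) p' by (intro ennpowr_mono) auto
      also have "\<dots> = ennreal (H powr (\<delta> / p')) * ennpowr (ennreal (C3 * C2 * ?D l powr \<gamma>)) \<delta>"
        using \<delta>(1) p' H by (simp add: ennpowr_mult ennpowr_ennpowr ennpowr_ennreal)
      also have "ennpowr (ennreal (C3 * C2 * ?D l powr \<gamma>)) \<delta> = ennreal ((C3 * C2) powr \<delta> * ?D l powr (\<gamma> * \<delta>))"
        using C3(1) C2(1) by (subst ennpowr_ennreal) (simp_all add: powr_mult powr_powr)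
      also have "ennreal (H powr (\<delta> / p')) * ennreal ((C3 * C2) powr \<delta> * ?D l powr (\<gamma> * \<delta>)) =
          ennreal (H powr (\<delta> / p') * ((C3 * C2) powr \<delta> * ?D l powr (\<gamma> * \<delta>)))"
        by (simp add: ennreal_mult)
      finally have Wle: "ennpowr (wint ?W p' (dcube j l) e') (\<delta> / p') \<le>
          ennreal (H powr (\<delta> / p') * ((C3 * C2) powr \<delta> * ?D l powr (\<gamma> * \<delta>)))" .
      have "(\<integral>\<^sup>+y\<in>dcube j l. R y \<partial>lebesgue) \<le> ennpowr (wint ?W p' (dcube j l) e') (\<delta> / p') * ennpowr (b l) (\<delta> / p)"
        unfolding R_def b_def by (rule dual_hoelder[OF w W \<delta>(1) p p' \<delta>(2) Vg]) simp
      also have "\<dots> \<le> ennreal (H powr (\<delta> / p') * ((C3 * C2) powr \<delta> * ?D l powr (\<gamma> * \<delta>))) * ennpowr (b l) (\<delta> / p)"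
        by (intro mult_right_mono Wle) simp
      finally show ?thesis .
    qed
    let ?J = "\<integral>\<^sup>+l. ennreal (?D l powr - (M + 2)) * ennpowr (b l) (\<delta> / p) \<partial>count_space UNIV"
    have "ennreal H * ennpowr ?X \<delta> \<le>
        (\<integral>\<^sup>+l. ennreal (C1 * ?D l powr - (\<gamma> * \<delta> + (M + 2))) * (\<integral>\<^sup>+y\<in>dcube j l. R y \<partial>lebesgue) \<partial>count_space UNIV)"
      unfolding H_def h_def
    proof (rule shift_average_le[OF R_meas])
      fix t :: "real ^ 'n" assume t: "t \<in> cube 0 (2 powi (- j))"
      have "ennpowr (ennreal (cmod (e' (g x)))) \<delta> \<le>
        ennreal C1 * (\<integral>\<^sup>+l. ennreal (?D l powr - (\<gamma> * \<delta> + (M + 2))) * R ((2 powi (- j)) *\<^sub>R lat l + t) \<partial>count_space UNIV)"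
        unfolding R_def g_def by (rule C1(2)[OF f x t])
      also have "\<dots> = (\<integral>\<^sup>+l. ennreal (C1 * ?D l powr - (\<gamma> * \<delta> + (M + 2))) * R ((2 powi (- j)) *\<^sub>R lat l + t) \<partial>count_space UNIV)"
        using C1(1) by (subst nn_integral_cmult[symmetric]) (simp_all add: ennreal_mult mult.assoc)
      finally show "ennpowr ?X \<delta> \<le>
        (\<integral>\<^sup>+l. ennreal (C1 * ?D l powr - (\<gamma> * \<delta> + (M + 2))) * R ((2 powi (- j)) *\<^sub>R lat l + t) \<partial>count_space UNIV)"
        unfolding e'(2) .
    qed
    also have "\<dots> \<le> (\<integral>\<^sup>+l. ennreal (B * H powr (\<delta> / p')) * (ennreal (?D l powr - (M + 2)) * ennpowr (b l) (\<delta> / p)) \<partial>count_space UNIV)"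
    proof (rule nn_integral_mono)
      fix l
      let ?c = "C1 * ?D l powr - (\<gamma> * \<delta> + (M + 2))"
      have c: "0 \<le> ?c" using C1(1) by simp
      have "ennreal ?c * (\<integral>\<^sup>+y\<in>dcube j l. R y \<partial>lebesgue) \<le> ennreal ?c * (ennreal (H powr (\<delta> / p') * ((C3 * C2) powr \<delta> * ?D l powr (\<gamma> * \<delta>))) * ennpowr (b l) (\<delta> / p))"
        by (intro mult_left_mono cell) simp
      also have "\<dots> = ennreal (?c * (H powr (\<delta> / p') * ((C3 * C2) powr \<delta> * ?D l powr (\<gamma> * \<delta>)))) * ennpowr (b l) (\<delta> / p)"
        by (subst ennreal_mult[OF c]) (simp_all only: powr_ge_zero mult_nonneg_nonneg mult.assoc)
      also have "?c * (H powr (\<delta> / p') * ((C3 * C2) powr \<delta> * ?D l powr (\<gamma> * \<delta>))) =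
          (B * H powr (\<delta> / p')) * (?D l powr - (\<gamma> * \<delta> + (M + 2)) * ?D l powr (\<gamma> * \<delta>))"
        by (simp add: B_def)
      also have "?D l powr - (\<gamma> * \<delta> + (M + 2)) * ?D l powr (\<gamma> * \<delta>) = ?D l powr - (M + 2)"
        by (simp flip: powr_add)
      also have "ennreal ((B * H powr (\<delta> / p')) * ?D l powr - (M + 2)) * ennpowr (b l) (\<delta> / p) =
          ennreal (B * H powr (\<delta> / p')) * (ennreal (?D l powr - (M + 2)) * ennpowr (b l) (\<delta> / p))"
        using B by (simp only: ennreal_mult powr_ge_zero mult_nonneg_nonneg mult.assoc)
      finally show "ennreal ?c * (\<integral>\<^sup>+y\<in>dcube j l. R y \<partial>lebesgue) \<le>
        ennreal (B * H powr (\<delta> / p')) * (ennreal (?D l powr - (M + 2)) * ennpowr (b l) (\<delta> / p))" .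
    qed
    also have "\<dots> = ennreal (B * H powr (\<delta> / p')) * ?J"
      by (rule nn_integral_cmult) simp
    \<comment> \<open>Dividing by the volume \<open>H\<close> leaves
      \<open>H powr (- (\<delta> / p))\<close>, which the power \<open>\<theta>\<close> turns into
      the factor \<open>1 / H\<close> of the claim.\<close>
    also have "B * H powr (\<delta> / p') = H * (B * H powr (- (\<delta> / p)))"
    proof -
      have "- (\<delta> / p) = \<delta> / p' - 1" using \<delta>1 by simp
      then have "H * H powr (- (\<delta> / p)) = H powr (\<delta> / p')"
        using H by (simp add: powr_diff)
      then show ?thesis by simp
    qed
    finally have "ennreal H * ennpowr ?X \<delta> \<le> ennreal H * (ennreal (B * H powr (- (\<delta> / p))) * ?J)"
      using H B by (simp only: ennreal_mult powr_ge_zero mult_nonneg_nonneg less_imp_le mult.assoc)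
    then have "ennpowr ?X \<delta> \<le> ennreal (B * H powr (- (\<delta> / p))) * ?J"
      using H by (subst (asm) ennreal_mult_le_mult_iff) (auto simp: ennreal_eq_0_iff not_le)
    then have "ennpowr (ennpowr ?X \<delta>) \<theta> \<le> ennpowr (ennreal (B * H powr (- (\<delta> / p))) * ?J) \<theta>"
      using \<theta> by (intro ennpowr_mono)
    also have "ennpowr (ennpowr ?X \<delta>) \<theta> = ennpowr ?X p" by (simp add: ennpowr_ennpowr \<delta>\<theta>)
    also have "ennpowr (ennreal (B * H powr (- (\<delta> / p))) * ?J) \<theta> = ennreal (B powr \<theta> / H) * ennpowr ?J \<theta>"
    proof -
      have "(B * H powr (- (\<delta> / p))) powr \<theta> = B powr \<theta> * H powr - (\<delta> / p * \<theta>)"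
        by (simp add: powr_mult powr_powr)
      also have "\<dots> = B powr \<theta> / H" unfolding \<delta>\<theta>(2) using H by (simp add: powr_minus_divide)
      finally show ?thesis using \<theta> B by (simp only: ennpowr_mult) (subst ennpowr_ennreal, simp_all)
    qed
    also have "\<dots> \<le> ennreal (B powr \<theta> / H) * (ennreal (S powr \<theta>) *
        (\<integral>\<^sup>+l. ennreal (?D l powr - (M * \<theta>)) * ennpowr (ennpowr (b l) (\<delta> / p)) \<theta> \<partial>count_space UNIV))"
      by (intro mult_left_mono ldist_sum_power_le[OF S \<theta>]) simp
    also have "\<dots> = ennreal (B powr \<theta> * S powr \<theta> / H) * (\<integral>\<^sup>+l. ennreal (?D l powr - 2) * b l \<partial>count_space UNIV)"
    proof -
      have "B powr \<theta> * S powr \<theta> / H = B powr \<theta> / H * S powr \<theta>" by simp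
      moreover have "0 \<le> B powr \<theta> / H" using H by simp
      ultimately show ?thesis
        by (simp only: M\<theta> ennpowr_ennpowr \<delta>\<theta>(2) ennpowr_1 ennreal_mult powr_ge_zero mult.assoc)
    qed
    also have "\<dots> \<le> ennreal ((B powr \<theta> * S powr \<theta> + 1) / H) * (\<integral>\<^sup>+l. ennreal (?D l powr - 2) * b l \<partial>count_space UNIV)"
      using H by (intro mult_right_mono ennreal_leI divide_right_mono) simp_all
    finally show "ennpowr (\<rho> V P (dcube j k) (convolve (dilate j \<phi>) f x)) p \<le>
      ennreal ((B powr \<theta> * S powr \<theta> + 1) / (2 powi (- j)) ^ CARD('n)) * (\<integral>\<^sup>+l. ennreal (ldist k l powr - 2) *
        (\<integral>\<^sup>+x\<in>dcube j l. ennpowr (ennreal (norm (V x (convolve (dilate j \<phi>) f x)))) p \<partial>lebesgue) \<partial>count_space UNIV)"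
      unfolding b_def g_def H_def h_def .
  qed
qed

text \<open>The bound of \<open>rho_convolve_le_weight_integral\<close> is constant in
  \<open>x\<close> on a cube. Integrating it gives the volume, which cancels the factor in front,
  and the double sum over cubes is of Schur type.\<close>

lemma avg_integral_le_weight_gt_1:
  fixes V :: "real ^ 'n \<Rightarrow> ('a::{complex_normed_vector, banach}, 'a) cblinfun"
  assumes p: "0 < p" and r: "0 < r" "r \<le> P" and P: "1 < P" and \<phi>: "littlewood_paley \<phi>" and V: "V \<in> A_class P"
  obtains K where "0 < K" "\<And>f j. f \<in> distributions_inf \<Longrightarrow>
    (\<integral>\<^sup>+x. ennpowr (\<rho> V r (dyadic_cube_at j x) (convolve (dilate j \<phi>) f x)) p \<partial>lebesgue) \<le>
    ennreal K * (\<integral>\<^sup>+x. ennpowr (ennreal (norm (V x (convolve (dilate j \<phi>) f x)))) p \<partial>lebesgue)"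
proof -
  have w: "weight V" using V by (simp add: A_class_def p_weight_def)
  obtain K1 where K1: "0 < K1" "\<And>f j k x. f \<in> distributions_inf \<Longrightarrow> x \<in> dcube j k \<Longrightarrow>
    ennpowr (\<rho> V P (dcube j k) (convolve (dilate j \<phi>) f x)) p \<le>
    ennreal (K1 / (2 powi (- j)) ^ CARD('n)) * (\<integral>\<^sup>+l. ennreal (ldist k l powr - 2) *
      (\<integral>\<^sup>+x\<in>dcube j l. ennpowr (ennreal (norm (V x (convolve (dilate j \<phi>) f x)))) p \<partial>lebesgue) \<partial>count_space UNIV)"
    by (rule rho_convolve_le_weight_integral[OF p P \<phi> V]) (rule that)
  obtain S where S: "0 < S" "\<And>k :: 'n \<Rightarrow> int. (\<integral>\<^sup>+l. ennreal (ldist k l powr - 2) \<partial>count_space UNIV) \<le> ennreal S"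
    by (rule ldist_sum_bound) (rule that)
  show ?thesis
  proof (rule that[of "K1 * S"])
    show "0 < K1 * S" using K1(1) S(1) by simp
    fix f j assume f: "f \<in> (distributions_inf :: ((real ^ 'n \<Rightarrow> complex) \<Rightarrow> 'a) set)"
    define g where "g = convolve (dilate j \<phi>) f"
    have gc: "continuous_on UNIV g" unfolding g_def by (rule convolve_continuous[OF \<phi> f])
    define h :: real where "h = 2 powi (- j)"
    have h: "0 < h" by (simp add: h_def)
    define H where "H = h ^ CARD('n)"
    have H: "0 < H" using h by (simp add: H_def)
    have Vg: "(\<lambda>x. norm (V x (g x))) \<in> borel_measurable lebesgue" by (rule weight_compose_measurable[OF w gc])
    have mI: "(\<lambda>x. ennpowr (ennreal (norm (V x (g x)))) p) \<in> borel_measurable lebesgue"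
      by (rule measurable_ennpowr[OF measurable_compose[OF Vg measurable_ennreal]])
    have mR: "(\<lambda>x. ennpowr (\<rho> V r (dyadic_cube_at j x) (g x)) p) \<in> borel_measurable lebesgue"
      by (rule measurable_ennpowr[OF rho_dyadic_measurable[OF w r(1) gc]])
    define b where "b l = (\<integral>\<^sup>+x\<in>dcube j l. ennpowr (ennreal (norm (V x (g x)))) p \<partial>lebesgue)" for l
    have "(\<integral>\<^sup>+x. ennpowr (\<rho> V r (dyadic_cube_at j x) (g x)) p \<partial>lebesgue) =
        (\<integral>\<^sup>+k. (\<integral>\<^sup>+x\<in>dcube j k. ennpowr (\<rho> V r (dyadic_cube_at j x) (g x)) p \<partial>lebesgue) \<partial>count_space UNIV)"
      by (rule nn_integral_dyadic[OF mR])
    also have "\<dots> \<le> (\<integral>\<^sup>+k. ennreal (K1) * (\<integral>\<^sup>+l. ennreal (ldist k l powr - 2) * b l \<partial>count_space UNIV) \<partial>count_space UNIV)"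
    proof (rule nn_integral_mono)
      fix k
      let ?J = "\<integral>\<^sup>+l. ennreal (ldist k l powr - 2) * b l \<partial>count_space UNIV"
      have "(\<integral>\<^sup>+x\<in>dcube j k. ennpowr (\<rho> V r (dyadic_cube_at j x) (g x)) p \<partial>lebesgue) \<le>
          (\<integral>\<^sup>+x. (ennreal (K1 / H) * ?J) * indicator (dcube j k) x \<partial>lebesgue)"
      proof (rule nn_integral_mono)
        fix x
        show "ennpowr (\<rho> V r (dyadic_cube_at j x) (g x)) p * indicator (dcube j k) x \<le>
          (ennreal (K1 / H) * ?J) * indicator (dcube j k) x"
        proof (cases "x \<in> dcube j k")
          case True
          then have eq: "dyadic_cube_at j x = dcube j k" by (simp add: dyadic_cube_at_eq mem_dcube_iff)
          have "ennpowr (\<rho> V r (dcube j k) (g x)) p \<le> ennpowr (\<rho> V P (dcube j k) (g x)) p"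
            unfolding dcube_def h_def[symmetric] by (intro ennpowr_mono rho_exponent_mono[OF w r h] p)
          also have "\<dots> \<le> ennreal (K1 / H) * ?J" using K1(2)[OF f True] unfolding b_def g_def H_def h_def .
          finally show ?thesis using True by (simp add: eq)
        qed simp
      qed
      also have "\<dots> = (ennreal (K1 / H) * ?J) * ennreal H"
        by (subst nn_integral_cmult_indicator) (simp_all add: emeasure_dcube H_def h_def del: emeasure_completion emeasure_lborel_box_eq)
      also have "\<dots> = (ennreal (K1 / H) * ennreal H) * ?J"
        by (simp only: mult_ac)
      also have "ennreal (K1 / H) * ennreal H = ennreal (K1)"
        using H K1(1) by (subst ennreal_mult[symmetric]) auto
      finally show "(\<integral>\<^sup>+x\<in>dcube j k. ennpowr (\<rho> V r (dyadic_cube_at j x) (g x)) p \<partial>lebesgue) \<le>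
        ennreal (K1) * ?J" .
    qed
    also have "\<dots> = ennreal (K1) * (\<integral>\<^sup>+k. (\<integral>\<^sup>+l. ennreal (ldist k l powr - 2) * b l \<partial>count_space UNIV) \<partial>count_space UNIV)"
      by (rule nn_integral_cmult) simp
    also have "\<dots> \<le> ennreal (K1) * (ennreal S * (\<integral>\<^sup>+l. b l \<partial>count_space UNIV))"
      by (intro mult_left_mono ldist_double_sum_le S) simp
    also have "(\<integral>\<^sup>+l. b l \<partial>count_space UNIV) = (\<integral>\<^sup>+x. ennpowr (ennreal (norm (V x (g x)))) p \<partial>lebesgue)"
      unfolding b_def by (rule nn_integral_dyadic[OF mI, symmetric])
    also have "ennreal (K1) * (ennreal S * (\<integral>\<^sup>+x. ennpowr (ennreal (norm (V x (g x)))) p \<partial>lebesgue)) =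
        ennreal (K1 * S) * (\<integral>\<^sup>+x. ennpowr (ennreal (norm (V x (g x)))) p \<partial>lebesgue)"
      using K1(1) S(1) by (simp add: ennreal_mult mult.assoc)
    finally show "(\<integral>\<^sup>+x. ennpowr (\<rho> V r (dyadic_cube_at j x) (convolve (dilate j \<phi>) f x)) p \<partial>lebesgue) \<le>
      ennreal (K1 * S) * (\<integral>\<^sup>+x. ennpowr (ennreal (norm (V x (convolve (dilate j \<phi>) f x)))) p \<partial>lebesgue)"
      unfolding g_def .
  qed
qed

section \<open>From integrals on one level to the Besov quasi-norms\<close>

theorem theorem14p3:
  fixes V :: "real ^ 'n \<Rightarrow> ('a::{complex_normed_vector, banach}, 'a) cblinfun"
    and \<phi> :: "real ^ 'n \<Rightarrow> complex"
    and p r s :: real and q :: ennreal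
  assumes "0 < p" and "0 < r" and "0 < q"
    and "littlewood_paley \<phi>"
    and "V \<in> A_class (max p r)"
  shows "\<exists>c C :: real. 0 < c \<and> 0 < C \<and>
    (\<forall>f \<in> distributions_inf.
      ennreal c * besov_avg_qnorm s p q (\<rho> V r) \<phi> f \<le> besov_weight_qnorm s p q V \<phi> f \<and>
      besov_weight_qnorm s p q V \<phi> f \<le> ennreal C * besov_avg_qnorm s p q (\<rho> V r) \<phi> f)"
proof -
  let ?P = "max p r"
  let ?w = "\<lambda>f j x. ennreal (norm (V x (convolve (dilate j \<phi>) f x)))"
  let ?a = "\<lambda>f j x. \<rho> V r (dyadic_cube_at j x) (convolve (dilate j \<phi>) f x)"
  obtain K1 where K1: "0 < K1" "\<And>f j. f \<in> distributions_inf \<Longrightarrow>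
    (\<integral>\<^sup>+x. ennpowr (?w f j x) p \<partial>lebesgue) \<le> ennreal K1 * (\<integral>\<^sup>+x. ennpowr (?a f j x) p \<partial>lebesgue)"
    by (rule weight_integral_le_avg[OF assms(1) _ assms(2,4,5)]) (simp, rule that)
  obtain K2 where K2: "0 < K2" "\<And>f j. f \<in> distributions_inf \<Longrightarrow>
    (\<integral>\<^sup>+x. ennpowr (?a f j x) p \<partial>lebesgue) \<le> ennreal K2 * (\<integral>\<^sup>+x. ennpowr (?w f j x) p \<partial>lebesgue)"
  proof (cases "?P \<le> 1")
    case True
    show ?thesis
      by (rule avg_integral_le_weight_le_1[OF assms(1,2) _ True assms(4,5)]) (simp, rule that)
  next
    case False
    then have "1 < ?P" by (simp only: not_le)
    show ?thesis
      by (rule avg_integral_le_weight_gt_1[OF assms(1,2) _ \<open>1 < ?P\<close> assms(4,5)]) (simp, rule that)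
  qed
  \<comment> \<open>\<open>besov_qnorm_le\<close> expects the constant between the integrals as a
    \<open>p\<close>-th power.\<close>
  define C1 where "C1 = K1 powr (1 / p)"
  define C2 where "C2 = K2 powr (1 / p)"
  have C: "0 < C1" "0 < C2" "C1 powr p = K1" "C2 powr p = K2"
    using K1(1) K2(1) assms(1) by (simp_all add: C1_def C2_def powr_powr)
  have "besov_weight_qnorm s p q V \<phi> f \<le> ennreal C1 * besov_avg_qnorm s p q (\<rho> V r) \<phi> f"
    if "f \<in> distributions_inf" for f
    unfolding besov_weight_qnorm_def besov_avg_qnorm_def
    using K1(2)[OF that] C by (intro besov_qnorm_le assms) auto
  moreover have "ennreal (1 / C2) * besov_avg_qnorm s p q (\<rho> V r) \<phi> f \<le> besov_weight_qnorm s p q V \<phi> f"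
    if "f \<in> distributions_inf" for f
  proof -
    have "besov_avg_qnorm s p q (\<rho> V r) \<phi> f \<le> ennreal C2 * besov_weight_qnorm s p q V \<phi> f"
      unfolding besov_weight_qnorm_def besov_avg_qnorm_def
      using K2(2)[OF that] C by (intro besov_qnorm_le assms) auto
    then have "ennreal (1 / C2) * besov_avg_qnorm s p q (\<rho> V r) \<phi> f \<le>
        ennreal (1 / C2) * (ennreal C2 * besov_weight_qnorm s p q V \<phi> f)"
      by (rule mult_left_mono) simp
    also have "\<dots> = besov_weight_qnorm s p q V \<phi> f"
      using C(2) by (simp add: mult.assoc[symmetric] flip: ennreal_mult)
    finally show ?thesis .
  qed
  ultimately show ?thesis
    using C by (intro exI[of _ "1 / C2"] exI[of _ C1]) auto
qed

end
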